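(* Let $(M,g,J,\Psi)$ be a balanced ACYT 6-manifold, i.e. an almost Calabi-Yau with torsion 6-manifold with vanishing Lee form $\theta=0$. Then the torsion connection $\nabla$ is an $SU(3)$-instanton if and only if its torsion 3-form $T$ is $\nabla$-parallel, $\nabla T=0$.
   Context: Setting. $M$ is a smooth 6-manifold (not necessarily compact), $g$ a Riemannian metric, $J$ an almost complex structure with $g(JX,JY)=g(X,Y)$. The Kähler form is $F(X,Y)=g(X,JY)$. The codifferential is $\delta=-*d*$, and the Lee form is $\theta(X)=(\delta F)(JX)$. $SU(3)$-structure. $\Psi=\Psi^++\sqrt{-1}\,\Psi^-$ is a complex 3-form of type $(3,0)$ with respect to $J$ such that near each point there is a local orthonormal coframe $e_1,\dots,e_6$ with $F=-e_{12}-e_{34}-e_{56}$ and $\Psi=-(e_1+\sqrt{-1}e_2)\wedge(e_3+\sqrt{-1}e_4)\wedge(e_5+\sqrt{-1}e_6)$ (here $e_{ij}=e_i\wedge e_j$). ACYT. $(M,g,J,\Psi)$ is ACYT if there is a linear connection $\nabla$ with $\nabla g=\nabla J=\nabla\Psi^+=\nabla\Psi^-=0$ whose torsion $T(X,Y)=\nabla_XY-\nabla_YX-[X,Y]$ is totally skew-symmetric, i.e. $T(X,Y,Z)=g(T(X,Y),Z)$ is a 3-form. Such a $\nabla$ is unique and is called the torsion connection; $T$ is called the torsion. Instanton. With $R(X,Y)Z=[\nabla_X,\nabla_Y]Z-\nabla_{[X,Y]}Z$ and $R(X,Y,Z,V)=g(R(X,Y)Z,V)$, the connection $\nabla$ (or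 its curvature) is an $SU(3)$-instanton if $R(JX,JY,Z,V)=R(X,Y,Z,V)$ and $\sum_{i=1}^6R(e_i,Je_i,Z,V)=0$ for all $X,Y,Z,V$ and any orthonormal basis $\{e_i\}$. *)

theory Defs
  imports "HOL-Analysis.Analysis" "HOL-Library.Function_Algebras"
begin

section \<open>Smooth maps between Euclidean spaces\<close>

primrec Ck_on :: "nat \<Rightarrow> 'a::euclidean_space set \<Rightarrow> ('a \<Rightarrow> 'b::real_normed_vector) \<Rightarrow> bool" where
  "Ck_on 0 S f \<longleftrightarrow> continuous_on S f"
| "Ck_on (Suc k) S f \<longleftrightarrow>
     (\<forall>x\<in>S. f differentiable (at x)) \<and> (\<forall>v. Ck_on k S (\<lambda>x. frechet_derivative f (at x) v))"

text \<open>Only used for open \<open>S\<close>.\<close>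

definition smooth_on :: "'a::euclidean_space set \<Rightarrow> ('a \<Rightarrow> 'b::real_normed_vector) \<Rightarrow> bool" where
  "smooth_on S f \<longleftrightarrow> (\<forall>k. Ck_on k S f)"


section \<open>Smooth 6-manifolds\<close>

text \<open>
  The underlying topological space is a whole type \<open>'m\<close>; Hausdorff and second countable are imposed
  through its sort where the manifold is introduced. A chart is a coordinate map together with its
  domain; the values of \<open>coord\<close> outside \<open>dom\<close> are irrelevant.
\<close>

datatype 'm chart = Chart (dom: "'m set") (coord: "'m \<Rightarrow> real ^ 6")

definition param :: "'m chart \<Rightarrow> real ^ 6 \<Rightarrow> 'm" where
  "param c = inv_into (dom c) (coord c)"

definition transition :: "'m chart \<Rightarrow> 'm chart \<Rightarrow> real ^ 6 \<Rightarrow> real ^ 6" where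
  "transition c d = coord d \<circ> param c"

definition smooth_atlas :: "'m::topological_space chart set \<Rightarrow> bool" where
  "smooth_atlas A \<longleftrightarrow>
     (\<Union>c\<in>A. dom c) = UNIV \<and>
     (\<forall>c\<in>A. open (dom c) \<and> open (coord c ` dom c) \<and>
             homeomorphism (dom c) (coord c ` dom c) (coord c) (param c)) \<and>
     (\<forall>c\<in>A. \<forall>d\<in>A. smooth_on (coord c ` (dom c \<inter> dom d)) (transition c d))"

definition smooth_fun ::
  "'m::topological_space chart set \<Rightarrow> 'm set \<Rightarrow> ('m \<Rightarrow> 'b::real_normed_vector) \<Rightarrow> bool" where
  "smooth_fun A U f \<longleftrightarrow> (\<forall>c\<in>A. smooth_on (coord c ` (U \<inter> dom c)) (f \<circ> param c))"

text \<open>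
  A tangent vector at \<open>p\<close> is the family of its coordinate vectors in all charts around \<open>p\<close>, any two of
  which are related by the Jacobian of the transition map. The family is set to \<open>0\<close> at all other
  charts, so that equality of tangent vectors is equality of functions. Addition, negation and
  subtraction of tangent vectors, and of vector fields, are the pointwise operations on functions.
\<close>

type_synonym 'm tvec = "'m chart \<Rightarrow> real ^ 6"
type_synonym 'm vfield = "'m \<Rightarrow> 'm tvec"

definition vscale :: "real \<Rightarrow> 'm tvec \<Rightarrow> 'm tvec" where
  "vscale a v = (\<lambda>c. a *\<^sub>R v c)"

definition tangent_space :: "'m chart set \<Rightarrow> 'm \<Rightarrow> 'm tvec set" where
  "tangent_space A p = {v.
     (\<forall>c\<in>A. \<forall>d\<in>A. p \<in> dom c \<and> p \<in> dom d \<longrightarrow>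
        v d = frechet_derivative (transition c d) (at (coord c p)) (v c)) \<and>
     (\<forall>c. \<not> (c \<in> A \<and> p \<in> dom c) \<longrightarrow> v c = 0)}"

definition vector_field :: "'m::topological_space chart set \<Rightarrow> 'm set \<Rightarrow> 'm vfield \<Rightarrow> bool" where
  "vector_field A U X \<longleftrightarrow>
     (\<forall>p\<in>U. X p \<in> tangent_space A p) \<and>
     (\<forall>c\<in>A. smooth_on (coord c ` (U \<inter> dom c)) (\<lambda>x. X (param c x) c))"

definition fscale :: "('m \<Rightarrow> real) \<Rightarrow> 'm vfield \<Rightarrow> 'm vfield" where
  "fscale f X = (\<lambda>p. vscale (f p) (X p))"

definition chart_at :: "'m chart set \<Rightarrow> 'm \<Rightarrow> 'm chart" where
  "chart_at A p = (SOME c. c \<in> A \<and> p \<in> dom c)"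

text \<open>The derivative \<open>v(f)\<close> of a function along a tangent vector at \<open>p\<close>; by the chain rule the chart
  around \<open>p\<close> does not matter.\<close>

definition vderiv :: "'m chart set \<Rightarrow> 'm \<Rightarrow> 'm tvec \<Rightarrow> ('m \<Rightarrow> real) \<Rightarrow> real" where
  "vderiv A p v f =
     (let c = chart_at A p in frechet_derivative (f \<circ> param c) (at (coord c p)) (v c))"

text \<open>In coordinates, \<open>[X, Y]\<close> is \<open>DY(X) - DX(Y)\<close>.\<close>

definition lie_bracket :: "'m chart set \<Rightarrow> 'm vfield \<Rightarrow> 'm vfield \<Rightarrow> 'm vfield" where
  "lie_bracket A X Y = (\<lambda>p c. if c \<in> A \<and> p \<in> dom c
     then frechet_derivative (\<lambda>x. Y (param c x) c) (at (coord c p)) (X p c)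
        - frechet_derivative (\<lambda>x. X (param c x) c) (at (coord c p)) (Y p c)
     else 0)"


section \<open>Tensors and differential forms\<close>

definition linear_form_on :: "'m tvec set \<Rightarrow> ('m tvec \<Rightarrow> real) \<Rightarrow> bool" where
  "linear_form_on V f \<longleftrightarrow>
     (\<forall>u\<in>V. \<forall>v\<in>V. f (u + v) = f u + f v) \<and> (\<forall>a. \<forall>v\<in>V. f (vscale a v) = a * f v)"

definition one_form ::
  "'m::topological_space chart set \<Rightarrow> 'm set \<Rightarrow> ('m \<Rightarrow> 'm tvec \<Rightarrow> real) \<Rightarrow> bool" where
  "one_form A U e \<longleftrightarrow>
     (\<forall>p\<in>U. linear_form_on (tangent_space A p) (e p)) \<and>
     (\<forall>V X. open V \<and> V \<subseteq> U \<and> vector_field A V X \<longrightarrow> smooth_fun A V (\<lambda>p. e p (X p)))"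

text \<open>A \<open>k\<close>-form as a function of the list of its \<open>k\<close> arguments.\<close>

type_synonym 'm form = "'m \<Rightarrow> 'm tvec list \<Rightarrow> real"

text \<open>The vector field with constant coefficients \<open>v c\<close> in the coordinates of \<open>c\<close>.\<close>

definition const_field :: "'m chart set \<Rightarrow> 'm chart \<Rightarrow> 'm tvec \<Rightarrow> 'm vfield" where
  "const_field A c v = (\<lambda>q d. if d \<in> A \<and> q \<in> dom d \<and> q \<in> dom c
     then frechet_derivative (transition c d) (at (coord c q)) (v c) else 0)"

text \<open>
  In coordinates, for a \<open>k\<close>-form,
  \<open>d\<omega>(v\<^sub>0, \<dots>, v\<^sub>k) = \<Sum>\<^sub>i (-1)\<^sup>i \<partial>\<^bsub>v\<^sub>i\<^esub> (\<omega>(v\<^sub>0, \<dots>, v\<^sub>i omitted, \<dots>, v\<^sub>k))\<close> with the \<open>v\<^sub>j\<close> extended as constant fields.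
\<close>

definition ext_deriv :: "'m chart set \<Rightarrow> 'm form \<Rightarrow> 'm form" where
  "ext_deriv A \<omega> p vs = (\<Sum>i<length vs. (- 1) ^ i *
     vderiv A p (vs ! i)
       (\<lambda>q. \<omega> q (map (\<lambda>v. const_field A (chart_at A p) v q) (take i vs @ drop (Suc i) vs))))"


section \<open>Almost Hermitian structures\<close>

type_synonym 'm metric = "'m \<Rightarrow> 'm tvec \<Rightarrow> 'm tvec \<Rightarrow> real"
type_synonym 'm endo = "'m \<Rightarrow> 'm tvec \<Rightarrow> 'm tvec"

definition riemannian_metric :: "'m::topological_space chart set \<Rightarrow> 'm metric \<Rightarrow> bool" where
  "riemannian_metric A g \<longleftrightarrow>
     (\<forall>p. \<forall>v\<in>tangent_space A p.
        linear_form_on (tangent_space A p) (g p v) \<and>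
        (\<forall>w\<in>tangent_space A p. g p v w = g p w v) \<and>
        (v \<noteq> (\<lambda>c. 0) \<longrightarrow> g p v v > 0)) \<and>
     (\<forall>U X Y. open U \<and> vector_field A U X \<and> vector_field A U Y \<longrightarrow>
        smooth_fun A U (\<lambda>p. g p (X p) (Y p)))"

definition app_endo :: "'m endo \<Rightarrow> 'm vfield \<Rightarrow> 'm vfield" where
  "app_endo J X = (\<lambda>p. J p (X p))"

definition almost_complex_structure :: "'m::topological_space chart set \<Rightarrow> 'm endo \<Rightarrow> bool" where
  "almost_complex_structure A J \<longleftrightarrow>
     (\<forall>p. \<forall>v\<in>tangent_space A p.
        J p v \<in> tangent_space A p \<and>
        (\<forall>w\<in>tangent_space A p. J p (v + w) = J p v + J p w) \<and>
        (\<forall>a. J p (vscale a v) = vscale a (J p v)) \<and>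
        J p (J p v) = - v) \<and>
     (\<forall>U X. open U \<and> vector_field A U X \<longrightarrow> vector_field A U (app_endo J X))"

definition almost_hermitian :: "'m::topological_space chart set \<Rightarrow> 'm metric \<Rightarrow> 'm endo \<Rightarrow> bool" where
  "almost_hermitian A g J \<longleftrightarrow>
     riemannian_metric A g \<and> almost_complex_structure A J \<and>
     (\<forall>p. \<forall>v\<in>tangent_space A p. \<forall>w\<in>tangent_space A p. g p (J p v) (J p w) = g p v w)"

definition kahler_form :: "'m metric \<Rightarrow> 'm endo \<Rightarrow> 'm \<Rightarrow> 'm tvec \<Rightarrow> 'm tvec \<Rightarrow> real" where
  "kahler_form g J p v w = g p v (J p w)"

text \<open>Six orthonormal vectors; they form a basis because the tangent spaces have dimension 6.\<close>

definition orthonormal_basis :: "'m chart set \<Rightarrow> 'm metric \<Rightarrow> 'm \<Rightarrow> (nat \<Rightarrow> 'm tvec) \<Rightarrow> bool" where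
  "orthonormal_basis A g p e \<longleftrightarrow>
     (\<forall>i<6. e i \<in> tangent_space A p) \<and>
     (\<forall>i<6. \<forall>j<6. g p (e i) (e j) = (if i = j then 1 else 0))"

text \<open>
  The orientation is the one induced by \<open>J\<close>, i.e. the one of the orthonormal bases
  \<open>e\<^sub>0, Je\<^sub>0, e\<^sub>2, Je\<^sub>2, e\<^sub>4, Je\<^sub>4\<close>. (The codifferential contains two Hodge stars and does not depend on it.)
\<close>

definition adapted_basis ::
  "'m chart set \<Rightarrow> 'm metric \<Rightarrow> 'm endo \<Rightarrow> 'm \<Rightarrow> (nat \<Rightarrow> 'm tvec) \<Rightarrow> bool" where
  "adapted_basis A g J p e \<longleftrightarrow> orthonormal_basis A g p e \<and>
     e 1 = J p (e 0) \<and> e 3 = J p (e 2) \<and> e 5 = J p (e 4)"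

text \<open>\<open>e\<^sup>0 \<and> \<dots> \<and> e\<^sup>5\<close> for the coframe dual to the orthonormal basis \<open>e\<close>.\<close>

definition volume :: "'m metric \<Rightarrow> 'm \<Rightarrow> (nat \<Rightarrow> 'm tvec) \<Rightarrow> 'm tvec list \<Rightarrow> real" where
  "volume g p e vs =
     (\<Sum>\<sigma> | \<sigma> permutes {..<6}. of_int (sign \<sigma>) * (\<Prod>i<6. g p (e i) (vs ! \<sigma> i)))"

text \<open>
  For a \<open>k\<close>-form, \<open>(*\<omega>)(w\<^sub>1, \<dots>, w\<^bsub>6-k\<^esub>) = \<Sum>\<^sub>I \<omega>(e\<^sub>I) vol(e\<^sub>I, w\<^sub>1, \<dots>, w\<^bsub>6-k\<^esub>)\<close> over increasing multi-indices \<open>I\<close>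
  of length \<open>k\<close>, for any oriented orthonormal basis; equivalently \<open>\<alpha> \<and> *\<omega> = \<langle>\<alpha>, \<omega>\<rangle> vol\<close>.
\<close>

definition hodge_star ::
  "'m chart set \<Rightarrow> 'm metric \<Rightarrow> 'm endo \<Rightarrow> 'm form \<Rightarrow> 'm form" where
  "hodge_star A g J \<omega> p ws =
     (let e = (SOME e. adapted_basis A g J p e) in
      \<Sum>I | I \<subseteq> {..<6} \<and> card I + length ws = 6.
        \<omega> p (map e (sorted_list_of_set I)) *
        volume g p e (map e (sorted_list_of_set I) @ ws))"

definition codifferential ::
  "'m chart set \<Rightarrow> 'm metric \<Rightarrow> 'm endo \<Rightarrow> 'm form \<Rightarrow> 'm form" where
  "codifferential A g J \<omega> = - hodge_star A g J (ext_deriv A (hodge_star A g J \<omega>))"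

definition lee_form :: "'m chart set \<Rightarrow> 'm metric \<Rightarrow> 'm endo \<Rightarrow> 'm \<Rightarrow> 'm tvec \<Rightarrow> real" where
  "lee_form A g J p v =
     codifferential A g J (\<lambda>q vs. kahler_form g J q (vs ! 0) (vs ! 1)) p [J p v]"


section \<open>SU(3)-structures\<close>

definition wedge2 :: "('v \<Rightarrow> 'a::comm_ring_1) \<Rightarrow> ('v \<Rightarrow> 'a) \<Rightarrow> 'v \<Rightarrow> 'v \<Rightarrow> 'a" where
  "wedge2 a b u v = a u * b v - a v * b u"

definition wedge3 ::
  "('v \<Rightarrow> 'a::comm_ring_1) \<Rightarrow> ('v \<Rightarrow> 'a) \<Rightarrow> ('v \<Rightarrow> 'a) \<Rightarrow> 'v \<Rightarrow> 'v \<Rightarrow> 'v \<Rightarrow> 'a" where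
  "wedge3 a b c u v w =
     a u * wedge2 b c v w - a v * wedge2 b c u w + a w * wedge2 b c u v"

type_synonym 'm cform3 = "'m \<Rightarrow> 'm tvec \<Rightarrow> 'm tvec \<Rightarrow> 'm tvec \<Rightarrow> complex"

text \<open>
  The coframe \<open>e\<close> is orthonormal iff \<open>g = \<Sum>\<^sub>i e\<^sub>i \<otimes> e\<^sub>i\<close>. The local expression makes \<open>\<Psi>\<close> a smooth
  (multilinear, alternating) complex 3-form.
\<close>

definition SU3_structure ::
  "'m::topological_space chart set \<Rightarrow> 'm metric \<Rightarrow> 'm endo \<Rightarrow> 'm cform3 \<Rightarrow> bool" where
  "SU3_structure A g J \<Psi> \<longleftrightarrow>
     (\<forall>p. \<forall>u\<in>tangent_space A p. \<forall>v\<in>tangent_space A p. \<forall>w\<in>tangent_space A p.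
        \<Psi> p (J p u) v w = \<i> * \<Psi> p u v w) \<and>
     (\<forall>p. \<exists>U (e :: nat \<Rightarrow> 'm \<Rightarrow> 'm tvec \<Rightarrow> real). open U \<and> p \<in> U \<and> (\<forall>i<6. one_form A U (e i)) \<and>
        (\<forall>q\<in>U. \<forall>u\<in>tangent_space A q. \<forall>v\<in>tangent_space A q. \<forall>w\<in>tangent_space A q.
           g q u v = (\<Sum>i<6. e i q u * e i q v) \<and>
           kahler_form g J q u v =
             - wedge2 (e 0 q) (e 1 q) u v - wedge2 (e 2 q) (e 3 q) u v
             - wedge2 (e 4 q) (e 5 q) u v \<and>
           \<Psi> q u v w =
             - wedge3 (\<lambda>x. Complex (e 0 q x) (e 1 q x)) (\<lambda>x. Complex (e 2 q x) (e 3 q x))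
                 (\<lambda>x. Complex (e 4 q x) (e 5 q x)) u v w))"


section \<open>Connections\<close>

text \<open>
  A connection acts on vector fields over every open set simultaneously, compatibly with restriction:
  for \<open>X\<close>, \<open>Y\<close> smooth on \<open>U\<close> only the values of \<open>\<nabla>\<^sub>X Y\<close> on \<open>U\<close> are meaningful, and they depend only on
  the restrictions of \<open>X\<close> and \<open>Y\<close> to \<open>U\<close>. Homogeneity of \<open>\<nabla>\<^sub>X Y\<close> in \<open>Y\<close> over the reals is the Leibniz rule for constant \<open>f\<close>.
\<close>

type_synonym 'm connection = "'m vfield \<Rightarrow> 'm vfield \<Rightarrow> 'm vfield"

definition linear_connection :: "'m::topological_space chart set \<Rightarrow> 'm connection \<Rightarrow> bool" where
  "linear_connection A D \<longleftrightarrow>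
     (\<forall>U X Y. open U \<and> vector_field A U X \<and> vector_field A U Y \<longrightarrow>
        vector_field A U (D X Y) \<and>
        (\<forall>X' Y'. (\<forall>p\<in>U. X' p = X p \<and> Y' p = Y p) \<longrightarrow> (\<forall>p\<in>U. D X' Y' p = D X Y p)) \<and>
        (\<forall>Z. vector_field A U Z \<longrightarrow>
           (\<forall>p\<in>U. D (X + Z) Y p = D X Y p + D Z Y p \<and> D X (Y + Z) p = D X Y p + D X Z p)) \<and>
        (\<forall>f. smooth_fun A U f \<longrightarrow>
           (\<forall>p\<in>U. D (fscale f X) Y p = vscale (f p) (D X Y p) \<and>
                   D X (fscale f Y) p = vscale (vderiv A p (X p) f) (Y p) + vscale (f p) (D X Y p))))"

text \<open>A covariant 3-tensor is regarded as a map from vector fields to functions.\<close>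

type_synonym 'm tensor3 = "'m vfield \<Rightarrow> 'm vfield \<Rightarrow> 'm vfield \<Rightarrow> 'm \<Rightarrow> real"

definition cov_deriv3 ::
  "'m chart set \<Rightarrow> 'm connection \<Rightarrow> 'm tensor3 \<Rightarrow>
     'm vfield \<Rightarrow> 'm vfield \<Rightarrow> 'm vfield \<Rightarrow> 'm vfield \<Rightarrow> 'm \<Rightarrow> real" where
  "cov_deriv3 A D S X Y Z V p =
     vderiv A p (X p) (S Y Z V) - S (D X Y) Z V p - S Y (D X Z) V p - S Y Z (D X V) p"

definition parallel3 :: "'m::topological_space chart set \<Rightarrow> 'm connection \<Rightarrow> 'm tensor3 \<Rightarrow> bool" where
  "parallel3 A D S \<longleftrightarrow>
     (\<forall>U X Y Z V. open U \<and> vector_field A U X \<and> vector_field A U Y \<and> vector_field A U Z \<and>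
        vector_field A U V \<longrightarrow> (\<forall>p\<in>U. cov_deriv3 A D S X Y Z V p = 0))"

definition parallel_metric ::
  "'m::topological_space chart set \<Rightarrow> 'm connection \<Rightarrow> 'm metric \<Rightarrow> bool" where
  "parallel_metric A D g \<longleftrightarrow>
     (\<forall>U X Y Z. open U \<and> vector_field A U X \<and> vector_field A U Y \<and> vector_field A U Z \<longrightarrow>
        (\<forall>p\<in>U. vderiv A p (X p) (\<lambda>q. g q (Y q) (Z q)) -
                g p (D X Y p) (Z p) - g p (Y p) (D X Z p) = 0))"

definition parallel_endo ::
  "'m::topological_space chart set \<Rightarrow> 'm connection \<Rightarrow> 'm endo \<Rightarrow> bool" where
  "parallel_endo A D J \<longleftrightarrow>
     (\<forall>U X Y. open U \<and> vector_field A U X \<and> vector_field A U Y \<longrightarrow>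
        (\<forall>p\<in>U. D X (app_endo J Y) p - J p (D X Y p) = (\<lambda>c. 0)))"

definition torsion_vec :: "'m chart set \<Rightarrow> 'm connection \<Rightarrow> 'm vfield \<Rightarrow> 'm vfield \<Rightarrow> 'm vfield" where
  "torsion_vec A D X Y = D X Y - D Y X - lie_bracket A X Y"

definition torsion :: "'m chart set \<Rightarrow> 'm metric \<Rightarrow> 'm connection \<Rightarrow> 'm tensor3" where
  "torsion A g D X Y Z p = g p (torsion_vec A D X Y p) (Z p)"

definition curvature_vec ::
  "'m chart set \<Rightarrow> 'm connection \<Rightarrow> 'm vfield \<Rightarrow> 'm vfield \<Rightarrow> 'm vfield \<Rightarrow> 'm vfield" where
  "curvature_vec A D X Y Z = D X (D Y Z) - D Y (D X Z) - D (lie_bracket A X Y) Z"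

definition curvature ::
  "'m chart set \<Rightarrow> 'm metric \<Rightarrow> 'm connection \<Rightarrow>
     'm vfield \<Rightarrow> 'm vfield \<Rightarrow> 'm vfield \<Rightarrow> 'm vfield \<Rightarrow> 'm \<Rightarrow> real" where
  "curvature A g D X Y Z V p = g p (curvature_vec A D X Y Z p) (V p)"

definition totally_skew :: "'m::topological_space chart set \<Rightarrow> 'm tensor3 \<Rightarrow> bool" where
  "totally_skew A S \<longleftrightarrow>
     (\<forall>U X Y Z. open U \<and> vector_field A U X \<and> vector_field A U Y \<and> vector_field A U Z \<longrightarrow>
        (\<forall>p\<in>U. S Y X Z p = - S X Y Z p \<and> S X Z Y p = - S X Y Z p))"


section \<open>Almost Calabi--Yau with torsion\<close>

definition torsion_connection ::
  "'m::topological_space chart set \<Rightarrow> 'm metric \<Rightarrow> 'm endo \<Rightarrow> 'm cform3 \<Rightarrow> 'm connection \<Rightarrow> bool" where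
  "torsion_connection A g J \<Psi> D \<longleftrightarrow>
     linear_connection A D \<and> parallel_metric A D g \<and> parallel_endo A D J \<and>
     parallel3 A D (\<lambda>X Y Z p. Re (\<Psi> p (X p) (Y p) (Z p))) \<and>
     parallel3 A D (\<lambda>X Y Z p. Im (\<Psi> p (X p) (Y p) (Z p))) \<and>
     totally_skew A (torsion A g D)"

definition ACYT ::
  "'m::topological_space chart set \<Rightarrow> 'm metric \<Rightarrow> 'm endo \<Rightarrow> 'm cform3 \<Rightarrow> bool" where
  "ACYT A g J \<Psi> \<longleftrightarrow>
     smooth_atlas A \<and> almost_hermitian A g J \<and> SU3_structure A g J \<Psi> \<and>
     (\<exists>D. torsion_connection A g J \<Psi> D)"

definition balanced :: "'m::topological_space chart set \<Rightarrow> 'm metric \<Rightarrow> 'm endo \<Rightarrow> bool" where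
  "balanced A g J \<longleftrightarrow> (\<forall>p. \<forall>v\<in>tangent_space A p. lee_form A g J p v = 0)"

text \<open>
  As \<open>R\<close> is tensorial, its trace over an orthonormal basis of the tangent space at \<open>p\<close> is computed with
  arbitrary local vector fields \<open>E\<^sub>i\<close> that extend the basis.
\<close>

definition SU3_instanton ::
  "'m::topological_space chart set \<Rightarrow> 'm metric \<Rightarrow> 'm endo \<Rightarrow> 'm connection \<Rightarrow> bool" where
  "SU3_instanton A g J D \<longleftrightarrow>
     (\<forall>U X Y Z V. open U \<and> vector_field A U X \<and> vector_field A U Y \<and> vector_field A U Z \<and>
        vector_field A U V \<longrightarrow>
        (\<forall>p\<in>U. curvature A g D (app_endo J X) (app_endo J Y) Z V p = curvature A g D X Y Z V p)) \<and>
     (\<forall>U E Z V p. open U \<and> p \<in> U \<and> (\<forall>i<6. vector_field A U (E i)) \<and>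
        vector_field A U Z \<and> vector_field A U V \<and> orthonormal_basis A g p (\<lambda>i. E i p) \<longrightarrow>
        (\<Sum>i<6. curvature A g D (E i) (app_endo J (E i)) Z V p) = 0)"

end

theory Submission
  imports Defs
begin

text \<open>
  In a local unitary frame \<open>Z\<^sub>a = (e\<^sub>a - \<i> J e\<^sub>a) / \<surd>2\<close>, \<open>a = 1, 2, 3\<close>, a real 3-form \<open>T\<close> is given by
  its (3,0)-part \<open>T\<^sub>a\<^sub>b\<^sub>c = \<epsilon>\<^sub>a\<^sub>b\<^sub>c h\<close> and its (2,1)-part \<open>T(Z\<^sub>a, Z\<^sub>b, Z\<^sub>c') = \<Sum>\<^sub>d \<epsilon>\<^sub>a\<^sub>b\<^sub>d S\<^sup>d\<^sup>c\<close>, where a prime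
  denotes complex conjugation. For the torsion, the trace of \<open>T\<close> against the Kaehler form is, up to
  a factor and composition with \<open>J\<close>, the Lee form, and this trace vanishes exactly if the matrix \<open>S\<close>
  is symmetric. So in the balanced case \<open>T\<close> is a pair \<open>(h, S)\<close> with \<open>S\<close> symmetric, and \<open>\<nabla>T\<close> is the
  pair \<open>(\<nabla>h, \<nabla>S)\<close> because \<open>\<nabla>\<close> preserves the \<open>SU(3)\<close>-structure. Everything follows from the first
  Bianchi identity: the cyclic sum of \<open>R(X, Y, Z, V)\<close> over \<open>X, Y, Z\<close> is the cyclic sum of
  \<open>(\<nabla>\<^sub>X T)(Y, Z, V)\<close> plus a 4-form \<open>\<sigma>\<close> quadratic in \<open>T\<close>.

  If \<open>\<nabla>T = 0\<close>, the cyclic sum of \<open>R\<close> is a 4-form, which forces \<open>R(X, Y, Z, V) = R(Z, V, X, Y)\<close>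
  (\<open>pair_symmetric\<close>). The curvature takes values in \<open>su(3)\<close> in its last two arguments, hence also in
  the first two, and this is the instanton condition.

  Let conversely \<open>\<nabla>\<close> be an instanton. The components of \<open>\<sigma>\<close> with three holomorphic indices vanish
  (\<open>sig_hol\<close>), and so do the curvature terms in the Bianchi identity of these types; what remains
  gives \<open>\<nabla>h = 0\<close> and \<open>\<nabla>\<^sub>a S = 0\<close> in the holomorphic directions (\<open>hvol_hol\<close>, \<open>hol_parallel\<close>). Put
  \<open>V\<^sub>a\<^sup>b\<^sup>c = \<nabla>\<^bsub>a'\<^esub> S\<^sup>b\<^sup>c\<close>. Two contractions of the Bianchi identity of type (2,2) are related by complex
  conjugation; comparing them shows that \<open>V\<close> is totally symmetric (\<open>V_sym12\<close>). By the Ricci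
  identity, and since both \<open>R\<close> and \<open>T\<close> are trace-free, \<open>V\<close> is divergence-free in its first index
  (\<open>W_tr\<close>), hence in every index. The vanishing of the divergence in another index, inserted in the
  Bianchi identity, says that \<open>V\<^sub>f\<^sup>a\<^sup>e S'\<^sub>a\<^sub>e = 0\<close> (\<open>norm_derivative\<close>), i.e. that the norm of \<open>S\<close> is
  constant. The divergence of this last identity is \<open>\<bar>V\<bar>\<^sup>2 = 0\<close> (\<open>V_zero\<close>), and \<open>\<nabla>T = 0\<close>.

  This argument takes place in \<open>su3_frame\<close>, which knows the manifold only as an algebra of functions
  with six derivations. On the manifold, the coframe of the \<open>SU(3)\<close>-structure is dual to a smooth
  local unitary frame (\<open>local_frame\<close>); \<open>\<nabla>g = 0\<close>, \<open>\<nabla>J = 0\<close> and the parallelism of the volume form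
  make the connection coefficients \<open>su(3)\<close>-valued; and tensoriality (\<open>tensorial_expand\<close>) reduces
  both conditions of the theorem to the components in such frames. For the Lee form,
  \<open>*F = - F \<and> F / 2\<close> (\<open>hodge_star_FF\<close>), and \<open>\<nabla>F = 0\<close> turns the exterior derivative of this form into
  the trace of the torsion (\<open>balanced_adapted\<close>).
\<close>

section \<open>Connections in a moving frame\<close>

text \<open>
  Components of the torsion, the curvature and the covariant derivative of the torsion in a frame
  \<open>E\<^sub>i\<close> with \<open>\<nabla>\<^bsub>E\<^sub>i\<^esub> E\<^sub>j = \<Sum>\<^sub>k \<Gamma> i j k E\<^sub>k\<close> and \<open>[E\<^sub>i, E\<^sub>j] = \<Sum>\<^sub>k \<beta> i j k E\<^sub>k\<close>. The last index of each of them
  is the component of a vector, whence the opposite sign of the last term of \<open>nabla_tor\<close>. The field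
  of scalars is arbitrary because both real and complexified frames occur.
\<close>
definition tor :: "('i \<Rightarrow> 'i \<Rightarrow> 'i \<Rightarrow> 'p \<Rightarrow> 'a::field) \<Rightarrow> ('i \<Rightarrow> 'i \<Rightarrow> 'i \<Rightarrow> 'p \<Rightarrow> 'a) \<Rightarrow>
    'i \<Rightarrow> 'i \<Rightarrow> 'i \<Rightarrow> 'p \<Rightarrow> 'a" where
  "tor \<Gamma> \<beta> i j k q = \<Gamma> i j k q - \<Gamma> j i k q - \<beta> i j k q"

definition curv :: "('i::finite \<Rightarrow> ('p \<Rightarrow> 'a::field) \<Rightarrow> 'p \<Rightarrow> 'a) \<Rightarrow>
    ('i \<Rightarrow> 'i \<Rightarrow> 'i \<Rightarrow> 'p \<Rightarrow> 'a) \<Rightarrow> ('i \<Rightarrow> 'i \<Rightarrow> 'i \<Rightarrow> 'p \<Rightarrow> 'a) \<Rightarrow>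
    'i \<Rightarrow> 'i \<Rightarrow> 'i \<Rightarrow> 'i \<Rightarrow> 'p \<Rightarrow> 'a" where
  "curv dd \<Gamma> \<beta> i j k l q = dd i (\<Gamma> j k l) q - dd j (\<Gamma> i k l) q +
     (\<Sum>m\<in>UNIV. \<Gamma> j k m q * \<Gamma> i m l q - \<Gamma> i k m q * \<Gamma> j m l q - \<beta> i j m q * \<Gamma> m k l q)"

definition nabla_tor :: "('i::finite \<Rightarrow> ('p \<Rightarrow> 'a::field) \<Rightarrow> 'p \<Rightarrow> 'a) \<Rightarrow>
    ('i \<Rightarrow> 'i \<Rightarrow> 'i \<Rightarrow> 'p \<Rightarrow> 'a) \<Rightarrow> ('i \<Rightarrow> 'i \<Rightarrow> 'i \<Rightarrow> 'p \<Rightarrow> 'a) \<Rightarrow>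
    'i \<Rightarrow> 'i \<Rightarrow> 'i \<Rightarrow> 'i \<Rightarrow> 'p \<Rightarrow> 'a" where
  "nabla_tor dd \<Gamma> \<beta> i j k l q = dd i (tor \<Gamma> \<beta> j k l) q -
     (\<Sum>m\<in>UNIV. \<Gamma> i j m q * tor \<Gamma> \<beta> m k l q + \<Gamma> i k m q * tor \<Gamma> \<beta> j m l q
        - \<Gamma> i m l q * tor \<Gamma> \<beta> j k m q)"

text \<open>
  The vector fields of a frame on \<open>U\<close> enter only through their action \<open>dd\<close> on an algebra \<open>C\<close> of
  functions.
\<close>
locale derivations =
  fixes U :: "'p set" and C :: "('p \<Rightarrow> 'a::field) set"
    and dd :: "'i::finite \<Rightarrow> ('p \<Rightarrow> 'a) \<Rightarrow> 'p \<Rightarrow> 'a"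
  assumes C_const: "(\<lambda>_. c) \<in> C"
    and C_add: "f \<in> C \<Longrightarrow> h \<in> C \<Longrightarrow> (\<lambda>q. f q + h q) \<in> C"
    and C_mult: "f \<in> C \<Longrightarrow> h \<in> C \<Longrightarrow> (\<lambda>q. f q * h q) \<in> C"
    and C_dd: "f \<in> C \<Longrightarrow> dd i f \<in> C"
    and dd_const: "q \<in> U \<Longrightarrow> dd i (\<lambda>_. c) q = 0"
    and dd_add: "f \<in> C \<Longrightarrow> h \<in> C \<Longrightarrow> q \<in> U \<Longrightarrow> dd i (\<lambda>q. f q + h q) q = dd i f q + dd i h q"
    and dd_mult: "f \<in> C \<Longrightarrow> h \<in> C \<Longrightarrow> q \<in> U \<Longrightarrow>
       dd i (\<lambda>q. f q * h q) q = dd i f q * h q + f q * dd i h q"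
    and dd_cong: "(\<And>q. q \<in> U \<Longrightarrow> f q = h q) \<Longrightarrow> q \<in> U \<Longrightarrow> dd i f q = dd i h q"
begin

lemma C_uminus: "f \<in> C \<Longrightarrow> (\<lambda>q. - f q) \<in> C"
  using C_mult[OF C_const[of "-1"]] by simp

lemma C_diff: "f \<in> C \<Longrightarrow> h \<in> C \<Longrightarrow> (\<lambda>q. f q - h q) \<in> C"
  using C_add[OF _ C_uminus] by simp

lemma C_sum: "finite I \<Longrightarrow> (\<And>i. i \<in> I \<Longrightarrow> f i \<in> C) \<Longrightarrow> (\<lambda>q. \<Sum>i\<in>I. f i q) \<in> C"
  by (induction I rule: finite_induct) (auto intro: C_const C_add)

lemma dd_uminus: "f \<in> C \<Longrightarrow> q \<in> U \<Longrightarrow> dd i (\<lambda>q. - f q) q = - dd i f q"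
  using dd_mult[OF C_const[of "-1"], of f q i] dd_const[of q i "-1"] by simp

lemma dd_diff: "f \<in> C \<Longrightarrow> h \<in> C \<Longrightarrow> q \<in> U \<Longrightarrow> dd i (\<lambda>q. f q - h q) q = dd i f q - dd i h q"
  using dd_add[OF _ C_uminus, of f h q i] by (simp add: dd_uminus)

lemma dd_sum: "finite I \<Longrightarrow> (\<And>k. k \<in> I \<Longrightarrow> f k \<in> C) \<Longrightarrow> q \<in> U \<Longrightarrow>
    dd i (\<lambda>q. \<Sum>k\<in>I. f k q) q = (\<Sum>k\<in>I. dd i (f k) q)"
proof (induction I rule: finite_induct)
  case (insert x F)
  then show ?case by (simp add: dd_add C_sum)
qed (simp add: dd_const)

lemma dd_zero: "(\<And>q. q \<in> U \<Longrightarrow> f q = 0) \<Longrightarrow> q \<in> U \<Longrightarrow> dd i f q = 0"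
  using dd_cong[of f "\<lambda>_. 0" q i] dd_const by simp

end

text \<open>
  The last assumption expresses the linear independence of the frame at each point: a combination of
  the frame vectors that annihilates all functions is zero.
\<close>
locale frame_calculus = derivations U C dd
  for U :: "'p set" and C :: "('p \<Rightarrow> 'a::field) set"
    and dd :: "'i::finite \<Rightarrow> ('p \<Rightarrow> 'a) \<Rightarrow> 'p \<Rightarrow> 'a" +
  fixes \<Gamma> \<beta> :: "'i \<Rightarrow> 'i \<Rightarrow> 'i \<Rightarrow> 'p \<Rightarrow> 'a"
  assumes \<Gamma>_C: "\<Gamma> i j k \<in> C" and \<beta>_C: "\<beta> i j k \<in> C"
    and commutator: "f \<in> C \<Longrightarrow> q \<in> U \<Longrightarrow>
      dd i (dd j f) q - dd j (dd i f) q = (\<Sum>k\<in>UNIV. \<beta> i j k q * dd k f q)"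
    and dd_independent: "q \<in> U \<Longrightarrow> (\<And>f. f \<in> C \<Longrightarrow> (\<Sum>k\<in>UNIV. a k * dd k f q) = 0) \<Longrightarrow> a k = 0"
begin

lemma tor_C: "tor \<Gamma> \<beta> i j k \<in> C"
  unfolding tor_def[abs_def] by (intro C_diff \<Gamma>_C \<beta>_C)

lemma bracket_skew:
  assumes "q \<in> U" shows "\<beta> i j k q = - \<beta> j i k q"
proof -
  have "\<beta> i j k q + \<beta> j i k q = 0"
  proof (rule dd_independent[OF assms, of "\<lambda>k. \<beta> i j k q + \<beta> j i k q"])
    fix f assume f: "f \<in> C"
    show "(\<Sum>k\<in>UNIV. (\<beta> i j k q + \<beta> j i k q) * dd k f q) = 0"
      unfolding distrib_right sum.distrib commutator[OF f assms, symmetric] by simp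
  qed
  then show ?thesis by (simp add: eq_neg_iff_add_eq_0)
qed

lemma tor_skew: "q \<in> U \<Longrightarrow> tor \<Gamma> \<beta> i j k q = - tor \<Gamma> \<beta> j i k q"
  by (simp add: tor_def bracket_skew[of q i j])

text \<open>
  The Jacobi identity for the commutators of the derivations \<open>dd i\<close>, with coefficients compared by
  their linear independence.
\<close>
lemma jacobi:
  assumes q: "q \<in> U"
  shows "dd i (\<beta> j k l) q + dd j (\<beta> k i l) q + dd k (\<beta> i j l) q +
    (\<Sum>m\<in>UNIV. \<beta> j k m q * \<beta> i m l q + \<beta> k i m q * \<beta> j m l q + \<beta> i j m q * \<beta> k m l q) = 0"
proof (rule dd_independent[OF q, of "\<lambda>l. dd i (\<beta> j k l) q + dd j (\<beta> k i l) q + dd k (\<beta> i j l) q +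
    (\<Sum>m\<in>UNIV. \<beta> j k m q * \<beta> i m l q + \<beta> k i m q * \<beta> j m l q + \<beta> i j m q * \<beta> k m l q)"])
  fix f assume f: "f \<in> C"
  have one: "dd i (dd j (dd k f)) q - dd i (dd k (dd j f)) q - (dd j (dd k (dd i f)) q - dd k (dd j (dd i f)) q)
     = (\<Sum>l\<in>UNIV. (dd i (\<beta> j k l) q + (\<Sum>m\<in>UNIV. \<beta> j k m q * \<beta> i m l q)) * dd l f q)" for i j k
  proof -
    have "dd i (dd j (dd k f)) q - dd i (dd k (dd j f)) q = dd i (\<lambda>q. dd j (dd k f) q - dd k (dd j f) q) q"
      by (simp add: dd_diff C_dd f q)
    also have "\<dots> = dd i (\<lambda>q. \<Sum>m\<in>UNIV. \<beta> j k m q * dd m f q) q"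
      by (rule dd_cong[OF _ q]) (rule commutator[OF f])
    also have "\<dots> = (\<Sum>m\<in>UNIV. dd i (\<beta> j k m) q * dd m f q + \<beta> j k m q * dd i (dd m f) q)"
      by (simp add: dd_sum dd_mult C_mult \<beta>_C C_dd f q)
    finally have 1: "dd i (dd j (dd k f)) q - dd i (dd k (dd j f)) q =
        (\<Sum>m\<in>UNIV. dd i (\<beta> j k m) q * dd m f q + \<beta> j k m q * dd i (dd m f) q)" .
    have 2: "dd j (dd k (dd i f)) q - dd k (dd j (dd i f)) q = (\<Sum>m\<in>UNIV. \<beta> j k m q * dd m (dd i f) q)"
      by (rule commutator[OF C_dd[OF f] q])
    have 3: "(\<Sum>m\<in>UNIV. \<beta> j k m q * (dd i (dd m f) q - dd m (dd i f) q)) =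
        (\<Sum>l\<in>UNIV. (\<Sum>m\<in>UNIV. \<beta> j k m q * \<beta> i m l q) * dd l f q)"
      unfolding commutator[OF f q] sum_distrib_left sum_distrib_right
      by (subst sum.swap) (simp add: mult.assoc)
    show ?thesis
      unfolding 1 2 distrib_right sum.distrib 3[symmetric] right_diff_distrib sum_subtractf by simp
  qed
  show "(\<Sum>l\<in>UNIV. (dd i (\<beta> j k l) q + dd j (\<beta> k i l) q + dd k (\<beta> i j l) q +
    (\<Sum>m\<in>UNIV. \<beta> j k m q * \<beta> i m l q + \<beta> k i m q * \<beta> j m l q + \<beta> i j m q * \<beta> k m l q)) * dd l f q) = 0"
    using one[of i j k] one[of j k i] one[of k i j] unfolding distrib_right sum.distrib by algebra
qed

text \<open>
  The derivatives of \<open>\<Gamma>\<close> on the left and those of the torsion on the right differ by the derivatives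
  of \<open>\<beta>\<close>, which the Jacobi identity turns into products.
\<close>
lemma bianchi:
  assumes q: "q \<in> U"
  shows "curv dd \<Gamma> \<beta> i j k l q + curv dd \<Gamma> \<beta> j k i l q + curv dd \<Gamma> \<beta> k i j l q =
     nabla_tor dd \<Gamma> \<beta> i j k l q + nabla_tor dd \<Gamma> \<beta> j k i l q + nabla_tor dd \<Gamma> \<beta> k i j l q +
     (\<Sum>m\<in>UNIV. tor \<Gamma> \<beta> i j m q * tor \<Gamma> \<beta> m k l q + tor \<Gamma> \<beta> j k m q * tor \<Gamma> \<beta> m i l q
        + tor \<Gamma> \<beta> k i m q * tor \<Gamma> \<beta> m j l q)"
proof -
  define r where "r i j k m = \<Gamma> j k m q * \<Gamma> i m l q - \<Gamma> i k m q * \<Gamma> j m l q - \<beta> i j m q * \<Gamma> m k l q" for i j k m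
  define s where "s i j k m = \<Gamma> i j m q * tor \<Gamma> \<beta> m k l q + \<Gamma> i k m q * tor \<Gamma> \<beta> j m l q
        - \<Gamma> i m l q * tor \<Gamma> \<beta> j k m q" for i j k m
  define t where "t m = tor \<Gamma> \<beta> i j m q * tor \<Gamma> \<beta> m k l q + tor \<Gamma> \<beta> j k m q * tor \<Gamma> \<beta> m i l q
        + tor \<Gamma> \<beta> k i m q * tor \<Gamma> \<beta> m j l q" for m
  define b where "b m = \<beta> j k m q * \<beta> i m l q + \<beta> k i m q * \<beta> j m l q + \<beta> i j m q * \<beta> k m l q" for m
  have dT: "dd i (tor \<Gamma> \<beta> j k l) q = dd i (\<Gamma> j k l) q - dd i (\<Gamma> k j l) q - dd i (\<beta> j k l) q" for i j k
    unfolding tor_def[abs_def] by (simp add: dd_diff C_diff \<Gamma>_C \<beta>_C q)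
  have \<beta>: "\<beta> m n l q = \<Gamma> m n l q - \<Gamma> n m l q - tor \<Gamma> \<beta> m n l q" for m n l by (simp add: tor_def)
  have T: "tor \<Gamma> \<beta> n m l q = - tor \<Gamma> \<beta> m n l q" for m n by (rule tor_skew[OF q])
  \<comment> \<open>The identity holds for each value of the summation index.\<close>
  have "r i j k m + r j k i m + r k i j m = b m - s i j k m - s j k i m - s k i j m + t m" for m
    unfolding r_def s_def t_def b_def
    by (simp add: \<beta> T[of _ k] T[of _ j] T[of _ i] algebra_simps)
  then have "(\<Sum>m\<in>UNIV. r i j k m + r j k i m + r k i j m) =
      (\<Sum>m\<in>UNIV. b m - s i j k m - s j k i m - s k i j m + t m)" by simp
  then have *: "sum (r i j k) UNIV + sum (r j k i) UNIV + sum (r k i j) UNIV =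
      sum b UNIV - sum (s i j k) UNIV - sum (s j k i) UNIV - sum (s k i j) UNIV + sum t UNIV"
    by (simp only: sum.distrib sum_subtractf)
  have J: "dd i (\<beta> j k l) q + dd j (\<beta> k i l) q + dd k (\<beta> i j l) q + sum b UNIV = 0"
    using jacobi[OF q, of i j k l] unfolding b_def[abs_def] .
  have c: "curv dd \<Gamma> \<beta> i j k l q = dd i (\<Gamma> j k l) q - dd j (\<Gamma> i k l) q + sum (r i j k) UNIV" for i j k
    unfolding curv_def r_def[abs_def] ..
  have n: "nabla_tor dd \<Gamma> \<beta> i j k l q = dd i (tor \<Gamma> \<beta> j k l) q - sum (s i j k) UNIV" for i j k
    unfolding nabla_tor_def s_def[abs_def] ..
  have "?thesis \<longleftrightarrow> curv dd \<Gamma> \<beta> i j k l q + curv dd \<Gamma> \<beta> j k i l q + curv dd \<Gamma> \<beta> k i j l q =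
     nabla_tor dd \<Gamma> \<beta> i j k l q + nabla_tor dd \<Gamma> \<beta> j k i l q + nabla_tor dd \<Gamma> \<beta> k i j l q + sum t UNIV"
    unfolding t_def[abs_def] ..
  then show ?thesis unfolding c n dT using * J by algebra
qed

end

section \<open>Three-forms in six dimensions by type\<close>

datatype i3 = I1 | I2 | I3

lemma UNIV_i3: "UNIV = {I1, I2, I3}"
  by (auto intro: i3.exhaust)

instance i3 :: finite
  by standard (simp add: UNIV_i3)

lemma sum_i3: "(\<Sum>a\<in>UNIV. f a) = f I1 + f I2 + f I3"
  unfolding UNIV_i3 by (simp add: add.assoc)

text \<open>
  Indices of a complex frame adapted to the type decomposition: \<open>Inl a\<close> stands for \<open>Z\<^sub>a\<close> of type
  (1,0) and \<open>Inr a\<close> for its conjugate. For the underlying orthonormal frame, \<open>Inl a\<close> stands for \<open>e\<^sub>a\<close>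
  and \<open>Inr a\<close> for \<open>J e\<^sub>a\<close>.
\<close>
type_synonym idx = "i3 + i3"

lemma sum_idx: "(\<Sum>A\<in>UNIV. f (A::idx)) = (\<Sum>a\<in>UNIV. f (Inl a)) + (\<Sum>a\<in>UNIV. f (Inr a))"
  by (subst UNIV_Plus_UNIV[symmetric], subst sum.Plus) auto

text \<open>
  Conjugation of indices; also the lowering of an index with the complex bilinear metric, for which
  \<open>Z\<^sub>a\<close> is paired with its conjugate.
\<close>
fun dual :: "idx \<Rightarrow> idx" where "dual (Inl a) = Inr a" | "dual (Inr a) = Inl a"

lemma dual_dual [simp]: "dual (dual A) = A" by (cases A) auto

lemma sum_dual: "(\<Sum>A\<in>UNIV. f (dual A)) = (\<Sum>A\<in>UNIV. f A)"
  by (simp add: sum_idx add.commute)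

fun eps :: "i3 \<Rightarrow> i3 \<Rightarrow> i3 \<Rightarrow> complex" where
  "eps I1 I2 I3 = 1" | "eps I2 I3 I1 = 1" | "eps I3 I1 I2 = 1"
| "eps I2 I1 I3 = -1" | "eps I1 I3 I2 = -1" | "eps I3 I2 I1 = -1" | "eps _ _ _ = 0"

fun nxt :: "i3 \<Rightarrow> i3" where "nxt I1 = I2" | "nxt I2 = I3" | "nxt I3 = I1"

definition skew3 :: "(idx \<Rightarrow> idx \<Rightarrow> idx \<Rightarrow> complex) \<Rightarrow> bool" where
  "skew3 t \<longleftrightarrow> (\<forall>A B C. t A B C = - t B A C \<and> t A B C = - t A C B)"

text \<open>The trace of a 3-form against the Kaehler form.\<close>
definition tracefree :: "(idx \<Rightarrow> idx \<Rightarrow> idx \<Rightarrow> complex) \<Rightarrow> bool" where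
  "tracefree t \<longleftrightarrow> (\<forall>C. (\<Sum>a\<in>UNIV. t (Inl a) (Inr a) C) = 0)"

text \<open>
  The (3,0)-part and the (2,1)-part of a 3-form. The bivector \<open>Z\<^sub>a \<and> Z\<^sub>b\<close> is identified with a
  covector by the complex volume form, so that the (2,1)-part is a matrix.
\<close>
definition hvol :: "(idx \<Rightarrow> idx \<Rightarrow> idx \<Rightarrow> complex) \<Rightarrow> complex" where
  "hvol t = t (Inl I1) (Inl I2) (Inl I3)"

definition prim :: "(idx \<Rightarrow> idx \<Rightarrow> idx \<Rightarrow> complex) \<Rightarrow> i3 \<Rightarrow> i3 \<Rightarrow> complex" where
  "prim t d c = t (Inl (nxt d)) (Inl (nxt (nxt d))) (Inr c)"

lemma skew3_vanish:
  assumes "skew3 t" shows "t A A B = 0" "t B A A = 0" "t A B A = 0"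
proof -
  have "t A A B = - t A A B" "t B A A = - t B A A" "t A B A = - t A A B" for A B
    using assms unfolding skew3_def by blast+
  then show "t A A B = 0" "t B A A = 0" "t A B A = 0" by simp_all
qed

lemma skew3_swap:
  assumes "skew3 t" shows "t B A C = - t A B C" "t A C B = - t A B C" "t C B A = - t A B C"
  using assms unfolding skew3_def by (metis minus_minus)+

lemma skew3_top:
  assumes "skew3 t" shows "t (Inl a) (Inl b) (Inl c) = eps a b c * hvol t"
proof -
  note sw = skew3_swap(1)[OF assms, of "Inl I1" "Inl I2"] skew3_swap(1)[OF assms, of "Inl I1" "Inl I3"]
    skew3_swap(1)[OF assms, of "Inl I2" "Inl I3"] skew3_swap(2)[OF assms, of _ "Inl I1" "Inl I2"]
    skew3_swap(2)[OF assms, of _ "Inl I1" "Inl I3"] skew3_swap(2)[OF assms, of _ "Inl I2" "Inl I3"]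
  show ?thesis
    by (cases a; cases b; cases c; simp add: hvol_def sw skew3_vanish[OF assms])
qed

text \<open>Both sides are skew in \<open>a, b\<close>, and \<open>(nxt d, nxt (nxt d), d)\<close> is an even permutation.\<close>
lemma skew3_prim:
  assumes "skew3 t" shows "t (Inl a) (Inl b) (Inr c) = (\<Sum>d\<in>UNIV. eps a b d * prim t d c)"
proof -
  note sw = skew3_swap(1)[OF assms, of "Inl I1" "Inl I2"] skew3_swap(1)[OF assms, of "Inl I1" "Inl I3"]
    skew3_swap(1)[OF assms, of "Inl I2" "Inl I3"]
  show ?thesis
    by (cases a; cases b; simp add: sum_i3 prim_def sw skew3_vanish[OF assms])
qed

text \<open>The skew part of the matrix is dual to the trace of the 3-form.\<close>
lemma prim_sym:
  assumes s: "skew3 t" and tr: "tracefree t" shows "prim t d c = prim t c d"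
proof -
  have 1: "t (Inl a) (Inl c) (Inr b) = - t (Inl a) (Inr b) (Inl c)" for a b c by (rule skew3_swap(2)[OF s])
  have 2: "(\<Sum>a\<in>UNIV. t (Inl a) (Inl c) (Inr a)) = 0" for c
    unfolding 1 sum_negf using tr by (simp add: tracefree_def)
  show ?thesis
    using 2[of I1] 2[of I2] 2[of I3] unfolding skew3_prim[OF s]
    by (cases d; cases c; simp add: sum_i3)
qed

text \<open>
  All components of \<open>t\<close> in terms of two scalars and two matrices. The form \<open>u\<close> is the conjugate of
  \<open>t\<close>; for a real form it is \<open>t\<close> itself, but for \<open>t = \<nabla>\<^sub>M T\<close> it is the derivative in the conjugate
  direction.
\<close>
lemma skew3_all:
  fixes t u :: "idx \<Rightarrow> idx \<Rightarrow> idx \<Rightarrow> complex"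
  assumes s: "skew3 t" and u: "skew3 u" and c: "\<And>A B C. cnj (u A B C) = t (dual A) (dual B) (dual C)"
  shows "t (Inl a) (Inl b) (Inl c) = eps a b c * hvol t"
    "t (Inl a) (Inl b) (Inr c) = (\<Sum>d\<in>UNIV. eps a b d * prim t d c)"
    "t (Inl a) (Inr c) (Inl b) = - (\<Sum>d\<in>UNIV. eps a b d * prim t d c)"
    "t (Inr c) (Inl a) (Inl b) = (\<Sum>d\<in>UNIV. eps a b d * prim t d c)"
    "t (Inr a) (Inr b) (Inr c) = eps a b c * cnj (hvol u)"
    "t (Inr a) (Inr b) (Inl c) = (\<Sum>d\<in>UNIV. eps a b d * cnj (prim u d c))"
    "t (Inr a) (Inl c) (Inr b) = - (\<Sum>d\<in>UNIV. eps a b d * cnj (prim u d c))"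
    "t (Inl c) (Inr a) (Inr b) = (\<Sum>d\<in>UNIV. eps a b d * cnj (prim u d c))"
proof -
  have e: "cnj (eps a b c) = eps a b c" for a b c by (cases a; cases b; cases c) simp_all
  have sw: "t A C B = - t A B C" "t C A B = t A B C" for A B C
    using skew3_swap[OF s] by (metis minus_minus)+
  have c': "t (Inr a) (Inr b) C = cnj (u (Inl a) (Inl b) (dual C))" for a b C
    by (simp add: c)
  show "t (Inl a) (Inl b) (Inl c) = eps a b c * hvol t" by (rule skew3_top[OF s])
  show "t (Inl a) (Inl b) (Inr c) = (\<Sum>d\<in>UNIV. eps a b d * prim t d c)"
    "t (Inl a) (Inr c) (Inl b) = - (\<Sum>d\<in>UNIV. eps a b d * prim t d c)"
    "t (Inr c) (Inl a) (Inl b) = (\<Sum>d\<in>UNIV. eps a b d * prim t d c)"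
    by (simp_all only: sw(1)[of "Inl a" "Inr c" "Inl b"] sw(2)[of "Inr c" "Inl a" "Inl b"] skew3_prim[OF s])
  show "t (Inr a) (Inr b) (Inr c) = eps a b c * cnj (hvol u)"
    by (simp add: c' skew3_top[OF u] e)
  show "t (Inr a) (Inr b) (Inl c) = (\<Sum>d\<in>UNIV. eps a b d * cnj (prim u d c))"
    "t (Inr a) (Inl c) (Inr b) = - (\<Sum>d\<in>UNIV. eps a b d * cnj (prim u d c))"
    "t (Inl c) (Inr a) (Inr b) = (\<Sum>d\<in>UNIV. eps a b d * cnj (prim u d c))"
    unfolding sw(1)[of "Inr a" "Inl c" "Inr b"] sw(2)[of "Inl c" "Inr a" "Inr b"]
    by (simp_all add: c' skew3_prim[OF u] e)
qed

section \<open>The first Bianchi identity for structure group SU(3)\<close>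

text \<open>
  The values at a point of a real trace-free 3-form \<open>T\<close>, its covariant derivative \<open>N = \<nabla>T\<close> and the
  curvature \<open>R\<close>, all with lowered indices, of a metric connection that preserves an
  \<open>SU(3)\<close>-structure: \<open>R\<close> is \<open>su(3)\<close>-valued in its last two arguments.
\<close>
locale su3_bianchi =
  fixes T :: "idx \<Rightarrow> idx \<Rightarrow> idx \<Rightarrow> complex" and N R :: "idx \<Rightarrow> idx \<Rightarrow> idx \<Rightarrow> idx \<Rightarrow> complex"
  assumes T_skew: "skew3 T" and N_skew: "skew3 (N M)"
    and T_tr: "tracefree T" and N_tr: "tracefree (N M)"
    and T_cnj: "cnj (T A B C) = T (dual A) (dual B) (dual C)"
    and N_cnj: "cnj (N M A B C) = N (dual M) (dual A) (dual B) (dual C)"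
    and R_cnj: "cnj (R M A B C) = R (dual M) (dual A) (dual B) (dual C)"
    and R_skew: "R A B X Y = - R B A X Y" "R A B X Y = - R A B Y X"
    and R_hol: "R A B (Inl x) (Inl y) = 0"
    and R_tr: "(\<Sum>x\<in>UNIV. R A B (Inl x) (Inr x)) = 0"
    and bianchi: "R A B X Y + R B X A Y + R X A B Y = N A B X Y + N B X A Y + N X A B Y
      + (\<Sum>M\<in>UNIV. T A B (dual M) * T M X Y + T B X (dual M) * T M A Y + T X A (dual M) * T M B Y)"
begin

lemmas T_comp = skew3_all[OF T_skew T_skew T_cnj]

lemma N_cnj': "cnj (N (dual M) A B C) = N M (dual A) (dual B) (dual C)"
  by (simp add: N_cnj)

lemmas N_comp = skew3_all[OF N_skew N_skew N_cnj']

lemma S_sym: "prim T I2 I1 = prim T I1 I2" "prim T I3 I1 = prim T I1 I3" "prim T I3 I2 = prim T I2 I3"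
  "prim (N M) I2 I1 = prim (N M) I1 I2" "prim (N M) I3 I1 = prim (N M) I1 I3" "prim (N M) I3 I2 = prim (N M) I2 I3"
  by (simp_all add: prim_sym[OF T_skew T_tr] prim_sym[OF N_skew N_tr])

text \<open>The quadratic term of the Bianchi identity. For skew \<open>T\<close> it is a 4-form.\<close>
definition sig :: "idx \<Rightarrow> idx \<Rightarrow> idx \<Rightarrow> idx \<Rightarrow> complex" where
  "sig A B X Y = (\<Sum>M\<in>UNIV. T A B (dual M) * T M X Y + T B X (dual M) * T M A Y + T X A (dual M) * T M B Y)"

text \<open>
  Writing \<open>Q A B X Y\<close> for the product \<open>\<langle>T(A, B), T(X, Y)\<rangle>\<close>, which is skew in either pair and
  symmetric under their exchange, \<open>sig\<close> is the cyclic sum of \<open>Q\<close> over three arguments.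
\<close>
lemma sig_skew: "skew3 (\<lambda>A B X. sig A B X Y)" and sig_swap: "sig A B Y X = - sig A B X Y"
proof -
  have t: "T A B C = - T B A C" "T A B C = - T A C B" for A B C
    using T_skew unfolding skew3_def by blast+
  have 1: "sig A B X Y = - sig B A X Y" "sig A B X Y = sig B X A Y" for A B X Y
    unfolding sig_def sum_negf[symmetric]
    by (rule sum.cong[OF refl]; simp add: t(1)[of B A] t(1)[of A X] t(1)[of X B])+
  then show "skew3 (\<lambda>A B X. sig A B X Y)"
    unfolding skew3_def by metis
  have 2: "(\<Sum>M\<in>UNIV. T A B (dual M) * T M Y X) = - (\<Sum>M\<in>UNIV. T A B (dual M) * T M X Y)" for A B X Y
    unfolding sum_negf[symmetric] by (rule sum.cong[OF refl]) (simp add: t(2)[of _ Y X])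
  have 3: "(\<Sum>M\<in>UNIV. T A B (dual M) * T M X Y) = (\<Sum>M\<in>UNIV. T X Y (dual M) * T M A B)" for A B X Y
  proof -
    have "(\<Sum>M\<in>UNIV. T A B (dual M) * T M X Y) = (\<Sum>M\<in>UNIV. T A B (dual (dual M)) * T (dual M) X Y)"
      by (rule sum_dual[symmetric])
    also have "\<dots> = (\<Sum>M\<in>UNIV. T X Y (dual M) * T M A B)"
      by (rule sum.cong[OF refl]) (metis (no_types) dual_dual mult.commute t minus_minus)
    finally show ?thesis .
  qed
  have t': "(\<Sum>M\<in>UNIV. T A B (dual M) * T M X Y) = - (\<Sum>M\<in>UNIV. T B A (dual M) * T M X Y)" for A B X Y
    unfolding sum_negf[symmetric] by (rule sum.cong[OF refl]) (simp add: t(1)[of A B])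
  have s: "sig A B X Y = (\<Sum>M\<in>UNIV. T A B (dual M) * T M X Y) + (\<Sum>M\<in>UNIV. T B X (dual M) * T M A Y)
     + (\<Sum>M\<in>UNIV. T X A (dual M) * T M B Y)" for A B X Y
    unfolding sig_def sum.distrib by simp
  define Q where "Q A B X Y = (\<Sum>M\<in>UNIV. T A B (dual M) * T M X Y)" for A B X Y
  have Q: "Q A B Y X = - Q A B X Y" "Q A B X Y = Q X Y A B" "Q A B X Y = - Q B A X Y" for A B X Y
    unfolding Q_def by (rule 2 3 t')+
  have "Q B Y A X = - Q X A B Y" "Q Y A B X = - Q B X A Y"
    using Q(2)[of B Y A X] Q(3)[of A X B Y] Q(2)[of Y A B X] Q(1)[of B X A Y] by simp_all
  then show "sig A B Y X = - sig A B X Y"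
    unfolding s Q_def[symmetric] by (simp add: Q(1)[of A B Y X])
qed

text \<open>
  Given the skewness, only \<open>Z\<^sub>1, Z\<^sub>2, Z\<^sub>3\<close> as first three arguments matter. There the products of
  components of \<open>T\<close> cancel because the matrix \<open>prim T\<close> is symmetric.
\<close>
lemma sig_hol: "sig (Inl a) (Inl b) (Inl c) X = 0"
proof -
  have "sig (Inl I1) (Inl I2) (Inl I3) (Inl x) = 0" for x
    by (cases x) (simp_all add: sig_def sum_idx sum_i3 T_comp S_sym)
  moreover have "sig (Inl I1) (Inl I2) (Inl I3) (Inr x) = 0" for x
    by (cases x) (simp_all add: sig_def sum_idx sum_i3 T_comp S_sym algebra_simps)
  ultimately have "sig (Inl I1) (Inl I2) (Inl I3) X = 0" by (cases X) simp_all
  then show ?thesis using skew3_top[OF sig_skew, of a b c X] by (simp add: hvol_def)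
qed

text \<open>
  The classical octahedron argument. In a signed sum of the Bianchi identities for the four cyclic
  rotations of the arguments, twice the difference of the two curvature components remains, and the
  four values of the 4-form \<open>sig\<close> cancel.
\<close>
lemma pair_symmetric:
  assumes "\<And>M A B X. N M A B X = 0"
  shows "R A B X Y = R X Y A B"
proof -
  have b: "R A B X Y + R B X A Y + R X A B Y = sig A B X Y" for A B X Y
    using bianchi[of A B X Y, folded sig_def] by (simp add: assms)
  have sk: "sig P Q Z W = - sig Q P Z W" "sig P Q Z W = - sig P Z Q W" for P Q Z W
    using sig_skew[of W] unfolding skew3_def by blast+
  have s: "sig B X Y A = - sig A B X Y" "sig X Y A B = sig A B X Y" "sig Y A B X = - sig A B X Y"
    by (metis sk sig_swap minus_minus)+
  have r: "R P Q Z W = - R Q P Z W" "R P Q Z W = - R P Q W Z" for P Q Z W by (rule R_skew)+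
  have "R B X Y A = - R B X A Y" "R Y B X A = - R B Y X A" "R B Y X A = - R B Y A X"
     "R X Y B A = - R X Y A B" "R Y A X B = - R A Y X B" "R A Y X B = - R A Y B X" "R A X Y B = - R X A Y B" "R X A Y B = - R X A B Y"
     "R Y A B X = - R A Y B X" "R A B Y X = - R A B X Y" "R B Y A X = - R B Y X A"
    by (rule r)+
  then have "2 * R A B X Y = 2 * R X Y A B"
    using b[of A B X Y] b[of B X Y A] b[of X Y A B] b[of Y A B X] unfolding s by algebra
  then show ?thesis by simp
qed

end

section \<open>The first Bianchi identity of an instanton\<close>

locale su3_instanton_bianchi = su3_bianchi +
  assumes inst: "R (Inl a) (Inl b) X Y = 0"
    and inst_tr: "(\<Sum>a\<in>UNIV. R (Inl a) (Inr a) X Y) = 0"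
begin

lemma R_comp: "R (Inr a) (Inl b) X Y = - R (Inl b) (Inr a) X Y" "R (Inl a) (Inl b) X Y = 0"
  "R (Inr a) (Inr b) X Y = 0" "R A B (Inl x) (Inl y) = 0" "R A B (Inr x) (Inr y) = 0"
  "R A B (Inr x) (Inl y) = - R A B (Inl y) (Inr x)"
proof -
  show "R (Inr a) (Inl b) X Y = - R (Inl b) (Inr a) X Y" "R A B (Inr x) (Inl y) = - R A B (Inl y) (Inr x)"
    by (rule R_skew)+
  show "R (Inl a) (Inl b) X Y = 0" "R A B (Inl x) (Inl y) = 0" by (rule inst R_hol)+
  have "cnj (R (Inr a) (Inr b) X Y) = 0" "cnj (R A B (Inr x) (Inr y)) = 0"
    by (simp_all add: R_cnj inst R_hol)
  then show "R (Inr a) (Inr b) X Y = 0" "R A B (Inr x) (Inr y) = 0" by simp_all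
qed

text \<open>
  By \<open>R_comp\<close>, all other curvature components of an instanton vanish or are determined by skewness.
\<close>
definition r :: "i3 \<Rightarrow> i3 \<Rightarrow> i3 \<Rightarrow> i3 \<Rightarrow> complex" where
  "r b z a v = R (Inl b) (Inr z) (Inl a) (Inr v)"

lemma r_cnj: "cnj (r b z a v) = r z b v a"
  unfolding r_def R_cnj by (simp add: R_skew(1)[of "Inr b"] R_skew(2)[of _ _ "Inr a"])

lemma r_tr: "(\<Sum>b\<in>UNIV. r b b a v) = 0" "(\<Sum>a\<in>UNIV. r b z a a) = 0"
  unfolding r_def by (rule inst_tr R_tr)+

text \<open>The Bianchi identity for \<open>Z\<^sub>1, Z\<^sub>2, Z\<^sub>3, Z\<^sub>a\<close>, in which only \<open>\<nabla>\<^sub>a h\<close> survives.\<close>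
lemma hvol_hol: "hvol (N (Inl a)) = 0"
  using bianchi[of "Inl I1" "Inl I2" "Inl I3" "Inl a", folded sig_def]
  by (cases a) (simp_all add: R_comp sig_hol N_comp)

text \<open>
  Two instances of the Bianchi identity with three holomorphic indices and one antiholomorphic
  index. With \<open>Z\<^sub>z'\<close> as the last argument, it gives that the trace of \<open>d \<mapsto> \<nabla>\<^sub>d S\<^sup>d\<^sup>z\<close> vanishes; with
  \<open>Z\<^sub>z'\<close> among the cyclic arguments it equates the sum of any two of the three terms of this trace
  with \<open>\<nabla>\<^bsub>z'\<^esub> h\<close>, so that all of them vanish, and it also gives the vanishing of \<open>\<nabla>\<^sub>a S\<^sup>d\<^sup>z\<close> for \<open>a \<noteq> d\<close>.
\<close>
lemma hol_parallel: "hvol (N (Inr z)) = 0" "prim (N (Inl a)) d z = 0"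
proof -
  have s: "sig (Inl a) (Inl b) (Inr z) (Inl v) = 0" for a b v
    using sig_hol[of a b v "Inr z"] sig_swap[of "Inl a" "Inl b" "Inl v" "Inr z"] by simp
  have 1: "N (Inl a) (Inl b) (Inr z) (Inl v) + N (Inl b) (Inr z) (Inl a) (Inl v) + N (Inr z) (Inl a) (Inl b) (Inl v) = 0" for a b v
    using bianchi[of "Inl a" "Inl b" "Inr z" "Inl v", folded sig_def] by (simp add: R_comp s)
  let ?v = "\<lambda>d. prim (N (Inl d)) d z"
  have 2: "?v I1 + ?v I2 + ?v I3 = 0"
    using bianchi[of "Inl I1" "Inl I2" "Inl I3" "Inr z", folded sig_def]
    by (simp add: R_comp sig_hol N_comp sum_i3)
  have 3: "?v I1 + ?v I2 = hvol (N (Inr z))" "?v I2 + ?v I3 = hvol (N (Inr z))" "?v I1 + ?v I3 = hvol (N (Inr z))"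
    using 1[of I1 I2 I3] 1[of I2 I3 I1] 1[of I1 I3 I2] by (simp_all add: N_comp sum_i3 algebra_simps add_eq_0_iff)
  have h: "3 * hvol (N (Inr z)) = 0" using 2 3 by algebra
  then show "hvol (N (Inr z)) = 0" by simp
  then show "prim (N (Inl a)) d z = 0"
    using 2 3 1[of a I1 a] 1[of a I2 a] 1[of a I3 a] by (cases a; cases d; simp add: N_comp sum_i3 add_eq_0_iff)
qed

lemma sig_pair: "sig A B X Y = sig X Y A B"
proof -
  have 1: "sig P Q R' Y = - sig Q P R' Y" "sig P Q R' Y = - sig P R' Q Y" for P Q R' Y
    using sig_skew[of Y] unfolding skew3_def by blast+
  have "sig A B X Y = sig X A B Y" by (metis 1 minus_minus)
  also have "\<dots> = - sig X A Y B" by (rule sig_swap)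
  also have "\<dots> = sig X Y A B" by (metis 1(2) minus_minus)
  finally show ?thesis .
qed

lemma sig_cnj: "cnj (sig A B X Y) = sig (dual A) (dual B) (dual X) (dual Y)"
proof -
  have "cnj (sig A B X Y) = (\<Sum>M\<in>UNIV. T (dual A) (dual B) (dual (dual M)) * T (dual M) (dual X) (dual Y)
      + T (dual B) (dual X) (dual (dual M)) * T (dual M) (dual A) (dual Y)
      + T (dual X) (dual A) (dual (dual M)) * T (dual M) (dual B) (dual Y))"
    by (simp add: sig_def T_cnj)
  also have "\<dots> = sig (dual A) (dual B) (dual X) (dual Y)"
    unfolding sig_def by (rule sum_dual)
  finally show ?thesis .
qed

text \<open>The part \<open>\<nabla>\<^bsub>a'\<^esub> S\<^sup>b\<^sup>c\<close> of \<open>\<nabla>T\<close> that the components with three holomorphic indices do not see.\<close>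
definition V :: "i3 \<Rightarrow> i3 \<Rightarrow> i3 \<Rightarrow> complex" where
  "V a b c = prim (N (Inr a)) b c"

lemma V_sym23: "V a b c = V a c b"
  unfolding V_def by (rule prim_sym[OF N_skew N_tr])

lemma V_ord: "V a I2 I1 = V a I1 I2" "V a I3 I1 = V a I1 I3" "V a I3 I2 = V a I2 I3"
  by (rule V_sym23)+

lemma bianchi_mixed:
  "r b z a v - r a z b v = (\<Sum>d\<in>UNIV. eps z v d * (cnj (V a d b) - cnj (V b d a)))
     + (\<Sum>d\<in>UNIV. eps a b d * V z d v) + sig (Inl a) (Inl b) (Inr z) (Inr v)"
  using bianchi[of "Inl a" "Inl b" "Inr z" "Inr v", folded sig_def]
  by (simp add: R_comp r_def N_comp V_def right_diff_distrib sum_subtractf)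

text \<open>
  Contract \<open>bianchi_mixed\<close> once over \<open>a = v\<close> and once over \<open>b = z\<close>. By \<open>r_cnj\<close>, the two traces of
  the curvature are conjugate to each other, and so are the traces of \<open>sig\<close>. The difference of the
  second identity and the conjugate of the first is \<open>\<Sum>\<^sub>b\<^sub>d \<epsilon>\<^sub>b\<^sub>v\<^sub>d V'\<^sub>b\<^sub>d\<^sub>a = 0\<close>, the symmetry of \<open>V\<close> in its
  first two indices.
\<close>
lemma V_sym12: "V a b c = V b a c"
proof -
  have E1: "- (\<Sum>a\<in>UNIV. r a z b a) = (\<Sum>a\<in>UNIV. \<Sum>d\<in>UNIV. eps z a d * cnj (V a d b))
      + (\<Sum>a\<in>UNIV. sig (Inl a) (Inl b) (Inr z) (Inr a))" for b z
  proof -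
    have "(\<Sum>a\<in>UNIV. r b z a a - r a z b a) = (\<Sum>a\<in>UNIV. (\<Sum>d\<in>UNIV. eps z a d * (cnj (V a d b) - cnj (V b d a)))
     + (\<Sum>d\<in>UNIV. eps a b d * V z d a) + sig (Inl a) (Inl b) (Inr z) (Inr a))"
      by (simp only: bianchi_mixed)
    then show ?thesis
      unfolding sum_subtractf r_tr by (cases z; cases b; simp add: sum_i3 V_ord algebra_simps)
  qed
  have E2: "- (\<Sum>b\<in>UNIV. r a b b v) = - (\<Sum>b\<in>UNIV. \<Sum>d\<in>UNIV. eps b v d * cnj (V b d a))
      + (\<Sum>b\<in>UNIV. \<Sum>d\<in>UNIV. eps a b d * V b d v)
      + (\<Sum>b\<in>UNIV. sig (Inl a) (Inl b) (Inr b) (Inr v))" for a v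
  proof -
    have "(\<Sum>b\<in>UNIV. r b b a v - r a b b v) = (\<Sum>b\<in>UNIV. (\<Sum>d\<in>UNIV. eps b v d * (cnj (V a d b) - cnj (V b d a)))
     + (\<Sum>d\<in>UNIV. eps a b d * V b d v) + sig (Inl a) (Inl b) (Inr b) (Inr v))"
      by (simp only: bianchi_mixed)
    then show ?thesis
      unfolding sum_subtractf r_tr by (cases v; cases a; simp add: sum_i3 V_ord algebra_simps)
  qed
  have e: "cnj (eps a b c) = eps a b c" for a b c by (cases a; cases b; cases c) simp_all
  have E3: "- (\<Sum>b\<in>UNIV. r a b b v) = (\<Sum>b\<in>UNIV. \<Sum>d\<in>UNIV. eps a b d * V b d v)
      + (\<Sum>b\<in>UNIV. sig (Inl a) (Inl b) (Inr b) (Inr v))" for a v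
    using arg_cong[OF E1[where b = v and z = a], of cnj]
    by (simp add: r_cnj sig_cnj sig_pair[of "Inr _"] e)
  have "(\<Sum>b\<in>UNIV. \<Sum>d\<in>UNIV. eps b v d * cnj (V b d a)) = 0" for a v
    using E2[of a v] E3[of a v] by simp
  then have "cnj (\<Sum>b\<in>UNIV. \<Sum>d\<in>UNIV. eps b v d * cnj (V b d a)) = 0" for a v by simp
  then have *: "(\<Sum>b\<in>UNIV. \<Sum>d\<in>UNIV. eps b v d * V b d c) = 0" for v
    by (simp add: e)
  show ?thesis
    using *[of I1] *[of I2] *[of I3] by (cases a; cases b; simp add: sum_i3)
qed

lemma bianchi_mixed':
  "r b z a v - r a z b v = (\<Sum>d\<in>UNIV. eps a b d * V z d v) + sig (Inl a) (Inl b) (Inr z) (Inr v)"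
proof -
  have "V a d b = V b d a" for d by (metis V_sym12 V_sym23)
  then show ?thesis using bianchi_mixed[of b z a v] by simp
qed

lemma sig_trace:
  "(\<Sum>a\<in>UNIV. sig (Inl a) (Inl e) (Inr b) (Inr a)) =
    2 * (\<Sum>c\<in>UNIV. cnj (prim T e c) * prim T c b) - (if e = b then 2 * hvol T * cnj (hvol T) else 0)"
  by (cases e; cases b; simp add: sig_def sum_idx sum_i3 T_comp S_sym algebra_simps)

text \<open>
  After the symmetry of \<open>V\<close>, the trace of \<open>bianchi_mixed'\<close> no longer contains derivatives of the
  torsion.
\<close>
lemma ricci_trace:
  "(\<Sum>a\<in>UNIV. r a b e a) = (if e = b then 2 * hvol T * cnj (hvol T) else 0)
     - 2 * (\<Sum>c\<in>UNIV. cnj (prim T e c) * prim T c b)"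
proof -
  have "(\<Sum>a\<in>UNIV. r e b a a - r a b e a) = (\<Sum>a\<in>UNIV.
     (\<Sum>d\<in>UNIV. eps a e d * V b d a) + sig (Inl a) (Inl e) (Inr b) (Inr a))"
    by (simp only: bianchi_mixed')
  moreover have "(\<Sum>a\<in>UNIV. \<Sum>d\<in>UNIV. eps a e d * V b d a) = 0"
    by (cases e; simp add: sum_i3 V_ord)
  ultimately show ?thesis
    unfolding sum_subtractf r_tr sum.distrib sig_trace by algebra
qed

text \<open>
  In the assumption, take the part that is skew in \<open>b, d\<close>. The first term does not contribute, since
  by \<open>ricci_trace\<close> it is the matrix \<open>2 \<bar>h\<bar>\<^sup>2 S - 2 S S' S\<close>, where \<open>h\<close> is the (3,0)-part of \<open>T\<close>, and
  this is symmetric. In the second term, the part of \<open>r\<close> that is skew in these indices is \<open>\<epsilon> V'\<close> by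
  \<open>bianchi_mixed'\<close>, up to a value of \<open>sig\<close> that is skew in \<open>a, e\<close> and drops out against the
  symmetric \<open>S\<close>.
\<close>
lemma torsion_orthogonal:
  assumes ric: "\<And>b d. (\<Sum>a\<in>UNIV. \<Sum>e\<in>UNIV. r a b e a * prim T e d + r a b e d * prim T a e) = 0"
  shows "(\<Sum>a\<in>UNIV. \<Sum>e\<in>UNIV. cnj (V f a e) * prim T a e) = 0"
proof -
  let ?S = "prim T"
  have S: "?S a b = ?S b a" for a b by (rule prim_sym[OF T_skew T_tr])
  have e: "cnj (eps a b c) = eps a b c" for a b c by (cases a; cases b; cases c) simp_all
  have 1: "(\<Sum>a\<in>UNIV. \<Sum>e\<in>UNIV. r a b e a * ?S e d) = (\<Sum>a\<in>UNIV. \<Sum>e\<in>UNIV. r a d e a * ?S e b)" for b d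
  proof -
    have s: "(\<Sum>a\<in>UNIV. \<Sum>e\<in>UNIV. r a b e a * ?S e d) = (\<Sum>e\<in>UNIV. (\<Sum>a\<in>UNIV. r a b e a) * ?S e d)" for b d
      by (subst sum.swap) (simp add: sum_distrib_right)
    show ?thesis unfolding s ricci_trace
      by (cases b; cases d; simp add: sum_i3 S_sym algebra_simps)
  qed
  have 2: "(\<Sum>a\<in>UNIV. \<Sum>e\<in>UNIV. (r a b e d - r a d e b) * ?S a e) = 0" for b d
    using ric[of b d] ric[of d b] 1[of b d] unfolding sum.distrib left_diff_distrib sum_subtractf by algebra
  have 3: "r a b e d - r a d e b = (\<Sum>f\<in>UNIV. eps d b f * cnj (V a f e)) + sig (Inr d) (Inr b) (Inl a) (Inl e)" for a b d e
    using arg_cong[OF bianchi_mixed'[where b = b and z = a and a = d and v = e], of cnj]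
    by (simp add: r_cnj sig_cnj e)
  have 4: "sig A B (Inl a) (Inl e) = - sig A B (Inl e) (Inl a)" for A B a e by (rule sig_swap)
  have z: "sig A B X X = 0" for A B X using sig_swap[of A B X X] by simp
  have 5: "(\<Sum>a\<in>UNIV. \<Sum>e\<in>UNIV. (\<Sum>f\<in>UNIV. eps d b f * cnj (V a f e)) * ?S a e) = 0" for b d
    using 2[of b d] unfolding 3
    by (simp add: sum_i3 S_sym z 4[of _ _ I2 I1] 4[of _ _ I3 I1] 4[of _ _ I3 I2] algebra_simps)
  have V: "V a f e = V f a e" for a e by (rule V_sym12)
  show ?thesis using 5[of I2 I3] 5[of I3 I1] 5[of I1 I2]
    by (cases f; simp add: sum_i3 V_sym12[of I2 I1] V_sym12[of I3 I1] V_sym12[of I3 I2])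
qed

end

section \<open>Unitary frames of balanced SU(3)-connections\<close>

text \<open>
  The tensors of \<open>tor\<close>, \<open>nabla_tor\<close> and \<open>curv\<close> with the vector index lowered by the metric of a
  unitary frame.
\<close>
definition Tl where "Tl \<Gamma> \<beta> A B X q = tor \<Gamma> \<beta> A B (dual X) q"
definition Nl where "Nl dd \<Gamma> \<beta> M A B X q = nabla_tor dd \<Gamma> \<beta> M A B (dual X) q"
definition Rl where "Rl dd \<Gamma> \<beta> A B X Y q = curv dd \<Gamma> \<beta> A B X (dual Y) q"

text \<open>
  A complexified frame that is unitary for an \<open>SU(3)\<close>-structure, with a connection whose
  coefficients take values in \<open>su(3)\<close> and whose torsion is a trace-free 3-form.
\<close>
locale su3_frame = frame_calculus U C dd \<Gamma> \<beta>
  for U :: "'p set" and C :: "('p \<Rightarrow> complex) set" and dd :: "idx \<Rightarrow> ('p \<Rightarrow> complex) \<Rightarrow> 'p \<Rightarrow> complex"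
    and \<Gamma> \<beta> :: "idx \<Rightarrow> idx \<Rightarrow> idx \<Rightarrow> 'p \<Rightarrow> complex" +
  assumes C_cnj: "f \<in> C \<Longrightarrow> (\<lambda>q. cnj (f q)) \<in> C"
    and dd_cnj: "f \<in> C \<Longrightarrow> q \<in> U \<Longrightarrow> cnj (dd A f q) = dd (dual A) (\<lambda>q. cnj (f q)) q"
    and \<Gamma>_cnj: "q \<in> U \<Longrightarrow> cnj (\<Gamma> A B X q) = \<Gamma> (dual A) (dual B) (dual X) q"
    and \<beta>_cnj: "q \<in> U \<Longrightarrow> cnj (\<beta> A B X q) = \<beta> (dual A) (dual B) (dual X) q"
    and \<Gamma>_metric: "q \<in> U \<Longrightarrow> \<Gamma> A B X q = - \<Gamma> A (dual X) (dual B) q"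
    and \<Gamma>_hol: "q \<in> U \<Longrightarrow> \<Gamma> A (Inl b) (Inr c) q = 0"
    and \<Gamma>_tr: "q \<in> U \<Longrightarrow> (\<Sum>b\<in>UNIV. \<Gamma> A (Inl b) (Inl b) q) = 0"
    and Tl_skew: "q \<in> U \<Longrightarrow> skew3 (\<lambda>A B X. Tl \<Gamma> \<beta> A B X q)"
    and Tl_tr: "q \<in> U \<Longrightarrow> tracefree (\<lambda>A B X. Tl \<Gamma> \<beta> A B X q)"
begin

abbreviation "T \<equiv> Tl \<Gamma> \<beta>"
abbreviation "N \<equiv> Nl dd \<Gamma> \<beta>"
abbreviation "R \<equiv> Rl dd \<Gamma> \<beta>"

lemma \<Gamma>_anti:
  assumes "q \<in> U" shows "\<Gamma> A (Inr b) (Inl c) q = 0" "\<Gamma> A (Inr b) (Inr c) q = - \<Gamma> A (Inl c) (Inl b) q"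
proof -
  have "cnj (\<Gamma> A (Inr b) (Inl c) q) = 0" by (simp add: \<Gamma>_cnj \<Gamma>_hol assms)
  then show "\<Gamma> A (Inr b) (Inl c) q = 0" by simp
  show "\<Gamma> A (Inr b) (Inr c) q = - \<Gamma> A (Inl c) (Inl b) q"
    using \<Gamma>_metric[OF assms, of A "Inr b" "Inr c"] by simp
qed

lemma T_C: "T A B X \<in> C"
  using tor_C[of A B "dual X"] by (simp add: Tl_def[abs_def])

lemma T_cnj:
  assumes "q \<in> U" shows "cnj (T A B X q) = T (dual A) (dual B) (dual X) q"
  by (simp add: Tl_def tor_def \<Gamma>_cnj \<beta>_cnj assms)

lemma N_eq:
  assumes q: "q \<in> U"
  shows "N M A B X q = dd M (T A B X) q -
    (\<Sum>m\<in>UNIV. \<Gamma> M A m q * T m B X q + \<Gamma> M B m q * T A m X q + \<Gamma> M X m q * T A B m q)"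
proof -
  have "(\<Sum>m\<in>UNIV. \<Gamma> M m (dual X) q * tor \<Gamma> \<beta> A B m q) = (\<Sum>m\<in>UNIV. \<Gamma> M (dual m) (dual X) q * tor \<Gamma> \<beta> A B (dual m) q)"
    by (rule sum_dual[symmetric])
  also have "\<dots> = - (\<Sum>m\<in>UNIV. \<Gamma> M X m q * T A B m q)"
    unfolding sum_negf[symmetric]
    by (rule sum.cong[OF refl]) (simp add: Tl_def \<Gamma>_metric[OF q, of M "dual _" "dual X"])
  finally show ?thesis
    unfolding Nl_def nabla_tor_def sum_subtractf sum.distrib
    by (simp add: Tl_def[abs_def])
qed

lemma dd_T_swap:
  assumes q: "q \<in> U"
  shows "dd M (T B A X) q = - dd M (T A B X) q" "dd M (T A X B) q = - dd M (T A B X) q"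
proof -
  have sw: "T B A X p = - T A B X p" "T A X B p = - T A B X p" if "p \<in> U" for p
    by (rule skew3_swap[OF Tl_skew[OF that]])+
  have "dd M (T B A X) q = dd M (\<lambda>q. - T A B X q) q" "dd M (T A X B) q = dd M (\<lambda>q. - T A B X q) q"
    by (rule dd_cong[OF _ q]; rule sw; assumption)+
  then show "dd M (T B A X) q = - dd M (T A B X) q" "dd M (T A X B) q = - dd M (T A B X) q"
    by (simp_all add: dd_uminus T_C q)
qed

lemma N_skew:
  assumes q: "q \<in> U" shows "skew3 (\<lambda>A B X. N M A B X q)"
proof -
  have sw: "T B A X q = - T A B X q" "T A X B q = - T A B X q" for A B X
    by (rule skew3_swap[OF Tl_skew[OF q]])+
  have "N M A B X q = - N M B A X q" for A B X
    unfolding N_eq[OF q] dd_T_swap(1)[OF q, of M B A] minus_diff_eq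
    by (simp add: sw(1)[of B A] sw(1)[of _ A] sw(1)[of B] sum.distrib sum_negf sum_subtractf)
  moreover have "N M A B X q = - N M A X B q" for A B X
    unfolding N_eq[OF q] dd_T_swap(2)[OF q, of M A X B] minus_diff_eq
    by (simp add: sw(2)[of A X B] sw(2)[of A _ B] sw(2)[of A X] sw(2)[of _ X B] sum.distrib sum_negf sum_subtractf)
  ultimately show ?thesis unfolding skew3_def by blast
qed

lemma N_tr:
  assumes q: "q \<in> U" shows "tracefree (\<lambda>A B X. N M A B X q)"
  unfolding tracefree_def
proof
  fix X
  have tr: "(\<Sum>a\<in>UNIV. T (Inl a) (Inr a) X p) = 0" if "p \<in> U" for p X
    using Tl_tr[OF that] by (simp add: tracefree_def)
  have "dd M (\<lambda>p. \<Sum>a\<in>UNIV. T (Inl a) (Inr a) X p) q = 0"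
    by (rule dd_zero[OF _ q]) (rule tr)
  then have d: "(\<Sum>a\<in>UNIV. dd M (T (Inl a) (Inr a) X) q) = 0"
    by (simp add: dd_sum T_C q)
  have 1: "(\<Sum>a\<in>UNIV. \<Sum>m\<in>UNIV. \<Gamma> M (Inl a) m q * T m (Inr a) X q) =
      (\<Sum>a\<in>UNIV. \<Sum>b\<in>UNIV. \<Gamma> M (Inl a) (Inl b) q * T (Inl b) (Inr a) X q)"
    by (simp add: sum_idx \<Gamma>_hol q)
  have 2: "(\<Sum>a\<in>UNIV. \<Sum>m\<in>UNIV. \<Gamma> M (Inr a) m q * T (Inl a) m X q) =
      - (\<Sum>a\<in>UNIV. \<Sum>b\<in>UNIV. \<Gamma> M (Inl a) (Inl b) q * T (Inl b) (Inr a) X q)"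
    by (subst sum.swap) (simp add: sum_idx \<Gamma>_anti q sum_negf)
  have 3: "(\<Sum>a\<in>UNIV. \<Sum>m\<in>UNIV. \<Gamma> M X m q * T (Inl a) (Inr a) m q) = 0"
    by (subst sum.swap) (simp add: sum_distrib_left[symmetric] tr q)
  show "(\<Sum>a\<in>UNIV. N M (Inl a) (Inr a) X q) = 0"
    unfolding N_eq[OF q] sum_subtractf sum.distrib 1 2 3 d by simp
qed

lemma N_cnj:
  assumes q: "q \<in> U" shows "cnj (N M A B X q) = N (dual M) (dual A) (dual B) (dual X) q"
proof -
  have "dd (dual M) (\<lambda>q. cnj (T A B X q)) q = dd (dual M) (T (dual A) (dual B) (dual X)) q"
    by (rule dd_cong[OF _ q]) (rule T_cnj)
  then have d: "cnj (dd M (T A B X) q) = dd (dual M) (T (dual A) (dual B) (dual X)) q"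
    by (simp add: dd_cnj T_C q)
  have "cnj (\<Sum>m\<in>UNIV. \<Gamma> M A m q * T m B X q + \<Gamma> M B m q * T A m X q + \<Gamma> M X m q * T A B m q) =
    (\<Sum>m\<in>UNIV. \<Gamma> (dual M) (dual A) (dual m) q * T (dual m) (dual B) (dual X) q +
       \<Gamma> (dual M) (dual B) (dual m) q * T (dual A) (dual m) (dual X) q +
       \<Gamma> (dual M) (dual X) (dual m) q * T (dual A) (dual B) (dual m) q)"
    by (simp add: \<Gamma>_cnj T_cnj q)
  also have "\<dots> = (\<Sum>m\<in>UNIV. \<Gamma> (dual M) (dual A) m q * T m (dual B) (dual X) q +
       \<Gamma> (dual M) (dual B) m q * T (dual A) m (dual X) q +
       \<Gamma> (dual M) (dual X) m q * T (dual A) (dual B) m q)"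
    by (rule sum_dual)
  finally show ?thesis unfolding N_eq[OF q] by (simp add: d)
qed

lemma R_cnj:
  assumes q: "q \<in> U" shows "cnj (R A B X Y q) = R (dual A) (dual B) (dual X) (dual Y) q"
proof -
  have d: "cnj (dd A (\<Gamma> B X Y) q) = dd (dual A) (\<Gamma> (dual B) (dual X) (dual Y)) q" for A B X Y
    unfolding dd_cnj[OF \<Gamma>_C q] by (rule dd_cong[OF _ q]) (rule \<Gamma>_cnj)
  have "cnj (R A B X Y q) = dd (dual A) (\<Gamma> (dual B) (dual X) Y) q - dd (dual B) (\<Gamma> (dual A) (dual X) Y) q +
     (\<Sum>m\<in>UNIV. \<Gamma> (dual B) (dual X) (dual m) q * \<Gamma> (dual A) (dual m) Y q - \<Gamma> (dual A) (dual X) (dual m) q * \<Gamma> (dual B) (dual m) Y q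
       - \<beta> (dual A) (dual B) (dual m) q * \<Gamma> (dual m) (dual X) Y q)"
    unfolding Rl_def curv_def by (simp add: d \<Gamma>_cnj \<beta>_cnj q)
  also have "(\<Sum>m\<in>UNIV. \<Gamma> (dual B) (dual X) (dual m) q * \<Gamma> (dual A) (dual m) Y q - \<Gamma> (dual A) (dual X) (dual m) q * \<Gamma> (dual B) (dual m) Y q
       - \<beta> (dual A) (dual B) (dual m) q * \<Gamma> (dual m) (dual X) Y q) =
     (\<Sum>m\<in>UNIV. \<Gamma> (dual B) (dual X) m q * \<Gamma> (dual A) m Y q - \<Gamma> (dual A) (dual X) m q * \<Gamma> (dual B) m Y q
       - \<beta> (dual A) (dual B) m q * \<Gamma> m (dual X) Y q)"
    by (rule sum_dual)
  finally show ?thesis unfolding Rl_def curv_def by simp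
qed

lemma R_skew:
  assumes q: "q \<in> U" shows "R A B X Y q = - R B A X Y q" "R A B X Y q = - R A B Y X q"
proof -
  show "R A B X Y q = - R B A X Y q"
    unfolding Rl_def curv_def by (simp add: bracket_skew[OF q, of A B] sum_subtractf sum_negf sum.distrib)
  have d: "dd A (\<Gamma> B X (dual Y)) q = - dd A (\<Gamma> B Y (dual X)) q" for A B
  proof -
    have "dd A (\<Gamma> B X (dual Y)) q = dd A (\<lambda>q. - \<Gamma> B Y (dual X) q) q"
      by (rule dd_cong[OF _ q]) (use \<Gamma>_metric[of _ B X "dual Y"] in simp)
    then show ?thesis by (simp add: dd_uminus \<Gamma>_C q)
  qed
  have p: "(\<Sum>m\<in>UNIV. \<Gamma> B X m q * \<Gamma> A m (dual Y) q) = (\<Sum>m\<in>UNIV. \<Gamma> A Y m q * \<Gamma> B m (dual X) q)" for A B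
  proof -
    have "(\<Sum>m\<in>UNIV. \<Gamma> B X m q * \<Gamma> A m (dual Y) q) = (\<Sum>m\<in>UNIV. \<Gamma> A Y (dual m) q * \<Gamma> B (dual m) (dual X) q)"
      by (rule sum.cong[OF refl])
        (simp add: \<Gamma>_metric[OF q, of B X] \<Gamma>_metric[OF q, of A _ "dual Y"])
    then show ?thesis using sum_dual[of "\<lambda>m. \<Gamma> A Y m q * \<Gamma> B m (dual X) q"] by simp
  qed
  have b: "(\<Sum>m\<in>UNIV. \<beta> A B m q * \<Gamma> m X (dual Y) q) = - (\<Sum>m\<in>UNIV. \<beta> A B m q * \<Gamma> m Y (dual X) q)"
    unfolding sum_negf[symmetric] by (rule sum.cong[OF refl]) (simp add: \<Gamma>_metric[OF q, of _ X])
  show "R A B X Y q = - R A B Y X q"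
    unfolding Rl_def curv_def sum_subtractf d p[of A B] p[of B A] b by simp
qed

lemma R_hol:
  assumes q: "q \<in> U" shows "R A B (Inl x) (Inl y) q = 0"
proof -
  have "dd A (\<Gamma> B (Inl x) (Inr y)) q = 0" for A B
    by (rule dd_zero[OF _ q]) (rule \<Gamma>_hol)
  then show ?thesis unfolding Rl_def curv_def by (simp add: sum_idx \<Gamma>_hol \<Gamma>_anti q)
qed

lemma R_tr:
  assumes q: "q \<in> U" shows "(\<Sum>x\<in>UNIV. R A B (Inl x) (Inr x) q) = 0"
proof -
  have d: "(\<Sum>x\<in>UNIV. dd A (\<Gamma> B (Inl x) (Inl x)) q) = 0" for A B
  proof -
    have "dd A (\<lambda>q. \<Sum>x\<in>UNIV. \<Gamma> B (Inl x) (Inl x) q) q = 0"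
      by (rule dd_zero[OF _ q]) (rule \<Gamma>_tr)
    then show ?thesis by (simp add: dd_sum \<Gamma>_C q)
  qed
  have 1: "(\<Sum>x\<in>UNIV. \<Sum>m\<in>UNIV. \<Gamma> B (Inl x) m q * \<Gamma> A m (Inl x) q) =
      (\<Sum>x\<in>UNIV. \<Sum>m\<in>UNIV. \<Gamma> B (Inl x) (Inl m) q * \<Gamma> A (Inl m) (Inl x) q)" for A B
    by (simp add: sum_idx \<Gamma>_hol q)
  have 2: "(\<Sum>x\<in>UNIV. \<Sum>m\<in>UNIV. \<Gamma> B (Inl x) (Inl m) q * \<Gamma> A (Inl m) (Inl x) q) =
      (\<Sum>x\<in>UNIV. \<Sum>m\<in>UNIV. \<Gamma> A (Inl x) (Inl m) q * \<Gamma> B (Inl m) (Inl x) q)"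
    by (subst sum.swap) (simp add: mult.commute)
  have 3: "(\<Sum>x\<in>UNIV. \<Sum>m\<in>UNIV. \<beta> A B m q * \<Gamma> m (Inl x) (Inl x) q) = 0"
    by (subst sum.swap) (simp add: sum_distrib_left[symmetric] \<Gamma>_tr q)
  show ?thesis
    unfolding Rl_def curv_def sum_subtractf sum.distrib dual.simps d 1 2 3 by simp
qed

text \<open>
  Each algebraic property of \<open>T\<close> passes to \<open>\<nabla>T\<close>, and each one of the connection coefficients to the
  curvature, because both sides of the property are differentiated and the connection is
  \<open>su(3)\<close>-valued.
\<close>
lemma pointwise_bianchi:
  assumes q: "q \<in> U"
  shows "su3_bianchi (\<lambda>A B X. T A B X q) (\<lambda>M A B X. N M A B X q) (\<lambda>A B X Y. R A B X Y q)"
proof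
  fix A B X Y
  show "R A B X Y q + R B X A Y q + R X A B Y q = N A B X Y q + N B X A Y q + N X A B Y q
      + (\<Sum>M\<in>UNIV. T A B (dual M) q * T M X Y q + T B X (dual M) q * T M A Y q + T X A (dual M) q * T M B Y q)"
    unfolding Rl_def Nl_def Tl_def dual_dual by (rule bianchi[OF q])
qed (rule Tl_skew[OF q] N_skew[OF q] Tl_tr[OF q] N_tr[OF q] T_cnj[OF q] N_cnj[OF q] R_cnj[OF q]
    R_skew[OF q] R_hol[OF q] R_tr[OF q])+

text \<open>
  The covariant derivative of a section of \<open>T\<^sup>1\<^sup>,\<^sup>0 \<otimes> T\<^sup>1\<^sup>,\<^sup>0\<close> with components \<open>f c d\<close>, in the direction
  \<open>Z\<^sub>M\<close>.
\<close>
definition nab :: "(i3 \<Rightarrow> i3 \<Rightarrow> 'p \<Rightarrow> complex) \<Rightarrow> idx \<Rightarrow> i3 \<Rightarrow> i3 \<Rightarrow> 'p \<Rightarrow> complex" where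
  "nab f M c d q = dd M (f c d) q +
     (\<Sum>l\<in>UNIV. \<Gamma> M (Inl l) (Inl c) q * f l d q + \<Gamma> M (Inl l) (Inl d) q * f c l q)"

lemma nab_C: "(\<And>c d. f c d \<in> C) \<Longrightarrow> nab f M c d \<in> C"
  unfolding nab_def[abs_def] by (intro C_add C_sum C_mult C_dd \<Gamma>_C) auto

text \<open>
  Iterated derivatives here are taken along the frame fields, so the derivative along their bracket
  remains on the right.
\<close>
lemma ricci_identity:
  assumes f: "\<And>c d. f c d \<in> C" and q: "q \<in> U"
  shows "nab (nab f B) A c d q - nab (nab f A) B c d q =
    (\<Sum>e\<in>UNIV. R A B (Inl e) (Inr c) q * f e d q + R A B (Inl e) (Inr d) q * f c e q)
      + (\<Sum>k\<in>UNIV. \<beta> A B k q * nab f k c d q)"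
proof -
  define G where "G A l c = \<Gamma> A (Inl l) (Inl c) q" for A l c
  define g where "g A B l c = dd A (\<Gamma> B (Inl l) (Inl c)) q" for A B l c
  define h where "h A c d = dd A (f c d) q" for A c d
  define F where "F c d = f c d q" for c d
  define b where "b k = \<beta> A B k q" for k
  have dd: "dd A (nab f B c d) q = dd A (dd B (f c d)) q +
      (\<Sum>l\<in>UNIV. g A B l c * F l d + G B l c * h A l d + (g A B l d * F c l + G B l d * h A c l))" for A B c d
    unfolding nab_def[abs_def] g_def G_def h_def F_def
    by (simp add: dd_add dd_sum dd_mult C_add C_sum C_mult C_dd \<Gamma>_C f q)
  have n: "nab (nab f B) A c d q = dd A (dd B (f c d)) q +
      (\<Sum>l\<in>UNIV. g A B l c * F l d + G B l c * h A l d + (g A B l d * F c l + G B l d * h A c l)) +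
      (\<Sum>l\<in>UNIV. G A l c * (h B l d + (\<Sum>m\<in>UNIV. G B m l * F m d + G B m d * F l m)) +
         G A l d * (h B c l + (\<Sum>m\<in>UNIV. G B m c * F m l + G B m l * F c m)))" for A B
    by (simp only: nab_def[of "nab f B"] dd) (simp only: nab_def G_def h_def F_def)
  have c: "dd A (dd B (f c d)) q = dd B (dd A (f c d)) q + (\<Sum>k\<in>UNIV. b k * h k c d)"
    using commutator[OF f q, of A B c d] by (simp add: h_def b_def algebra_simps)
  have r: "R A B (Inl e) (Inr c) q = g A B e c - g B A e c +
      (\<Sum>m\<in>UNIV. G B e m * G A m c - G A e m * G B m c) - (\<Sum>k\<in>UNIV. b k * G k e c)" for e c
    unfolding Rl_def curv_def sum_subtractf
    by (simp add: sum_idx \<Gamma>_hol q g_def G_def b_def sum_subtractf)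
  have k: "(\<Sum>k\<in>UNIV. \<beta> A B k q * nab f k c d q) = (\<Sum>k\<in>UNIV. b k * h k c d) +
     (\<Sum>e\<in>UNIV. (\<Sum>k\<in>UNIV. b k * G k e c) * F e d + (\<Sum>k\<in>UNIV. b k * G k e d) * F c e)"
    unfolding nab_def[abs_def] h_def[symmetric] G_def[symmetric] F_def[symmetric] b_def[symmetric] distrib_left sum.distrib
      sum_distrib_left sum_distrib_right
    by (subst (2 4) sum.swap) (simp add: mult.assoc)
  show ?thesis
    unfolding n r k c F_def[symmetric] by (simp add: sum_i3 algebra_simps)
qed

text \<open>The (2,1)-part of the torsion as a matrix-valued function.\<close>
definition S :: "i3 \<Rightarrow> i3 \<Rightarrow> 'p \<Rightarrow> complex" where
  "S b c q = prim (\<lambda>A B X. T A B X q) b c"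

lemma S_C: "S b c \<in> C"
  unfolding S_def[abs_def] prim_def by (rule T_C)

text \<open>
  The volume form that identifies \<open>\<Lambda>\<^sup>2\<close> with covectors is parallel, so taking the (2,1)-part commutes
  with \<open>\<nabla>\<close>. In components this is the trace condition on \<open>\<Gamma>\<close>.
\<close>
lemma prim_N:
  assumes q: "q \<in> U" shows "prim (\<lambda>A B X. N M A B X q) b c = nab S M b c q"
proof -
  interpret P: su3_bianchi "\<lambda>A B X. T A B X q" "\<lambda>M A B X. N M A B X q" "\<lambda>A B X Y. R A B X Y q"
    by (rule pointwise_bianchi[OF q])
  have n: "prim (\<lambda>A B X. N M A B X q) b c = N M (Inl (nxt b)) (Inl (nxt (nxt b))) (Inr c) q"
    by (simp add: prim_def)
  have S: "prim (\<lambda>A B X. T A B X q) b c = S b c q" for b c by (simp add: S_def)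
  have d: "dd M (T (Inl (nxt b)) (Inl (nxt (nxt b))) (Inr c)) q = dd M (S b c) q"
    unfolding S_def[abs_def] prim_def ..
  have g: "\<Gamma> M (Inl I3) (Inl I3) q = - \<Gamma> M (Inl I1) (Inl I1) q - \<Gamma> M (Inl I2) (Inl I2) q"
    using \<Gamma>_tr[OF q, of M] by (simp add: sum_i3) algebra
  show ?thesis
    unfolding n unfolding N_eq[OF q] d nab_def
    by (cases b; cases c; simp add: sum_idx sum_i3 P.T_comp S P.S_sym(1-3)[unfolded S] \<Gamma>_hol \<Gamma>_anti q g algebra_simps)
qed

end

section \<open>The torsion of a balanced instanton is parallel\<close>

locale su3_instanton_frame = su3_frame U C dd \<Gamma> \<beta>
  for U :: "'p set" and C :: "('p \<Rightarrow> complex) set" and dd :: "idx \<Rightarrow> ('p \<Rightarrow> complex) \<Rightarrow> 'p \<Rightarrow> complex"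
    and \<Gamma> \<beta> :: "idx \<Rightarrow> idx \<Rightarrow> idx \<Rightarrow> 'p \<Rightarrow> complex" +
  assumes instanton: "q \<in> U \<Longrightarrow> R (Inl a) (Inl b) X Y q = 0"
    and instanton_tr: "q \<in> U \<Longrightarrow> (\<Sum>a\<in>UNIV. R (Inl a) (Inr a) X Y q) = 0"
begin

lemma pointwise:
  assumes "q \<in> U"
  shows "su3_instanton_bianchi (\<lambda>A B X. T A B X q) (\<lambda>M A B X. N M A B X q) (\<lambda>A B X Y. R A B X Y q)"
  by (intro su3_instanton_bianchi.intro pointwise_bianchi su3_instanton_bianchi_axioms.intro
      instanton instanton_tr assms)

definition V :: "i3 \<Rightarrow> i3 \<Rightarrow> i3 \<Rightarrow> 'p \<Rightarrow> complex" where "V a b c = nab S (Inr a) b c"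

lemma V_C: "V a b c \<in> C"
  unfolding V_def by (rule nab_C[OF S_C])

lemma V_pointwise:
  assumes "q \<in> U"
  shows "su3_instanton_bianchi.V (\<lambda>M A B X. N M A B X q) a b c = V a b c q"
  unfolding su3_instanton_bianchi.V_def[OF pointwise[OF assms]] prim_N[OF assms] V_def ..

lemma S_sym:
  assumes "q \<in> U" shows "S b c q = S c b q"
  unfolding S_def using prim_sym[OF Tl_skew[OF assms] Tl_tr[OF assms]] .

lemma V_sym:
  assumes "q \<in> U" shows "V a b c q = V b a c q" "V a b c q = V a c b q"
  using su3_instanton_bianchi.V_sym12[OF pointwise[OF assms]]
    su3_instanton_bianchi.V_sym23[OF pointwise[OF assms]] unfolding V_pointwise[OF assms] by blast+

lemma nab_S_hol:
  assumes "q \<in> U" shows "nab S (Inl a) b c q = 0"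
  using su3_instanton_bianchi.hol_parallel(2)[OF pointwise[OF assms], of a b c]
  unfolding prim_N[OF assms] .

text \<open>
  The covariant derivative \<open>\<nabla>\<^sub>a V\<^sub>b\<^sup>c\<^sup>d\<close>. The antiholomorphic index of \<open>V\<close> is raised to a holomorphic
  one, so that all three indices are treated alike.
\<close>
definition W :: "i3 \<Rightarrow> i3 \<Rightarrow> i3 \<Rightarrow> i3 \<Rightarrow> 'p \<Rightarrow> complex" where
  "W a b c d q = dd (Inl a) (V b c d) q + (\<Sum>l\<in>UNIV. \<Gamma> (Inl a) (Inl l) (Inl b) q * V l c d q +
     \<Gamma> (Inl a) (Inl l) (Inl c) q * V b l d q + \<Gamma> (Inl a) (Inl l) (Inl d) q * V b c l q)"

lemma W_sym:
  assumes q: "q \<in> U" shows "W a b c d q = W a c b d q"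
proof -
  have "dd (Inl a) (V b c d) q = dd (Inl a) (V c b d) q"
    by (rule dd_cong[OF _ q]) (rule V_sym(1))
  then show ?thesis
    unfolding W_def V_sym(1)[OF q, of c b] V_sym(1)[OF q, of _ b d] V_sym(1)[OF q, of c _ d] by (simp add: add_ac)
qed

text \<open>
  The Ricci identity for \<open>\<nabla>\<^sub>a \<nabla>\<^bsub>b'\<^esub> S - \<nabla>\<^bsub>b'\<^esub> \<nabla>\<^sub>a S\<close>, where the second term vanishes and the bracket is
  expressed by the connection and the torsion.
\<close>
lemma W_eq:
  assumes q: "q \<in> U"
  shows "W a b c d q = (\<Sum>e\<in>UNIV. R (Inl a) (Inr b) (Inl e) (Inr c) q * S e d q
       + R (Inl a) (Inr b) (Inl e) (Inr d) q * S c e q)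
     - (\<Sum>m\<in>UNIV. T (Inl a) (Inr b) (Inl m) q * V m c d q)"
proof -
  have z: "nab (nab S (Inl a)) (Inr b) c d q = 0"
    unfolding nab_def[of "nab S (Inl a)"] by (simp add: nab_S_hol q dd_zero)
  have b: "\<beta> (Inl a) (Inr b) (Inr m) q = - \<Gamma> (Inl a) (Inl m) (Inl b) q - T (Inl a) (Inr b) (Inl m) q" for m
    by (simp add: Tl_def tor_def \<Gamma>_hol \<Gamma>_anti q)
  have "nab (V b) (Inl a) c d q = (\<Sum>e\<in>UNIV. R (Inl a) (Inr b) (Inl e) (Inr c) q * S e d q
       + R (Inl a) (Inr b) (Inl e) (Inr d) q * S c e q)
     + (\<Sum>m\<in>UNIV. \<beta> (Inl a) (Inr b) (Inr m) q * V m c d q)"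
    using ricci_identity[of S, OF S_C q, where B = "Inr b" and A = "Inl a" and c = c and d = d]
    by (simp add: z sum_idx nab_S_hol q V_def[abs_def])
  then show ?thesis
    unfolding b W_def nab_def
    by (simp add: sum.distrib sum_subtractf left_diff_distrib sum_negf algebra_simps)
qed

text \<open>
  After contraction, each term of \<open>W_eq\<close> contains the trace of the curvature or of the torsion over
  the first two arguments.
\<close>
lemma W_tr:
  assumes q: "q \<in> U" shows "(\<Sum>a\<in>UNIV. W a a c d q) = 0"
proof -
  have i: "(\<Sum>a\<in>UNIV. R (Inl a) (Inr a) X Y q * x) = 0" for X Y x
    by (simp add: sum_distrib_right[symmetric] instanton_tr q)
  have t: "(\<Sum>a\<in>UNIV. T (Inl a) (Inr a) X q * x) = 0" for X x
    using Tl_tr[OF q] by (simp add: sum_distrib_right[symmetric] tracefree_def)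
  have 1: "(\<Sum>a\<in>UNIV. \<Sum>e\<in>UNIV. R (Inl a) (Inr a) (Inl e) (Inr c) q * S e d q) = 0"
    "(\<Sum>a\<in>UNIV. \<Sum>e\<in>UNIV. R (Inl a) (Inr a) (Inl e) (Inr d) q * S c e q) = 0"
    "(\<Sum>a\<in>UNIV. \<Sum>m\<in>UNIV. T (Inl a) (Inr a) (Inl m) q * V m c d q) = 0"
    by (subst sum.swap; simp add: i t)+
  show ?thesis unfolding W_eq[OF q] sum_subtractf sum.distrib 1 by simp
qed

text \<open>
  As \<open>V\<close> is totally symmetric, it is also divergence-free when the derivative is contracted with the
  index \<open>c\<close> of \<open>W_eq\<close>. The torsion term of this contraction vanishes, \<open>T\<close> being skew and \<open>V\<close>
  symmetric, and \<open>torsion_orthogonal\<close> applies. Since \<open>\<nabla>\<^sub>f S = 0\<close>, the sum is the conjugate of the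
  derivative of \<open>\<bar>S\<bar>\<^sup>2\<close> along \<open>Z\<^sub>f'\<close>.
\<close>
lemma norm_derivative:
  assumes q: "q \<in> U" shows "(\<Sum>a\<in>UNIV. \<Sum>e\<in>UNIV. cnj (V f a e q) * S a e q) = 0"
proof -
  interpret P: su3_instanton_bianchi "\<lambda>A B X. T A B X q" "\<lambda>M A B X. N M A B X q" "\<lambda>A B X Y. R A B X Y q"
    by (rule pointwise[OF q])
  have "(\<Sum>a\<in>UNIV. \<Sum>e\<in>UNIV. R (Inl a) (Inr b) (Inl e) (Inr a) q * S e d q + R (Inl a) (Inr b) (Inl e) (Inr d) q * S a e q) = 0" for b d
  proof -
    have m: "(\<Sum>a\<in>UNIV. \<Sum>m\<in>UNIV. T (Inl a) (Inr b) (Inl m) q * V m a d q) = 0"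
      unfolding P.T_comp(3)
      by (cases b; simp add: sum_i3 V_sym(1)[OF q, of I2 I1] V_sym(1)[OF q, of I3 I1] V_sym(1)[OF q, of I3 I2])
    have "(\<Sum>a\<in>UNIV. W a b a d q) = 0"
      using W_tr[OF q, of b d] W_sym[OF q] by simp
    then show ?thesis unfolding W_eq[OF q] sum_subtractf m by simp
  qed
  then show ?thesis
    using P.torsion_orthogonal unfolding P.r_def V_pointwise[OF q] S_def by blast
qed

text \<open>
  The divergence of the identity \<open>\<Sum>\<^sub>a\<^sub>e V\<^sub>f\<^sup>a\<^sup>e S'\<^sub>a\<^sub>e = 0\<close> is \<open>(div V) S' + V V' = 0\<close>, and \<open>div V = 0\<close>.
\<close>
lemma V_zero:
  assumes q: "q \<in> U" shows "V a b c q = 0"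
proof -
  define H where "H f p = (\<Sum>a\<in>UNIV. \<Sum>e\<in>UNIV. V f a e p * cnj (S a e p))" for f p
  have H0: "H f p = 0" if "p \<in> U" for f p
    using arg_cong[OF norm_derivative[OF that, of f], of cnj] by (simp add: H_def)
  (* The holomorphic derivative of conj S is the conjugate of the antiholomorphic
     derivative of S, i.e. of V. *)
  have S': "dd (Inl f) (\<lambda>p. cnj (S a e p)) q = cnj (V f a e q) +
     (\<Sum>l\<in>UNIV. \<Gamma> (Inl f) (Inl a) (Inl l) q * cnj (S l e q) + \<Gamma> (Inl f) (Inl e) (Inl l) q * cnj (S a l q))" for f a e
  proof -
    have g: "cnj (\<Gamma> (Inr f) (Inl l) (Inl a) q) = - \<Gamma> (Inl f) (Inl a) (Inl l) q" for l a
      by (simp add: \<Gamma>_cnj \<Gamma>_anti q)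
    have "cnj (dd (Inr f) (S a e) q) = dd (Inl f) (\<lambda>p. cnj (S a e p)) q"
      by (simp add: dd_cnj S_C q)
    moreover have "dd (Inr f) (S a e) q = V f a e q - (\<Sum>l\<in>UNIV. \<Gamma> (Inr f) (Inl l) (Inl a) q * S l e q + \<Gamma> (Inr f) (Inl l) (Inl e) q * S a l q)"
      by (simp add: V_def nab_def)
    ultimately have "dd (Inl f) (\<lambda>p. cnj (S a e p)) q = cnj (V f a e q - (\<Sum>l\<in>UNIV. \<Gamma> (Inr f) (Inl l) (Inl a) q * S l e q
        + \<Gamma> (Inr f) (Inl l) (Inl e) q * S a l q))"
      by simp
    then show ?thesis by (simp add: g sum_negf sum.distrib)
  qed
  have V': "dd (Inl f) (V b c d) q = W f b c d q - (\<Sum>l\<in>UNIV. \<Gamma> (Inl f) (Inl l) (Inl b) q * V l c d q +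
     \<Gamma> (Inl f) (Inl l) (Inl c) q * V b l d q + \<Gamma> (Inl f) (Inl l) (Inl d) q * V b c l q)" for f b c d
    by (simp add: W_def)
  have dH: "dd (Inl f) (H f) q = (\<Sum>a\<in>UNIV. \<Sum>e\<in>UNIV. W f f a e q * cnj (S a e q) + V f a e q * cnj (V f a e q))
      - (\<Sum>l\<in>UNIV. \<Gamma> (Inl f) (Inl l) (Inl f) q * H l q)" for f
  proof -
    have "dd (Inl f) (H f) q = (\<Sum>a\<in>UNIV. \<Sum>e\<in>UNIV. dd (Inl f) (V f a e) q * cnj (S a e q) + V f a e q * dd (Inl f) (\<lambda>p. cnj (S a e p)) q)"
      unfolding H_def[abs_def] by (simp add: dd_sum dd_mult C_sum C_mult V_C S_C C_cnj q)
    then show ?thesis unfolding S' V' H_def by (simp add: sum_i3 algebra_simps)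
  qed
  have "dd (Inl f) (H f) q = 0" for f
    by (rule dd_zero[OF _ q]) (rule H0)
  then have "(\<Sum>f\<in>UNIV. \<Sum>a\<in>UNIV. \<Sum>e\<in>UNIV. W f f a e q * cnj (S a e q) + V f a e q * cnj (V f a e q)) = 0"
    using dH by (simp add: H0 q)
  moreover have "(\<Sum>f\<in>UNIV. \<Sum>a\<in>UNIV. \<Sum>e\<in>UNIV. W f f a e q * cnj (S a e q)) = 0"
  proof -
    have "(\<Sum>f\<in>UNIV. \<Sum>a\<in>UNIV. \<Sum>e\<in>UNIV. W f f a e q * cnj (S a e q)) =
       (\<Sum>a\<in>UNIV. \<Sum>e\<in>UNIV. (\<Sum>f\<in>UNIV. W f f a e q) * cnj (S a e q))"
      by (simp add: sum_i3 algebra_simps)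
    then show ?thesis by (simp add: W_tr q)
  qed
  ultimately have "(\<Sum>f\<in>UNIV. \<Sum>a\<in>UNIV. \<Sum>e\<in>UNIV. V f a e q * cnj (V f a e q)) = 0"
    by (simp add: sum.distrib)
  then have "complex_of_real (\<Sum>f\<in>UNIV. \<Sum>a\<in>UNIV. \<Sum>e\<in>UNIV. (cmod (V f a e q))\<^sup>2) = 0"
    by (simp only: complex_norm_square of_real_sum)
  then have *: "(\<Sum>f\<in>UNIV. \<Sum>a\<in>UNIV. \<Sum>e\<in>UNIV. (cmod (V f a e q))\<^sup>2) = 0"
    by (simp only: of_real_eq_0_iff)
  then have "(cmod (V a b c q))\<^sup>2 = 0"
    by (subst (asm) sum_nonneg_eq_0_iff; simp add: sum_nonneg sum_nonneg_eq_0_iff)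
  then show ?thesis by simp
qed

theorem torsion_parallel:
  assumes q: "q \<in> U" shows "N M A B X q = 0"
proof -
  interpret P: su3_instanton_bianchi "\<lambda>A B X. T A B X q" "\<lambda>M A B X. N M A B X q" "\<lambda>A B X Y. R A B X Y q"
    by (rule pointwise[OF q])
  have h: "hvol (\<lambda>A B X. N M A B X q) = 0" for M
    by (cases M) (simp_all add: P.hvol_hol P.hol_parallel)
  have p: "prim (\<lambda>A B X. N M A B X q) b c = 0" for M b c
    using V_zero[OF q] by (cases M) (simp_all add: P.hol_parallel prim_N[OF q] V_def)
  show ?thesis
    by (cases A; cases B; cases X) (simp_all add: P.N_comp h p)
qed

end

section \<open>From orthonormal to unitary frames\<close>

definition rsqrt2 :: complex where "rsqrt2 = complex_of_real (1 / sqrt 2)"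

lemma rsqrt2_sq: "rsqrt2 * rsqrt2 = 1 / 2" "rsqrt2 * (rsqrt2 * x) = x / 2"
proof -
  show *: "rsqrt2 * rsqrt2 = 1 / 2"
  proof -
    have "1 / sqrt 2 * (1 / sqrt 2) = (1 / 2 :: real)" by simp
    then show ?thesis unfolding rsqrt2_def of_real_mult[symmetric] by simp
  qed
  show "rsqrt2 * (rsqrt2 * x) = x / 2" by (simp add: mult.assoc[symmetric] *)
qed

lemma rsqrt2_nz: "rsqrt2 \<noteq> 0" "cnj rsqrt2 = rsqrt2" by (auto simp: rsqrt2_def)

text \<open>
  The components of a linear form on the vectors \<open>Z\<^sub>a = (e\<^sub>a - \<i> J e\<^sub>a) / \<surd>2\<close> and their conjugates,
  from its components on \<open>e\<^sub>a\<close> and \<open>J e\<^sub>a\<close>. Tensors are transformed one index at a time.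
\<close>
definition hol :: "(idx \<Rightarrow> complex) \<Rightarrow> idx \<Rightarrow> complex" where
  "hol x A = (case A of Inl a \<Rightarrow> rsqrt2 * (x (Inl a) - \<i> * x (Inr a))
     | Inr a \<Rightarrow> rsqrt2 * (x (Inl a) + \<i> * x (Inr a)))"

lemma hol_add: "hol (\<lambda>i. f i + h i) A = hol f A + hol h A"
  and hol_diff: "hol (\<lambda>i. f i - h i) A = hol f A - hol h A"
  and hol_uminus: "hol (\<lambda>i. - f i) A = - hol f A"
  and hol_mult_left: "hol (\<lambda>i. c * f i) A = c * hol f A"
  and hol_mult_right: "hol (\<lambda>i. f i * c) A = hol f A * c"
  and hol_zero: "hol (\<lambda>i. 0) A = 0"
  by (cases A; simp add: hol_def algebra_simps)+

lemma hol_sum: "finite I \<Longrightarrow> hol (\<lambda>i. \<Sum>m\<in>I. f m i) A = (\<Sum>m\<in>I. hol (f m) A)"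
  by (induction I rule: finite_induct) (auto simp: hol_zero hol_add)

lemma hol_commute: "hol (\<lambda>i. hol (\<lambda>j. f i j) B) A = hol (\<lambda>j. hol (\<lambda>i. f i j) A) B"
  by (cases A; cases B; simp add: hol_def algebra_simps)

text \<open>
  The complex frame is unitary, so contraction with the metric is the pairing of conjugate indices.
\<close>
lemma hol_contract: "(\<Sum>M\<in>UNIV. hol x (dual M) * hol y M) = (\<Sum>m\<in>UNIV. x m * y m)"
proof -
  have "(\<Sum>M\<in>UNIV. hol x (dual M) * hol y M) = (\<Sum>a\<in>UNIV. hol x (Inr a) * hol y (Inl a) + hol x (Inl a) * hol y (Inr a))"
    by (simp add: sum_idx sum.distrib)
  also have "\<dots> = (\<Sum>a\<in>UNIV. x (Inl a) * y (Inl a) + x (Inr a) * y (Inr a))"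
    by (rule sum.cong[OF refl]) (simp add: hol_def algebra_simps rsqrt2_sq)
  finally show ?thesis by (simp add: sum_idx sum.distrib)
qed

lemma cnj_hol: "cnj (hol x A) = hol (\<lambda>i. cnj (x i)) (dual A)"
  by (cases A) (simp_all add: hol_def rsqrt2_nz)

lemma hol_inject:
  assumes "hol x (Inl a) = 0" "hol x (Inr a) = 0" shows "x (Inl a) = 0" "x (Inr a) = 0"
proof -
  have "x (Inl a) - \<i> * x (Inr a) = 0" "x (Inl a) + \<i> * x (Inr a) = 0"
    using assms by (simp_all add: hol_def rsqrt2_nz)
  then have "2 * x (Inl a) = 0" "2 * (\<i> * x (Inr a)) = 0" by algebra+
  then show "x (Inl a) = 0" "x (Inr a) = 0" by simp_all
qed

lemma hol_inj: "(\<And>A. hol x A = 0) \<Longrightarrow> x i = 0"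
  using hol_inject[of x] by (cases i) auto

lemma hol_hol_zero_iff: "(\<forall>X Y. hol (\<lambda>k. hol (\<lambda>l. z k l) Y) X = 0) \<longleftrightarrow> (\<forall>k l. z k l = 0)"
proof (intro iffI allI)
  fix k l assume "\<forall>X Y. hol (\<lambda>k. hol (\<lambda>l. z k l) Y) X = 0"
  then have "hol (\<lambda>l. z k l) Y = 0" for Y
    by (intro hol_inj[of "\<lambda>k. hol (\<lambda>l. z k l) Y"]) blast
  then show "z k l = 0" by (rule hol_inj)
qed (simp add: hol_zero)

lemma hol_pair:
  "hol (\<lambda>i. hol (\<lambda>j. x i j) (Inl b)) (Inl a) = 1 / 2 * ((x (Inl a) (Inl b) - x (Inr a) (Inr b)) - \<i> * (x (Inl a) (Inr b) + x (Inr a) (Inl b)))"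
  "hol (\<lambda>i. hol (\<lambda>j. x i j) (Inr b)) (Inr a) = 1 / 2 * ((x (Inl a) (Inl b) - x (Inr a) (Inr b)) + \<i> * (x (Inl a) (Inr b) + x (Inr a) (Inl b)))"
  "hol (\<lambda>i. hol (\<lambda>j. x i j) (Inr b)) (Inl a) = 1 / 2 * ((x (Inl a) (Inl b) + x (Inr a) (Inr b)) + \<i> * (x (Inl a) (Inr b) - x (Inr a) (Inl b)))"
  by (simp_all add: hol_def algebra_simps rsqrt2_sq)

text \<open>
  The (2,0)- and the (0,2)-part of a bilinear form are the two complex combinations of the defects
  of \<open>J\<close>-invariance on the right.
\<close>
lemma hol_type11:
  "(\<forall>a b. hol (\<lambda>i. hol (\<lambda>j. x i j) (Inl b)) (Inl a) = 0 \<and> hol (\<lambda>i. hol (\<lambda>j. x i j) (Inr b)) (Inr a) = 0) \<longleftrightarrow>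
   (\<forall>a b. x (Inr a) (Inr b) = x (Inl a) (Inl b) \<and> x (Inr a) (Inl b) = - x (Inl a) (Inr b))"
proof -
  have "(P - \<i> * Q = 0 \<and> P + \<i> * Q = 0) \<longleftrightarrow> (P = 0 \<and> Q = 0)" for P Q :: complex
  proof
    assume "P - \<i> * Q = 0 \<and> P + \<i> * Q = 0"
    then have "2 * P = 0" "2 * (\<i> * Q) = 0" by algebra+
    then show "P = 0 \<and> Q = 0" by simp
  qed simp
  then have "(1 / 2 * (P - \<i> * Q) = 0 \<and> 1 / 2 * (P + \<i> * Q) = 0) \<longleftrightarrow> (P = 0 \<and> Q = 0)" for P Q :: complex
    by simp
  moreover have "(p - p' = 0 \<and> q + q' = 0) \<longleftrightarrow> (p' = p \<and> q' = - q)" for p p' q q' :: complex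
    by (metis add_eq_0_iff eq_iff_diff_eq_0)
  ultimately show ?thesis unfolding hol_pair by presburger
qed

text \<open>
  An orthonormal frame \<open>e\<^sub>a, J e\<^sub>a\<close> in which the connection coefficients take values in \<open>su(3)\<close>, with
  skew and trace-free torsion.
\<close>
locale real_su3_frame = frame_calculus U C dd \<Gamma> \<beta>
  for U :: "'p set" and C :: "('p \<Rightarrow> real) set" and dd :: "idx \<Rightarrow> ('p \<Rightarrow> real) \<Rightarrow> 'p \<Rightarrow> real"
    and \<Gamma> \<beta> :: "idx \<Rightarrow> idx \<Rightarrow> idx \<Rightarrow> 'p \<Rightarrow> real" +
  assumes \<Gamma>_skew: "q \<in> U \<Longrightarrow> \<Gamma> i j k q = - \<Gamma> i k j q"
    and \<Gamma>_J: "q \<in> U \<Longrightarrow> \<Gamma> i (Inr b) (Inr c) q = \<Gamma> i (Inl b) (Inl c) q"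
      "q \<in> U \<Longrightarrow> \<Gamma> i (Inr b) (Inl c) q = - \<Gamma> i (Inl b) (Inr c) q"
    and \<Gamma>_tr: "q \<in> U \<Longrightarrow> (\<Sum>b\<in>UNIV. \<Gamma> i (Inl b) (Inr b) q) = 0"
    and tor_skew23: "q \<in> U \<Longrightarrow> tor \<Gamma> \<beta> i j k q = - tor \<Gamma> \<beta> i k j q"
    and tor_tr: "q \<in> U \<Longrightarrow> (\<Sum>a\<in>UNIV. tor \<Gamma> \<beta> (Inl a) (Inr a) k q) = 0"
begin

text \<open>
  Complex-valued functions, and the complex-linear extension of the frame derivations to them.
\<close>
definition CC :: "('p \<Rightarrow> complex) set" where
  "CC = {f. (\<lambda>q. Re (f q)) \<in> C \<and> (\<lambda>q. Im (f q)) \<in> C}"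

definition cd :: "idx \<Rightarrow> ('p \<Rightarrow> complex) \<Rightarrow> 'p \<Rightarrow> complex" where
  "cd i f q = Complex (dd i (\<lambda>q. Re (f q)) q) (dd i (\<lambda>q. Im (f q)) q)"

lemma derivations_cd: "derivations U CC cd"
proof
  fix f h :: "'p \<Rightarrow> complex" and q i and c :: complex
  show "(\<lambda>_. c) \<in> CC" by (simp add: CC_def C_const)
  show "(\<lambda>q. f q + h q) \<in> CC" "(\<lambda>q. f q * h q) \<in> CC" if "f \<in> CC" "h \<in> CC"
    using that by (auto simp: CC_def intro!: C_add C_diff C_mult)
  show "cd i f \<in> CC" if "f \<in> CC"
  proof -
    have "(\<lambda>q. Re (cd i f q)) = dd i (\<lambda>q. Re (f q))" "(\<lambda>q. Im (cd i f q)) = dd i (\<lambda>q. Im (f q))"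
      by (simp_all add: cd_def)
    then show ?thesis using that by (simp add: CC_def C_dd)
  qed
  assume q: "q \<in> U"
  show "cd i (\<lambda>_. c) q = 0" by (simp add: cd_def dd_const q complex_eq_iff)
  show "cd i (\<lambda>q. f q + h q) q = cd i f q + cd i h q" "cd i (\<lambda>q. f q * h q) q = cd i f q * h q + f q * cd i h q"
    if "f \<in> CC" "h \<in> CC"
    using that by (auto simp: CC_def cd_def complex_eq_iff dd_add dd_mult dd_diff C_mult q)
  show "cd i f q = cd i h q" if "\<And>q. q \<in> U \<Longrightarrow> f q = h q"
    using dd_cong[of "\<lambda>q. Re (f q)" "\<lambda>q. Re (h q)" q i] dd_cong[of "\<lambda>q. Im (f q)" "\<lambda>q. Im (h q)" q i] that q
    by (simp add: cd_def)
qed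

sublocale cd: derivations U CC cd by (rule derivations_cd)

lemma CC_of_real: "f \<in> C \<Longrightarrow> (\<lambda>q. complex_of_real (f q)) \<in> CC"
  by (simp add: CC_def C_const)

lemma cd_of_real: "q \<in> U \<Longrightarrow> cd i (\<lambda>q. complex_of_real (f q)) q = complex_of_real (dd i f q)"
  by (simp add: cd_def dd_const complex_eq_iff)

lemma cd_commutator:
  assumes f: "f \<in> CC" and q: "q \<in> U"
  shows "cd i (cd j f) q - cd j (cd i f) q = (\<Sum>k\<in>UNIV. complex_of_real (\<beta> i j k q) * cd k f q)"
proof -
  have "(\<lambda>q. Re (cd j f q)) = dd j (\<lambda>q. Re (f q))" "(\<lambda>q. Im (cd j f q)) = dd j (\<lambda>q. Im (f q))" for j
    by (simp_all add: cd_def)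
  then show ?thesis
    using f commutator[of "\<lambda>q. Re (f q)" q i j] commutator[of "\<lambda>q. Im (f q)" q i j] q
    by (simp add: complex_eq_iff cd_def[of _ "cd _ _"] CC_def) (simp add: cd_def)
qed

text \<open>
  Derivations along the unitary frame, and the components in it of a tensor with one upper index:
  the last index is dual because the vector component of \<open>Z\<^sub>X\<close> is read off by pairing with the
  conjugate of \<open>Z\<^sub>X\<close>.
\<close>
definition cdd :: "idx \<Rightarrow> ('p \<Rightarrow> complex) \<Rightarrow> 'p \<Rightarrow> complex" where
  "cdd A f q = hol (\<lambda>i. cd i f q) A"

definition holc :: "(idx \<Rightarrow> idx \<Rightarrow> idx \<Rightarrow> 'p \<Rightarrow> real) \<Rightarrow> idx \<Rightarrow> idx \<Rightarrow> idx \<Rightarrow> 'p \<Rightarrow> complex" where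
  "holc x A B X q = hol (\<lambda>i. hol (\<lambda>j. hol (\<lambda>k. complex_of_real (x i j k q)) (dual X)) B) A"

lemma CC_hol:
  assumes "\<And>i. f i \<in> CC" shows "(\<lambda>q. hol (\<lambda>i. f i q) A) \<in> CC"
  unfolding hol_def
  by (cases A; simp; intro cd.C_mult cd.C_diff cd.C_add cd.C_const assms)

lemma cd_hol:
  assumes f: "\<And>j. f j \<in> CC" and q: "q \<in> U"
  shows "cd i (\<lambda>q. hol (\<lambda>j. f j q) B) q = hol (\<lambda>j. cd i (f j) q) B"
  by (cases B) (simp_all add: hol_def cd.dd_add cd.dd_mult cd.dd_diff cd.dd_const cd.C_const cd.C_mult cd.C_diff cd.C_add f q)

lemma CC_holc: "(\<And>i j k. x i j k \<in> C) \<Longrightarrow> holc x A B X \<in> CC"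
  unfolding holc_def[abs_def] by (intro CC_hol CC_of_real)

lemma holc_x: "cd i (holc x A B X) q = hol (\<lambda>a. hol (\<lambda>b. hol (\<lambda>k. complex_of_real (dd i (x a b k) q)) (dual X)) B) A"
  if "\<And>i j k. x i j k \<in> C" "q \<in> U"
  unfolding holc_def[abs_def] by (simp add: cd_hol CC_hol CC_of_real cd_of_real that)

lemma cdd_derivations: "derivations U CC cdd"
proof
  fix f h :: "'p \<Rightarrow> complex" and q i and c :: complex
  show "(\<lambda>_. c) \<in> CC" by (rule cd.C_const)
  show "(\<lambda>q. f q + h q) \<in> CC" "(\<lambda>q. f q * h q) \<in> CC" if "f \<in> CC" "h \<in> CC"
    using that by (auto intro!: cd.C_add cd.C_mult)
  show "cdd i f \<in> CC" if "f \<in> CC"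
    unfolding cdd_def[abs_def] by (intro CC_hol cd.C_dd that)
  assume q: "q \<in> U"
  show "cdd i (\<lambda>_. c) q = 0" by (simp add: cdd_def cd.dd_const q hol_zero)
  show "cdd i (\<lambda>q. f q + h q) q = cdd i f q + cdd i h q" "cdd i (\<lambda>q. f q * h q) q = cdd i f q * h q + f q * cdd i h q"
    if "f \<in> CC" "h \<in> CC"
    by (simp_all add: cdd_def cd.dd_add cd.dd_mult that q hol_add hol_mult_left hol_mult_right)
  show "cdd i f q = cdd i h q" if "\<And>q. q \<in> U \<Longrightarrow> f q = h q"
    using cd.dd_cong[OF that q] by (simp add: cdd_def)
qed

lemma cdd_frame_calculus: "frame_calculus U CC cdd (holc \<Gamma>) (holc \<beta>)"
proof (intro frame_calculus.intro frame_calculus_axioms.intro cdd_derivations)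
  show "holc \<Gamma> i j k \<in> CC" "holc \<beta> i j k \<in> CC" for i j k
    by (intro CC_holc \<Gamma>_C \<beta>_C)+
  fix f q A B assume f: "f \<in> CC" and q: "q \<in> U"
  have c: "cdd A (cdd B f) q = hol (\<lambda>i. hol (\<lambda>j. cd i (cd j f) q) B) A" for A B
    unfolding cdd_def[abs_def] by (simp add: cd_hol cd.C_dd f q)
  have "cdd A (cdd B f) q - cdd B (cdd A f) q = hol (\<lambda>i. hol (\<lambda>j. cd i (cd j f) q - cd j (cd i f) q) B) A"
    unfolding c hol_diff by (simp add: hol_commute[of _ A B])
  also have "\<dots> = (\<Sum>k\<in>UNIV. hol (\<lambda>i. hol (\<lambda>j. complex_of_real (\<beta> i j k q)) B) A * cd k f q)"
    unfolding cd_commutator[OF f q] by (simp add: hol_sum hol_mult_right)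
  also have "\<dots> = (\<Sum>K\<in>UNIV. hol (\<lambda>k. hol (\<lambda>i. hol (\<lambda>j. complex_of_real (\<beta> i j k q)) B) A) (dual K) * hol (\<lambda>k. cd k f q) K)"
    by (rule hol_contract[symmetric])
  also have "\<dots> = (\<Sum>K\<in>UNIV. holc \<beta> A B K q * cdd K f q)"
    unfolding holc_def cdd_def by (simp add: hol_commute[of _ _ "dual _"])
  finally show "cdd A (cdd B f) q - cdd B (cdd A f) q = (\<Sum>K\<in>UNIV. holc \<beta> A B K q * cdd K f q)" .
next
  fix q and a :: "idx \<Rightarrow> complex" and k assume q: "q \<in> U" and a: "\<And>f. f \<in> CC \<Longrightarrow> (\<Sum>k\<in>UNIV. a k * cdd k f q) = 0"
  (* A relation between the complex derivations gives one between the real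
     derivations, with coefficients b up to the factor rsqrt2. *)
  define b where "b k = (case k of Inl c \<Rightarrow> a (Inl c) + a (Inr c) | Inr c \<Rightarrow> \<i> * (a (Inr c) - a (Inl c)))" for k
  have b: "(\<Sum>k\<in>UNIV. b k * x k) * rsqrt2 = (\<Sum>k\<in>UNIV. a k * hol x k)" for x
    by (simp add: sum_idx sum_i3 b_def hol_def algebra_simps)
  have *: "(\<Sum>k\<in>UNIV. b k * complex_of_real (dd k f q)) = 0" if "f \<in> C" for f
    using a[OF CC_of_real[OF that]] rsqrt2_nz by (simp add: cdd_def b[symmetric] cd_of_real q)
  have "Re (b k) = 0" "Im (b k) = 0" for k
    by (rule dd_independent[OF q, of "\<lambda>k. Re (b k)"], use arg_cong[OF *, where f = Re] in simp)
      (rule dd_independent[OF q, of "\<lambda>k. Im (b k)"], use arg_cong[OF *, where f = Im] in simp)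
  then have b0: "b k = 0" for k by (simp add: complex_eq_iff)
  have ac: "a (Inl c) + a (Inr c) = 0 \<and> a (Inr c) - a (Inl c) = 0" for c
    using b0[of "Inl c"] b0[of "Inr c"] by (simp add: b_def)
  have "2 * a (Inl c) = 0 \<and> 2 * a (Inr c) = 0" for c using ac[of c] by algebra
  then show "a k = 0" by (cases k) simp_all
qed

lemma tor_holc: "tor (holc \<Gamma>) (holc \<beta>) A B X q = holc (tor \<Gamma> \<beta>) A B X q"
  unfolding tor_def[of "holc \<Gamma>"] holc_def
  by (subst hol_commute[of _ A B]) (simp add: tor_def[abs_def] hol_diff)

text \<open>
  The three connection terms are contractions over one index, which \<open>hol_contract\<close> transports.
\<close>
lemma nabla_tor_holc:
  assumes q: "q \<in> U"
  shows "nabla_tor cdd (holc \<Gamma>) (holc \<beta>) M A B X q =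
    hol (\<lambda>m. hol (\<lambda>i. hol (\<lambda>j. hol (\<lambda>k. complex_of_real (nabla_tor dd \<Gamma> \<beta> m i j k q)) (dual X)) B) A) M"
proof -
  let ?t = "\<lambda>i j k. complex_of_real (tor \<Gamma> \<beta> i j k q)" and ?g = "\<lambda>i j k. complex_of_real (\<Gamma> i j k q)"
  have d: "cdd M (tor (holc \<Gamma>) (holc \<beta>) A B X) q =
     hol (\<lambda>m. hol (\<lambda>i. hol (\<lambda>j. hol (\<lambda>k. complex_of_real (dd m (tor \<Gamma> \<beta> i j k) q)) (dual X)) B) A) M"
    unfolding tor_holc[abs_def] cdd_def by (simp add: holc_x tor_C q)
  have 1: "(\<Sum>m\<in>UNIV. holc \<Gamma> M A m q * holc (tor \<Gamma> \<beta>) m B X q) =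
     hol (\<lambda>i. hol (\<lambda>a. hol (\<lambda>b. hol (\<lambda>k. \<Sum>m\<in>UNIV. ?g i a m * ?t m b k) (dual X)) B) A) M"
  proof -
    have "(\<Sum>m\<in>UNIV. holc \<Gamma> M A m q * holc (tor \<Gamma> \<beta>) m B X q) =
       (\<Sum>m\<in>UNIV. hol (\<lambda>m. hol (\<lambda>i. hol (\<lambda>a. ?g i a m) A) M) (dual m) *
           hol (\<lambda>m. hol (\<lambda>b. hol (\<lambda>k. ?t m b k) (dual X)) B) m)"
      unfolding holc_def by (simp add: hol_commute[of _ _ "dual _"])
    also have "\<dots> = (\<Sum>m\<in>UNIV. hol (\<lambda>i. hol (\<lambda>a. ?g i a m) A) M * hol (\<lambda>b. hol (\<lambda>k. ?t m b k) (dual X)) B)"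
      by (rule hol_contract)
    finally show ?thesis by (simp add: hol_sum hol_mult_left hol_mult_right)
  qed
  have 2: "(\<Sum>m\<in>UNIV. holc \<Gamma> M B m q * holc (tor \<Gamma> \<beta>) A m X q) =
     hol (\<lambda>i. hol (\<lambda>a. hol (\<lambda>b. hol (\<lambda>k. \<Sum>m\<in>UNIV. ?g i b m * ?t a m k) (dual X)) B) A) M"
  proof -
    have "(\<Sum>m\<in>UNIV. holc \<Gamma> M B m q * holc (tor \<Gamma> \<beta>) A m X q) =
       (\<Sum>m\<in>UNIV. hol (\<lambda>m. hol (\<lambda>i. hol (\<lambda>b. ?g i b m) B) M) (dual m) *
           hol (\<lambda>m. hol (\<lambda>a. hol (\<lambda>k. ?t a m k) (dual X)) A) m)"
      unfolding holc_def by (simp add: hol_commute[of _ _ "dual _"] hol_commute[of _ A])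
    also have "\<dots> = (\<Sum>m\<in>UNIV. hol (\<lambda>i. hol (\<lambda>b. ?g i b m) B) M * hol (\<lambda>a. hol (\<lambda>k. ?t a m k) (dual X)) A)"
      by (rule hol_contract)
    also have "\<dots> = hol (\<lambda>i. hol (\<lambda>a. hol (\<lambda>b. \<Sum>m\<in>UNIV. ?g i b m * hol (\<lambda>k. ?t a m k) (dual X)) B) A) M"
      by (simp add: hol_sum hol_mult_left hol_mult_right)
    finally show ?thesis by (simp add: hol_sum hol_mult_left)
  qed
  have 3: "(\<Sum>m\<in>UNIV. holc \<Gamma> M m X q * holc (tor \<Gamma> \<beta>) A B m q) =
     hol (\<lambda>i. hol (\<lambda>a. hol (\<lambda>b. hol (\<lambda>k. \<Sum>m\<in>UNIV. ?g i m k * ?t a b m) (dual X)) B) A) M"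
  proof -
    have "(\<Sum>m\<in>UNIV. holc \<Gamma> M m X q * holc (tor \<Gamma> \<beta>) A B m q) =
       (\<Sum>m\<in>UNIV. hol (\<lambda>m. hol (\<lambda>a. hol (\<lambda>b. ?t a b m) B) A) (dual m) *
          hol (\<lambda>m. hol (\<lambda>i. hol (\<lambda>k. ?g i m k) (dual X)) M) m)"
      unfolding holc_def by (rule sum.cong[OF refl])
        (simp add: mult.commute hol_commute[of _ _ "dual _"] hol_commute[of _ M])
    also have "\<dots> = (\<Sum>m\<in>UNIV. hol (\<lambda>a. hol (\<lambda>b. ?t a b m) B) A * hol (\<lambda>i. hol (\<lambda>k. ?g i m k) (dual X)) M)"
      by (rule hol_contract)
    also have "\<dots> = hol (\<lambda>i. hol (\<lambda>a. hol (\<lambda>b. \<Sum>m\<in>UNIV. hol (\<lambda>k. ?g i m k) (dual X) * ?t a b m) B) A) M"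
      by (simp add: hol_sum hol_mult_left hol_mult_right mult.commute)
    finally show ?thesis by (simp add: hol_sum hol_mult_right)
  qed
  show ?thesis
    unfolding nabla_tor_def[of cdd] sum_subtractf sum.distrib d tor_holc 1 2 3
    by (simp add: nabla_tor_def hol_diff hol_add sum_subtractf sum.distrib)
qed

lemma curv_holc:
  assumes q: "q \<in> U"
  shows "curv cdd (holc \<Gamma>) (holc \<beta>) A B X Y q =
    hol (\<lambda>i. hol (\<lambda>j. hol (\<lambda>k. hol (\<lambda>l. complex_of_real (curv dd \<Gamma> \<beta> i j k l q)) (dual Y)) X) B) A"
proof -
  let ?b = "\<lambda>i j k. complex_of_real (\<beta> i j k q)" and ?g = "\<lambda>i j k. complex_of_real (\<Gamma> i j k q)"
  have d: "cdd A (holc \<Gamma> B X Y) q =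
     hol (\<lambda>i. hol (\<lambda>j. hol (\<lambda>k. hol (\<lambda>l. complex_of_real (dd i (\<Gamma> j k l) q)) (dual Y)) X) B) A" for A B
    unfolding cdd_def by (simp add: holc_x \<Gamma>_C q)
  have 1: "(\<Sum>m\<in>UNIV. holc \<Gamma> B X m q * holc \<Gamma> A m Y q) =
     hol (\<lambda>i. hol (\<lambda>j. hol (\<lambda>k. hol (\<lambda>l. \<Sum>m\<in>UNIV. ?g j k m * ?g i m l) (dual Y)) X) B) A" for A B
  proof -
    have "(\<Sum>m\<in>UNIV. holc \<Gamma> B X m q * holc \<Gamma> A m Y q) =
       (\<Sum>m\<in>UNIV. hol (\<lambda>m. hol (\<lambda>j. hol (\<lambda>k. ?g j k m) X) B) (dual m) *
           hol (\<lambda>m. hol (\<lambda>i. hol (\<lambda>l. ?g i m l) (dual Y)) A) m)"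
      unfolding holc_def by (simp add: hol_commute[of _ _ "dual _"] hol_commute[of _ A])
    also have "\<dots> = (\<Sum>m\<in>UNIV. hol (\<lambda>j. hol (\<lambda>k. ?g j k m) X) B * hol (\<lambda>i. hol (\<lambda>l. ?g i m l) (dual Y)) A)"
      by (rule hol_contract)
    also have "\<dots> = hol (\<lambda>i. hol (\<lambda>j. hol (\<lambda>k. \<Sum>m\<in>UNIV. ?g j k m * hol (\<lambda>l. ?g i m l) (dual Y)) X) B) A"
      by (simp add: hol_sum hol_mult_left hol_mult_right)
    finally show ?thesis by (simp add: hol_sum hol_mult_left)
  qed
  have 2: "(\<Sum>m\<in>UNIV. holc \<beta> A B m q * holc \<Gamma> m X Y q) =
     hol (\<lambda>i. hol (\<lambda>j. hol (\<lambda>k. hol (\<lambda>l. \<Sum>m\<in>UNIV. ?b i j m * ?g m k l) (dual Y)) X) B) A"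
  proof -
    have "(\<Sum>m\<in>UNIV. holc \<beta> A B m q * holc \<Gamma> m X Y q) =
       (\<Sum>m\<in>UNIV. hol (\<lambda>m. hol (\<lambda>i. hol (\<lambda>j. ?b i j m) B) A) (dual m) *
           hol (\<lambda>m. hol (\<lambda>k. hol (\<lambda>l. ?g m k l) (dual Y)) X) m)"
      unfolding holc_def by (simp add: hol_commute[of _ _ "dual _"])
    also have "\<dots> = (\<Sum>m\<in>UNIV. hol (\<lambda>i. hol (\<lambda>j. ?b i j m) B) A * hol (\<lambda>k. hol (\<lambda>l. ?g m k l) (dual Y)) X)"
      by (rule hol_contract)
    finally show ?thesis by (simp add: hol_sum hol_mult_left hol_mult_right)
  qed
  have sw: "hol (\<lambda>i. hol (\<lambda>j. hol (\<lambda>k. hol (\<lambda>l. x i j k l) (dual Y)) X) A) B =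
      hol (\<lambda>i. hol (\<lambda>j. hol (\<lambda>k. hol (\<lambda>l. x j i k l) (dual Y)) X) B) A" for x
    by (rule hol_commute)
  show ?thesis
    unfolding curv_def[of cdd] sum_subtractf d 1 2
    unfolding sw[of "\<lambda>i j k l. complex_of_real (dd i (\<Gamma> j k l) q)"] sw[of "\<lambda>i j k l. \<Sum>m\<in>UNIV. ?g j k m * ?g i m l"]
    by (simp add: curv_def hol_diff hol_add sum_subtractf)
qed

lemma Tl_holc: "Tl (holc \<Gamma>) (holc \<beta>) A B X q =
    hol (\<lambda>i. hol (\<lambda>j. hol (\<lambda>k. complex_of_real (tor \<Gamma> \<beta> i j k q)) X) B) A"
  by (simp add: Tl_def tor_holc holc_def)

lemma Nl_holc: "q \<in> U \<Longrightarrow> Nl cdd (holc \<Gamma>) (holc \<beta>) M A B X q =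
    hol (\<lambda>m. hol (\<lambda>i. hol (\<lambda>j. hol (\<lambda>k. complex_of_real (nabla_tor dd \<Gamma> \<beta> m i j k q)) X) B) A) M"
  by (simp add: Nl_def nabla_tor_holc)

lemma Rl_holc: "q \<in> U \<Longrightarrow> Rl cdd (holc \<Gamma>) (holc \<beta>) A B X Y q =
    hol (\<lambda>i. hol (\<lambda>j. hol (\<lambda>k. hol (\<lambda>l. complex_of_real (curv dd \<Gamma> \<beta> i j k l q)) Y) X) B) A"
  by (simp add: Rl_def curv_holc)

lemma hol_trace: "(\<Sum>a\<in>UNIV. hol (\<lambda>i. hol (\<lambda>j. x i j) (Inr a)) (Inl a)) =
    1 / 2 * ((\<Sum>a\<in>UNIV. x (Inl a) (Inl a) + x (Inr a) (Inr a)) + \<i> * (\<Sum>a\<in>UNIV. x (Inl a) (Inr a) - x (Inr a) (Inl a)))"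
  by (simp only: hol_pair sum_distrib_left sum.distrib distrib_left)

lemma complex_su3_frame: "su3_frame U CC cdd (holc \<Gamma>) (holc \<beta>)"
proof (intro su3_frame.intro cdd_frame_calculus su3_frame_axioms.intro)
  show "(\<lambda>q. cnj (f q)) \<in> CC" if "f \<in> CC" for f
    using that by (simp add: CC_def C_uminus)
next
  fix f q A assume f: "f \<in> CC" and q: "q \<in> U"
  have "cnj (cd i f q) = cd i (\<lambda>q. cnj (f q)) q" for i
    using f by (simp add: cd_def complex_eq_iff CC_def dd_uminus q)
  then show "cnj (cdd A f q) = cdd (dual A) (\<lambda>q. cnj (f q)) q"
    by (simp add: cdd_def cnj_hol)
next
  fix q assume q: "q \<in> U"
  show "cnj (holc \<Gamma> A B X q) = holc \<Gamma> (dual A) (dual B) (dual X) q"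
    "cnj (holc \<beta> A B X q) = holc \<beta> (dual A) (dual B) (dual X) q" for A B X
    by (simp_all add: holc_def cnj_hol)
  show "holc \<Gamma> A B X q = - holc \<Gamma> A (dual X) (dual B) q" for A B X
  proof -
    have "hol (\<lambda>j. hol (\<lambda>k. complex_of_real (\<Gamma> i j k q)) (dual X)) B =
        - hol (\<lambda>j. hol (\<lambda>k. complex_of_real (\<Gamma> i j k q)) B) (dual X)" for i
      unfolding hol_uminus[symmetric] of_real_minus[symmetric] \<Gamma>_skew[OF q, of i, symmetric]
      by (rule hol_commute)
    then show ?thesis by (simp add: holc_def hol_uminus)
  qed
  show "holc \<Gamma> A (Inl b) (Inr c) q = 0" for A b c
    unfolding holc_def dual.simps hol_pair by (simp add: \<Gamma>_J[OF q] hol_zero)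
  show "(\<Sum>b\<in>UNIV. holc \<Gamma> A (Inl b) (Inl b) q) = 0" for A
  proof -
    have z: "\<Gamma> i j j q = 0" for i j using \<Gamma>_skew[OF q, of i j j] by simp
    have "(\<Sum>b\<in>UNIV. complex_of_real (\<Gamma> i (Inl b) (Inr b) q)) = 0" for i
      unfolding of_real_sum[symmetric] \<Gamma>_tr[OF q] by simp
    then have "hol (\<lambda>i. \<Sum>b\<in>UNIV. hol (\<lambda>j. hol (\<lambda>k. complex_of_real (\<Gamma> i j k q)) (Inr b)) (Inl b)) A = 0"
      unfolding hol_trace by (simp add: z \<Gamma>_J(2)[OF q] sum_distrib_left[symmetric] hol_zero)
    then show ?thesis by (simp add: holc_def hol_sum)
  qed
  let ?c = "\<lambda>i j k. complex_of_real (tor \<Gamma> \<beta> i j k q)"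
  have "hol (\<lambda>i. hol (\<lambda>j. hol (\<lambda>k. ?c i j k) X) B) A = - hol (\<lambda>i. hol (\<lambda>j. hol (\<lambda>k. ?c i j k) X) A) B" for A B X
  proof -
    have e: "- tor \<Gamma> \<beta> i j k q = tor \<Gamma> \<beta> j i k q" for i j k using tor_skew[OF q, of i j k] by simp
    show ?thesis unfolding hol_uminus[symmetric] of_real_minus[symmetric] e by (rule hol_commute)
  qed
  moreover have "hol (\<lambda>i. hol (\<lambda>j. hol (\<lambda>k. ?c i j k) X) B) A = - hol (\<lambda>i. hol (\<lambda>j. hol (\<lambda>k. ?c i j k) B) X) A" for A B X
  proof -
    have e: "- tor \<Gamma> \<beta> i j k q = tor \<Gamma> \<beta> i k j q" for i j k using tor_skew23[OF q, of i j k] by simp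
    have "hol (\<lambda>j. hol (\<lambda>k. ?c i j k) X) B = - hol (\<lambda>j. hol (\<lambda>k. ?c i j k) B) X" for i
      unfolding hol_uminus[symmetric] of_real_minus[symmetric] e by (rule hol_commute)
    then show ?thesis by (simp add: hol_uminus)
  qed
  ultimately show "skew3 (\<lambda>A B X. Tl (holc \<Gamma>) (holc \<beta>) A B X q)"
    unfolding skew3_def Tl_holc by blast
  show "tracefree (\<lambda>A B X. Tl (holc \<Gamma>) (holc \<beta>) A B X q)"
    unfolding tracefree_def Tl_holc
  proof
    fix X
    let ?t = "\<lambda>i j. hol (\<lambda>k. complex_of_real (tor \<Gamma> \<beta> i j k q)) X"
    have e: "- tor \<Gamma> \<beta> j i k q = tor \<Gamma> \<beta> i j k q" for i j k using tor_skew[OF q, of i j k] by simp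
    have sk: "?t i j = - ?t j i" for i j
      unfolding hol_uminus[symmetric] of_real_minus[symmetric] e ..
    then have z: "?t i i = 0" for i by (metis add.inverse_neutral eq_neg_iff_add_eq_0 mult_2 mult_eq_0_iff zero_neq_numeral)
    have "(\<Sum>a\<in>UNIV. ?t (Inl a) (Inr a)) = hol (\<lambda>k. \<Sum>a\<in>UNIV. complex_of_real (tor \<Gamma> \<beta> (Inl a) (Inr a) k q)) X"
      by (simp add: hol_sum)
    also have "\<dots> = 0"
      unfolding of_real_sum[symmetric] tor_tr[OF q] by (simp add: hol_zero)
    finally have s: "(\<Sum>a\<in>UNIV. ?t (Inl a) (Inr a)) = 0" .
    show "(\<Sum>a\<in>UNIV. hol (\<lambda>i. hol (\<lambda>j. ?t i j) (Inr a)) (Inl a)) = 0"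
      unfolding hol_trace using s by (simp add: z sk[of "Inr _" "Inl _"] sum_distrib_left[symmetric])
  qed
qed

text \<open>
  The \<open>J\<close>-invariance and the trace condition in the real frame are the vanishing of the (2,0)-part
  and of the trace of the (1,1)-part in the unitary frame.
\<close>
lemma instanton_iff:
  assumes q: "q \<in> U"
  shows "(\<forall>a b X Y. Rl cdd (holc \<Gamma>) (holc \<beta>) (Inl a) (Inl b) X Y q = 0) \<and>
     (\<forall>X Y. (\<Sum>a\<in>UNIV. Rl cdd (holc \<Gamma>) (holc \<beta>) (Inl a) (Inr a) X Y q) = 0) \<longleftrightarrow>
    (\<forall>a b k l. curv dd \<Gamma> \<beta> (Inr a) (Inr b) k l q = curv dd \<Gamma> \<beta> (Inl a) (Inl b) k l q \<and>
       curv dd \<Gamma> \<beta> (Inr a) (Inl b) k l q = - curv dd \<Gamma> \<beta> (Inl a) (Inr b) k l q) \<and>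
     (\<forall>k l. (\<Sum>a\<in>UNIV. curv dd \<Gamma> \<beta> (Inl a) (Inr a) k l q) = 0)"
    (is "?L \<longleftrightarrow> ?R")
proof -
  interpret F: su3_frame U CC cdd "holc \<Gamma>" "holc \<beta>" by (rule complex_su3_frame)
  let ?r = "\<lambda>i j k l. complex_of_real (curv dd \<Gamma> \<beta> i j k l q)"
  let ?x = "\<lambda>X Y i j. hol (\<lambda>k. hol (\<lambda>l. ?r i j k l) Y) X"
  have rskew: "curv dd \<Gamma> \<beta> j i k l q = - curv dd \<Gamma> \<beta> i j k l q" for i j k l
    unfolding curv_def by (simp add: bracket_skew[OF q, of j i] sum_subtractf sum_negf sum.distrib)
  have sk: "?x X Y j i = - ?x X Y i j" for X Y i j
    by (simp add: rskew[of j i] hol_uminus)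
  have R: "Rl cdd (holc \<Gamma>) (holc \<beta>) A B X Y q = hol (\<lambda>i. hol (\<lambda>j. ?x X Y i j) B) A" for A B X Y
    by (rule Rl_holc[OF q])
  have conj: "(\<forall>a b X Y. Rl cdd (holc \<Gamma>) (holc \<beta>) (Inl a) (Inl b) X Y q = 0) \<Longrightarrow>
      Rl cdd (holc \<Gamma>) (holc \<beta>) (Inr a) (Inr b) X Y q = 0" for a b X Y
    using F.R_cnj[OF q, of "Inl a" "Inl b" "dual X" "dual Y"] by simp
  have "(\<forall>a b X Y. Rl cdd (holc \<Gamma>) (holc \<beta>) (Inl a) (Inl b) X Y q = 0) \<longleftrightarrow>
     (\<forall>X Y a b. Rl cdd (holc \<Gamma>) (holc \<beta>) (Inl a) (Inl b) X Y q = 0 \<and> Rl cdd (holc \<Gamma>) (holc \<beta>) (Inr a) (Inr b) X Y q = 0)"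
    using conj by blast
  also have "\<dots> \<longleftrightarrow> (\<forall>X Y a b. ?x X Y (Inr a) (Inr b) - ?x X Y (Inl a) (Inl b) = 0 \<and> ?x X Y (Inr a) (Inl b) + ?x X Y (Inl a) (Inr b) = 0)"
    unfolding R hol_type11 eq_neg_iff_add_eq_0 right_minus_eq ..
  also have "\<dots> \<longleftrightarrow> (\<forall>a b. (\<forall>X Y. hol (\<lambda>k. hol (\<lambda>l. ?r (Inr a) (Inr b) k l - ?r (Inl a) (Inl b) k l) Y) X = 0) \<and>
       (\<forall>X Y. hol (\<lambda>k. hol (\<lambda>l. ?r (Inr a) (Inl b) k l + ?r (Inl a) (Inr b) k l) Y) X = 0))"
    unfolding hol_diff hol_add by blast
  also have "\<dots> \<longleftrightarrow> (\<forall>a b k l. curv dd \<Gamma> \<beta> (Inr a) (Inr b) k l q = curv dd \<Gamma> \<beta> (Inl a) (Inl b) k l q \<and>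
       curv dd \<Gamma> \<beta> (Inr a) (Inl b) k l q = - curv dd \<Gamma> \<beta> (Inl a) (Inr b) k l q)"
    unfolding hol_hol_zero_iff of_real_diff[symmetric] of_real_add[symmetric] of_real_eq_0_iff
      eq_neg_iff_add_eq_0 right_minus_eq by blast
  finally have 1: "(\<forall>a b X Y. Rl cdd (holc \<Gamma>) (holc \<beta>) (Inl a) (Inl b) X Y q = 0) \<longleftrightarrow>
     (\<forall>a b k l. curv dd \<Gamma> \<beta> (Inr a) (Inr b) k l q = curv dd \<Gamma> \<beta> (Inl a) (Inl b) k l q \<and>
       curv dd \<Gamma> \<beta> (Inr a) (Inl b) k l q = - curv dd \<Gamma> \<beta> (Inl a) (Inr b) k l q)" .
  have z: "?x X Y i i = 0" for X Y i using sk[of i i Y X] by (simp add: eq_neg_iff_add_eq_0)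
  have tr: "(\<Sum>a\<in>UNIV. hol (\<lambda>i. hol (\<lambda>j. ?x X Y i j) (Inr a)) (Inl a)) = \<i> * (\<Sum>a\<in>UNIV. ?x X Y (Inl a) (Inr a))" for X Y
    unfolding hol_trace by (simp add: z sk[of "Inr _" "Inl _" Y X] sum_distrib_left[symmetric])
  have "(\<forall>X Y. (\<Sum>a\<in>UNIV. Rl cdd (holc \<Gamma>) (holc \<beta>) (Inl a) (Inr a) X Y q) = 0) \<longleftrightarrow>
     (\<forall>X Y. hol (\<lambda>k. hol (\<lambda>l. \<Sum>a\<in>UNIV. ?r (Inl a) (Inr a) k l) Y) X = 0)"
    unfolding R tr by (simp add: hol_sum)
  also have "\<dots> \<longleftrightarrow> (\<forall>k l. (\<Sum>a\<in>UNIV. curv dd \<Gamma> \<beta> (Inl a) (Inr a) k l q) = 0)"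
    unfolding hol_hol_zero_iff of_real_sum[symmetric] of_real_eq_0_iff ..
  finally show ?thesis unfolding 1 by simp
qed

definition instanton_at :: "'p \<Rightarrow> bool" where
  "instanton_at q \<longleftrightarrow> (\<forall>a b k l. curv dd \<Gamma> \<beta> (Inr a) (Inr b) k l q = curv dd \<Gamma> \<beta> (Inl a) (Inl b) k l q \<and>
       curv dd \<Gamma> \<beta> (Inr a) (Inl b) k l q = - curv dd \<Gamma> \<beta> (Inl a) (Inr b) k l q) \<and>
     (\<forall>k l. (\<Sum>a\<in>UNIV. curv dd \<Gamma> \<beta> (Inl a) (Inr a) k l q) = 0)"

theorem instanton_imp_parallel:
  assumes inst: "\<And>q. q \<in> U \<Longrightarrow> instanton_at q" and q: "q \<in> U"
  shows "nabla_tor dd \<Gamma> \<beta> i j k l q = 0"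
proof -
  interpret F: su3_frame U CC cdd "holc \<Gamma>" "holc \<beta>" by (rule complex_su3_frame)
  interpret I: su3_instanton_frame U CC cdd "holc \<Gamma>" "holc \<beta>"
    using instanton_iff inst unfolding instanton_at_def by unfold_locales blast+
  have "hol (\<lambda>m. hol (\<lambda>i. hol (\<lambda>j. hol (\<lambda>k. complex_of_real (nabla_tor dd \<Gamma> \<beta> m i j k q)) X) B) A) M = 0" for M A B X
    using I.torsion_parallel[OF q, of M A B X] unfolding Nl_holc[OF q] .
  then have "hol (\<lambda>j. hol (\<lambda>k. complex_of_real (nabla_tor dd \<Gamma> \<beta> m i j k q)) X) B = 0" for m i B X
    using hol_hol_zero_iff[of "\<lambda>m i. hol (\<lambda>j. hol (\<lambda>k. complex_of_real (nabla_tor dd \<Gamma> \<beta> m i j k q)) X) B"] by blast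
  then have "complex_of_real (nabla_tor dd \<Gamma> \<beta> m i j k q) = 0" for m i j k
    using hol_hol_zero_iff[of "\<lambda>j k. complex_of_real (nabla_tor dd \<Gamma> \<beta> m i j k q)"] by blast
  then show ?thesis by simp
qed

text \<open>
  By pair symmetry the \<open>su(3)\<close>-conditions on the last two arguments of the curvature hold for the
  first two as well.
\<close>
theorem parallel_imp_instanton:
  assumes q: "q \<in> U" and N: "\<And>i j k l. nabla_tor dd \<Gamma> \<beta> i j k l q = 0"
  shows "instanton_at q"
proof -
  interpret F: su3_frame U CC cdd "holc \<Gamma>" "holc \<beta>" by (rule complex_su3_frame)
  interpret P: su3_bianchi "\<lambda>A B X. F.T A B X q" "\<lambda>M A B X. F.N M A B X q" "\<lambda>A B X Y. F.R A B X Y q"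
    by (rule F.pointwise_bianchi[OF q])
  have N0: "F.N M A B X q = 0" for M A B X by (simp add: Nl_holc[OF q] N hol_zero)
  have pair: "F.R A B X Y q = F.R X Y A B q" for A B X Y
    by (rule P.pair_symmetric[OF N0])
  show ?thesis
    unfolding instanton_at_def instanton_iff[OF q, symmetric]
  proof (intro conjI allI)
    fix a b X Y
    show "F.R (Inl a) (Inl b) X Y q = 0" by (subst pair) (rule P.R_hol)
    show "(\<Sum>a\<in>UNIV. F.R (Inl a) (Inr a) X Y q) = 0"
      by (subst pair) (rule P.R_tr)
  qed
qed

end

section \<open>Smooth maps between Euclidean spaces\<close>

lemma frechet_derivative_eq: "(f has_derivative f') (at x) \<Longrightarrow> frechet_derivative f (at x) = f'"
  using frechet_derivative_at by metis

lemma frechet_derivative_worksI: "f differentiable (at x) \<Longrightarrow> (f has_derivative frechet_derivative f (at x)) (at x)"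
  by (simp add: frechet_derivative_works)

lemma frechet_cong:
  assumes "open S" "x \<in> S" "\<And>y. y \<in> S \<Longrightarrow> f y = g y"
  shows "f differentiable (at x) \<longleftrightarrow> g differentiable (at x)" "frechet_derivative f (at x) = frechet_derivative g (at x)"
proof -
  have "(f has_derivative f') (at x) \<longleftrightarrow> (g has_derivative f') (at x)" for f'
    by (metis assms has_derivative_transform_within_open)
  then show "f differentiable (at x) \<longleftrightarrow> g differentiable (at x)"
    "frechet_derivative f (at x) = frechet_derivative g (at x)"
    by (auto simp: differentiable_def frechet_derivative_def)
qed

lemma Ck_on_cong:
  assumes "open S" "\<And>x. x \<in> S \<Longrightarrow> f x = g x"
  shows "Ck_on k S f \<longleftrightarrow> Ck_on k S g"
  using assms(2)
proof (induction k arbitrary: f g)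
  case 0
  then show ?case by (simp cong: continuous_on_cong)
next
  case (Suc k)
  have "Ck_on k S (\<lambda>x. frechet_derivative f (at x) v) \<longleftrightarrow> Ck_on k S (\<lambda>x. frechet_derivative g (at x) v)" for v
    by (rule Suc.IH) (simp add: frechet_cong(2)[OF assms(1) _ Suc.prems])
  then show ?case using frechet_cong(1)[OF assms(1) _ Suc.prems] by auto
qed

lemma Ck_on_Suc_D: "Ck_on (Suc k) S f \<Longrightarrow> Ck_on k S f"
proof (induction k arbitrary: f)
  case 0
  then show ?case
    by (auto intro!: differentiable_imp_continuous_on simp: differentiable_on_def differentiable_at_withinI)
next
  case (Suc k)
  then show ?case by (metis Ck_on.simps(2))
qed

lemma Ck_on_subset: "Ck_on k S f \<Longrightarrow> U \<subseteq> S \<Longrightarrow> Ck_on k U f"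
  by (induction k arbitrary: f) (auto intro: continuous_on_subset)

lemma Ck_on_const: "Ck_on k S (\<lambda>x. c)"
  by (induction k arbitrary: c) (auto simp: frechet_derivative_const)

lemma Ck_on_add:
  assumes "open S"
  shows "Ck_on k S f \<Longrightarrow> Ck_on k S g \<Longrightarrow> Ck_on k S (\<lambda>x. f x + g x)"
proof (induction k arbitrary: f g)
  case 0
  then show ?case by (auto intro: continuous_on_add)
next
  case (Suc k)
  have "Ck_on k S (\<lambda>x. frechet_derivative (\<lambda>x. f x + g x) (at x) v)" for v
  proof (subst Ck_on_cong[OF assms])
    show "frechet_derivative (\<lambda>x. f x + g x) (at x) v = frechet_derivative f (at x) v + frechet_derivative g (at x) v"
      if "x \<in> S" for x
      using Suc.prems that
      by (subst frechet_derivative_eq[OF has_derivative_add[OF frechet_derivative_worksI frechet_derivative_worksI]]) auto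
    show "Ck_on k S (\<lambda>x. frechet_derivative f (at x) v + frechet_derivative g (at x) v)"
      using Suc by auto
  qed
  then show ?case using Suc.prems by auto
qed

lemma Ck_on_linear:
  assumes "open S" and L: "bounded_linear L"
  shows "Ck_on k S f \<Longrightarrow> Ck_on k S (\<lambda>x. L (f x))"
proof (induction k arbitrary: f)
  case 0
  then show ?case using bounded_linear.continuous_on[OF L] by auto
next
  case (Suc k)
  have d: "((\<lambda>x. L (f x)) has_derivative (\<lambda>v. L (frechet_derivative f (at x) v))) (at x)" if "x \<in> S" for x
    using bounded_linear.has_derivative[OF L frechet_derivative_worksI] Suc.prems that by auto
  have "Ck_on k S (\<lambda>x. frechet_derivative (\<lambda>x. L (f x)) (at x) v)" for v
    by (subst Ck_on_cong[OF assms(1)], subst frechet_derivative_eq[OF d], assumption, rule refl)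
      (use Suc in auto)
  then show ?case using d by (auto simp: differentiable_def)
qed

lemma Ck_on_scaleR:
  fixes f :: "'a::euclidean_space \<Rightarrow> real" and g :: "'a \<Rightarrow> 'b::real_normed_vector"
  assumes S: "open S"
  shows "Ck_on k S f \<Longrightarrow> Ck_on k S g \<Longrightarrow> Ck_on k S (\<lambda>x. f x *\<^sub>R g x)"
proof (induction k arbitrary: f g)
  case 0
  then show ?case by (auto intro: continuous_on_scaleR)
next
  case (Suc k)
  have d: "((\<lambda>x. f x *\<^sub>R g x) has_derivative (\<lambda>v. f x *\<^sub>R frechet_derivative g (at x) v + frechet_derivative f (at x) v *\<^sub>R g x)) (at x)"
    if "x \<in> S" for x
    using Suc.prems that by (intro has_derivative_scaleR frechet_derivative_worksI) auto
  have "Ck_on k S (\<lambda>x. frechet_derivative (\<lambda>x. f x *\<^sub>R g x) (at x) v)" for v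
  proof (subst Ck_on_cong[OF S])
    show "frechet_derivative (\<lambda>x. f x *\<^sub>R g x) (at x) v = f x *\<^sub>R frechet_derivative g (at x) v + frechet_derivative f (at x) v *\<^sub>R g x"
      if "x \<in> S" for x by (subst frechet_derivative_eq[OF d[OF that]]) auto
    show "Ck_on k S (\<lambda>x. f x *\<^sub>R frechet_derivative g (at x) v + frechet_derivative f (at x) v *\<^sub>R g x)"
      using Suc.prems Suc.prems[THEN Ck_on_Suc_D] by (intro Ck_on_add[OF S] Suc.IH) auto
  qed
  then show ?case using d by (auto simp: differentiable_def)
qed

lemma Ck_on_sum:
  assumes "open S" shows "finite I \<Longrightarrow> (\<And>i. i \<in> I \<Longrightarrow> Ck_on k S (f i)) \<Longrightarrow> Ck_on k S (\<lambda>x. \<Sum>i\<in>I. f i x)"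
  by (induction I rule: finite_induct) (auto intro: Ck_on_const Ck_on_add assms)

text \<open>
  The derivative of the composition is expanded in a basis to have it as a sum of products of
  functions to which the induction hypothesis applies.
\<close>
lemma Ck_on_compose:
  fixes \<phi> :: "'c::euclidean_space \<Rightarrow> 'a::euclidean_space"
  assumes S: "open S" and U: "open U" and img: "\<And>x. x \<in> S \<Longrightarrow> \<phi> x \<in> U"
  shows "Ck_on k U f \<Longrightarrow> Ck_on k S \<phi> \<Longrightarrow> Ck_on k S (\<lambda>x. f (\<phi> x))"
proof (induction k arbitrary: f)
  case 0
  then show ?case using img by (auto intro: continuous_on_compose2)
next
  case (Suc k)
  have d: "((\<lambda>x. f (\<phi> x)) has_derivative (\<lambda>v. frechet_derivative f (at (\<phi> x)) (frechet_derivative \<phi> (at x) v))) (at x)"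
    if "x \<in> S" for x
    using Suc.prems that img by (intro has_derivative_compose[OF frechet_derivative_worksI frechet_derivative_worksI]) auto
  have "Ck_on k S (\<lambda>x. frechet_derivative (\<lambda>x. f (\<phi> x)) (at x) v)" for v
  proof (subst Ck_on_cong[OF S])
    show "frechet_derivative (\<lambda>x. f (\<phi> x)) (at x) v =
      (\<Sum>b\<in>Basis. (frechet_derivative \<phi> (at x) v \<bullet> b) *\<^sub>R frechet_derivative f (at (\<phi> x)) b)"
      if x: "x \<in> S" for x
    proof -
      have "linear (frechet_derivative f (at (\<phi> x)))"
        using Suc.prems img[OF x] by (intro linear_frechet_derivative) auto
      then show ?thesis
        by (subst frechet_derivative_eq[OF d[OF x]], subst (1) euclidean_representation[symmetric])
          (simp add: linear_sum linear_scale)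
    qed
    have "Ck_on k S \<phi>" using Suc.prems(2) by (rule Ck_on_Suc_D)
    then show "Ck_on k S (\<lambda>x. \<Sum>b\<in>Basis. (frechet_derivative \<phi> (at x) v \<bullet> b) *\<^sub>R frechet_derivative f (at (\<phi> x)) b)"
      using Suc by (intro Ck_on_sum[OF S] Ck_on_scaleR[OF S] Ck_on_linear[OF S bounded_linear_inner_left]) auto
  qed
  then show ?case using d by (auto simp: differentiable_def)
qed

lemma Ck_on_inverse:
  fixes f :: "'a::euclidean_space \<Rightarrow> real"
  assumes S: "open S"  and nz: "\<And>x. x \<in> S \<Longrightarrow> f x \<noteq> 0"
  shows "Ck_on k S f \<Longrightarrow> Ck_on k S (\<lambda>x. inverse (f x))"
proof (induction k)
  case 0
  then show ?case using nz by (auto intro: continuous_on_inverse)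
next
  case (Suc k)
  have d: "((\<lambda>x. inverse (f x)) has_derivative (\<lambda>v. - (inverse (f x) * frechet_derivative f (at x) v * inverse (f x)))) (at x)"
    if "x \<in> S" for x
    using Suc.prems that nz by (intro Deriv.has_derivative_inverse frechet_derivative_worksI) auto
  have "Ck_on k S (\<lambda>x. frechet_derivative (\<lambda>x. inverse (f x)) (at x) v)" for v
  proof (subst Ck_on_cong[OF S])
    show "frechet_derivative (\<lambda>x. inverse (f x)) (at x) v = (- 1) *\<^sub>R (inverse (f x) *\<^sub>R (frechet_derivative f (at x) v *\<^sub>R inverse (f x)))"
      if "x \<in> S" for x by (subst frechet_derivative_eq[OF d[OF that]]) auto
    have "Ck_on k S (\<lambda>x. inverse (f x))" using Suc Ck_on_Suc_D by blast
    then show "Ck_on k S (\<lambda>x. (- 1) *\<^sub>R (inverse (f x) *\<^sub>R (frechet_derivative f (at x) v *\<^sub>R inverse (f x))))"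
      using Suc.prems by (intro Ck_on_scaleR[OF S] Ck_on_const) auto
  qed
  then show ?case using d by (auto simp: differentiable_def)
qed

lemma Ck_on_id: "Ck_on k S (\<lambda>x. x)"
  by (cases k) (auto simp: frechet_derivative_ident Ck_on_const)

lemma smooth_on_cong: "open S \<Longrightarrow> (\<And>x. x \<in> S \<Longrightarrow> f x = g x) \<Longrightarrow> smooth_on S f \<longleftrightarrow> smooth_on S g"
  unfolding smooth_on_def using Ck_on_cong[of S f g] by blast

lemma smooth_on_subset: "smooth_on S f \<Longrightarrow> U \<subseteq> S \<Longrightarrow> smooth_on U f"
  unfolding smooth_on_def by (blast intro: Ck_on_subset)

lemma smooth_on_const: "smooth_on S (\<lambda>x. c)"
  unfolding smooth_on_def by (simp add: Ck_on_const)

lemma smooth_on_id: "smooth_on S (\<lambda>x. x)"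
  unfolding smooth_on_def by (simp add: Ck_on_id)

lemma smooth_on_add: "open S \<Longrightarrow> smooth_on S f \<Longrightarrow> smooth_on S g \<Longrightarrow> smooth_on S (\<lambda>x. f x + g x)"
  unfolding smooth_on_def by (blast intro: Ck_on_add)

lemma smooth_on_linear: "open S \<Longrightarrow> bounded_linear L \<Longrightarrow> smooth_on S f \<Longrightarrow> smooth_on S (\<lambda>x. L (f x))"
  unfolding smooth_on_def by (blast intro: Ck_on_linear)

lemma smooth_on_scaleR:
  fixes f :: "'a::euclidean_space \<Rightarrow> real"
  shows "open S \<Longrightarrow> smooth_on S f \<Longrightarrow> smooth_on S g \<Longrightarrow> smooth_on S (\<lambda>x. f x *\<^sub>R g x)"
  unfolding smooth_on_def by (blast intro: Ck_on_scaleR)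

lemma smooth_on_mult:
  fixes f g :: "'a::euclidean_space \<Rightarrow> real"
  shows "open S \<Longrightarrow> smooth_on S f \<Longrightarrow> smooth_on S g \<Longrightarrow> smooth_on S (\<lambda>x. f x * g x)"
  using smooth_on_scaleR[of S f g] by simp

lemma smooth_on_sum: "open S \<Longrightarrow> finite I \<Longrightarrow> (\<And>i. i \<in> I \<Longrightarrow> smooth_on S (f i)) \<Longrightarrow> smooth_on S (\<lambda>x. \<Sum>i\<in>I. f i x)"
  unfolding smooth_on_def by (blast intro: Ck_on_sum)

lemma smooth_on_compose:
  fixes \<phi> :: "'c::euclidean_space \<Rightarrow> 'a::euclidean_space"
  shows "open S \<Longrightarrow> open U \<Longrightarrow> (\<And>x. x \<in> S \<Longrightarrow> \<phi> x \<in> U) \<Longrightarrow> smooth_on U f \<Longrightarrow> smooth_on S \<phi> \<Longrightarrow> smooth_on S (\<lambda>x. f (\<phi> x))"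
  unfolding smooth_on_def by (blast intro: Ck_on_compose)

lemma smooth_on_inverse:
  fixes f :: "'a::euclidean_space \<Rightarrow> real"
  shows "open S \<Longrightarrow> (\<And>x. x \<in> S \<Longrightarrow> f x \<noteq> 0) \<Longrightarrow> smooth_on S f \<Longrightarrow> smooth_on S (\<lambda>x. inverse (f x))"
  unfolding smooth_on_def by (blast intro: Ck_on_inverse)

lemma smooth_on_differentiable: "smooth_on S f \<Longrightarrow> x \<in> S \<Longrightarrow> f differentiable (at x)"
  unfolding smooth_on_def by (metis Ck_on.simps(2))

lemma smooth_on_has_derivative: "smooth_on S f \<Longrightarrow> x \<in> S \<Longrightarrow> (f has_derivative frechet_derivative f (at x)) (at x)"
  by (intro frechet_derivative_worksI smooth_on_differentiable)

lemma smooth_on_linear_derivative: "smooth_on S f \<Longrightarrow> x \<in> S \<Longrightarrow> linear (frechet_derivative f (at x))"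
  by (intro linear_frechet_derivative smooth_on_differentiable)

lemma smooth_on_derivative: "smooth_on S f \<Longrightarrow> smooth_on S (\<lambda>x. frechet_derivative f (at x) v)"
  unfolding smooth_on_def by (metis Ck_on.simps(2))

lemma smooth_on_derivative_along:
  fixes v :: "'a::euclidean_space \<Rightarrow> 'a"
  assumes S: "open S" and f: "smooth_on S f" and v: "smooth_on S v"
  shows "smooth_on S (\<lambda>x. frechet_derivative f (at x) (v x))"
proof (subst smooth_on_cong[OF S])
  show "frechet_derivative f (at x) (v x) = (\<Sum>b\<in>Basis. (v x \<bullet> b) *\<^sub>R frechet_derivative f (at x) b)" if "x \<in> S" for x
    using smooth_on_linear_derivative[OF f that]
    by (subst (1) euclidean_representation[symmetric, of "v x"]) (simp only: linear_sum linear_scale)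
  show "smooth_on S (\<lambda>x. \<Sum>b\<in>Basis. (v x \<bullet> b) *\<^sub>R frechet_derivative f (at x) b)"
    by (intro smooth_on_sum S smooth_on_scaleR smooth_on_linear[OF S bounded_linear_inner_left] v smooth_on_derivative f) auto
qed

text \<open>The product rule for the derivative of \<open>f\<close> along a vector field \<open>v\<close>.\<close>
lemma frechet_derivative_along:
  fixes v :: "'a::euclidean_space \<Rightarrow> 'a"
  assumes S: "open S" and f: "smooth_on S f" and v: "smooth_on S v" and x: "x \<in> S"
  shows "frechet_derivative (\<lambda>y. frechet_derivative f (at y) (v y)) (at x) u =
    frechet_derivative (\<lambda>y. frechet_derivative f (at y) (v x)) (at x) u +
    frechet_derivative f (at x) (frechet_derivative v (at x) u)"
proof -
  have lin: "linear (frechet_derivative f (at y))" if "y \<in> S" for y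
    by (rule smooth_on_linear_derivative[OF f that])
  have rep: "frechet_derivative f (at y) w = (\<Sum>b\<in>Basis. (w \<bullet> b) *\<^sub>R frechet_derivative f (at y) b)" if "y \<in> S" for y w
    using lin[OF that] by (subst (1) euclidean_representation[symmetric, of w]) (simp only: linear_sum linear_scale)
  have fb: "((\<lambda>y. frechet_derivative f (at y) b) has_derivative frechet_derivative (\<lambda>y. frechet_derivative f (at y) b) (at x)) (at x)" for b
    by (rule smooth_on_has_derivative[OF smooth_on_derivative[OF f] x])
  have "frechet_derivative (\<lambda>y. frechet_derivative f (at y) (v y)) (at x) =
      frechet_derivative (\<lambda>y. \<Sum>b\<in>Basis. (v y \<bullet> b) *\<^sub>R frechet_derivative f (at y) b) (at x)"
    by (rule frechet_cong(2)[OF S x rep])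
  also have "\<dots> = (\<lambda>u. \<Sum>b\<in>Basis. (v x \<bullet> b) *\<^sub>R frechet_derivative (\<lambda>y. frechet_derivative f (at y) b) (at x) u +
      (frechet_derivative v (at x) u \<bullet> b) *\<^sub>R frechet_derivative f (at x) b)"
    by (rule frechet_derivative_eq)
      (intro has_derivative_sum has_derivative_scaleR has_derivative_inner_left smooth_on_has_derivative[OF v x] fb)
  finally have 1: "frechet_derivative (\<lambda>y. frechet_derivative f (at y) (v y)) (at x) u =
     (\<Sum>b\<in>Basis. (v x \<bullet> b) *\<^sub>R frechet_derivative (\<lambda>y. frechet_derivative f (at y) b) (at x) u) +
     (\<Sum>b\<in>Basis. (frechet_derivative v (at x) u \<bullet> b) *\<^sub>R frechet_derivative f (at x) b)"
    by (simp add: sum.distrib)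
  have "frechet_derivative (\<lambda>y. frechet_derivative f (at y) (v x)) (at x) =
      frechet_derivative (\<lambda>y. \<Sum>b\<in>Basis. (v x \<bullet> b) *\<^sub>R frechet_derivative f (at y) b) (at x)"
    by (rule frechet_cong(2)[OF S x rep])
  also have "\<dots> = (\<lambda>u. \<Sum>b\<in>Basis. (v x \<bullet> b) *\<^sub>R frechet_derivative (\<lambda>y. frechet_derivative f (at y) b) (at x) u)"
    by (rule frechet_derivative_eq) (intro has_derivative_sum has_derivative_scaleR_right fb)
  finally show ?thesis unfolding 1 rep[OF x, symmetric] by simp
qed

lemma smooth_on_continuous: "smooth_on S f \<Longrightarrow> continuous_on S f"
  unfolding smooth_on_def by (metis Ck_on.simps(1))

text \<open>
  Two applications of the mean value theorem, first in the direction \<open>u\<close> and then in the direction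
  \<open>v\<close>.
\<close>
lemma second_difference:
  fixes f :: "'a::euclidean_space \<Rightarrow> real"
  assumes f: "smooth_on S f" and t: "0 < t" and S: "\<And>a b. 0 \<le> a \<Longrightarrow> a \<le> t \<Longrightarrow> 0 \<le> b \<Longrightarrow> b \<le> t \<Longrightarrow> x + a *\<^sub>R u + b *\<^sub>R v \<in> S"
  shows "\<exists>a b. 0 \<le> a \<and> a \<le> t \<and> 0 \<le> b \<and> b \<le> t \<and>
    f (x + t *\<^sub>R u + t *\<^sub>R v) - f (x + t *\<^sub>R u) - f (x + t *\<^sub>R v) + f x =
      t\<^sup>2 * frechet_derivative (\<lambda>y. frechet_derivative f (at y) u) (at (x + a *\<^sub>R u + b *\<^sub>R v)) v"
proof -
  have line: "DERIV (\<lambda>s. h (p + s *\<^sub>R w)) s :> frechet_derivative h (at (p + s *\<^sub>R w)) w"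
    if h: "smooth_on S h" and "p + s *\<^sub>R w \<in> S" for h :: "'a \<Rightarrow> real" and p w s
  proof -
    have "((\<lambda>s. h (p + s *\<^sub>R w)) has_derivative (\<lambda>r. frechet_derivative h (at (p + s *\<^sub>R w)) (r *\<^sub>R w))) (at s)"
      by (rule has_derivative_compose[where f = "\<lambda>s. p + s *\<^sub>R w" and g = h, OF _ smooth_on_has_derivative[OF that]]) (auto intro!: derivative_eq_intros)
    then show ?thesis
      using linear_scale[OF smooth_on_linear_derivative[OF that]] by (simp add: has_field_derivative_def mult_commute_abs)
  qed
  define g where "g s = f (x + t *\<^sub>R v + s *\<^sub>R u) - f (x + s *\<^sub>R u)" for s
  have "\<exists>z>0. z < t \<and> g t - g 0 = (t - 0) * (frechet_derivative f (at (x + t *\<^sub>R v + z *\<^sub>R u)) u - frechet_derivative f (at (x + z *\<^sub>R u)) u)"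
  proof (rule MVT2[OF t])
    fix s assume "0 \<le> s" "s \<le> t"
    then have "x + t *\<^sub>R v + s *\<^sub>R u \<in> S" "x + s *\<^sub>R u \<in> S"
      using S[of s t] S[of s 0] t by (simp_all add: add_ac)
    then show "DERIV g s :> frechet_derivative f (at (x + t *\<^sub>R v + s *\<^sub>R u)) u - frechet_derivative f (at (x + s *\<^sub>R u)) u"
      unfolding g_def by (intro DERIV_diff line f)
  qed
  then obtain a where a: "0 < a" "a < t" "g t - g 0 = t * (frechet_derivative f (at (x + t *\<^sub>R v + a *\<^sub>R u)) u - frechet_derivative f (at (x + a *\<^sub>R u)) u)"
    by auto
  define h where "h y = frechet_derivative f (at y) u" for y
  have h: "smooth_on S h" unfolding h_def by (rule smooth_on_derivative[OF f])
  have "\<exists>z>0. z < t \<and> h (x + a *\<^sub>R u + t *\<^sub>R v) - h (x + a *\<^sub>R u + 0 *\<^sub>R v) = (t - 0) * frechet_derivative h (at (x + a *\<^sub>R u + z *\<^sub>R v)) v"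
    by (rule MVT2[OF t]) (intro line h S, use a in auto)
  then obtain b where b: "0 < b" "b < t" "h (x + a *\<^sub>R u + t *\<^sub>R v) - h (x + a *\<^sub>R u) = t * frechet_derivative h (at (x + a *\<^sub>R u + b *\<^sub>R v)) v"
    by auto
  have "f (x + t *\<^sub>R u + t *\<^sub>R v) - f (x + t *\<^sub>R u) - f (x + t *\<^sub>R v) + f x = g t - g 0"
    by (simp add: g_def add_ac)
  also have "\<dots> = t * (h (x + a *\<^sub>R u + t *\<^sub>R v) - h (x + a *\<^sub>R u))"
    by (simp add: a(3) h_def add_ac)
  also have "\<dots> = t\<^sup>2 * frechet_derivative h (at (x + a *\<^sub>R u + b *\<^sub>R v)) v"
    by (simp add: b(3) power2_eq_square)
  finally show ?thesis using a b unfolding h_def by (intro exI[of _ a] exI[of _ b]) auto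
qed

text \<open>
  The second difference of \<open>f\<close> is symmetric in \<open>u, v\<close> and by \<open>second_difference\<close> equals \<open>t\<^sup>2\<close> times
  either mixed derivative at some point nearby; the mixed derivatives are continuous.
\<close>
theorem second_derivative_symmetric_real:
  fixes f :: "'a::euclidean_space \<Rightarrow> real"
  assumes S: "open S" and x: "x \<in> S" and f: "smooth_on S f"
  shows "frechet_derivative (\<lambda>y. frechet_derivative f (at y) u) (at x) v =
    frechet_derivative (\<lambda>y. frechet_derivative f (at y) v) (at x) u"
proof (rule ccontr)
  define A where "A y = frechet_derivative (\<lambda>y. frechet_derivative f (at y) u) (at y) v" for y
  define B where "B y = frechet_derivative (\<lambda>y. frechet_derivative f (at y) v) (at y) u" for y
  assume "\<not> ?thesis"
  then have e: "0 < \<bar>A x - B x\<bar> / 2" by (simp add: A_def B_def)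
  have "continuous_on S A" "continuous_on S B"
    unfolding A_def B_def by (intro smooth_on_continuous smooth_on_derivative f)+
  then have "isCont A x" "isCont B x" using S x by (auto simp: continuous_on_eq_continuous_at)
  then have "\<exists>d>0. \<forall>y. dist y x < d \<longrightarrow> dist (A y) (A x) < \<bar>A x - B x\<bar> / 2"
      "\<exists>d>0. \<forall>y. dist y x < d \<longrightarrow> dist (B y) (B x) < \<bar>A x - B x\<bar> / 2"
    using e unfolding continuous_at_eps_delta by blast+
  then obtain d1 d2 where d: "0 < d1" "\<And>y. dist y x < d1 \<Longrightarrow> dist (A y) (A x) < \<bar>A x - B x\<bar> / 2"
      "0 < d2" "\<And>y. dist y x < d2 \<Longrightarrow> dist (B y) (B x) < \<bar>A x - B x\<bar> / 2"
    by blast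
  obtain d3 where d3: "0 < d3" "ball x d3 \<subseteq> S" using S x open_contains_ball by blast
  define r where "r = min d1 (min d2 d3)"
  have r: "0 < r" using d d3 by (simp add: r_def)
  (* The parallelogram spanned by \<open>t u\<close> and \<open>t v\<close> at \<open>x\<close> lies in the ball of radius
     \<open>r\<close>. *)
  define t where "t = r / (2 * (norm u + norm v + 1))"
  have t: "0 < t" using r by (simp add: t_def add_nonneg_pos)
  have "0 < norm u + norm v + 1" by (simp add: add_nonneg_pos)
  then have "t * (norm u + norm v + 1) = r / 2" by (simp add: t_def field_simps)
  then have tr: "t * (norm u + norm v) < r" using t r by (simp add: algebra_simps)
  have near: "dist (x + a *\<^sub>R u + b *\<^sub>R v) x < r" if "0 \<le> a" "a \<le> t" "0 \<le> b" "b \<le> t" for a b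
  proof -
    have "dist (x + a *\<^sub>R u + b *\<^sub>R v) x = norm (a *\<^sub>R u + b *\<^sub>R v)" by (simp add: dist_norm)
    also have "\<dots> \<le> a * norm u + b * norm v"
      using norm_triangle_ineq[of "a *\<^sub>R u" "b *\<^sub>R v"] that by simp
    also have "\<dots> \<le> t * norm u + t * norm v"
      using that by (intro add_mono mult_right_mono) auto
    finally show ?thesis using tr by (simp add: algebra_simps)
  qed
  have inS: "y \<in> S" if "dist y x < r" for y using that d3 by (auto simp: r_def dist_commute)
  obtain a b where ab: "0 \<le> a" "a \<le> t" "0 \<le> b" "b \<le> t"
     "f (x + t *\<^sub>R u + t *\<^sub>R v) - f (x + t *\<^sub>R u) - f (x + t *\<^sub>R v) + f x = t\<^sup>2 * A (x + a *\<^sub>R u + b *\<^sub>R v)"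
    using second_difference[OF f t, of x u v] near inS unfolding A_def by blast
  have near': "dist (x + a *\<^sub>R v + b *\<^sub>R u) x < r" if "0 \<le> a" "a \<le> t" "0 \<le> b" "b \<le> t" for a b
    using near[OF that(3,4,1,2)] by (simp add: add_ac)
  obtain a' b' where ab': "0 \<le> a'" "a' \<le> t" "0 \<le> b'" "b' \<le> t"
     "f (x + t *\<^sub>R v + t *\<^sub>R u) - f (x + t *\<^sub>R v) - f (x + t *\<^sub>R u) + f x = t\<^sup>2 * B (x + a' *\<^sub>R v + b' *\<^sub>R u)"
    using second_difference[OF f t, of x v u] near' inS unfolding B_def by blast
  have "t\<^sup>2 * A (x + a *\<^sub>R u + b *\<^sub>R v) = t\<^sup>2 * B (x + a' *\<^sub>R v + b' *\<^sub>R u)"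
  proof -
    have e: "x + t *\<^sub>R v + t *\<^sub>R u = x + t *\<^sub>R u + t *\<^sub>R v" by (simp add: add_ac)
    show ?thesis using ab(5) ab'(5)[unfolded e] by linarith
  qed
  then have eq: "A (x + a *\<^sub>R u + b *\<^sub>R v) = B (x + a' *\<^sub>R v + b' *\<^sub>R u)" using t by simp
  have "dist (A (x + a *\<^sub>R u + b *\<^sub>R v)) (A x) < \<bar>A x - B x\<bar> / 2"
    by (rule d(2)) (use near[OF ab(1-4)] in \<open>simp add: r_def\<close>)
  moreover have "dist (B (x + a' *\<^sub>R v + b' *\<^sub>R u)) (B x) < \<bar>A x - B x\<bar> / 2"
    by (rule d(4)) (use near'[OF ab'(1-4)] in \<open>simp add: r_def\<close>)
  moreover have "\<bar>A x - B x\<bar> \<le> \<bar>r - A x\<bar> + \<bar>r - B x\<bar>" for r by arith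
  ultimately show False unfolding eq dist_real_def by (metis add_strict_mono field_sum_of_halves not_le)
qed

lemma frechet_derivative_linear:
  assumes "f differentiable (at x)" "bounded_linear L"
  shows "frechet_derivative (\<lambda>x. L (f x)) (at x) v = L (frechet_derivative f (at x) v)"
  using frechet_derivative_eq[OF bounded_linear.has_derivative[OF assms(2) frechet_derivative_worksI[OF assms(1)]]] by simp

theorem second_derivative_symmetric:
  fixes f :: "'a::euclidean_space \<Rightarrow> 'b::euclidean_space"
  assumes S: "open S" and x: "x \<in> S" and f: "smooth_on S f"
  shows "frechet_derivative (\<lambda>y. frechet_derivative f (at y) u) (at x) v =
    frechet_derivative (\<lambda>y. frechet_derivative f (at y) v) (at x) u"
proof (rule euclidean_eqI)
  fix b :: 'b
  have fb: "smooth_on S (\<lambda>y. f y \<bullet> b)" by (rule smooth_on_linear[OF S bounded_linear_inner_left f])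
  have *: "frechet_derivative (\<lambda>y. frechet_derivative (\<lambda>y. f y \<bullet> b) (at y) u) (at x) v =
     frechet_derivative (\<lambda>y. frechet_derivative f (at y) u) (at x) v \<bullet> b" for u v
  proof -
    have "frechet_derivative (\<lambda>y. frechet_derivative (\<lambda>y. f y \<bullet> b) (at y) u) (at x) =
       frechet_derivative (\<lambda>y. frechet_derivative f (at y) u \<bullet> b) (at x)"
      by (rule frechet_cong(2)[OF S x])
        (rule frechet_derivative_linear[OF smooth_on_differentiable[OF f] bounded_linear_inner_left])
    then show ?thesis
      using frechet_derivative_linear[OF smooth_on_differentiable[OF smooth_on_derivative[OF f] x] bounded_linear_inner_left]
      by simp
  qed
  show "frechet_derivative (\<lambda>y. frechet_derivative f (at y) u) (at x) v \<bullet> b =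
    frechet_derivative (\<lambda>y. frechet_derivative f (at y) v) (at x) u \<bullet> b"
    unfolding *[symmetric] by (rule second_derivative_symmetric_real[OF S x fb])
qed

section \<open>Calculus on a manifold\<close>

lemma sum_fun_apply: "(\<Sum>i\<in>I. f i) x = (\<Sum>i\<in>I. f i x)"
  by (induction I rule: infinite_finite_induct) auto

locale smooth_manifold =
  fixes A :: "'m::t2_space chart set"
  assumes atlas: "smooth_atlas A"
begin

lemma dom_open: "c \<in> A \<Longrightarrow> open (dom c)"
  and homeo: "c \<in> A \<Longrightarrow> homeomorphism (dom c) (coord c ` dom c) (coord c) (param c)"
  and image_open: "c \<in> A \<Longrightarrow> open (coord c ` dom c)"
  and transition_smooth: "c \<in> A \<Longrightarrow> d \<in> A \<Longrightarrow> smooth_on (coord c ` (dom c \<inter> dom d)) (transition c d)"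
  using atlas unfolding smooth_atlas_def by blast+

lemma chart_exists: "\<exists>c\<in>A. p \<in> dom c"
  using atlas unfolding smooth_atlas_def by blast

lemma chart_at: "chart_at A p \<in> A" "p \<in> dom (chart_at A p)"
  using someI_ex[of "\<lambda>c. c \<in> A \<and> p \<in> dom c"] chart_exists[of p] unfolding chart_at_def by blast+

lemma param_coord: "c \<in> A \<Longrightarrow> p \<in> dom c \<Longrightarrow> param c (coord c p) = p"
  using homeo unfolding homeomorphism_def by blast

lemma open_image:
  assumes "c \<in> A" "open V" shows "open (coord c ` (V \<inter> dom c))"
proof -
  have "openin (top_of_set (dom c)) (V \<inter> dom c)"
    using assms by (auto simp: openin_open)
  then have "openin (top_of_set (coord c ` dom c)) (coord c ` (V \<inter> dom c))"
    using homeomorphism_imp_open_map[OF homeo[OF assms(1)]] by blast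
  then show ?thesis using image_open[OF assms(1)] by (simp add: openin_open_eq)
qed

lemma open_image': "c \<in> A \<Longrightarrow> open V \<Longrightarrow> V \<subseteq> dom c \<Longrightarrow> open (coord c ` V)"
  using open_image[of c V] by (simp add: inf_absorb1)

lemma transition_coord: "c \<in> A \<Longrightarrow> p \<in> dom c \<Longrightarrow> transition c d (coord c p) = coord d p"
  by (simp add: transition_def param_coord)

lemma overlap_open: "c \<in> A \<Longrightarrow> d \<in> A \<Longrightarrow> open (coord c ` (dom c \<inter> dom d))"
  using open_image[of c "dom d"] dom_open[of d] by (simp add: Int_commute)

abbreviation jac :: "'m chart \<Rightarrow> 'm chart \<Rightarrow> 'm \<Rightarrow> real ^ 6 \<Rightarrow> real ^ 6" where
  "jac c d p \<equiv> frechet_derivative (transition c d) (at (coord c p))"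

lemma transition_derivative:
  assumes "c \<in> A" "d \<in> A" "p \<in> dom c" "p \<in> dom d"
  shows "(transition c d has_derivative jac c d p) (at (coord c p))"
  by (rule smooth_on_has_derivative[OF transition_smooth]) (use assms in auto)

lemma linear_jac:
  assumes "c \<in> A" "d \<in> A" "p \<in> dom c" "p \<in> dom d"
  shows "linear (jac c d p)"
  using transition_derivative[OF assms] has_derivative_bounded_linear bounded_linear.linear by blast

lemma jac_cocycle:
  assumes c: "c \<in> A" "p \<in> dom c" and d: "d \<in> A" "p \<in> dom d" and e: "e \<in> A" "p \<in> dom e"
  shows "jac d e p (jac c d p v) = jac c e p v"
proof -
  let ?S = "coord c ` (dom d \<inter> dom c)"
  have S: "open ?S" by (rule open_image[OF c(1) dom_open[OF d(1)]])
  have "((\<lambda>x. transition d e (transition c d x)) has_derivative (\<lambda>v. jac d e p (jac c d p v))) (at (coord c p))"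
    by (rule has_derivative_compose[where f = "transition c d" and g = "transition d e", OF transition_derivative[OF c(1) d(1) c(2) d(2)]])
      (use transition_derivative[OF d(1) e(1) d(2) e(2)] transition_coord[OF c] in metis)
  moreover have "transition d e (transition c d x) = transition c e x" if "x \<in> ?S" for x
    using that c d by (auto simp: transition_coord)
  ultimately have "(transition c e has_derivative (\<lambda>v. jac d e p (jac c d p v))) (at (coord c p))"
    using has_derivative_transform_within_open[OF _ S] c d by blast
  then show ?thesis by (simp add: frechet_derivative_eq)
qed

lemma jac_self:
  assumes c: "c \<in> A" "p \<in> dom c" shows "jac c c p v = v"
proof -
  have "((\<lambda>x. x) has_derivative (\<lambda>v. v)) (at (coord c p))" by (rule has_derivative_ident)
  then have "(transition c c has_derivative (\<lambda>v. v)) (at (coord c p))"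
    by (rule has_derivative_transform_within_open[OF _ image_open[OF c(1)]]) (use c in \<open>auto simp: transition_coord\<close>)
  then show ?thesis by (simp add: frechet_derivative_eq)
qed

abbreviation Tan :: "'m \<Rightarrow> 'm tvec set" where "Tan p \<equiv> tangent_space A p"

lemma Tan_jac: "v \<in> Tan p \<Longrightarrow> c \<in> A \<Longrightarrow> d \<in> A \<Longrightarrow> p \<in> dom c \<Longrightarrow> p \<in> dom d \<Longrightarrow> v d = jac c d p (v c)"
  unfolding tangent_space_def by blast

lemma Tan_zero: "v \<in> Tan p \<Longrightarrow> \<not> (c \<in> A \<and> p \<in> dom c) \<Longrightarrow> v c = 0"
  unfolding tangent_space_def by blast

lemma Tan_eqI:
  assumes "v \<in> Tan p" "w \<in> Tan p" "c \<in> A" "p \<in> dom c" "v c = w c" shows "v = w"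
proof
  fix d show "v d = w d"
    using Tan_jac[OF assms(1,3) _ assms(4), of d] Tan_jac[OF assms(2,3) _ assms(4), of d]
      Tan_zero[OF assms(1), of d] Tan_zero[OF assms(2), of d] assms(5) by (cases "d \<in> A \<and> p \<in> dom d") auto
qed

lemma TanI:
  assumes "\<And>c d. c \<in> A \<Longrightarrow> d \<in> A \<Longrightarrow> p \<in> dom c \<Longrightarrow> p \<in> dom d \<Longrightarrow> v d = jac c d p (v c)"
    and "\<And>c. \<not> (c \<in> A \<and> p \<in> dom c) \<Longrightarrow> v c = 0"
  shows "v \<in> Tan p"
  unfolding tangent_space_def using assms by blast

lemma Tan_add:
  assumes v: "v \<in> Tan p" and w: "w \<in> Tan p" shows "v + w \<in> Tan p"
proof (rule TanI)
  fix c d assume "c \<in> A" "d \<in> A" "p \<in> dom c" "p \<in> dom d"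
  then show "(v + w) d = jac c d p ((v + w) c)"
    using Tan_jac[OF v] Tan_jac[OF w] linear_add[OF linear_jac, of c d p "v c" "w c"] unfolding plus_fun_apply by metis
qed (simp add: Tan_zero[OF v] Tan_zero[OF w])

lemma Tan_vscale:
  assumes v: "v \<in> Tan p" shows "vscale a v \<in> Tan p"
proof (rule TanI)
  fix c d assume "c \<in> A" "d \<in> A" "p \<in> dom c" "p \<in> dom d"
  then show "vscale a v d = jac c d p (vscale a v c)"
    using Tan_jac[OF v] linear_scale[OF linear_jac, of c d p a "v c"] unfolding vscale_def by metis
qed (simp add: Tan_zero[OF v] vscale_def)

lemma Tan_0: "0 \<in> Tan p"
proof (rule TanI)
  fix c d assume "c \<in> A" "d \<in> A" "p \<in> dom c" "p \<in> dom d"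
  then show "(0 :: 'm tvec) d = jac c d p ((0 :: 'm tvec) c)"
    using linear_0[OF linear_jac, of c d p] unfolding zero_fun_apply by metis
qed simp

lemma uminus_vscale: "- v = vscale (- 1) (v :: 'm tvec)" by (auto simp: vscale_def fun_eq_iff)

lemma Tan_uminus: "v \<in> Tan p \<Longrightarrow> - v \<in> Tan p" unfolding uminus_vscale by (rule Tan_vscale)

lemma Tan_diff: "v \<in> Tan p \<Longrightarrow> w \<in> Tan p \<Longrightarrow> v - w \<in> Tan p"
  using Tan_add[OF _ Tan_uminus, of v p w] by (simp add: fun_eq_iff)

lemma Tan_sum: "finite I \<Longrightarrow> (\<And>i. i \<in> I \<Longrightarrow> v i \<in> Tan p) \<Longrightarrow> (\<Sum>i\<in>I. v i) \<in> Tan p"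
  by (induction I rule: finite_induct) (auto intro: Tan_0 Tan_add)

subsection \<open>Smooth functions\<close>

abbreviation sfun :: "'m set \<Rightarrow> ('m \<Rightarrow> real) \<Rightarrow> bool" where "sfun \<equiv> smooth_fun A"
abbreviation vfield :: "'m set \<Rightarrow> 'm vfield \<Rightarrow> bool" where "vfield \<equiv> vector_field A"

lemma sfun_at: "sfun U f \<Longrightarrow> c \<in> A \<Longrightarrow> smooth_on (coord c ` (U \<inter> dom c)) (\<lambda>x. f (param c x))"
  unfolding smooth_fun_def comp_def by blast

lemma sfunI: "(\<And>c. c \<in> A \<Longrightarrow> smooth_on (coord c ` (U \<inter> dom c)) (\<lambda>x. f (param c x))) \<Longrightarrow> sfun U f"
  unfolding smooth_fun_def comp_def by blast

lemma transition_maps: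
  assumes "c \<in> A" "d \<in> A" "U \<subseteq> dom c" "y \<in> coord d ` (U \<inter> dom d)"
  shows "transition d c y \<in> coord c ` U" "param c (transition d c y) = param d y" "y = coord d (param d y)"
    "param d y \<in> U" "param d y \<in> dom d"
  using assms by (auto simp: transition_def param_coord)

lemma smooth_on_change_chart:
  assumes c: "c \<in> A" and d: "d \<in> A" and U: "open U" "U \<subseteq> dom c" and f: "smooth_on (coord c ` U) f"
  shows "smooth_on (coord d ` (U \<inter> dom d)) (\<lambda>y. f (transition d c y))"
proof (rule smooth_on_compose[OF open_image[OF d U(1)] _ _ f])
  show "open (coord c ` U)" by (rule open_image'[OF c U])
  show "transition d c y \<in> coord c ` U" if "y \<in> coord d ` (U \<inter> dom d)" for y
    by (rule transition_maps[OF c d U(2) that])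
  show "smooth_on (coord d ` (U \<inter> dom d)) (transition d c)"
    by (rule smooth_on_subset[OF transition_smooth[OF d c]]) (use U in auto)
qed

text \<open>
  Smoothness on the domain of a chart can be tested in this chart, since the transition maps are
  smooth.
\<close>
lemma sfun_chart:
  assumes c: "c \<in> A" and U: "open U" "U \<subseteq> dom c" and f: "smooth_on (coord c ` U) (\<lambda>x. f (param c x))"
  shows "sfun U f"
proof (rule sfunI)
  fix d assume d: "d \<in> A"
  show "smooth_on (coord d ` (U \<inter> dom d)) (\<lambda>x. f (param d x))"
    using smooth_on_change_chart[OF c d U f] transition_maps[OF c d U(2)]
    by (subst smooth_on_cong[OF open_image[OF d U(1)], of _ "\<lambda>y. f (param c (transition d c y))"]) auto
qed

lemma sfun_const: "sfun U (\<lambda>_. k)" by (rule sfunI, rule smooth_on_const)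

lemma sfun_add: "open U \<Longrightarrow> sfun U f \<Longrightarrow> sfun U h \<Longrightarrow> sfun U (\<lambda>q. f q + h q)"
  by (rule sfunI, (intro smooth_on_add open_image sfun_at; assumption))

lemma sfun_mult: "open U \<Longrightarrow> sfun U f \<Longrightarrow> sfun U h \<Longrightarrow> sfun U (\<lambda>q. f q * h q)"
  by (rule sfunI, (intro smooth_on_mult open_image sfun_at; assumption))

lemma sfun_sum: "open U \<Longrightarrow> finite I \<Longrightarrow> (\<And>i. i \<in> I \<Longrightarrow> sfun U (f i)) \<Longrightarrow> sfun U (\<lambda>q. \<Sum>i\<in>I. f i q)"
  by (rule sfunI, (intro smooth_on_sum open_image sfun_at; assumption))

lemma sfun_prod: "finite I \<Longrightarrow> open U \<Longrightarrow> (\<And>i. i \<in> I \<Longrightarrow> sfun U (f i)) \<Longrightarrow> sfun U (\<lambda>q. \<Prod>i\<in>I. f i q)"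
  by (induction I rule: finite_induct) (auto intro: sfun_const sfun_mult)

lemma sfun_uminus: "open U \<Longrightarrow> sfun U f \<Longrightarrow> sfun U (\<lambda>q. - f q)"
  using sfun_mult[of U "\<lambda>_. -1" f] by (simp add: sfun_const)

lemma sfun_diff: "open U \<Longrightarrow> sfun U f \<Longrightarrow> sfun U h \<Longrightarrow> sfun U (\<lambda>q. f q - h q)"
  using sfun_add[of U f "\<lambda>q. - h q"] by (simp add: sfun_uminus)

lemma sfun_inverse: "open U \<Longrightarrow> sfun U f \<Longrightarrow> (\<And>q. q \<in> U \<Longrightarrow> f q \<noteq> 0) \<Longrightarrow> sfun U (\<lambda>q. inverse (f q))"
  by (rule sfunI, rule smooth_on_inverse[OF open_image _ sfun_at]) (auto simp: param_coord)

subsection \<open>Vector fields\<close>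

lemma vfield_Tan: "vfield U X \<Longrightarrow> p \<in> U \<Longrightarrow> X p \<in> Tan p"
  unfolding vector_field_def by blast

lemma vfield_at: "vfield U X \<Longrightarrow> c \<in> A \<Longrightarrow> smooth_on (coord c ` (U \<inter> dom c)) (\<lambda>x. X (param c x) c)"
  unfolding vector_field_def by blast

lemma vfield_subset: "vfield U X \<Longrightarrow> W \<subseteq> U \<Longrightarrow> vfield W X"
  unfolding vector_field_def by (blast intro: smooth_on_subset)

lemma vfield_chart:
  assumes c: "c \<in> A" and U: "open U" "U \<subseteq> dom c" and X: "\<And>p. p \<in> U \<Longrightarrow> X p \<in> Tan p"
    and f: "smooth_on (coord c ` U) (\<lambda>x. X (param c x) c)"
  shows "vfield U X"
  unfolding vector_field_def
proof (intro conjI ballI X)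
  fix d assume d: "d \<in> A"
  let ?S = "coord d ` (U \<inter> dom d)"
  have S: "open ?S" by (rule open_image[OF d U(1)])
  have j: "smooth_on (coord c ` (U \<inter> dom d)) (\<lambda>x. frechet_derivative (transition c d) (at x) (X (param c x) c))"
    by (intro smooth_on_derivative_along smooth_on_subset[OF transition_smooth[OF c d]] smooth_on_subset[OF f] open_image')
      (use U c d dom_open in auto)
  have "smooth_on ?S (\<lambda>y. frechet_derivative (transition c d) (at (transition d c y)) (X (param c (transition d c y)) c))"
    using smooth_on_change_chart[OF c d _ _ j] U dom_open[OF d] by (simp add: Int_assoc open_Int le_infI1)
  moreover have "frechet_derivative (transition c d) (at (transition d c y)) (X (param c (transition d c y)) c) = X (param d y) d"
    if y: "y \<in> ?S" for y
  proof -
    obtain p where p: "p \<in> U" "p \<in> dom d" "y = coord d p" using y by blast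
    then show ?thesis
      using Tan_jac[OF X[OF p(1)] c d] U(2) d by (auto simp: transition_coord param_coord c)
  qed
  ultimately show "smooth_on ?S (\<lambda>y. X (param d y) d)"
    by (subst (asm) smooth_on_cong[OF S]) auto
qed

lemma vfield_add: "open U \<Longrightarrow> vfield U X \<Longrightarrow> vfield U Y \<Longrightarrow> vfield U (X + Y)"
  unfolding vector_field_def by (auto intro: Tan_add smooth_on_add open_image)

lemma vfield_fscale: "open U \<Longrightarrow> sfun U f \<Longrightarrow> vfield U X \<Longrightarrow> vfield U (fscale f X)"
proof -
  assume U: "open U" and f: "sfun U f" and X: "vfield U X"
  have "vscale (f p) (X p) \<in> Tan p" if "p \<in> U" for p by (rule Tan_vscale[OF vfield_Tan[OF X that]])
  then show ?thesis
    unfolding vector_field_def fscale_def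
    by (simp add: vscale_def smooth_on_scaleR[OF open_image[OF _ U] sfun_at[OF f] vfield_at[OF X]])
qed

lemma vfield_0: "vfield U 0"
  unfolding vector_field_def by (auto intro: Tan_0 smooth_on_const)

lemma vfield_sum: "finite I \<Longrightarrow> open U \<Longrightarrow> (\<And>i. i \<in> I \<Longrightarrow> vfield U (X i)) \<Longrightarrow> vfield U (\<Sum>i\<in>I. X i)"
  by (induction I rule: finite_induct) (auto intro: vfield_0 vfield_add)

lemma vfield_cong:
  assumes "open U" "\<And>q. q \<in> U \<Longrightarrow> X q = Y q" "vfield U X" shows "vfield U Y"
  unfolding vector_field_def
proof (intro conjI ballI)
  show "Y p \<in> Tan p" if "p \<in> U" for p using vfield_Tan[OF assms(3) that] assms(2)[OF that] by simp
  fix c assume c: "c \<in> A"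
  show "smooth_on (coord c ` (U \<inter> dom c)) (\<lambda>x. Y (param c x) c)"
    using vfield_at[OF assms(3) c] assms(2)
    by (subst smooth_on_cong[OF open_image[OF c assms(1)], of _ "\<lambda>x. X (param c x) c"]) (auto simp: param_coord c)
qed

lemma sfun_coord:
  assumes "open U" "c \<in> A" "U \<subseteq> dom c" shows "sfun U (\<lambda>q. coord c q $ n)"
proof (rule sfun_chart[OF assms(2,1,3)])
  have o: "open (coord c ` U)" by (rule open_image'[OF assms(2,1,3)])
  show "smooth_on (coord c ` U) (\<lambda>x. coord c (param c x) $ n)"
    using smooth_on_linear[OF o bounded_linear_vec_nth smooth_on_id, of n] assms
    by (subst smooth_on_cong[OF o, of _ "\<lambda>x. x $ n"]) (auto simp: param_coord subset_iff)
qed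

subsection \<open>Directional derivatives\<close>

lemma vderiv_chart:
  assumes c: "c \<in> A" "p \<in> dom c" and v: "v \<in> Tan p" and U: "open U" "p \<in> U" and f: "sfun U f"
  shows "vderiv A p v f = frechet_derivative (\<lambda>x. f (param c x)) (at (coord c p)) (v c)"
proof -
  let ?d = "chart_at A p"
  note d = chart_at[of p]
  let ?S = "coord ?d ` (U \<inter> dom c \<inter> dom ?d)"
  have S: "open ?S" "coord ?d p \<in> ?S"
    using open_image[OF d(1), of "U \<inter> dom c"] U c dom_open d(2) by (auto simp: open_Int)
  have fc: "((\<lambda>x. f (param c x)) has_derivative frechet_derivative (\<lambda>x. f (param c x)) (at (coord c p))) (at (coord c p))"
    by (rule smooth_on_has_derivative[OF sfun_at[OF f c(1)]]) (use U c in auto)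
  have "((\<lambda>y. f (param c (transition ?d c y))) has_derivative
     (\<lambda>w. frechet_derivative (\<lambda>x. f (param c x)) (at (coord c p)) (jac ?d c p w))) (at (coord ?d p))"
    by (rule has_derivative_compose[where f = "transition ?d c" and g = "\<lambda>x. f (param c x)", OF transition_derivative[OF d(1) c(1) d(2) c(2)]])
      (use fc transition_coord[OF d] in metis)
  then have "((\<lambda>y. f (param ?d y)) has_derivative
     (\<lambda>w. frechet_derivative (\<lambda>x. f (param c x)) (at (coord c p)) (jac ?d c p w))) (at (coord ?d p))"
    by (rule has_derivative_transform_within_open[OF _ S]) (auto simp: transition_def param_coord c d)
  then show ?thesis
    unfolding vderiv_def Let_def comp_def
    by (simp add: frechet_derivative_eq Tan_jac[OF v d(1) c(1) d(2) c(2)])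
qed

lemma vderiv_cong:
  assumes U: "open U" "p \<in> U" and eq: "\<And>q. q \<in> U \<Longrightarrow> f q = h q"
  shows "vderiv A p v f = vderiv A p v h"
proof -
  let ?d = "chart_at A p"
  note d = chart_at[of p]
  have "frechet_derivative (f \<circ> param ?d) (at (coord ?d p)) = frechet_derivative (h \<circ> param ?d) (at (coord ?d p))"
    by (rule frechet_cong(2)[OF open_image[OF d(1) U(1)]]) (use U d eq in \<open>auto simp: param_coord\<close>)
  then show ?thesis unfolding vderiv_def Let_def by simp
qed

lemma sfun_differentiable:
  assumes "sfun U f" "c \<in> A" "p \<in> dom c" "p \<in> U"
  shows "(\<lambda>x. f (param c x)) differentiable (at (coord c p))"
    "((\<lambda>x. f (param c x)) has_derivative frechet_derivative (\<lambda>x. f (param c x)) (at (coord c p))) (at (coord c p))"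
  by (rule smooth_on_differentiable[OF sfun_at] smooth_on_has_derivative[OF sfun_at], rule assms, rule assms, use assms in blast)+

context
  fixes U p v assumes U: "open U" "p \<in> U" and v: "v \<in> Tan p"
begin

lemma vderiv_const: "vderiv A p v (\<lambda>_. k) = 0"
  unfolding vderiv_def Let_def comp_def by (simp add: frechet_derivative_const)

lemma vderiv_add:
  assumes "sfun U f" "sfun U h" shows "vderiv A p v (\<lambda>q. f q + h q) = vderiv A p v f + vderiv A p v h"
  unfolding vderiv_def Let_def comp_def
  by (subst frechet_derivative_eq[OF has_derivative_add[OF sfun_differentiable(2) sfun_differentiable(2)]])
    (use assms U chart_at in auto)

lemma vderiv_mult:
  assumes "sfun U f" "sfun U h" shows "vderiv A p v (\<lambda>q. f q * h q) = vderiv A p v f * h p + f p * vderiv A p v h"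
  unfolding vderiv_def Let_def comp_def
  by (subst frechet_derivative_eq[OF has_derivative_mult[OF sfun_differentiable(2) sfun_differentiable(2)]])
    (use assms U chart_at in \<open>auto simp: param_coord\<close>)

lemma vderiv_add_vec:
  assumes "sfun U f" "w \<in> Tan p" shows "vderiv A p (v + w) f = vderiv A p v f + vderiv A p w f"
  unfolding vderiv_def Let_def comp_def
  using linear_add[OF linear_frechet_derivative[OF sfun_differentiable(1)[OF assms(1) chart_at U(2)]]] by simp

lemma vderiv_vscale_vec:
  assumes "sfun U f" shows "vderiv A p (vscale a v) f = a * vderiv A p v f"
  unfolding vderiv_def Let_def comp_def vscale_def
  using linear_scale[OF linear_frechet_derivative[OF sfun_differentiable(1)[OF assms(1) chart_at U(2)]]] by simp

end

lemma vderiv_coord: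
  assumes "c \<in> A" "p \<in> dom c" "v \<in> Tan p"
  shows "vderiv A p v (\<lambda>q. coord c q $ n) = v c $ n"
proof -
  have "((\<lambda>x. x $ n) has_derivative (\<lambda>w. w $ n)) (at (coord c p))"
    by (rule bounded_linear_imp_has_derivative[OF bounded_linear_vec_nth])
  then have "((\<lambda>x. coord c (param c x) $ n) has_derivative (\<lambda>w. w $ n)) (at (coord c p))"
    by (rule has_derivative_transform_within_open[OF _ image_open[OF assms(1)]]) (use assms in \<open>auto simp: param_coord\<close>)
  then show ?thesis
    by (subst vderiv_chart[OF assms(1,2,3) dom_open[OF assms(1)] assms(2) sfun_coord[OF dom_open]])
      (use assms in \<open>auto simp: frechet_derivative_eq\<close>)
qed

lemma sfun_vderiv:
  assumes U: "open U" and X: "vfield U X" and f: "sfun U f"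
  shows "sfun U (\<lambda>q. vderiv A q (X q) f)"
proof (rule sfunI)
  fix c assume c: "c \<in> A"
  let ?S = "coord c ` (U \<inter> dom c)"
  have S: "open ?S" by (rule open_image[OF c U])
  have "smooth_on ?S (\<lambda>x. frechet_derivative (\<lambda>x. f (param c x)) (at x) (X (param c x) c))"
    by (rule smooth_on_derivative_along[OF S sfun_at[OF f c] vfield_at[OF X c]])
  moreover have "vderiv A (param c x) (X (param c x)) f = frechet_derivative (\<lambda>x. f (param c x)) (at x) (X (param c x) c)"
    if x: "x \<in> ?S" for x
  proof -
    obtain q where q: "q \<in> U" "q \<in> dom c" "x = coord c q" using x by blast
    show ?thesis using vderiv_chart[OF c q(2) vfield_Tan[OF X q(1)] U q(1) f] q c by (simp add: param_coord)
  qed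
  ultimately show "smooth_on ?S (\<lambda>x. vderiv A (param c x) (X (param c x)) f)"
    by (subst smooth_on_cong[OF S]) auto
qed

subsection \<open>The Lie bracket\<close>

abbreviation lie :: "'m vfield \<Rightarrow> 'm vfield \<Rightarrow> 'm vfield" where "lie \<equiv> lie_bracket A"

lemma lie_at: "c \<in> A \<Longrightarrow> p \<in> dom c \<Longrightarrow> lie X Y p c =
   frechet_derivative (\<lambda>x. Y (param c x) c) (at (coord c p)) (X p c)
     - frechet_derivative (\<lambda>x. X (param c x) c) (at (coord c p)) (Y p c)"
  by (simp add: lie_bracket_def)

lemma vfield_differentiable:
  assumes "vfield U X" "c \<in> A" "p \<in> dom c" "p \<in> U"
  shows "(\<lambda>x. X (param c x) c) differentiable (at (coord c p))"
    "((\<lambda>x. X (param c x) c) has_derivative frechet_derivative (\<lambda>x. X (param c x) c) (at (coord c p))) (at (coord c p))"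
  by (rule smooth_on_differentiable[OF vfield_at] smooth_on_has_derivative[OF vfield_at], rule assms, rule assms, use assms in blast)+

text \<open>
  The derivative of the coordinates of \<open>Y\<close> in the chart \<open>d\<close> differs from the transformed derivative
  in the chart \<open>c\<close> by the second derivative of the transition map.
\<close>
lemma vfield_change_chart:
  assumes U: "open U" "p \<in> U" and Y: "vfield U Y" and c: "c \<in> A" "p \<in> dom c" and d: "d \<in> A" "p \<in> dom d"
  shows "frechet_derivative (\<lambda>y. Y (param d y) d) (at (coord d p)) (jac c d p u) =
    frechet_derivative (\<lambda>y. frechet_derivative (transition c d) (at y) (Y p c)) (at (coord c p)) u +
    jac c d p (frechet_derivative (\<lambda>x. Y (param c x) c) (at (coord c p)) u)"
proof -
  let ?S = "coord c ` (U \<inter> dom d \<inter> dom c)"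
  have S: "open ?S" "coord c p \<in> ?S"
    using open_image[OF c(1), of "U \<inter> dom d"] U d dom_open c by auto
  have "((\<lambda>x. Y (param d (transition c d x)) d) has_derivative
      (\<lambda>u. frechet_derivative (\<lambda>y. Y (param d y) d) (at (coord d p)) (jac c d p u))) (at (coord c p))"
    by (rule has_derivative_compose[where f = "transition c d" and g = "\<lambda>y. Y (param d y) d", OF transition_derivative[OF c(1) d(1) c(2) d(2)]])
      (use vfield_differentiable(2)[OF Y d U(2)] transition_coord[OF c] in metis)
  then have "frechet_derivative (\<lambda>x. Y (param d (transition c d x)) d) (at (coord c p)) u =
      frechet_derivative (\<lambda>y. Y (param d y) d) (at (coord d p)) (jac c d p u)"
    by (simp add: frechet_derivative_eq)
  moreover have "frechet_derivative (\<lambda>x. Y (param d (transition c d x)) d) (at (coord c p)) =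
      frechet_derivative (\<lambda>x. frechet_derivative (transition c d) (at x) (Y (param c x) c)) (at (coord c p))"
  proof (rule frechet_cong(2)[OF S])
    fix x assume "x \<in> ?S"
    then obtain q where q: "q \<in> U" "q \<in> dom c" "q \<in> dom d" "x = coord c q" by blast
    show "Y (param d (transition c d x)) d = frechet_derivative (transition c d) (at x) (Y (param c x) c)"
      using Tan_jac[OF vfield_Tan[OF Y q(1)] c(1) d(1) q(2,3)] q
      by (simp add: transition_coord param_coord c d)
  qed
  moreover have "frechet_derivative (\<lambda>x. frechet_derivative (transition c d) (at x) (Y (param c x) c)) (at (coord c p)) u =
     frechet_derivative (\<lambda>y. frechet_derivative (transition c d) (at y) (Y p c)) (at (coord c p)) u +
     jac c d p (frechet_derivative (\<lambda>x. Y (param c x) c) (at (coord c p)) u)"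
  proof -
    have "?S \<subseteq> coord c ` (dom c \<inter> dom d)" "?S \<subseteq> coord c ` (U \<inter> dom c)" by blast+
    from frechet_derivative_along[OF S(1) smooth_on_subset[OF transition_smooth[OF c(1) d(1)] this(1)]
        smooth_on_subset[OF vfield_at[OF Y c(1)] this(2)] S(2), of u]
    show ?thesis by (simp add: param_coord c)
  qed
  ultimately show ?thesis by simp
qed

text \<open>
  The second derivatives of the transition map in \<open>vfield_change_chart\<close> cancel by their symmetry, so
  the bracket transforms as a tangent vector.
\<close>
lemma vfield_lie:
  assumes U: "open U" and X: "vfield U X" and Y: "vfield U Y"
  shows "vfield U (lie X Y)"
  unfolding vector_field_def
proof (intro conjI ballI)
  fix p assume p: "p \<in> U"
  show "lie X Y p \<in> Tan p"
  proof (rule TanI)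
    fix c d assume c: "c \<in> A" "p \<in> dom c" and d: "d \<in> A" "p \<in> dom d"
    have "frechet_derivative (\<lambda>y. frechet_derivative (transition c d) (at y) (Y p c)) (at (coord c p)) (X p c) =
        frechet_derivative (\<lambda>y. frechet_derivative (transition c d) (at y) (X p c)) (at (coord c p)) (Y p c)"
      by (rule second_derivative_symmetric[OF overlap_open[OF c(1) d(1)] _ transition_smooth[OF c(1) d(1)]]) (use c d in auto)
    then show "lie X Y p d = jac c d p (lie X Y p c)"
      unfolding lie_at[OF c] lie_at[OF d] linear_diff[OF linear_jac[OF c(1) d(1) c(2) d(2)]]
        Tan_jac[OF vfield_Tan[OF X p] c(1) d(1) c(2) d(2)] Tan_jac[OF vfield_Tan[OF Y p] c(1) d(1) c(2) d(2)]
        vfield_change_chart[OF U p Y c d] vfield_change_chart[OF U p X c d]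
      by simp
  qed (auto simp: lie_bracket_def)
next
  fix c assume c: "c \<in> A"
  let ?S = "coord c ` (U \<inter> dom c)"
  have S: "open ?S" by (rule open_image[OF c U])
  have "smooth_on ?S (\<lambda>x. frechet_derivative (\<lambda>x. Y (param c x) c) (at x) (X (param c x) c)
     + (- 1) *\<^sub>R frechet_derivative (\<lambda>x. X (param c x) c) (at x) (Y (param c x) c))"
    by (intro smooth_on_add S smooth_on_scaleR smooth_on_const smooth_on_derivative_along vfield_at[OF X c] vfield_at[OF Y c])
  then show "smooth_on ?S (\<lambda>x. lie X Y (param c x) c)"
    by (subst smooth_on_cong[OF S]) (auto simp: lie_at param_coord c)
qed

text \<open>In coordinates the second derivatives of \<open>f\<close> cancel.\<close>
lemma lie_commutator:
  assumes U: "open U" "p \<in> U" and X: "vfield U X" and Y: "vfield U Y" and f: "sfun U f"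
  shows "vderiv A p (X p) (\<lambda>q. vderiv A q (Y q) f) - vderiv A p (Y p) (\<lambda>q. vderiv A q (X q) f) = vderiv A p (lie X Y p) f"
proof -
  let ?c = "chart_at A p"
  note c = chart_at[of p]
  let ?S = "coord ?c ` (U \<inter> dom ?c)"
  have S: "open ?S" "coord ?c p \<in> ?S" using open_image[OF c(1) U(1)] U c by auto
  let ?F = "\<lambda>x. f (param ?c x)"
  have F: "smooth_on ?S ?F" by (rule sfun_at[OF f c(1)])
  have one: "vderiv A p (X p) (\<lambda>q. vderiv A q (Y q) f) =
      frechet_derivative (\<lambda>y. frechet_derivative ?F (at y) (Y p ?c)) (at (coord ?c p)) (X p ?c) +
      frechet_derivative ?F (at (coord ?c p)) (frechet_derivative (\<lambda>x. Y (param ?c x) ?c) (at (coord ?c p)) (X p ?c))"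
    if X: "vfield U X" and Y: "vfield U Y" for X Y
  proof -
    have "vderiv A p (X p) (\<lambda>q. vderiv A q (Y q) f) =
       frechet_derivative (\<lambda>x. vderiv A (param ?c x) (Y (param ?c x)) f) (at (coord ?c p)) (X p ?c)"
      by (rule vderiv_chart[OF c vfield_Tan[OF X U(2)] U sfun_vderiv[OF U(1) Y f]])
    also have "frechet_derivative (\<lambda>x. vderiv A (param ?c x) (Y (param ?c x)) f) (at (coord ?c p)) =
       frechet_derivative (\<lambda>x. frechet_derivative ?F (at x) (Y (param ?c x) ?c)) (at (coord ?c p))"
    proof (rule frechet_cong(2)[OF S])
      fix x assume "x \<in> ?S"
      then obtain q where q: "q \<in> U" "q \<in> dom ?c" "x = coord ?c q" by blast
      show "vderiv A (param ?c x) (Y (param ?c x)) f = frechet_derivative ?F (at x) (Y (param ?c x) ?c)"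
        using vderiv_chart[OF c(1) q(2) vfield_Tan[OF Y q(1)] U(1) q(1) f] q c by (simp add: param_coord)
    qed
    also have "\<dots> (X p ?c) = frechet_derivative (\<lambda>y. frechet_derivative ?F (at y) (Y p ?c)) (at (coord ?c p)) (X p ?c) +
      frechet_derivative ?F (at (coord ?c p)) (frechet_derivative (\<lambda>x. Y (param ?c x) ?c) (at (coord ?c p)) (X p ?c))"
      using frechet_derivative_along[OF S(1) F vfield_at[OF Y c(1)] S(2), of "X p ?c"]
      by (simp add: param_coord c)
    finally show ?thesis .
  qed
  have "vderiv A p (lie X Y p) f = frechet_derivative ?F (at (coord ?c p)) (lie X Y p ?c)"
    by (rule vderiv_chart[OF c vfield_Tan[OF vfield_lie[OF U(1) X Y] U(2)] U f])
  also have "\<dots> = frechet_derivative ?F (at (coord ?c p)) (frechet_derivative (\<lambda>x. Y (param ?c x) ?c) (at (coord ?c p)) (X p ?c))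
     - frechet_derivative ?F (at (coord ?c p)) (frechet_derivative (\<lambda>x. X (param ?c x) ?c) (at (coord ?c p)) (Y p ?c))"
    unfolding lie_at[OF c] by (rule linear_diff[OF smooth_on_linear_derivative[OF F S(2)]])
  finally show ?thesis
    using second_derivative_symmetric[OF S F, of "Y p ?c" "X p ?c"] by (simp add: one X Y)
qed

lemma lie_skew: "lie X Y = - lie Y X"
  by (simp add: fun_eq_iff lie_bracket_def)

lemma lie_cong:
  assumes U: "open U" "p \<in> U" and eq: "\<And>q. q \<in> U \<Longrightarrow> X q = X' q" "\<And>q. q \<in> U \<Longrightarrow> Y q = Y' q"
  shows "lie X Y p = lie X' Y' p"
proof
  fix c
  show "lie X Y p c = lie X' Y' p c"
  proof (cases "c \<in> A \<and> p \<in> dom c")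
    case True
    have "frechet_derivative (\<lambda>x. Z (param c x) c) (at (coord c p)) = frechet_derivative (\<lambda>x. Z' (param c x) c) (at (coord c p))"
      if "\<And>q. q \<in> U \<Longrightarrow> Z q = Z' q" for Z Z' :: "'m vfield"
      by (rule frechet_cong(2)[OF open_image[OF _ U(1)]]) (use True U that in \<open>auto simp: param_coord\<close>)
    from this[of X X'] this[of Y Y'] show ?thesis using True eq U by (simp add: lie_at)
  qed (auto simp: lie_bracket_def)
qed

lemma lie_add_right:
  assumes U: "open U" "p \<in> U" and X: "vfield U X" and Y: "vfield U Y" and Z: "vfield U Z"
  shows "lie X (Y + Z) p = lie X Y p + lie X Z p"
proof
  fix c
  show "lie X (Y + Z) p c = (lie X Y p + lie X Z p) c"
  proof (cases "c \<in> A \<and> p \<in> dom c")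
    case True
    have "frechet_derivative (\<lambda>x. Y (param c x) c + Z (param c x) c) (at (coord c p)) =
      (\<lambda>u. frechet_derivative (\<lambda>x. Y (param c x) c) (at (coord c p)) u + frechet_derivative (\<lambda>x. Z (param c x) c) (at (coord c p)) u)"
      by (rule frechet_derivative_eq, intro has_derivative_add vfield_differentiable(2)[OF Y _ _ U(2)] vfield_differentiable(2)[OF Z _ _ U(2)])
        (use True in auto)
    moreover have "linear (frechet_derivative (\<lambda>x. X (param c x) c) (at (coord c p)))"
      by (rule linear_frechet_derivative[OF vfield_differentiable(1)[OF X _ _ U(2)]]) (use True in auto)
    ultimately show ?thesis using True by (simp add: lie_at linear_add)
  qed (auto simp: lie_bracket_def)
qed

lemma lie_fscale_right:
  assumes U: "open U" "p \<in> U" and X: "vfield U X" and Y: "vfield U Y" and f: "sfun U f"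
  shows "lie X (fscale f Y) p = vscale (vderiv A p (X p) f) (Y p) + vscale (f p) (lie X Y p)"
proof
  fix c
  show "lie X (fscale f Y) p c = (vscale (vderiv A p (X p) f) (Y p) + vscale (f p) (lie X Y p)) c"
  proof (cases "c \<in> A \<and> p \<in> dom c")
    case True
    then have c: "c \<in> A" "p \<in> dom c" by auto
    have "frechet_derivative (\<lambda>x. f (param c x) *\<^sub>R Y (param c x) c) (at (coord c p)) =
      (\<lambda>u. f (param c (coord c p)) *\<^sub>R frechet_derivative (\<lambda>x. Y (param c x) c) (at (coord c p)) u +
           frechet_derivative (\<lambda>x. f (param c x)) (at (coord c p)) u *\<^sub>R Y (param c (coord c p)) c)"
      by (rule frechet_derivative_eq, intro has_derivative_scaleR vfield_differentiable(2)[OF Y c U(2)] sfun_differentiable(2)[OF f c U(2)])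
    moreover have "linear (frechet_derivative (\<lambda>x. X (param c x) c) (at (coord c p)))"
      by (rule linear_frechet_derivative[OF vfield_differentiable(1)[OF X c U(2)]])
    ultimately show ?thesis
      using vderiv_chart[OF c vfield_Tan[OF X U(2)] U f]
      by (simp add: lie_at c fscale_def vscale_def linear_scale param_coord algebra_simps)
  qed (use Tan_zero[OF vfield_Tan[OF Y U(2)]] in \<open>auto simp: lie_bracket_def vscale_def\<close>)
qed

subsection \<open>Constant fields\<close>

lemma vfield_const_field:
  assumes c: "c \<in> A" shows "vfield (dom c) (const_field A c v)"
proof (rule vfield_chart[OF c dom_open[OF c] subset_refl])
  have j: "const_field A c v q d = jac c d q (v c)" if "q \<in> dom c" "d \<in> A" "q \<in> dom d" for q d
    using that by (simp add: const_field_def)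
  show "const_field A c v p \<in> Tan p" if p: "p \<in> dom c" for p
  proof (rule TanI)
    fix d e assume d: "d \<in> A" "p \<in> dom d" and e: "e \<in> A" "p \<in> dom e"
    show "const_field A c v p e = jac d e p (const_field A c v p d)"
      by (simp add: j p d e jac_cocycle[OF c p d e])
  qed (auto simp: const_field_def)
  have "const_field A c v (param c x) c = v c" if "x \<in> coord c ` dom c" for x
    using that by (auto simp: const_field_def c param_coord jac_self)
  then show "smooth_on (coord c ` dom c) (\<lambda>x. const_field A c v (param c x) c)"
    by (subst smooth_on_cong[OF image_open[OF c], of _ "\<lambda>_. v c"]) (auto intro: smooth_on_const)
qed

lemma const_field_chart: "c \<in> A \<Longrightarrow> q \<in> dom c \<Longrightarrow> const_field A c v q c = v c"
  by (simp add: const_field_def jac_self)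

lemma const_field_eq:
  assumes c: "c \<in> A" "p \<in> dom c" and v: "v \<in> Tan p" shows "const_field A c v p = v"
  by (rule Tan_eqI[OF vfield_Tan[OF vfield_const_field[OF c(1)] c(2)] v c]) (rule const_field_chart[OF c])

lemma lie_const_field:
  assumes c: "c \<in> A" "p \<in> dom c" shows "lie (const_field A c v) (const_field A c w) p = 0"
proof (rule Tan_eqI[OF _ Tan_0 c])
  show "lie (const_field A c v) (const_field A c w) p \<in> Tan p"
    by (rule vfield_Tan[OF vfield_lie[OF dom_open[OF c(1)] vfield_const_field[OF c(1)] vfield_const_field[OF c(1)]] c(2)])
  have "frechet_derivative (\<lambda>x. const_field A c v (param c x) c) (at (coord c p)) = frechet_derivative (\<lambda>x. v c) (at (coord c p))" for v
    by (rule frechet_cong(2)[OF image_open[OF c(1)]]) (use c in \<open>auto simp: param_coord const_field_chart\<close>)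
  then show "lie (const_field A c v) (const_field A c w) p c = (0 :: 'm tvec) c"
    using c by (simp add: lie_at frechet_derivative_const)
qed

end

section \<open>Local unitary frames of an SU(3)-structure\<close>

text \<open>
  The position in the coframe \<open>e\<^sub>0, \<dots>, e\<^sub>5\<close> of an \<open>SU(3)\<close>-structure: \<open>J\<close> maps the vector dual to an
  even position to the one dual to the next position.
\<close>
fun num :: "idx \<Rightarrow> nat" where
  "num (Inl I1) = 0" | "num (Inr I1) = 1" | "num (Inl I2) = 2" | "num (Inr I2) = 3"
| "num (Inl I3) = 4" | "num (Inr I3) = 5"

lemma sum_lt6: "(\<Sum>i<6. f (i::nat)) = f 0 + f 1 + f 2 + f 3 + f 4 + f 5"
  by (simp add: eval_nat_numeral lessThan_Suc add_ac)

lemma sum_num: "(\<Sum>A\<in>UNIV. f (num A)) = (\<Sum>i<6. f i)"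
  by (simp add: sum_lt6 sum_idx sum_i3 algebra_simps)

lemma num_less: "num A < 6" by (cases A rule: num.cases) auto

lemma num_inject: "num A = num B \<longleftrightarrow> A = B"
  by (cases A rule: num.cases; cases B rule: num.cases) auto

lemma num_surj: "i < 6 \<Longrightarrow> \<exists>A. i = num A"
proof -
  assume "i < 6"
  then consider "i = 0" | "i = 1" | "i = 2" | "i = 3" | "i = 4" | "i = 5" by linarith
  then show ?thesis
  proof cases
    case 1 then show ?thesis by (intro exI[of _ "Inl I1"]) simp
  next
    case 2 then show ?thesis by (intro exI[of _ "Inr I1"]) simp
  next
    case 3 then show ?thesis by (intro exI[of _ "Inl I2"]) simp
  next
    case 4 then show ?thesis by (intro exI[of _ "Inr I2"]) simp
  next
    case 5 then show ?thesis by (intro exI[of _ "Inl I3"]) simp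
  next
    case 6 then show ?thesis by (intro exI[of _ "Inr I3"]) simp
  qed
qed

lemma ex_bij_6_idx: "\<exists>\<kappa>. bij_betw \<kappa> (UNIV :: 6 set) (UNIV :: idx set)"
proof -
  have "card (UNIV :: idx set) = 6"
    by (simp add: card_Plus UNIV_Plus_UNIV[symmetric] UNIV_i3 del: UNIV_Plus_UNIV)
  then show ?thesis by (intro finite_same_card_bij) auto
qed

locale almost_hermitian_manifold = smooth_manifold A
  for A :: "'m::t2_space chart set" +
  fixes g :: "'m metric" and J :: "'m endo"
  assumes herm: "almost_hermitian A g J"
begin

lemma g_linear: "v \<in> Tan p \<Longrightarrow> linear_form_on (Tan p) (g p v)"
  and g_sym: "v \<in> Tan p \<Longrightarrow> w \<in> Tan p \<Longrightarrow> g p v w = g p w v"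
  and g_pos: "v \<in> Tan p \<Longrightarrow> v \<noteq> 0 \<Longrightarrow> g p v v > 0"
  and g_smooth: "open U \<Longrightarrow> vfield U X \<Longrightarrow> vfield U Y \<Longrightarrow> sfun U (\<lambda>p. g p (X p) (Y p))"
  and J_Tan: "v \<in> Tan p \<Longrightarrow> J p v \<in> Tan p"
  and J_vscale: "v \<in> Tan p \<Longrightarrow> J p (vscale a v) = vscale a (J p v)"
  and J_J: "v \<in> Tan p \<Longrightarrow> J p (J p v) = - v"
  and J_smooth: "open U \<Longrightarrow> vfield U X \<Longrightarrow> vfield U (app_endo J X)"
  and g_J: "v \<in> Tan p \<Longrightarrow> w \<in> Tan p \<Longrightarrow> g p (J p v) (J p w) = g p v w"
  using herm unfolding almost_hermitian_def riemannian_metric_def almost_complex_structure_def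
  by (auto simp: zero_fun_def)

lemma g_add_right: "u \<in> Tan p \<Longrightarrow> v \<in> Tan p \<Longrightarrow> w \<in> Tan p \<Longrightarrow> g p u (v + w) = g p u v + g p u w"
  using g_linear unfolding linear_form_on_def by blast

lemma g_vscale_right: "u \<in> Tan p \<Longrightarrow> v \<in> Tan p \<Longrightarrow> g p u (vscale a v) = a * g p u v"
  using g_linear unfolding linear_form_on_def by blast

lemma g_add_left: "u \<in> Tan p \<Longrightarrow> v \<in> Tan p \<Longrightarrow> w \<in> Tan p \<Longrightarrow> g p (v + w) u = g p v u + g p w u"
  using g_add_right[of u p v w] g_sym Tan_add by metis

lemma g_vscale_left: "u \<in> Tan p \<Longrightarrow> v \<in> Tan p \<Longrightarrow> g p (vscale a v) u = a * g p v u"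
  using g_vscale_right[of u p v a] g_sym Tan_vscale by metis

lemma g_uminus_left: "u \<in> Tan p \<Longrightarrow> v \<in> Tan p \<Longrightarrow> g p (- v) u = - g p v u"
  and g_uminus_right: "u \<in> Tan p \<Longrightarrow> v \<in> Tan p \<Longrightarrow> g p u (- v) = - g p u v"
  unfolding uminus_vscale by (simp_all add: g_vscale_left g_vscale_right)

lemma g_diff_left: "u \<in> Tan p \<Longrightarrow> v \<in> Tan p \<Longrightarrow> w \<in> Tan p \<Longrightarrow> g p (v - w) u = g p v u - g p w u"
  using g_add_left[of u p v "- w"] Tan_uminus[of w p] by (simp add: g_uminus_left)

lemma g_zero_right: "u \<in> Tan p \<Longrightarrow> g p u 0 = 0"
proof -
  assume u: "u \<in> Tan p"
  have "g p u (0 + 0) = g p u 0 + g p u 0" by (rule g_add_right[OF u Tan_0 Tan_0])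
  then show ?thesis by simp
qed

lemma g_zero_left: "u \<in> Tan p \<Longrightarrow> g p 0 u = 0"
  using g_zero_right[of u p] g_sym[OF Tan_0, of u p] by simp

lemma g_sum_right: "finite I \<Longrightarrow> u \<in> Tan p \<Longrightarrow> (\<And>i. i \<in> I \<Longrightarrow> v i \<in> Tan p) \<Longrightarrow> g p u (\<Sum>i\<in>I. v i) = (\<Sum>i\<in>I. g p u (v i))"
  by (induction I rule: finite_induct) (auto simp: g_zero_right g_add_right Tan_sum)

lemma g_sum_left: "finite I \<Longrightarrow> u \<in> Tan p \<Longrightarrow> (\<And>i. i \<in> I \<Longrightarrow> v i \<in> Tan p) \<Longrightarrow> g p (\<Sum>i\<in>I. v i) u = (\<Sum>i\<in>I. g p (v i) u)"
  by (induction I rule: finite_induct) (auto simp: g_zero_left g_add_left Tan_sum)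

lemma g_nondegenerate: "v \<in> Tan p \<Longrightarrow> g p v v = 0 \<Longrightarrow> v = 0"
  using g_pos[of v p] by force

lemma g_J_skew: "v \<in> Tan p \<Longrightarrow> w \<in> Tan p \<Longrightarrow> g p (J p v) w = - g p v (J p w)"
proof -
  assume v: "v \<in> Tan p" and w: "w \<in> Tan p"
  have "g p v (J p w) = g p (J p v) (J p (J p w))" by (rule g_J[OF v J_Tan[OF w], symmetric])
  then show ?thesis by (simp add: J_J w v g_uminus_right J_Tan)
qed

text \<open>
  Orthonormal bases of the form \<open>e\<^sub>a, J e\<^sub>a\<close>. That they span, which the dimension of the tangent space
  implies, is part of the definition so that expansions in the basis are at hand.
\<close>
definition unitary_at :: "'m \<Rightarrow> (idx \<Rightarrow> 'm tvec) \<Rightarrow> bool" where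
  "unitary_at p E \<longleftrightarrow> (\<forall>i. E i \<in> Tan p) \<and> (\<forall>i j. g p (E i) (E j) = (if i = j then 1 else 0)) \<and>
     (\<forall>a. J p (E (Inl a)) = E (Inr a)) \<and> (\<forall>v\<in>Tan p. v = (\<Sum>i\<in>UNIV. vscale (g p v (E i)) (E i)))"

lemma unitary_at_Inr: "unitary_at p E \<Longrightarrow> J p (E (Inr a)) = - E (Inl a)"
  unfolding unitary_at_def using J_J by metis

end

locale su3_manifold = almost_hermitian_manifold A g J
  for A :: "'m::t2_space chart set" and g J +
  fixes \<Psi> :: "'m cform3"
  assumes su3: "SU3_structure A g J \<Psi>"
begin

text \<open>
  The frame is dual to the given coframe. The matrix of the coframe in the coordinate fields is
  invertible, as \<open>g\<close> is the sum of the squares of the coframe and positive definite, and Cramer's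
  rule shows that the entries of the inverse are smooth.
\<close>
lemma local_frame:
  "\<exists>U c E. open U \<and> p \<in> U \<and> c \<in> A \<and> U \<subseteq> dom c \<and> (\<forall>i. vfield U (E i)) \<and>
     (\<forall>q\<in>U. unitary_at q (\<lambda>i. E i q) \<and>
        (\<exists>e. \<forall>u\<in>Tan q. \<forall>v\<in>Tan q. \<forall>w\<in>Tan q. (\<forall>i. e (num i) u = g q u (E i q)) \<and> \<Psi> q u v w =
             - wedge3 (\<lambda>x. Complex (e 0 x) (e (1::nat) x)) (\<lambda>x. Complex (e 2 x) (e 3 x))
                 (\<lambda>x. Complex (e 4 x) (e 5 x)) u v w))"
proof -
  from su3[unfolded SU3_structure_def, THEN conjunct2, THEN spec[of _ p]]
  obtain U0 and e :: "nat \<Rightarrow> 'm \<Rightarrow> 'm tvec \<Rightarrow> real" where U0: "open U0" "p \<in> U0" and e': "\<forall>i<6. one_form A U0 (e i)"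
    and all: "\<forall>q\<in>U0. \<forall>u\<in>Tan q. \<forall>v\<in>Tan q. \<forall>w\<in>Tan q. g q u v = (\<Sum>i<6. e i q u * e i q v) \<and>
           kahler_form g J q u v = - wedge2 (e 0 q) (e 1 q) u v - wedge2 (e 2 q) (e 3 q) u v - wedge2 (e 4 q) (e 5 q) u v \<and>
           \<Psi> q u v w = - wedge3 (\<lambda>x. Complex (e 0 q x) (e 1 q x)) (\<lambda>x. Complex (e 2 q x) (e 3 q x))
                 (\<lambda>x. Complex (e 4 q x) (e 5 q x)) u v w"
    by (elim exE conjE) rule
  have e: "one_form A U0 (e i)" if "i < 6" for i using e' that by blast
  have ge: "g q u v = (\<Sum>i<6. e i q u * e i q v)" if "q \<in> U0" "u \<in> Tan q" "v \<in> Tan q" for q u v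
    using all[THEN bspec, OF that(1), THEN bspec, OF that(2), THEN bspec, OF that(3), THEN bspec, OF Tan_0] by (rule conjunct1)
  have Je: "kahler_form g J q u v = - wedge2 (e 0 q) (e 1 q) u v - wedge2 (e 2 q) (e 3 q) u v - wedge2 (e 4 q) (e 5 q) u v"
    if "q \<in> U0" "u \<in> Tan q" "v \<in> Tan q" for q u v
    using all[THEN bspec, OF that(1), THEN bspec, OF that(2), THEN bspec, OF that(3), THEN bspec, OF Tan_0] by (elim conjE)
  have Pe: "\<Psi> q u v w = - wedge3 (\<lambda>x. Complex (e 0 q x) (e 1 q x)) (\<lambda>x. Complex (e 2 q x) (e 3 q x))
                 (\<lambda>x. Complex (e 4 q x) (e 5 q x)) u v w"
    if "q \<in> U0" "u \<in> Tan q" "v \<in> Tan q" "w \<in> Tan q" for q u v w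
    using all[THEN bspec, OF that(1), THEN bspec, OF that(2), THEN bspec, OF that(3), THEN bspec, OF that(4)] by (elim conjE)
  let ?c = "chart_at A p"
  note c = chart_at[of p]
  define U where "U = U0 \<inter> dom ?c"
  have U: "open U" "p \<in> U" "U \<subseteq> dom ?c" "U \<subseteq> U0" using U0 c dom_open by (auto simp: U_def)
  have elin: "linear_form_on (Tan q) (e i q)" if "i < 6" "q \<in> U" for i q
    using e[OF that(1)] that(2) U(4) unfolding one_form_def by blast
  have eadd: "e i q (u + v) = e i q u + e i q v" "e i q (vscale a u) = a * e i q u" if "i < 6" "q \<in> U" "u \<in> Tan q" "v \<in> Tan q" for i q u v a
    using elin[OF that(1,2)] that unfolding linear_form_on_def by blast+
  have e0: "e i q 0 = 0" if "i < 6" "q \<in> U" for i q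
    using eadd(1)[OF that Tan_0 Tan_0] by simp
  have esum: "e i q (\<Sum>k\<in>I. v k) = (\<Sum>k\<in>I. e i q (v k))" if "finite I" "i < 6" "q \<in> U" "\<And>k. v k \<in> Tan q" for I :: "6 set" and v i q
    using that(1)
  proof (induction I rule: finite_induct)
    case empty
    show ?case by (simp only: sum.empty e0[OF that(2,3)])
  next
    case (insert x F)
    show ?case
      by (simp only: sum.insert[OF insert(1,2)] eadd(1)[OF that(2,3,4) Tan_sum[OF insert(1) that(4)]] insert.IH)
  qed
  \<comment> \<open>Coordinates in a chart are indexed by the type \<open>6\<close>.\<close>
  obtain \<kappa> where \<kappa>: "bij_betw \<kappa> (UNIV :: 6 set) (UNIV :: idx set)" using ex_bij_6_idx by blast
  define \<kappa>' where "\<kappa>' = inv \<kappa>"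
  have \<kappa>\<kappa>: "\<kappa> (\<kappa>' i) = i" "\<kappa>' (\<kappa> r) = r" for i r
    using \<kappa> by (auto simp: \<kappa>'_def bij_betw_def surj_f_inv_f inv_f_f)
  define B :: "6 \<Rightarrow> 'm vfield" where "B n = const_field A ?c (\<lambda>_. axis n 1)" for n
  have B: "vfield U (B n)" for n unfolding B_def by (rule vfield_subset[OF vfield_const_field[OF c(1)] U(3)])
  have BT: "B n q \<in> Tan q" if "q \<in> U" for n q by (rule vfield_Tan[OF B that])
  define M :: "'m \<Rightarrow> real ^ 6 ^ 6" where "M q = (\<chi> r n. e (num (\<kappa> r)) q (B n q))" for q
  have M_smooth: "sfun U (\<lambda>q. M q $ r $ n)" for r n
    using e[OF num_less] B U(1,4) unfolding one_form_def M_def by simp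
  have M_ker: "x = 0" if q: "q \<in> U" and x: "M q *v x = 0" for q x
  proof -
    define v where "v = (\<Sum>n\<in>UNIV. vscale (x $ n) (B n q))"
    have v: "v \<in> Tan q" unfolding v_def by (intro Tan_sum Tan_vscale BT q) auto
    have "e (num i) q v = 0" for i
    proof -
      have "e (num i) q v = (\<Sum>n\<in>UNIV. x $ n * e (num i) q (B n q))"
        unfolding v_def by (subst esum) (auto intro!: Tan_vscale BT q sum.cong simp: num_less eadd(2)[OF num_less q BT[OF q] Tan_0])
      also have "\<dots> = (M q *v x) $ \<kappa>' i"
        by (simp add: matrix_vector_mult_def M_def \<kappa>\<kappa> mult.commute)
      finally show ?thesis using x by simp
    qed
    then have "g q v v = 0"
      using ge[of q v v] q U(4) v by (auto simp: sum_num[symmetric])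
    then have "v = 0" by (rule g_nondegenerate[OF v])
    then have "v ?c = 0" by simp
    moreover have "v ?c = (\<Sum>n\<in>UNIV. x $ n *\<^sub>R axis n 1)"
      using q U(3) c(1) by (simp add: v_def sum_fun_apply vscale_def B_def const_field_chart subset_iff)
    ultimately have "(\<Sum>n\<in>UNIV. x $ n *\<^sub>R (axis n 1 :: real ^ 6)) = 0" by simp
    then show "x = 0" by (simp add: basis_expansion[of x, unfolded scalar_mult_eq_scaleR])
  qed
  have det: "det (M q) \<noteq> 0" if "q \<in> U" for q
    using M_ker[OF that] by (metis invertible_det_nz invertible_left_inverse matrix_left_invertible_ker)
  \<comment> \<open>The inverse of the matrix \<open>M\<close>, by Cramer's rule.\<close>
  define y :: "6 \<Rightarrow> 6 \<Rightarrow> 'm \<Rightarrow> real" where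
    "y r k q = det (\<chi> i j. if j = k then axis r 1 $ i else M q $ i $ j) * inverse (det (M q))" for r k q
  have y_smooth: "sfun U (y r k)" for r k
    unfolding y_def[abs_def]
  proof (intro sfun_mult sfun_inverse U det)
    show "sfun U (\<lambda>q. det (M q))"
      unfolding det_def by (intro sfun_sum sfun_mult sfun_prod sfun_const M_smooth U) auto
    show "sfun U (\<lambda>q. det (\<chi> i j. if j = k then axis r 1 $ i else M q $ i $ j))"
      unfolding det_def
    proof (intro sfun_sum sfun_mult sfun_prod sfun_const U)
      fix \<sigma> :: "6 \<Rightarrow> 6" and i
      show "sfun U (\<lambda>q. (\<chi> i j. if j = k then axis r 1 $ i else M q $ i $ j) $ i $ \<sigma> i)"
        by (cases "\<sigma> i = k") (auto intro: sfun_const M_smooth)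
    qed auto
  qed
  have y: "M q *v (\<chi> k. y r k q) = axis r 1" if "q \<in> U" for q r
    using cramer[OF det[OF that], of "\<chi> k. y r k q" "axis r 1"] by (simp add: y_def divide_inverse)
  define E where "E i = (\<Sum>k\<in>UNIV. fscale (y (\<kappa>' i) k) (B k))" for i
  have Eq: "E i q = (\<Sum>k\<in>UNIV. vscale (y (\<kappa>' i) k q) (B k q))" for i q
    unfolding E_def by (subst sum_fun_apply) (simp only: fscale_def)
  have E: "vfield U (E i)" for i
    unfolding E_def by (intro vfield_sum vfield_fscale U y_smooth B) auto
  have ET: "E i q \<in> Tan q" if "q \<in> U" for i q by (rule vfield_Tan[OF E that])
  have eE: "e (num j) q (E i q) = (if i = j then 1 else 0)" if q: "q \<in> U" for i j q
  proof -
    have "e (num j) q (E i q) = (\<Sum>k\<in>UNIV. y (\<kappa>' i) k q * e (num j) q (B k q))"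
      unfolding Eq by (subst esum) (auto intro!: Tan_vscale BT q sum.cong simp: num_less eadd(2)[OF num_less q BT[OF q] Tan_0])
    also have "\<dots> = (M q *v (\<chi> k. y (\<kappa>' i) k q)) $ \<kappa>' j"
      by (simp add: matrix_vector_mult_def M_def \<kappa>\<kappa> mult.commute)
    also have "\<dots> = (if i = j then 1 else 0)"
      unfolding y[OF q] by (simp add: axis_def) (metis \<kappa>\<kappa>(1))
    finally show ?thesis .
  qed
  have eg: "e (num i) q u = g q u (E i q)" if q: "q \<in> U" and u: "u \<in> Tan q" for i q u
  proof -
    have "g q u (E i q) = (\<Sum>k\<in>UNIV. e (num k) q u * e (num k) q (E i q))"
      using ge[OF _ u ET[OF q]] q U(4) by (auto simp: sum_num[of "\<lambda>k. e k q u * e k q (E i q)"])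
    also have "\<dots> = (\<Sum>k\<in>UNIV. if k = i then e (num k) q u else 0)"
      by (rule sum.cong[OF refl]) (auto simp: eE[OF q])
    finally show ?thesis by simp
  qed
  have ext: "u = v" if q: "q \<in> U" and u: "u \<in> Tan q" and v: "v \<in> Tan q" and eq: "\<And>i. e (num i) q u = e (num i) q v" for q u v
  proof -
    have "g q (u - v) (u - v) = (\<Sum>k\<in>UNIV. e (num k) q (u - v) * e (num k) q (u - v))"
      using ge[OF _ Tan_diff[OF u v] Tan_diff[OF u v]] q U(4) by (auto simp: sum_num[of "\<lambda>k. e k q (u - v) * e k q (u - v)"])
    moreover have "e (num k) q (u - v) = 0" for k
      unfolding eg[OF q Tan_diff[OF u v]] g_diff_left[OF ET[OF q] u v] using eq[of k] by (simp add: eg[OF q u] eg[OF q v])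
    ultimately have "u - v = 0" by (intro g_nondegenerate[OF Tan_diff[OF u v]]) simp
    then show ?thesis by simp
  qed
  have eE': "e 0 q (E i q) = (if i = Inl I1 then 1 else 0)" "e (Suc 0) q (E i q) = (if i = Inr I1 then 1 else 0)"
    "e 2 q (E i q) = (if i = Inl I2 then 1 else 0)" "e 3 q (E i q) = (if i = Inr I2 then 1 else 0)"
    "e 4 q (E i q) = (if i = Inl I3 then 1 else 0)" "e 5 q (E i q) = (if i = Inr I3 then 1 else 0)"
    if q: "q \<in> U" for i q
    using eE[OF q, of "Inl I1" i] eE[OF q, of "Inr I1" i] eE[OF q, of "Inl I2" i] eE[OF q, of "Inr I2" i]
      eE[OF q, of "Inl I3" i] eE[OF q, of "Inr I3" i] by simp_all
  have uni: "unitary_at q (\<lambda>i. E i q)" if q: "q \<in> U" for q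
    unfolding unitary_at_def
  proof (intro conjI allI ballI ET[OF q])
    show "g q (E i q) (E j q) = (if i = j then 1 else 0)" for i j
      using eg[OF q ET[OF q]] eE[OF q] by metis
    show "J q (E (Inl a) q) = E (Inr a) q" for a
    proof (rule ext[OF q J_Tan[OF ET[OF q]] ET[OF q]])
      fix i
      have "e (num i) q (J q (E (Inl a) q)) = kahler_form g J q (E i q) (E (Inl a) q)"
        unfolding kahler_form_def eg[OF q J_Tan[OF ET[OF q]]] by (rule g_sym[OF J_Tan[OF ET[OF q]] ET[OF q]])
      also have "\<dots> = e (num i) q (E (Inr a) q)"
        by (cases a; cases i rule: num.cases; simp add: Je[OF subsetD[OF U(4) q] ET[OF q] ET[OF q]] wedge2_def eE'[OF q])
      finally show "e (num i) q (J q (E (Inl a) q)) = e (num i) q (E (Inr a) q)" .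
    qed
    fix v assume v: "v \<in> Tan q"
    let ?s = "\<Sum>i\<in>UNIV. vscale (g q v (E i q)) (E i q)"
    have sT: "?s \<in> Tan q" by (intro Tan_sum Tan_vscale ET[OF q]) auto
    show "v = ?s"
    proof (rule ext[OF q v sT])
      fix i
      have "e (num i) q ?s = (\<Sum>k\<in>UNIV. g q v (E k q) * g q (E k q) (E i q))"
        unfolding eg[OF q sT] by (simp add: g_sum_left Tan_vscale ET[OF q] g_vscale_left)
      also have "\<dots> = (\<Sum>k\<in>UNIV. if k = i then g q v (E k q) else 0)"
        by (rule sum.cong[OF refl]) (simp add: eg[OF q ET[OF q], symmetric] eE[OF q])
      finally show "e (num i) q v = e (num i) q ?s" by (simp add: eg[OF q v])
    qed
  qed
  show ?thesis
  proof (intro exI[of _ U] exI[of _ ?c] exI[of _ E] conjI allI ballI E U c uni)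
    fix q assume q: "q \<in> U"
    show "\<exists>e. \<forall>u\<in>Tan q. \<forall>v\<in>Tan q. \<forall>w\<in>Tan q. (\<forall>i. e (num i) u = g q u (E i q)) \<and> \<Psi> q u v w =
             - wedge3 (\<lambda>x. Complex (e 0 x) (e (1::nat) x)) (\<lambda>x. Complex (e 2 x) (e 3 x))
                 (\<lambda>x. Complex (e 4 x) (e 5 x)) u v w"
      using Pe[of q] q U(4) eg[OF q] by (intro exI[of _ "\<lambda>i. e i q"]) auto
  qed
qed

end

section \<open>Tensoriality of torsion and curvature\<close>

context smooth_manifold
begin

text \<open>
  A functional of vector fields on \<open>W\<close> that depends only on their values on \<open>W\<close> and is linear over
  the smooth functions there; by \<open>tensorial_expand\<close> below it depends on the values at \<open>p\<close> only.
\<close>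
definition tensorial :: "'m set \<Rightarrow> 'm \<Rightarrow> ('m vfield \<Rightarrow> real) \<Rightarrow> bool" where
  "tensorial W p \<Phi> \<longleftrightarrow>
     (\<forall>X Y. vfield W X \<longrightarrow> vfield W Y \<longrightarrow> \<Phi> (X + Y) = \<Phi> X + \<Phi> Y) \<and>
     (\<forall>f X. sfun W f \<longrightarrow> vfield W X \<longrightarrow> \<Phi> (fscale f X) = f p * \<Phi> X) \<and>
     (\<forall>X Y. vfield W X \<longrightarrow> (\<forall>q\<in>W. X q = Y q) \<longrightarrow> \<Phi> X = \<Phi> Y)"

lemma tensorial_add: "tensorial W p \<Phi> \<Longrightarrow> vfield W X \<Longrightarrow> vfield W Y \<Longrightarrow> \<Phi> (X + Y) = \<Phi> X + \<Phi> Y"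
  and tensorial_fscale: "tensorial W p \<Phi> \<Longrightarrow> sfun W f \<Longrightarrow> vfield W X \<Longrightarrow> \<Phi> (fscale f X) = f p * \<Phi> X"
  and tensorial_cong: "tensorial W p \<Phi> \<Longrightarrow> vfield W X \<Longrightarrow> (\<And>q. q \<in> W \<Longrightarrow> X q = Y q) \<Longrightarrow> \<Phi> X = \<Phi> Y"
  unfolding tensorial_def by blast+

lemma tensorialI:
  assumes "\<And>X Y. vfield W X \<Longrightarrow> vfield W Y \<Longrightarrow> \<Phi> (X + Y) = \<Phi> X + \<Phi> Y"
    and "\<And>f X. sfun W f \<Longrightarrow> vfield W X \<Longrightarrow> \<Phi> (fscale f X) = f p * \<Phi> X"
    and "\<And>X Y. vfield W X \<Longrightarrow> vfield W Y \<Longrightarrow> (\<And>q. q \<in> W \<Longrightarrow> X q = Y q) \<Longrightarrow> \<Phi> X = \<Phi> Y"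
    and W: "open W"
  shows "tensorial W p \<Phi>"
  unfolding tensorial_def using assms(1,2) assms(3) vfield_cong[OF W] by blast

lemma tensorial_uminus:
  assumes W: "open W" and t: "tensorial W p \<Theta>" and e: "\<And>Z. vfield W Z \<Longrightarrow> \<Phi> Z = - \<Theta> Z"
  shows "tensorial W p \<Phi>"
proof (rule tensorialI[OF _ _ _ W])
  show "\<Phi> (Z + Z') = \<Phi> Z + \<Phi> Z'" if "vfield W Z" "vfield W Z'" for Z Z'
    unfolding e[OF that(1)] e[OF that(2)] e[OF vfield_add[OF W that]] tensorial_add[OF t that] by simp
  show "\<Phi> (fscale f Z) = f p * \<Phi> Z" if "sfun W f" "vfield W Z" for f Z
    unfolding e[OF that(2)] e[OF vfield_fscale[OF W that]] tensorial_fscale[OF t that] by simp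
  show "\<Phi> Z = \<Phi> Z'" if "vfield W Z" "vfield W Z'" "\<And>q. q \<in> W \<Longrightarrow> Z q = Z' q" for Z Z'
    using tensorial_cong[OF t that(1,3)] unfolding e[OF that(1)] e[OF that(2)] by simp
qed

lemma tensorial_0:
  assumes "tensorial W p \<Phi>" shows "\<Phi> 0 = 0"
proof -
  have "\<Phi> (0 + 0) = \<Phi> 0 + \<Phi> 0" by (rule tensorial_add[OF assms vfield_0 vfield_0])
  then show ?thesis by simp
qed

lemma tensorial_sum:
  assumes W: "open W" and t: "tensorial W p \<Phi>" and I: "finite I" and X: "\<And>i. i \<in> I \<Longrightarrow> vfield W (X i)"
  shows "\<Phi> (\<Sum>i\<in>I. X i) = (\<Sum>i\<in>I. \<Phi> (X i))"
  using I X
proof (induction I rule: finite_induct)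
  case empty
  show ?case by (simp only: sum.empty tensorial_0[OF t])
next
  case (insert x F)
  have "\<Phi> (X x + sum X F) = \<Phi> (X x) + \<Phi> (sum X F)"
    by (rule tensorial_add[OF t _ vfield_sum[OF insert(1) W]]) (use insert in auto)
  then show ?case using insert by (simp only: sum.insert[OF insert(1,2)]) auto
qed

lemma vderiv_uminus: "open U \<Longrightarrow> p \<in> U \<Longrightarrow> v \<in> Tan p \<Longrightarrow> sfun U f \<Longrightarrow> vderiv A p v (\<lambda>q. - f q) = - vderiv A p v f"
  using vderiv_mult[of U p v "\<lambda>_. -1" f] by (simp add: sfun_const vderiv_const[of U])

lemma vderiv_sum_vec:
  assumes "open U" "p \<in> U" "sfun U f" "finite I" "\<And>i. i \<in> I \<Longrightarrow> v i \<in> Tan p"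
  shows "vderiv A p (\<Sum>i\<in>I. vscale (a i) (v i)) f = (\<Sum>i\<in>I. a i * vderiv A p (v i) f)"
  using assms(4,5)
proof (induction I rule: finite_induct)
  case empty
  have "vderiv A p (0 + 0) f = vderiv A p 0 f + vderiv A p 0 f"
    by (rule vderiv_add_vec[OF assms(1,2) Tan_0 assms(3) Tan_0])
  then have "vderiv A p 0 f = 0" by simp
  then show ?case by (simp only: sum.empty)
next
  case (insert x F)
  have vx: "v x \<in> Tan p" "\<And>i. i \<in> F \<Longrightarrow> v i \<in> Tan p" using insert by auto
  have "vderiv A p (vscale (a x) (v x) + (\<Sum>i\<in>F. vscale (a i) (v i))) f =
      vderiv A p (vscale (a x) (v x)) f + vderiv A p (\<Sum>i\<in>F. vscale (a i) (v i)) f"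
    by (rule vderiv_add_vec[OF assms(1,2) Tan_vscale[OF vx(1)] assms(3) Tan_sum[OF insert(1) Tan_vscale[OF vx(2)]]])
  moreover have "vderiv A p (vscale (a x) (v x)) f = a x * vderiv A p (v x) f"
    by (rule vderiv_vscale_vec[OF assms(1,2) vx(1) assms(3)])
  ultimately show ?case using insert by (simp only: sum.insert[OF insert(1,2)]) auto
qed

end

locale connection = smooth_manifold A
  for A :: "'m::t2_space chart set" +
  fixes D :: "'m connection"
  assumes D: "linear_connection A D"
begin

lemma D_vfield: "open U \<Longrightarrow> vfield U X \<Longrightarrow> vfield U Y \<Longrightarrow> vfield U (D X Y)"
  using D unfolding linear_connection_def by blast

lemma D_cong:
  assumes "open U" "vfield U X" "vfield U Y" "\<And>q. q \<in> U \<Longrightarrow> X' q = X q" "\<And>q. q \<in> U \<Longrightarrow> Y' q = Y q" "p \<in> U"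
  shows "D X' Y' p = D X Y p"
  using D[unfolded linear_connection_def, rule_format, of U X Y] assms by blast

context
  fixes U :: "'m set" and p :: 'm assumes U: "open U" "p \<in> U"
begin

lemma D_add_left: "vfield U X \<Longrightarrow> vfield U Y \<Longrightarrow> vfield U Z \<Longrightarrow> D (X + Z) Y p = D X Y p + D Z Y p"
  and D_add_right: "vfield U X \<Longrightarrow> vfield U Y \<Longrightarrow> vfield U Z \<Longrightarrow> D X (Y + Z) p = D X Y p + D X Z p"
  and D_fscale_left: "vfield U X \<Longrightarrow> vfield U Y \<Longrightarrow> sfun U f \<Longrightarrow> D (fscale f X) Y p = vscale (f p) (D X Y p)"
  and D_fscale_right: "vfield U X \<Longrightarrow> vfield U Y \<Longrightarrow> sfun U f \<Longrightarrow>
    D X (fscale f Y) p = vscale (vderiv A p (X p) f) (Y p) + vscale (f p) (D X Y p)"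
  using D[unfolded linear_connection_def, rule_format, of U X Y] U by blast+

lemma D_Tan: "vfield U X \<Longrightarrow> vfield U Y \<Longrightarrow> D X Y p \<in> Tan p"
  using vfield_Tan[OF D_vfield[OF U(1)] U(2)] .

lemma torsion_vec_at: "torsion_vec A D X Y p = D X Y p - D Y X p - lie X Y p"
  by (simp add: torsion_vec_def)

lemma torsion_vec_Tan: "vfield U X \<Longrightarrow> vfield U Y \<Longrightarrow> torsion_vec A D X Y p \<in> Tan p"
  unfolding torsion_vec_at by (intro Tan_diff D_Tan vfield_Tan[OF vfield_lie[OF U(1)] U(2)])

lemma torsion_vec_add_left:
  assumes X: "vfield U X" and Y: "vfield U Y" and Z: "vfield U Z"
  shows "torsion_vec A D (X + Z) Y p = torsion_vec A D X Y p + torsion_vec A D Z Y p"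
proof -
  have l: "lie (X + Z) Y p = lie X Y p + lie Z Y p"
    using lie_add_right[OF U Y X Z] by (simp add: lie_skew[of _ Y])
  show ?thesis unfolding torsion_vec_at D_add_left[OF X Y Z] D_add_right[OF Y X Z] l
    by (simp add: fun_eq_iff)
qed

lemma torsion_vec_fscale_left:
  assumes X: "vfield U X" and Y: "vfield U Y" and f: "sfun U f"
  shows "torsion_vec A D (fscale f X) Y p = vscale (f p) (torsion_vec A D X Y p)"
proof -
  have l: "lie (fscale f X) Y p = - (vscale (vderiv A p (Y p) f) (X p)) + vscale (f p) (lie X Y p)"
    using lie_fscale_right[OF U Y X f] by (simp add: lie_skew[of _ Y] vscale_def fun_eq_iff)
  show ?thesis unfolding torsion_vec_at D_fscale_left[OF X Y f] D_fscale_right[OF Y X f] l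
    by (simp add: fun_eq_iff vscale_def algebra_simps)
qed

lemma curvature_vec_at: "curvature_vec A D X Y Z p = D X (D Y Z) p - D Y (D X Z) p - D (lie X Y) Z p"
  by (simp add: curvature_vec_def)

lemma curvature_vec_Tan: "vfield U X \<Longrightarrow> vfield U Y \<Longrightarrow> vfield U Z \<Longrightarrow> curvature_vec A D X Y Z p \<in> Tan p"
  unfolding curvature_vec_at by (intro Tan_diff D_Tan D_vfield vfield_lie U)

lemma curvature_vec_add_left:
  assumes X: "vfield U X" and X': "vfield U X'" and Y: "vfield U Y" and Z: "vfield U Z"
  shows "curvature_vec A D (X + X') Y Z p = curvature_vec A D X Y Z p + curvature_vec A D X' Y Z p"
proof -
  note XX = vfield_add[OF U(1) X X']
  have l: "lie (X + X') Y q = (lie X Y + lie X' Y) q" if "q \<in> U" for q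
    using lie_add_right[OF U(1) that Y X X'] by (simp add: lie_skew[of _ Y])
  have 1: "D (lie (X + X') Y) Z p = D (lie X Y) Z p + D (lie X' Y) Z p"
  proof -
    have "D (lie (X + X') Y) Z p = D (lie X Y + lie X' Y) Z p"
      by (rule D_cong[OF U(1) vfield_add[OF U(1) vfield_lie[OF U(1) X Y] vfield_lie[OF U(1) X' Y]] Z l refl U(2)])
    then show ?thesis unfolding D_add_left[OF vfield_lie[OF U(1) X Y] Z vfield_lie[OF U(1) X' Y]] .
  qed
  have d: "D (X + X') Z q = (D X Z + D X' Z) q" if "q \<in> U" for q
    using D[unfolded linear_connection_def, rule_format, of U X Z] X Z X' U(1) that by (metis plus_fun_apply)
  have 2: "D Y (D (X + X') Z) p = D Y (D X Z) p + D Y (D X' Z) p"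
  proof -
    have "D Y (D (X + X') Z) p = D Y (D X Z + D X' Z) p"
      by (rule D_cong[OF U(1) Y vfield_add[OF U(1) D_vfield[OF U(1) X Z] D_vfield[OF U(1) X' Z]] refl d U(2)])
    then show ?thesis unfolding D_add_right[OF Y D_vfield[OF U(1) X Z] D_vfield[OF U(1) X' Z]] .
  qed
  show ?thesis
    unfolding curvature_vec_at 1 2 D_add_left[OF X D_vfield[OF U(1) Y Z] X'] by (simp add: fun_eq_iff)
qed

lemma curvature_vec_skew: "curvature_vec A D Y X Z p = - curvature_vec A D X Y Z p"
  if X: "vfield U X" and Y: "vfield U Y" and Z: "vfield U Z"
proof -
  have "D (lie Y X) Z p = D (fscale (\<lambda>_. -1) (lie X Y)) Z p"
  proof (rule D_cong[OF U(1) vfield_fscale[OF U(1) sfun_const vfield_lie[OF U(1) X Y]] Z _ refl U(2)])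
    show "lie Y X q = fscale (\<lambda>_. -1) (lie X Y) q" for q
      by (subst lie_skew) (simp add: fscale_def vscale_def fun_eq_iff)
  qed
  then have "D (lie Y X) Z p = - D (lie X Y) Z p"
    using D_fscale_left[OF vfield_lie[OF U(1) X Y] Z sfun_const] by (simp add: uminus_vscale)
  then show ?thesis unfolding curvature_vec_at by simp
qed

lemma curvature_vec_fscale_left:
  assumes X: "vfield U X" and Y: "vfield U Y" and Z: "vfield U Z" and f: "sfun U f"
  shows "curvature_vec A D (fscale f X) Y Z p = vscale (f p) (curvature_vec A D X Y Z p)"
proof -
  let ?Yf = "\<lambda>q. vderiv A q (Y q) f"
  have Yf: "sfun U ?Yf" by (rule sfun_vderiv[OF U(1) Y f])
  have mYf: "sfun U (\<lambda>q. - ?Yf q)" by (rule sfun_uminus[OF U(1) Yf])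
  have l: "lie (fscale f X) Y q = (fscale (\<lambda>q. - ?Yf q) X + fscale f (lie X Y)) q" if "q \<in> U" for q
    using lie_fscale_right[OF U(1) that Y X f] by (simp add: lie_skew[of _ Y] fscale_def vscale_def fun_eq_iff)
  have 1: "D (lie (fscale f X) Y) Z p = vscale (- ?Yf p) (D X Z p) + vscale (f p) (D (lie X Y) Z p)"
  proof -
    have "D (lie (fscale f X) Y) Z p = D (fscale (\<lambda>q. - ?Yf q) X + fscale f (lie X Y)) Z p"
      by (rule D_cong[OF U(1) vfield_add[OF U(1) vfield_fscale[OF U(1) mYf X] vfield_fscale[OF U(1) f vfield_lie[OF U(1) X Y]]] Z l refl U(2)])
    then show ?thesis
      unfolding D_add_left[OF vfield_fscale[OF U(1) mYf X] Z vfield_fscale[OF U(1) f vfield_lie[OF U(1) X Y]]]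
        D_fscale_left[OF X Z mYf] D_fscale_left[OF vfield_lie[OF U(1) X Y] Z f] .
  qed
  have d: "D (fscale f X) Z q = fscale f (D X Z) q" if "q \<in> U" for q
    using D[unfolded linear_connection_def, rule_format, of U X Z] X Z f U(1) that unfolding fscale_def by blast
  have 2: "D Y (D (fscale f X) Z) p = vscale (?Yf p) (D X Z p) + vscale (f p) (D Y (D X Z) p)"
    using D_cong[OF U(1) Y vfield_fscale[OF U(1) f D_vfield[OF U(1) X Z]] refl d U(2)]
      D_fscale_right[OF Y D_vfield[OF U(1) X Z] f] by simp
  show ?thesis
    unfolding curvature_vec_at 1 2 D_fscale_left[OF X D_vfield[OF U(1) Y Z] f]
    by (simp add: fun_eq_iff vscale_def algebra_simps)
qed

lemma curvature_vec_add_right: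
  assumes X: "vfield U X" and Y: "vfield U Y" and Z: "vfield U Z" and Z': "vfield U Z'"
  shows "curvature_vec A D X Y (Z + Z') p = curvature_vec A D X Y Z p + curvature_vec A D X Y Z' p"
proof -
  have 2: "D X (D Y (Z + Z')) p = D X (D Y Z) p + D X (D Y Z') p" if X: "vfield U X" and Y: "vfield U Y" for X Y
  proof -
    have d: "D Y (Z + Z') q = (D Y Z + D Y Z') q" if "q \<in> U" for q
      using D[unfolded linear_connection_def, rule_format, of U Y Z] Y Z Z' U(1) that by (metis plus_fun_apply)
    have "D X (D Y (Z + Z')) p = D X (D Y Z + D Y Z') p"
      by (rule D_cong[OF U(1) X vfield_add[OF U(1) D_vfield[OF U(1) Y Z] D_vfield[OF U(1) Y Z']] refl d U(2)])
    then show ?thesis unfolding D_add_right[OF X D_vfield[OF U(1) Y Z] D_vfield[OF U(1) Y Z']] .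
  qed
  show ?thesis
    unfolding curvature_vec_at 2[OF X Y] 2[OF Y X] D_add_right[OF vfield_lie[OF U(1) X Y] Z Z'] by (simp add: fun_eq_iff)
qed

text \<open>The second derivatives of \<open>f\<close> combine to the derivative along the bracket.\<close>
lemma curvature_vec_fscale_right:
  assumes X: "vfield U X" and Y: "vfield U Y" and Z: "vfield U Z" and f: "sfun U f"
  shows "curvature_vec A D X Y (fscale f Z) p = vscale (f p) (curvature_vec A D X Y Z p)"
proof -
  have 2: "D X (D Y (fscale f Z)) p = vscale (vderiv A p (X p) (\<lambda>q. vderiv A q (Y q) f)) (Z p) + vscale (vderiv A p (Y p) f) (D X Z p)
      + (vscale (vderiv A p (X p) f) (D Y Z p) + vscale (f p) (D X (D Y Z) p))"
    if X: "vfield U X" and Y: "vfield U Y" for X Y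
  proof -
    let ?Yf = "\<lambda>q. vderiv A q (Y q) f"
    have Yf: "sfun U ?Yf" by (rule sfun_vderiv[OF U(1) Y f])
    have d: "D Y (fscale f Z) q = (fscale ?Yf Z + fscale f (D Y Z)) q" if "q \<in> U" for q
      using D[unfolded linear_connection_def, rule_format, of U Y Z] Y Z f U(1) that
      unfolding fscale_def plus_fun_apply by blast
    have "D X (D Y (fscale f Z)) p = D X (fscale ?Yf Z + fscale f (D Y Z)) p"
      by (rule D_cong[OF U(1) X vfield_add[OF U(1) vfield_fscale[OF U(1) Yf Z] vfield_fscale[OF U(1) f D_vfield[OF U(1) Y Z]]] refl d U(2)])
    then show ?thesis
      unfolding D_add_right[OF X vfield_fscale[OF U(1) Yf Z] vfield_fscale[OF U(1) f D_vfield[OF U(1) Y Z]]]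
        D_fscale_right[OF X Z Yf] D_fscale_right[OF X D_vfield[OF U(1) Y Z] f] .
  qed
  have c: "vderiv A p (lie X Y p) f = vderiv A p (X p) (\<lambda>q. vderiv A q (Y q) f) - vderiv A p (Y p) (\<lambda>q. vderiv A q (X q) f)"
    by (rule lie_commutator[OF U X Y f, symmetric])
  show ?thesis
    unfolding curvature_vec_at 2[OF X Y] 2[OF Y X] D_fscale_right[OF vfield_lie[OF U(1) X Y] Z f] c
    by (simp add: fun_eq_iff vscale_def algebra_simps)
qed

end

lemma D_local:
  assumes "open U" "vfield U X" "vfield U Y" "\<And>q. q \<in> U \<Longrightarrow> X q = X' q" "\<And>q. q \<in> U \<Longrightarrow> Y q = Y' q" "p \<in> U"
  shows "D X Y p = D X' Y' p"
  by (rule D_cong[OF assms(1,2,3) _ _ assms(6), symmetric]) (simp_all add: assms(4,5))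

lemma torsion_vec_cong:
  assumes "open U" "vfield U X" "vfield U Y" "\<And>q. q \<in> U \<Longrightarrow> X q = X' q" "\<And>q. q \<in> U \<Longrightarrow> Y q = Y' q" "p \<in> U"
  shows "torsion_vec A D X Y p = torsion_vec A D X' Y' p"
proof -
  have "lie X Y p = lie X' Y' p" by (rule lie_cong[OF assms(1,6)]) (rule assms(4,5); assumption)+
  then show ?thesis
    using D_local[OF assms(1,2,3,4,5,6)] D_local[OF assms(1,3,2,5,4,6)] unfolding torsion_vec_at[OF assms(1,6)] by simp
qed

lemma curvature_vec_cong:
  assumes U: "open U" and X: "vfield U X" and Y: "vfield U Y" and Z: "vfield U Z"
    and eq: "\<And>q. q \<in> U \<Longrightarrow> X q = X' q" "\<And>q. q \<in> U \<Longrightarrow> Y q = Y' q" "\<And>q. q \<in> U \<Longrightarrow> Z q = Z' q" and p: "p \<in> U"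
  shows "curvature_vec A D X Y Z p = curvature_vec A D X' Y' Z' p"
proof -
  have "D X (D Y Z) p = D X' (D Y' Z') p"
    by (rule D_local[OF U X D_vfield[OF U Y Z] eq(1) D_local[OF U Y Z eq(2,3)] p])
  moreover have "D Y (D X Z) p = D Y' (D X' Z') p"
    by (rule D_local[OF U Y D_vfield[OF U X Z] eq(2) D_local[OF U X Z eq(1,3)] p])
  moreover have "D (lie X Y) Z p = D (lie X' Y') Z' p"
    by (rule D_local[OF U vfield_lie[OF U X Y] Z lie_cong[OF U _ eq(1,2)] eq(3) p])
  ultimately show ?thesis unfolding curvature_vec_at[OF U p] by simp
qed

end

lemma fscale_apply: "fscale f X q = vscale (f q) (X q)" by (simp add: fscale_def)

locale acyt_connection = su3_manifold A g J \<Psi> + connection A D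
  for A :: "'m::t2_space chart set" and g J \<Psi> and D :: "'m connection" +
  assumes par_g: "parallel_metric A D g" and par_J: "parallel_endo A D J"
    and par_Re: "parallel3 A D (\<lambda>X Y Z p. Re (\<Psi> p (X p) (Y p) (Z p)))"
    and par_Im: "parallel3 A D (\<lambda>X Y Z p. Im (\<Psi> p (X p) (Y p) (Z p)))"
    and skew_T: "totally_skew A (torsion A g D)"
begin

abbreviation Tor :: "'m tensor3" where "Tor \<equiv> torsion A g D"
abbreviation Curv where "Curv \<equiv> curvature A g D"
abbreviation NT where "NT \<equiv> cov_deriv3 A D (torsion A g D)"

lemma Tor_skew:
  assumes "open W" "p \<in> W" "vfield W X" "vfield W Y" "vfield W Z"
  shows "Tor Y X Z p = - Tor X Y Z p" "Tor X Z Y p = - Tor X Y Z p"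
  using skew_T assms unfolding totally_skew_def by blast+

lemma Tor_smooth:
  assumes "open W" "vfield W X" "vfield W Y" "vfield W Z"
  shows "sfun W (Tor X Y Z)"
proof -
  have "vfield W (torsion_vec A D X Y)"
  proof (rule vfield_cong[OF assms(1)])
    show "vfield W (D X Y + (fscale (\<lambda>_. -1) (D Y X) + fscale (\<lambda>_. -1) (lie X Y)))"
      by (intro vfield_add vfield_fscale D_vfield vfield_lie sfun_const assms)
    show "(D X Y + (fscale (\<lambda>_. -1) (D Y X) + fscale (\<lambda>_. -1) (lie X Y))) q = torsion_vec A D X Y q" for q
      by (simp add: torsion_vec_def fscale_def vscale_def fun_eq_iff)
  qed
  then show ?thesis
    unfolding torsion_def[abs_def] by (rule g_smooth[OF assms(1) _ assms(4)])
qed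

lemma Tor_tensorial:
  assumes W: "open W" "p \<in> W" and X: "vfield W X" and Y: "vfield W Y"
  shows "tensorial W p (\<lambda>Z. Tor Z X Y p)" "tensorial W p (\<lambda>Z. Tor X Z Y p)" "tensorial W p (\<lambda>Z. Tor X Y Z p)"
proof -
  have 1: "tensorial W p (\<lambda>Z. Tor Z X Y p)" if X: "vfield W X" and Y: "vfield W Y" for X Y
  proof (rule tensorialI[OF _ _ _ W(1)])
    note YT = vfield_Tan[OF Y W(2)]
    show "Tor (Z + Z') X Y p = Tor Z X Y p + Tor Z' X Y p" if "vfield W Z" "vfield W Z'" for Z Z'
      unfolding torsion_def torsion_vec_add_left[OF W that(1) X that(2)]
      by (rule g_add_left[OF YT torsion_vec_Tan[OF W that(1) X] torsion_vec_Tan[OF W that(2) X]])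
    show "Tor (fscale f Z) X Y p = f p * Tor Z X Y p" if "sfun W f" "vfield W Z" for f Z
      unfolding torsion_def torsion_vec_fscale_left[OF W that(2) X that(1)]
      by (rule g_vscale_left[OF YT torsion_vec_Tan[OF W that(2) X]])
    show "Tor Z X Y p = Tor Z' X Y p" if "vfield W Z" "vfield W Z'" "\<And>q. q \<in> W \<Longrightarrow> Z q = Z' q" for Z Z'
      unfolding torsion_def using torsion_vec_cong[OF W(1) that(1) X that(3) refl W(2)] by simp
  qed
  show "tensorial W p (\<lambda>Z. Tor Z X Y p)" by (rule 1[OF X Y])
  note eq = tensorial_uminus[OF W(1)]
  have 2: "tensorial W p (\<lambda>Z. Tor X Z Y p)" if "vfield W X" "vfield W Y" for X Y
    by (rule eq[OF 1[OF that]]) (rule Tor_skew(1)[OF W _ that])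
  show "tensorial W p (\<lambda>Z. Tor X Z Y p)" by (rule 2[OF X Y])
  show "tensorial W p (\<lambda>Z. Tor X Y Z p)"
    by (rule eq[OF 2[OF X Y]]) (rule Tor_skew(2)[OF W X _ Y])
qed

lemma Curv_skew:
  assumes W: "open W" "p \<in> W" and v: "vfield W X" "vfield W Y" "vfield W Z" "vfield W V"
  shows "Curv Y X Z V p = - Curv X Y Z V p"
  unfolding curvature_def curvature_vec_skew[OF W v(1,2,3)]
  by (rule g_uminus_left[OF vfield_Tan[OF v(4) W(2)] curvature_vec_Tan[OF W v(1,2,3)]])

lemma Curv_tensorial:
  assumes W: "open W" "p \<in> W" and X: "vfield W X" and Y: "vfield W Y" and Z: "vfield W Z"
  shows "tensorial W p (\<lambda>V. Curv V X Y Z p)" "tensorial W p (\<lambda>V. Curv X V Y Z p)"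
    "tensorial W p (\<lambda>V. Curv X Y V Z p)" "tensorial W p (\<lambda>V. Curv X Y Z V p)"
proof -
  note ZT = vfield_Tan[OF Z W(2)]
  note c = curvature_vec_Tan[OF W]
  show 1: "tensorial W p (\<lambda>V. Curv V X Y Z p)"
  proof (rule tensorialI[OF _ _ _ W(1)])
    show "Curv (V + V') X Y Z p = Curv V X Y Z p + Curv V' X Y Z p" if "vfield W V" "vfield W V'" for V V'
      unfolding curvature_def curvature_vec_add_left[OF W that X Y]
      by (rule g_add_left[OF ZT c[OF that(1) X Y] c[OF that(2) X Y]])
    show "Curv (fscale f V) X Y Z p = f p * Curv V X Y Z p" if "sfun W f" "vfield W V" for f V
      unfolding curvature_def curvature_vec_fscale_left[OF W that(2) X Y that(1)]
      by (rule g_vscale_left[OF ZT c[OF that(2) X Y]])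
    show "Curv V X Y Z p = Curv V' X Y Z p" if "vfield W V" "vfield W V'" "\<And>q. q \<in> W \<Longrightarrow> V q = V' q" for V V'
      unfolding curvature_def using curvature_vec_cong[OF W(1) that(1) X Y that(3) refl refl W(2)] by simp
  qed
  show "tensorial W p (\<lambda>V. Curv X V Y Z p)"
    by (rule tensorial_uminus[OF W(1) 1]) (rule Curv_skew[OF W _ X Y Z])
  show "tensorial W p (\<lambda>V. Curv X Y V Z p)"
  proof (rule tensorialI[OF _ _ _ W(1)])
    show "Curv X Y (V + V') Z p = Curv X Y V Z p + Curv X Y V' Z p" if "vfield W V" "vfield W V'" for V V'
      unfolding curvature_def curvature_vec_add_right[OF W X Y that]
      by (rule g_add_left[OF ZT c[OF X Y that(1)] c[OF X Y that(2)]])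
    show "Curv X Y (fscale f V) Z p = f p * Curv X Y V Z p" if "sfun W f" "vfield W V" for f V
      unfolding curvature_def curvature_vec_fscale_right[OF W X Y that(2,1)]
      by (rule g_vscale_left[OF ZT c[OF X Y that(2)]])
    show "Curv X Y V Z p = Curv X Y V' Z p" if "vfield W V" "vfield W V'" "\<And>q. q \<in> W \<Longrightarrow> V q = V' q" for V V'
      unfolding curvature_def using curvature_vec_cong[OF W(1) X Y that(1) refl refl that(3) W(2)] by simp
  qed
  show "tensorial W p (\<lambda>V. Curv X Y Z V p)"
  proof (rule tensorialI[OF _ _ _ W(1)])
    note cT = c[OF X Y Z]
    show "Curv X Y Z (V + V') p = Curv X Y Z V p + Curv X Y Z V' p" if "vfield W V" "vfield W V'" for V V'
    proof -
      have e: "(V + V') p = V p + V' p" by simp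
      show ?thesis
        unfolding curvature_def e by (rule g_add_right[OF cT vfield_Tan[OF that(1) W(2)] vfield_Tan[OF that(2) W(2)]])
    qed
    show "Curv X Y Z (fscale f V) p = f p * Curv X Y Z V p" if "sfun W f" "vfield W V" for f V
      unfolding curvature_def fscale_def by (rule g_vscale_right[OF cT vfield_Tan[OF that(2) W(2)]])
    show "Curv X Y Z V p = Curv X Y Z V' p" if "vfield W V" "vfield W V'" "\<And>q. q \<in> W \<Longrightarrow> V q = V' q" for V V'
      unfolding curvature_def that(3)[OF W(2)] ..
  qed
qed

lemma NT_skew:
  assumes W: "open W" "p \<in> W" and X: "vfield W X" and v: "vfield W Y" "vfield W Z" "vfield W V"
  shows "NT X Z Y V p = - NT X Y Z V p" "NT X Y V Z p = - NT X Y Z V p"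
proof -
  have d: "vderiv A p (X p) f = - vderiv A p (X p) h" if "sfun W h" "\<And>q. q \<in> W \<Longrightarrow> f q = - h q" for f h
    using vderiv_cong[OF W that(2)] vderiv_uminus[OF W vfield_Tan[OF X W(2)] that(1)] by simp
  have D: "vfield W (D X Y)" if "vfield W Y" for Y by (rule D_vfield[OF W(1) X that])
  have 1: "vderiv A p (X p) (Tor Z Y V) = - vderiv A p (X p) (Tor Y Z V)"
    by (rule d[OF Tor_smooth[OF W(1) v]]) (rule Tor_skew(1)[OF W(1) _ v])
  have 2: "vderiv A p (X p) (Tor Y V Z) = - vderiv A p (X p) (Tor Y Z V)"
    by (rule d[OF Tor_smooth[OF W(1) v]]) (rule Tor_skew(2)[OF W(1) _ v])
  show "NT X Z Y V p = - NT X Y Z V p"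
    unfolding cov_deriv3_def 1 using Tor_skew(1)[OF W D[OF v(1)] v(2,3)] Tor_skew(1)[OF W v(1) D[OF v(2)] v(3)]
      Tor_skew(1)[OF W v(1,2) D[OF v(3)]] by simp
  show "NT X Y V Z p = - NT X Y Z V p"
    unfolding cov_deriv3_def 2 using Tor_skew(2)[OF W D[OF v(1)] v(2,3)] Tor_skew(2)[OF W v(1) D[OF v(2)] v(3)]
      Tor_skew(2)[OF W v(1,2) D[OF v(3)]] by simp
qed

text \<open>
  The derivative of \<open>f\<close> in \<open>X(T(f Y, Z, V))\<close> cancels against the one in \<open>T(\<nabla>\<^sub>X (f Y), Z, V)\<close>. With
  \<open>NT_skew\<close> this covers the three arguments of \<open>T\<close>.
\<close>
lemma NT_tensorial_2:
  assumes W: "open W" "p \<in> W" and X: "vfield W X" and Z: "vfield W Z" and V: "vfield W V"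
  shows "tensorial W p (\<lambda>Y. NT X Y Z V p)"
proof -
  note XT = vfield_Tan[OF X W(2)]
  note t = Tor_tensorial(1)[OF W]
  have D: "vfield W (D X Y)" if "vfield W Y" for Y by (rule D_vfield[OF W(1) X that])
  note t0 = t[OF Z V] and t1 = t[OF D[OF Z] V] and t2 = t[OF Z D[OF V]]
  show ?thesis
  proof (rule tensorialI[OF _ _ _ W(1)])
    fix Y Y' assume Y: "vfield W Y" and Y': "vfield W Y'"
    have v: "vderiv A p (X p) (Tor (Y + Y') Z V) = vderiv A p (X p) (Tor Y Z V) + vderiv A p (X p) (Tor Y' Z V)"
    proof -
      have "vderiv A p (X p) (Tor (Y + Y') Z V) = vderiv A p (X p) (\<lambda>q. Tor Y Z V q + Tor Y' Z V q)"
        by (rule vderiv_cong[OF W]) (rule tensorial_add[OF Tor_tensorial(1)[OF W(1) _ Z V] Y Y'])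
      then show ?thesis
        by (simp add: vderiv_add[OF W XT Tor_smooth[OF W(1) Y Z V] Tor_smooth[OF W(1) Y' Z V]])
    qed
    have "Tor (D X (Y + Y')) Z V p = Tor (D X Y + D X Y') Z V p"
    proof (rule tensorial_cong[OF t0 D[OF vfield_add[OF W(1) Y Y']]])
      show "D X (Y + Y') q = (D X Y + D X Y') q" if "q \<in> W" for q
        using D_add_right[OF W(1) that X Y Y'] by simp
    qed
    then show "NT X (Y + Y') Z V p = NT X Y Z V p + NT X Y' Z V p"
      unfolding cov_deriv3_def v tensorial_add[OF t1 Y Y'] tensorial_add[OF t2 Y Y'] tensorial_add[OF t0 D[OF Y] D[OF Y']]
      by simp
  next
    fix f Y assume f: "sfun W f" and Y: "vfield W Y"
    let ?Xf = "\<lambda>q. vderiv A q (X q) f"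
    have Xf: "sfun W ?Xf" by (rule sfun_vderiv[OF W(1) X f])
    have v: "vderiv A p (X p) (Tor (fscale f Y) Z V) = ?Xf p * Tor Y Z V p + f p * vderiv A p (X p) (Tor Y Z V)"
    proof -
      have "vderiv A p (X p) (Tor (fscale f Y) Z V) = vderiv A p (X p) (\<lambda>q. f q * Tor Y Z V q)"
        by (rule vderiv_cong[OF W]) (rule tensorial_fscale[OF Tor_tensorial(1)[OF W(1) _ Z V] f Y])
      then show ?thesis
        by (simp add: vderiv_mult[OF W XT f Tor_smooth[OF W(1) Y Z V]])
    qed
    have "Tor (D X (fscale f Y)) Z V p = Tor (fscale ?Xf Y + fscale f (D X Y)) Z V p"
    proof (rule tensorial_cong[OF t0 D[OF vfield_fscale[OF W(1) f Y]]])
      show "D X (fscale f Y) q = (fscale ?Xf Y + fscale f (D X Y)) q" if "q \<in> W" for q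
        unfolding D_fscale_right[OF W(1) that X Y f] by (simp add: fscale_apply)
    qed
    then show "NT X (fscale f Y) Z V p = f p * NT X Y Z V p"
      unfolding cov_deriv3_def v tensorial_fscale[OF t1 f Y] tensorial_fscale[OF t2 f Y]
        tensorial_add[OF t0 vfield_fscale[OF W(1) Xf Y] vfield_fscale[OF W(1) f D[OF Y]]]
        tensorial_fscale[OF t0 Xf Y] tensorial_fscale[OF t0 f D[OF Y]]
      by (simp add: algebra_simps)
  next
    fix Y Y' assume Y: "vfield W Y" and Y': "vfield W Y'" and eq: "\<And>q. q \<in> W \<Longrightarrow> Y q = Y' q"
    have "vderiv A p (X p) (Tor Y Z V) = vderiv A p (X p) (Tor Y' Z V)"
      by (rule vderiv_cong[OF W]) (rule tensorial_cong[OF Tor_tensorial(1)[OF W(1) _ Z V] Y eq])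
    moreover have "Tor (D X Y) Z V p = Tor (D X Y') Z V p"
      by (rule tensorial_cong[OF t0 D[OF Y]]) (rule D_local[OF W(1) X Y refl eq])
    ultimately show "NT X Y Z V p = NT X Y' Z V p"
      unfolding cov_deriv3_def using tensorial_cong[OF t1 Y eq] tensorial_cong[OF t2 Y eq] by simp
  qed
qed

lemma NT_tensorial_1:
  assumes W: "open W" "p \<in> W" and Y: "vfield W Y" and Z: "vfield W Z" and V: "vfield W V"
  shows "tensorial W p (\<lambda>X. NT X Y Z V p)"
proof (rule tensorialI[OF _ _ _ W(1)])
  note t = Tor_tensorial[OF W]
  note sm = Tor_smooth[OF W(1) Y Z V]
  fix X assume X: "vfield W X"
  note DX = D_vfield[OF W(1) X]
  fix X' assume X': "vfield W X'"
  note DX' = D_vfield[OF W(1) X']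
  have d: "D (X + X') Y q = (D X Y + D X' Y) q" if "q \<in> W" "vfield W Y" for q Y
    using D_add_left[OF W(1) that(1) X that(2) X'] by simp
  note DXX = D_vfield[OF W(1) vfield_add[OF W(1) X X']]
  have e: "vderiv A p ((X + X') p) (Tor Y Z V) = vderiv A p (X p) (Tor Y Z V) + vderiv A p (X' p) (Tor Y Z V)"
    using vderiv_add_vec[OF W vfield_Tan[OF X W(2)] sm vfield_Tan[OF X' W(2)]] by simp
  have "Tor (D (X + X') Y) Z V p = Tor (D X Y + D X' Y) Z V p"
    by (rule tensorial_cong[OF t(1)[OF Z V] DXX[OF Y] d[OF _ Y]])
  moreover have "Tor Y (D (X + X') Z) V p = Tor Y (D X Z + D X' Z) V p"
    by (rule tensorial_cong[OF t(2)[OF Y V] DXX[OF Z] d[OF _ Z]])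
  moreover have "Tor Y Z (D (X + X') V) p = Tor Y Z (D X V + D X' V) p"
    by (rule tensorial_cong[OF t(3)[OF Y Z] DXX[OF V] d[OF _ V]])
  ultimately show "NT (X + X') Y Z V p = NT X Y Z V p + NT X' Y Z V p"
    unfolding cov_deriv3_def e tensorial_add[OF t(1)[OF Z V] DX[OF Y] DX'[OF Y]]
      tensorial_add[OF t(2)[OF Y V] DX[OF Z] DX'[OF Z]] tensorial_add[OF t(3)[OF Y Z] DX[OF V] DX'[OF V]]
    by simp
next
  note t = Tor_tensorial[OF W]
  note sm = Tor_smooth[OF W(1) Y Z V]
  fix f X assume f: "sfun W f" and X: "vfield W X"
  note DX = D_vfield[OF W(1) X]
  have d: "D (fscale f X) Y q = fscale f (D X Y) q" if "q \<in> W" "vfield W Y" for q Y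
    using D_fscale_left[OF W(1) that(1) X that(2) f] by (simp add: fscale_def)
  note DfX = D_vfield[OF W(1) vfield_fscale[OF W(1) f X]]
  have "Tor (D (fscale f X) Y) Z V p = f p * Tor (D X Y) Z V p"
    using tensorial_cong[OF t(1)[OF Z V] DfX[OF Y] d[OF _ Y]] tensorial_fscale[OF t(1)[OF Z V] f DX[OF Y]] by simp
  moreover have "Tor Y (D (fscale f X) Z) V p = f p * Tor Y (D X Z) V p"
    using tensorial_cong[OF t(2)[OF Y V] DfX[OF Z] d[OF _ Z]] tensorial_fscale[OF t(2)[OF Y V] f DX[OF Z]] by simp
  moreover have "Tor Y Z (D (fscale f X) V) p = f p * Tor Y Z (D X V) p"
    using tensorial_cong[OF t(3)[OF Y Z] DfX[OF V] d[OF _ V]] tensorial_fscale[OF t(3)[OF Y Z] f DX[OF V]] by simp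
  ultimately show "NT (fscale f X) Y Z V p = f p * NT X Y Z V p"
    unfolding cov_deriv3_def fscale_apply
    using vderiv_vscale_vec[OF W vfield_Tan[OF X W(2)] sm] by (simp add: algebra_simps)
next
  note t = Tor_tensorial[OF W]
  fix X X' assume X: "vfield W X" and X': "vfield W X'" and eq: "\<And>q. q \<in> W \<Longrightarrow> X q = X' q"
  have d: "D X Y q = D X' Y q" if "q \<in> W" "vfield W Y" for q Y
    by (rule D_local[OF W(1) X that(2) eq refl that(1)])
  note DX = D_vfield[OF W(1) X]
  show "NT X Y Z V p = NT X' Y Z V p"
    unfolding cov_deriv3_def eq[OF W(2)]
    using tensorial_cong[OF t(1)[OF Z V] DX[OF Y] d[OF _ Y]] tensorial_cong[OF t(2)[OF Y V] DX[OF Z] d[OF _ Z]]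
      tensorial_cong[OF t(3)[OF Y Z] DX[OF V] d[OF _ V]] by simp
qed

end

section \<open>The torsion connection in a local unitary frame\<close>

text \<open>
  A unitary frame on a coordinate domain, in which \<open>\<Psi>\<close> has its standard form. As the frame is
  orthonormal, the coframe of the \<open>SU(3)\<close>-structure is given by the metric products with its
  vectors.
\<close>
locale framed = acyt_connection A g J \<Psi> D
  for A :: "'m::t2_space chart set" and g J \<Psi> and D :: "'m connection" +
  fixes U :: "'m set" and c :: "'m chart" and E :: "idx \<Rightarrow> 'm vfield"
  assumes U: "open U" and c: "c \<in> A" "U \<subseteq> dom c" and E: "vfield U (E i)"
    and unitary: "q \<in> U \<Longrightarrow> unitary_at q (\<lambda>i. E i q)"
    and psi: "q \<in> U \<Longrightarrow> \<exists>e. \<forall>u\<in>Tan q. \<forall>v\<in>Tan q. \<forall>w\<in>Tan q. (\<forall>i. e (num i) u = g q u (E i q)) \<and> \<Psi> q u v w =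
             - wedge3 (\<lambda>x. Complex (e 0 x) (e (1::nat) x)) (\<lambda>x. Complex (e 2 x) (e 3 x))
                 (\<lambda>x. Complex (e 4 x) (e 5 x)) u v w"
begin

lemma E_Tan: "q \<in> U \<Longrightarrow> E i q \<in> Tan q"
  and E_orth: "q \<in> U \<Longrightarrow> g q (E i q) (E j q) = (if i = j then 1 else 0)"
  and J_Inl: "q \<in> U \<Longrightarrow> J q (E (Inl a) q) = E (Inr a) q"
  and E_expand: "q \<in> U \<Longrightarrow> v \<in> Tan q \<Longrightarrow> v = (\<Sum>i\<in>UNIV. vscale (g q v (E i q)) (E i q))"
  using unitary unfolding unitary_at_def by blast+

lemma J_Inr: "q \<in> U \<Longrightarrow> J q (E (Inr a) q) = - E (Inl a) q"
  by (rule unitary_at_Inr[OF unitary])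

lemma EW: "W \<subseteq> U \<Longrightarrow> vfield W (E i)" by (rule vfield_subset[OF E])

lemma tensorial_expand:
  assumes W: "open W" "p \<in> W" "W \<subseteq> U" and t: "tensorial W p \<Phi>" and X: "vfield W X"
  shows "\<Phi> X = (\<Sum>i\<in>UNIV. g p (X p) (E i p) * \<Phi> (E i))"
proof -
  let ?f = "\<lambda>i q. g q (X q) (E i q)"
  have f: "sfun W (?f i)" for i by (rule g_smooth[OF W(1) X EW[OF W(3)]])
  have fE: "vfield W (fscale (?f i) (E i))" for i by (rule vfield_fscale[OF W(1) f EW[OF W(3)]])
  have "\<Phi> X = \<Phi> (\<Sum>i\<in>UNIV. fscale (?f i) (E i))"
  proof (rule tensorial_cong[OF t X])
    fix q assume q: "q \<in> W"
    show "X q = (\<Sum>i\<in>UNIV. fscale (?f i) (E i)) q"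
      unfolding sum_fun_apply[of "\<lambda>i. fscale (?f i) (E i)" UNIV q] fscale_apply
      using E_expand[OF subsetD[OF W(3) q] vfield_Tan[OF X q]] .
  qed
  also have "\<dots> = (\<Sum>i\<in>UNIV. \<Phi> (fscale (?f i) (E i)))"
    by (rule tensorial_sum[OF W(1) t finite fE])
  also have "\<dots> = (\<Sum>i\<in>UNIV. ?f i p * \<Phi> (E i))"
    by (rule sum.cong[OF refl]) (rule tensorial_fscale[OF t f EW[OF W(3)]])
  finally show ?thesis .
qed

definition dd :: "idx \<Rightarrow> ('m \<Rightarrow> real) \<Rightarrow> 'm \<Rightarrow> real" where "dd i f q = vderiv A q (E i q) f"
definition \<Gamma> :: "idx \<Rightarrow> idx \<Rightarrow> idx \<Rightarrow> 'm \<Rightarrow> real" where "\<Gamma> i j k q = g q (D (E i) (E j) q) (E k q)"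
definition \<beta> :: "idx \<Rightarrow> idx \<Rightarrow> idx \<Rightarrow> 'm \<Rightarrow> real" where "\<beta> i j k q = g q (lie (E i) (E j) q) (E k q)"
definition C :: "('m \<Rightarrow> real) set" where "C = {f. sfun U f}"

lemma \<Gamma>_smooth: "sfun U (\<Gamma> i j k)" unfolding \<Gamma>_def[abs_def] by (intro g_smooth D_vfield U E)
lemma \<beta>_smooth: "sfun U (\<beta> i j k)" unfolding \<beta>_def[abs_def] by (intro g_smooth vfield_lie U E)

lemma D_E: "q \<in> U \<Longrightarrow> D (E i) (E j) q = (\<Sum>m\<in>UNIV. vscale (\<Gamma> i j m q) (E m q))"
  unfolding \<Gamma>_def by (rule E_expand[OF _ D_Tan[OF U _ E E]])

lemma lie_E: "q \<in> U \<Longrightarrow> lie (E i) (E j) q = (\<Sum>m\<in>UNIV. vscale (\<beta> i j m q) (E m q))"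
  unfolding \<beta>_def by (rule E_expand[OF _ vfield_Tan[OF vfield_lie[OF U E E]]])

lemma g_sum_E:
  assumes q: "q \<in> U" shows "g q (\<Sum>m\<in>UNIV. vscale (a m) (E m q)) (E l q) = a l"
proof -
  have "g q (\<Sum>m\<in>UNIV. vscale (a m) (E m q)) (E l q) = (\<Sum>m\<in>UNIV. a m * g q (E m q) (E l q))"
    by (subst g_sum_left[OF finite E_Tan[OF q] Tan_vscale[OF E_Tan[OF q]]])
      (simp only: g_vscale_left[OF E_Tan[OF q] E_Tan[OF q]])
  also have "\<dots> = (\<Sum>m\<in>UNIV. if m = l then a m else 0)"
    by (rule sum.cong[OF refl]) (simp add: E_orth[OF q])
  finally show ?thesis by simp
qed

lemma frame_derivations: "derivations U C dd"
proof
  fix f h :: "'m \<Rightarrow> real" and q i and k :: real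
  show "(\<lambda>_. k) \<in> C" by (simp add: C_def sfun_const)
  show "(\<lambda>q. f q + h q) \<in> C" "(\<lambda>q. f q * h q) \<in> C" if "f \<in> C" "h \<in> C"
    using that by (simp_all add: C_def sfun_add sfun_mult U)
  show "dd i f \<in> C" if "f \<in> C"
    using that sfun_vderiv[OF U E] by (simp add: C_def dd_def[abs_def])
  assume q: "q \<in> U"
  show "dd i (\<lambda>_. k) q = 0" unfolding dd_def by (rule vderiv_const[OF U q E_Tan[OF q]])
  show "dd i (\<lambda>q. f q + h q) q = dd i f q + dd i h q" "dd i (\<lambda>q. f q * h q) q = dd i f q * h q + f q * dd i h q"
    if "f \<in> C" "h \<in> C"
    using that unfolding dd_def C_def
    by (simp_all add: vderiv_add[OF U q E_Tan[OF q]] vderiv_mult[OF U q E_Tan[OF q]])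
  show "dd i f q = dd i h q" if "\<And>q. q \<in> U \<Longrightarrow> f q = h q"
    unfolding dd_def by (rule vderiv_cong[OF U q that])
qed

sublocale derivations U C dd by (rule frame_derivations)

text \<open>
  The frame is linearly independent in the sense of the locale because the coordinate functions of
  the chart separate tangent vectors.
\<close>
lemma frame_calc: "frame_calculus U C dd \<Gamma> \<beta>"
proof (intro frame_calculus.intro frame_derivations frame_calculus_axioms.intro)
  show "\<Gamma> i j k \<in> C" "\<beta> i j k \<in> C" for i j k by (simp_all add: C_def \<Gamma>_smooth \<beta>_smooth)
next
  fix f q i j assume f: "f \<in> C" and q: "q \<in> U"
  have f': "sfun U f" using f by (simp add: C_def)
  have "dd i (dd j f) q - dd j (dd i f) q = vderiv A q (lie (E i) (E j) q) f"
    unfolding dd_def[abs_def] by (rule lie_commutator[OF U q E E f'])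
  also have "\<dots> = (\<Sum>k\<in>UNIV. \<beta> i j k q * dd k f q)"
    unfolding lie_E[OF q] dd_def by (rule vderiv_sum_vec[OF U q f' finite E_Tan[OF q]])
  finally show "dd i (dd j f) q - dd j (dd i f) q = (\<Sum>k\<in>UNIV. \<beta> i j k q * dd k f q)" .
next
  fix q and a :: "idx \<Rightarrow> real" and k assume q: "q \<in> U" and a: "\<And>f. f \<in> C \<Longrightarrow> (\<Sum>k\<in>UNIV. a k * dd k f q) = 0"
  let ?v = "\<Sum>k\<in>UNIV. vscale (a k) (E k q)"
  have v: "?v \<in> Tan q" by (intro Tan_sum Tan_vscale E_Tan q) auto
  have qc: "q \<in> dom c" using q c by blast
  have 0: "vderiv A q ?v f = 0" if "sfun U f" for f
    using a[of f] that vderiv_sum_vec[OF U q that finite E_Tan[OF q], of a] by (simp add: dd_def C_def)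
  have "?v c $ n = 0" for n
    using vderiv_coord[OF c(1) qc v, of n] 0[OF sfun_coord[OF U c]] by simp
  then have "?v c = (0 :: 'm tvec) c" by (simp add: vec_eq_iff)
  then have "?v = 0" by (rule Tan_eqI[OF v Tan_0 c(1) qc])
  then have "g q ?v (E k q) = 0" by (simp only: g_zero_left[OF E_Tan[OF q]])
  then show "a k = 0" unfolding g_sum_E[OF q] .
qed

lemma vderiv_g:
  assumes q: "q \<in> U" and X: "vfield U X" and Y: "vfield U Y" and Z: "vfield U Z"
  shows "vderiv A q (X q) (\<lambda>p. g p (Y p) (Z p)) = g q (D X Y q) (Z q) + g q (Y q) (D X Z q)"
  using par_g X Y Z U q unfolding parallel_metric_def by force

lemma \<Gamma>_skew:
  assumes q: "q \<in> U" shows "\<Gamma> i j k q = - \<Gamma> i k j q"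
proof -
  have "vderiv A q (E i q) (\<lambda>p. g p (E j p) (E k p)) = vderiv A q (E i q) (\<lambda>p. if j = k then 1 else 0)"
    by (rule vderiv_cong[OF U q]) (rule E_orth)
  also have "\<dots> = 0" by (rule vderiv_const[OF U q E_Tan[OF q]])
  finally have "\<Gamma> i j k q + g q (E j q) (D (E i) (E k) q) = 0"
    unfolding vderiv_g[OF q E E E] \<Gamma>_def .
  then show ?thesis
    unfolding \<Gamma>_def using g_sym[OF E_Tan[OF q] D_Tan[OF U q E E]] by simp
qed

lemma D_J:
  assumes q: "q \<in> U" shows "D (E i) (E (Inr b)) q = J q (D (E i) (E (Inl b)) q)"
proof -
  have "D (E i) (app_endo J (E (Inl b))) q - J q (D (E i) (E (Inl b)) q) = (\<lambda>c. 0)"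
    using par_J E U q unfolding parallel_endo_def by blast
  then have "D (E i) (app_endo J (E (Inl b))) q = J q (D (E i) (E (Inl b)) q)"
    by (simp add: fun_eq_iff)
  moreover have "D (E i) (app_endo J (E (Inl b))) q = D (E i) (E (Inr b)) q"
    by (rule D_cong[OF U E E refl _ q]) (simp add: app_endo_def J_Inl)
  ultimately show ?thesis by simp
qed

text \<open>From \<open>\<nabla>J = 0\<close>: the connection matrices are complex linear.\<close>
lemma \<Gamma>_J:
  assumes q: "q \<in> U"
  shows "\<Gamma> i (Inr b) (Inr a) q = \<Gamma> i (Inl b) (Inl a) q" "\<Gamma> i (Inr b) (Inl a) q = - \<Gamma> i (Inl b) (Inr a) q"
proof -
  have T: "D (E i) (E (Inl b)) q \<in> Tan q" by (rule D_Tan[OF U q E E])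
  show "\<Gamma> i (Inr b) (Inr a) q = \<Gamma> i (Inl b) (Inl a) q"
    unfolding \<Gamma>_def D_J[OF q] J_Inl[OF q, symmetric] by (rule g_J[OF T E_Tan[OF q]])
  show "\<Gamma> i (Inr b) (Inl a) q = - \<Gamma> i (Inl b) (Inr a) q"
    unfolding \<Gamma>_def D_J[OF q] J_Inl[OF q, symmetric] by (rule g_J_skew[OF T E_Tan[OF q]])
qed

text \<open>
  The imaginary part of \<open>\<Psi>\<close> is parallel and vanishes on \<open>(E\<^sub>1, E\<^sub>2, E\<^sub>3)\<close>; the derivative of this value
  is, up to sign, the trace of the connection matrix against \<open>J\<close>.
\<close>
lemma \<Gamma>_tr:
  assumes q: "q \<in> U" shows "(\<Sum>b\<in>UNIV. \<Gamma> i (Inl b) (Inr b) q) = 0"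
proof -
  let ?P = "\<lambda>X Y Z p. Im (\<Psi> p (X p) (Y p) (Z p))"
  have val: "\<Psi> p u v w = - wedge3 (\<lambda>x. Complex (g p x (E (Inl I1) p)) (g p x (E (Inr I1) p)))
      (\<lambda>x. Complex (g p x (E (Inl I2) p)) (g p x (E (Inr I2) p)))
      (\<lambda>x. Complex (g p x (E (Inl I3) p)) (g p x (E (Inr I3) p))) u v w"
    if p: "p \<in> U" and T: "u \<in> Tan p" "v \<in> Tan p" "w \<in> Tan p" for p u v w
  proof -
    obtain e where e: "\<And>u v w. u \<in> Tan p \<Longrightarrow> v \<in> Tan p \<Longrightarrow> w \<in> Tan p \<Longrightarrow> (\<forall>i. e (num i) u = g p u (E i p)) \<and> \<Psi> p u v w =
             - wedge3 (\<lambda>x. Complex (e 0 x) (e (1::nat) x)) (\<lambda>x. Complex (e 2 x) (e 3 x))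
                 (\<lambda>x. Complex (e 4 x) (e 5 x)) u v w"
      using psi[OF p] by blast
    have e': "e 0 x = g p x (E (Inl I1) p)" "e 1 x = g p x (E (Inr I1) p)" "e 2 x = g p x (E (Inl I2) p)"
      "e 3 x = g p x (E (Inr I2) p)" "e 4 x = g p x (E (Inl I3) p)" "e 5 x = g p x (E (Inr I3) p)" if "x \<in> Tan p" for x
      using e[OF that that that, THEN conjunct1, THEN spec, of "Inl I1"] e[OF that that that, THEN conjunct1, THEN spec, of "Inr I1"]
       e[OF that that that, THEN conjunct1, THEN spec, of "Inl I2"] e[OF that that that, THEN conjunct1, THEN spec, of "Inr I2"]
       e[OF that that that, THEN conjunct1, THEN spec, of "Inl I3"] e[OF that that that, THEN conjunct1, THEN spec, of "Inr I3"]
      by simp_all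
    show ?thesis
      using e[OF T, THEN conjunct2] unfolding wedge3_def wedge2_def by (simp only: e'[OF T(1)] e'[OF T(2)] e'[OF T(3)])
  qed
  note T = D_Tan[OF U q E E]
  have "vderiv A q (E i q) (?P (E (Inl I1)) (E (Inl I2)) (E (Inl I3))) = vderiv A q (E i q) (\<lambda>_. 0)"
    by (rule vderiv_cong[OF U q]) (simp add: val E_Tan E_orth wedge3_def wedge2_def)
  then have "vderiv A q (E i q) (?P (E (Inl I1)) (E (Inl I2)) (E (Inl I3))) = 0"
    by (simp add: vderiv_const[OF U q E_Tan[OF q]])
  moreover have "cov_deriv3 A D ?P (E i) (E (Inl I1)) (E (Inl I2)) (E (Inl I3)) q = 0"
    using par_Im E U q unfolding parallel3_def by blast
  ultimately have "?P (D (E i) (E (Inl I1))) (E (Inl I2)) (E (Inl I3)) q + ?P (E (Inl I1)) (D (E i) (E (Inl I2))) (E (Inl I3)) q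
      + ?P (E (Inl I1)) (E (Inl I2)) (D (E i) (E (Inl I3))) q = 0"
    unfolding cov_deriv3_def by linarith
  then show ?thesis
    by (simp add: val T E_Tan[OF q] q E_orth wedge3_def wedge2_def sum_i3 \<Gamma>_def)
qed

lemma tor_eq: "q \<in> U \<Longrightarrow> Tor (E i) (E j) (E k) q = tor \<Gamma> \<beta> i j k q"
  unfolding torsion_def torsion_vec_at[OF U] tor_def \<Gamma>_def \<beta>_def
  by (simp add: g_diff_left Tan_diff E_Tan D_Tan[OF U _ E E] vfield_Tan[OF vfield_lie[OF U E E]])

lemma NT_eq:
  assumes q: "q \<in> U" shows "NT (E i) (E j) (E k) (E l) q = nabla_tor dd \<Gamma> \<beta> i j k l q"
proof -
  have d: "vderiv A q (E i q) (Tor (E j) (E k) (E l)) = dd i (tor \<Gamma> \<beta> j k l) q"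
    unfolding dd_def by (rule vderiv_cong[OF U q]) (rule tor_eq)
  note e = tensorial_expand[OF U q subset_refl]
  note t = Tor_tensorial[OF U q E E]
  have DE: "vfield U (D (E i) (E j))" for i j by (rule D_vfield[OF U E E])
  have 1: "Tor (D (E i) (E j)) (E k) (E l) q = (\<Sum>m\<in>UNIV. \<Gamma> i j m q * tor \<Gamma> \<beta> m k l q)"
    using e[OF t(1) DE] by (simp add: \<Gamma>_def tor_eq[OF q])
  have 2: "Tor (E j) (D (E i) (E k)) (E l) q = (\<Sum>m\<in>UNIV. \<Gamma> i k m q * tor \<Gamma> \<beta> j m l q)"
    using e[OF t(2) DE] by (simp add: \<Gamma>_def tor_eq[OF q])
  have 3: "Tor (E j) (E k) (D (E i) (E l)) q = (\<Sum>m\<in>UNIV. \<Gamma> i l m q * tor \<Gamma> \<beta> j k m q)"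
    using e[OF t(3) DE] by (simp add: \<Gamma>_def tor_eq[OF q])
  have 4: "(\<Sum>m\<in>UNIV. \<Gamma> i m l q * tor \<Gamma> \<beta> j k m q) = - (\<Sum>m\<in>UNIV. \<Gamma> i l m q * tor \<Gamma> \<beta> j k m q)"
    unfolding sum_negf[symmetric] by (rule sum.cong[OF refl]) (simp add: \<Gamma>_skew[OF q, of i _ l])
  show ?thesis
    unfolding cov_deriv3_def nabla_tor_def sum_subtractf sum.distrib d 1 2 3 4 by simp
qed

lemma DD_E:
  assumes q: "q \<in> U"
  shows "g q (D (E i) (D (E j) (E k)) q) (E l q) = dd i (\<Gamma> j k l) q + (\<Sum>m\<in>UNIV. \<Gamma> j k m q * \<Gamma> i m l q)"
proof -
  have fE: "vfield U (fscale (\<Gamma> j k m) (E m))" for m by (rule vfield_fscale[OF U \<Gamma>_smooth E])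
  have s: "D (E i) (\<Sum>m\<in>I. fscale (\<Gamma> j k m) (E m)) q = (\<Sum>m\<in>I. D (E i) (fscale (\<Gamma> j k m) (E m)) q)" if "finite I" for I
    using that
  proof (induction I rule: finite_induct)
    case empty
    have "D (E i) (fscale (\<lambda>_. 0) (E i)) q = vscale 0 (E i q) + vscale 0 (D (E i) (E i) q)"
      using D_fscale_right[OF U q E E sfun_const, of i 0 i] vderiv_const[OF U q E_Tan[OF q], of i 0] by simp
    moreover have "fscale (\<lambda>_. 0) (E i) = 0" by (simp add: fscale_def vscale_def fun_eq_iff)
    ultimately have "D (E i) 0 q = 0" by (simp add: vscale_def fun_eq_iff)
    then show ?case by (simp only: sum.empty)
  next
    case (insert x F)
    show ?case unfolding sum.insert[OF insert(1,2)] D_add_right[OF U q E fE vfield_sum[OF insert(1) U fE]] insert.IH ..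
  qed
  have "D (E i) (D (E j) (E k)) q = D (E i) (\<Sum>m\<in>UNIV. fscale (\<Gamma> j k m) (E m)) q"
  proof (rule D_local[OF U E D_vfield[OF U E E] refl _ q])
    fix r assume "r \<in> U"
    then show "D (E j) (E k) r = (\<Sum>m\<in>UNIV. fscale (\<Gamma> j k m) (E m)) r"
      unfolding sum_fun_apply[of "\<lambda>m. fscale (\<Gamma> j k m) (E m)" UNIV r] fscale_apply by (rule D_E)
  qed
  also have "\<dots> = (\<Sum>m\<in>UNIV. vscale (dd i (\<Gamma> j k m) q) (E m q) + vscale (\<Gamma> j k m q) (D (E i) (E m) q))"
    unfolding s[OF finite] D_fscale_right[OF U q E E \<Gamma>_smooth] dd_def ..
  also have "\<dots> = (\<Sum>m\<in>UNIV. vscale (dd i (\<Gamma> j k m) q) (E m q)) + (\<Sum>m\<in>UNIV. vscale (\<Gamma> j k m q) (D (E i) (E m) q))"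
    by (rule sum.distrib)
  finally have "g q (D (E i) (D (E j) (E k)) q) (E l q) = g q (\<Sum>m\<in>UNIV. vscale (dd i (\<Gamma> j k m) q) (E m q)) (E l q)
      + g q (\<Sum>m\<in>UNIV. vscale (\<Gamma> j k m q) (D (E i) (E m) q)) (E l q)"
    by (simp only: g_add_left[OF E_Tan[OF q] Tan_sum[OF finite Tan_vscale[OF E_Tan[OF q]]] Tan_sum[OF finite Tan_vscale[OF D_Tan[OF U q E E]]]])
  also have "g q (\<Sum>m\<in>UNIV. vscale (\<Gamma> j k m q) (D (E i) (E m) q)) (E l q) = (\<Sum>m\<in>UNIV. \<Gamma> j k m q * \<Gamma> i m l q)"
    by (subst g_sum_left[OF finite E_Tan[OF q] Tan_vscale[OF D_Tan[OF U q E E]]])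
      (simp only: g_vscale_left[OF E_Tan[OF q] D_Tan[OF U q E E]] \<Gamma>_def)
  finally show ?thesis by (simp add: g_sum_E[OF q])
qed

text \<open>
  In the term with the bracket, \<open>\<nabla>\<close> is tensorial in its first argument and can be expanded in the
  frame.
\<close>
lemma curv_eq:
  assumes q: "q \<in> U" shows "Curv (E i) (E j) (E k) (E l) q = curv dd \<Gamma> \<beta> i j k l q"
proof -
  have L: "tensorial U q (\<lambda>X. g q (D X (E k) q) (E l q))"
  proof (rule tensorialI[OF _ _ _ U])
    show "g q (D (X + Y) (E k) q) (E l q) = g q (D X (E k) q) (E l q) + g q (D Y (E k) q) (E l q)" if "vfield U X" "vfield U Y" for X Y
      unfolding D_add_left[OF U q that(1) E that(2)] by (rule g_add_left[OF E_Tan[OF q] D_Tan[OF U q that(1) E] D_Tan[OF U q that(2) E]])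
    show "g q (D (fscale f X) (E k) q) (E l q) = f q * g q (D X (E k) q) (E l q)" if "sfun U f" "vfield U X" for f X
      unfolding D_fscale_left[OF U q that(2) E that(1)] by (rule g_vscale_left[OF E_Tan[OF q] D_Tan[OF U q that(2) E]])
    show "g q (D X (E k) q) (E l q) = g q (D Y (E k) q) (E l q)" if "vfield U X" "vfield U Y" "\<And>q. q \<in> U \<Longrightarrow> X q = Y q" for X Y
      using D_local[OF U that(1) E that(3) refl q] by simp
  qed
  have "g q (D (lie (E i) (E j)) (E k) q) (E l q) = (\<Sum>m\<in>UNIV. \<beta> i j m q * \<Gamma> m k l q)"
    using tensorial_expand[OF U q subset_refl L vfield_lie[OF U E E]] by (simp add: \<beta>_def \<Gamma>_def)
  moreover have DD: "D (E i) (D (E j) (E k)) q \<in> Tan q" for i j by (rule D_Tan[OF U q E D_vfield[OF U E E]])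
  moreover have "D (lie (E i) (E j)) (E k) q \<in> Tan q" by (rule D_Tan[OF U q vfield_lie[OF U E E] E])
  ultimately show ?thesis
    unfolding curvature_def curvature_vec_at[OF U q] curv_def
    by (simp add: g_diff_left[OF E_Tan[OF q]] Tan_diff DD_E[OF q] sum_subtractf)
qed

lemma real_frame:
  assumes tr: "\<And>q k. q \<in> U \<Longrightarrow> (\<Sum>a\<in>UNIV. Tor (E (Inl a)) (E (Inr a)) (E k) q) = 0"
  shows "real_su3_frame U C dd \<Gamma> \<beta>"
proof (intro real_su3_frame.intro frame_calc real_su3_frame_axioms.intro)
  fix q assume q: "q \<in> U"
  show "tor \<Gamma> \<beta> i j k q = - tor \<Gamma> \<beta> i k j q" for i j k
    unfolding tor_eq[OF q, symmetric] by (rule Tor_skew(2)[OF U q E E E])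
  show "(\<Sum>a\<in>UNIV. tor \<Gamma> \<beta> (Inl a) (Inr a) k q) = 0" for k
    using tr[OF q] by (simp add: tor_eq[OF q])
qed (rule \<Gamma>_skew \<Gamma>_J \<Gamma>_tr; assumption)+

lemma app_J_Inl: "q \<in> U \<Longrightarrow> app_endo J (E (Inl a)) q = E (Inr a) q"
  by (simp add: app_endo_def J_Inl)

lemma app_J_Inr: "q \<in> U \<Longrightarrow> app_endo J (E (Inr a)) q = fscale (\<lambda>_. -1) (E (Inl a)) q"
  by (simp add: app_endo_def J_Inr fscale_apply uminus_vscale)

lemma tensorial_J:
  assumes W: "open W" "p \<in> W" "W \<subseteq> U" and t: "tensorial W p \<Phi>"
  shows "\<Phi> (app_endo J (E (Inl a))) = \<Phi> (E (Inr a))" "\<Phi> (app_endo J (E (Inr a))) = - \<Phi> (E (Inl a))"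
proof -
  note JE = J_smooth[OF W(1) EW[OF W(3)]]
  show "\<Phi> (app_endo J (E (Inl a))) = \<Phi> (E (Inr a))"
    by (rule tensorial_cong[OF t JE]) (rule app_J_Inl[OF subsetD[OF W(3)]])
  have "\<Phi> (app_endo J (E (Inr a))) = \<Phi> (fscale (\<lambda>_. -1) (E (Inl a)))"
    by (rule tensorial_cong[OF t JE]) (rule app_J_Inr[OF subsetD[OF W(3)]])
  then show "\<Phi> (app_endo J (E (Inr a))) = - \<Phi> (E (Inl a))"
    using tensorial_fscale[OF t sfun_const EW[OF W(3)], of "-1" "Inl a"] by simp
qed

lemma instanton_at_frame:
  assumes tr: "\<And>q k. q \<in> U \<Longrightarrow> (\<Sum>a\<in>UNIV. Tor (E (Inl a)) (E (Inr a)) (E k) q) = 0"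
    and inst: "SU3_instanton A g J D" and q: "q \<in> U"
  shows "real_su3_frame.instanton_at dd \<Gamma> \<beta> q"
proof -
  have J: "Curv (app_endo J (E i)) (app_endo J (E j)) (E k) (E l) q = Curv (E i) (E j) (E k) (E l) q" for i j k l
    using inst E U q unfolding SU3_instanton_def by blast
  note JE = J_smooth[OF U E]
  note t1 = tensorial_J[OF U q subset_refl Curv_tensorial(1)[OF U q _ E E]]
  note t2 = tensorial_J[OF U q subset_refl Curv_tensorial(2)[OF U q E E E]]
  have 1: "Curv (E (Inr a)) (E (Inr b)) (E k) (E l) q = Curv (E (Inl a)) (E (Inl b)) (E k) (E l) q" for a b k l
    using J[of "Inl a" "Inl b"] unfolding t1[OF JE] t2 .
  have 2: "Curv (E (Inr a)) (E (Inl b)) (E k) (E l) q = - Curv (E (Inl a)) (E (Inr b)) (E k) (E l) q" for a b k l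
    using J[of "Inl a" "Inr b" k l] unfolding t1[OF JE] t2 by simp
  have num_inv: "inv num (num i) = i" for i by (rule inv_f_f) (simp add: inj_on_def num_inject)
  have 3: "(\<Sum>a\<in>UNIV. Curv (E (Inl a)) (E (Inr a)) (E k) (E l) q) = 0" for k l
  proof -
    have on: "orthonormal_basis A g q (\<lambda>i. E (inv num i) q)"
      unfolding orthonormal_basis_def
    proof (intro conjI allI impI)
      fix i j :: nat assume i: "i < 6" and j: "j < 6"
      show "E (inv num i) q \<in> Tan q" by (rule E_Tan[OF q])
      show "g q (E (inv num i) q) (E (inv num j) q) = (if i = j then 1 else 0)"
      proof -
        obtain K L where "i = num K" "j = num L" using num_surj i j by blast
        then show ?thesis by (simp add: num_inv E_orth[OF q] num_inject)
      qed
    qed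
    have "(\<Sum>i<6. Curv (E (inv num i)) (app_endo J (E (inv num i))) (E k) (E l) q) = 0"
      using inst[unfolded SU3_instanton_def, THEN conjunct2, rule_format, of U q "\<lambda>i. E (inv num i)" "E k" "E l"]
        U q E on by blast
    then have "(\<Sum>i\<in>UNIV. Curv (E i) (app_endo J (E i)) (E k) (E l) q) = 0"
      unfolding sum_num[symmetric] num_inv .
    then have "(\<Sum>a\<in>UNIV. Curv (E (Inl a)) (E (Inr a)) (E k) (E l) q) + (\<Sum>a\<in>UNIV. - Curv (E (Inr a)) (E (Inl a)) (E k) (E l) q) = 0"
      unfolding sum_idx t2 .
    moreover have "- Curv (E (Inr a)) (E (Inl a)) (E k) (E l) q = Curv (E (Inl a)) (E (Inr a)) (E k) (E l) q" for a
      using Curv_skew[OF U q E E E E, of "Inr a" "Inl a" k l] by simp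
    ultimately show ?thesis by simp
  qed
  interpret F: real_su3_frame U C dd \<Gamma> \<beta> by (rule real_frame[OF tr])
  show ?thesis
    unfolding F.instanton_at_def curv_eq[OF q, symmetric] using 1 2 3 by blast
qed

lemma NT_zero:
  assumes NT: "\<And>i j k l. NT (E i) (E j) (E k) (E l) p = 0"
    and W0: "open W0" "p \<in> W0" and p: "p \<in> U" and v: "vfield W0 X" "vfield W0 Y" "vfield W0 Z" "vfield W0 V"
  shows "NT X Y Z V p = 0"
proof -
  define W where "W = W0 \<inter> U"
  have W: "open W" "p \<in> W" "W \<subseteq> U" using W0 U p by (auto simp: W_def)
  have v: "vfield W X" "vfield W Y" "vfield W Z" "vfield W V" using v by (auto simp: W_def intro: vfield_subset)
  note EE = EW[OF W(3)] and ex = tensorial_expand[OF W]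
  have 4: "NT (E i) (E j) (E k) V p = 0" for i j k
  proof -
    have "NT (E i) V (E j) (E k) p = 0"
      using ex[OF NT_tensorial_2[OF W(1,2) EE EE EE] v(4), of i j k] NT by simp
    then have "NT (E i) (E j) V (E k) p = 0" using NT_skew(1)[OF W(1,2) EE v(4) EE EE, of i j k] by simp
    then show ?thesis using NT_skew(2)[OF W(1,2) EE EE v(4) EE, of i j k] by simp
  qed
  have 3: "NT (E i) (E j) Z V p = 0" for i j
  proof -
    have "NT (E i) (E k) (E j) V p = 0" for k by (rule 4)
    then have "NT (E i) Z (E j) V p = 0"
      using ex[OF NT_tensorial_2[OF W(1,2) EE EE v(4)] v(3), of i j] by simp
    then show ?thesis using NT_skew(1)[OF W(1,2) EE v(3) EE v(4), of i j] by simp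
  qed
  have 2: "NT (E i) Y Z V p = 0" for i
    using ex[OF NT_tensorial_2[OF W(1,2) EE v(3,4)] v(2), of i] 3 by simp
  show ?thesis
    using ex[OF NT_tensorial_1[OF W(1,2) v(2,3,4)] v(1)] 2 by simp
qed

lemma Curv_expand:
  assumes W: "open W" "p \<in> W" "W \<subseteq> U" and v: "vfield W X" "vfield W Y" "vfield W Z" "vfield W V"
  shows "Curv X Y Z V p = (\<Sum>i\<in>UNIV. \<Sum>j\<in>UNIV. g p (X p) (E i p) * g p (Y p) (E j p) * Curv (E i) (E j) Z V p)"
    "Curv (E i) (E j) Z V p = (\<Sum>k\<in>UNIV. \<Sum>l\<in>UNIV. g p (Z p) (E k p) * g p (V p) (E l p) * Curv (E i) (E j) (E k) (E l) p)"
proof -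
  note EE = EW[OF W(3)] and ex = tensorial_expand[OF W]
  show "Curv X Y Z V p = (\<Sum>i\<in>UNIV. \<Sum>j\<in>UNIV. g p (X p) (E i p) * g p (Y p) (E j p) * Curv (E i) (E j) Z V p)"
    unfolding ex[OF Curv_tensorial(1)[OF W(1,2) v(2,3,4)] v(1)]
    by (rule sum.cong[OF refl]) (simp only: ex[OF Curv_tensorial(2)[OF W(1,2) EE v(3,4)] v(2)] sum_distrib_left mult.assoc)
  show "Curv (E i) (E j) Z V p = (\<Sum>k\<in>UNIV. \<Sum>l\<in>UNIV. g p (Z p) (E k p) * g p (V p) (E l p) * Curv (E i) (E j) (E k) (E l) p)"
    unfolding ex[OF Curv_tensorial(3)[OF W(1,2) EE EE v(4)] v(3)]
    by (rule sum.cong[OF refl]) (simp only: ex[OF Curv_tensorial(4)[OF W(1,2) EE EE EE] v(4)] sum_distrib_left mult.assoc)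
qed

text \<open>
  The second part provides, for fixed \<open>Z\<close> and \<open>V\<close>, the curvature as a skew bilinear form with
  coefficients \<open>r\<close> and vanishing trace; by \<open>hermitian_trace\<close> below, its trace against \<open>J\<close> is the
  same in every orthonormal basis.
\<close>
lemma instanton_from_frame:
  assumes tr: "\<And>q k. q \<in> U \<Longrightarrow> (\<Sum>a\<in>UNIV. Tor (E (Inl a)) (E (Inr a)) (E k) q) = 0"
    and inst: "real_su3_frame.instanton_at dd \<Gamma> \<beta> p"
    and W0: "open W0" "p \<in> W0" and p: "p \<in> U" and Z: "vfield W0 Z" and V: "vfield W0 V"
  shows "vfield W0 X \<Longrightarrow> vfield W0 Y \<Longrightarrow> Curv (app_endo J X) (app_endo J Y) Z V p = Curv X Y Z V p"
    and "\<exists>r. (\<forall>X Y. vfield W0 X \<longrightarrow> vfield W0 Y \<longrightarrow> Curv X Y Z V p = (\<Sum>i\<in>UNIV. \<Sum>j\<in>UNIV. g p (X p) (E i p) * g p (Y p) (E j p) * r i j))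
       \<and> (\<Sum>a\<in>UNIV. r (Inl a) (Inr a)) = (0::real) \<and> (\<forall>i j. r i j = - r j i)"
proof -
  define W where "W = W0 \<inter> U"
  have W: "open W" "p \<in> W" "W \<subseteq> U" using W0 U p by (auto simp: W_def)
  have sub: "vfield W X" if "vfield W0 X" for X using that by (auto simp: W_def intro: vfield_subset)
  note ZV = sub[OF Z] sub[OF V] and EE = EW[OF W(3)]
  interpret F: real_su3_frame U C dd \<Gamma> \<beta> by (rule real_frame[OF tr])
  define r where "r i j = Curv (E i) (E j) Z V p" for i j
  have r: "r i j = (\<Sum>k\<in>UNIV. \<Sum>l\<in>UNIV. g p (Z p) (E k p) * g p (V p) (E l p) * curv dd \<Gamma> \<beta> i j k l p)" for i j
    unfolding r_def Curv_expand(2)[OF W EE EE ZV] curv_eq[OF p] ..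
  have i1: "r (Inr a) (Inr b) = r (Inl a) (Inl b)" "r (Inr a) (Inl b) = - r (Inl a) (Inr b)" for a b
    using inst unfolding r F.instanton_at_def by (simp_all add: sum_negf)
  have i2: "(\<Sum>a\<in>UNIV. r (Inl a) (Inr a)) = 0"
  proof -
    have "(\<Sum>a\<in>UNIV. r (Inl a) (Inr a)) = (\<Sum>k\<in>UNIV. \<Sum>l\<in>UNIV. g p (Z p) (E k p) * g p (V p) (E l p) * (\<Sum>a\<in>UNIV. curv dd \<Gamma> \<beta> (Inl a) (Inr a) k l p))"
      unfolding r sum_distrib_left by (subst sum.swap, rule sum.cong[OF refl], rule sum.swap)
    then show ?thesis using inst unfolding F.instanton_at_def by simp
  qed
  have ex: "Curv X Y Z V p = (\<Sum>i\<in>UNIV. \<Sum>j\<in>UNIV. g p (X p) (E i p) * g p (Y p) (E j p) * r i j)" if "vfield W0 X" "vfield W0 Y" for X Y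
    unfolding r_def by (rule Curv_expand(1)[OF W sub[OF that(1)] sub[OF that(2)] ZV])
  have sk: "r i j = - r j i" for i j unfolding r_def by (rule Curv_skew[OF W(1,2) EE EE ZV])
  show "\<exists>r. (\<forall>X Y. vfield W0 X \<longrightarrow> vfield W0 Y \<longrightarrow> Curv X Y Z V p = (\<Sum>i\<in>UNIV. \<Sum>j\<in>UNIV. g p (X p) (E i p) * g p (Y p) (E j p) * r i j))
       \<and> (\<Sum>a\<in>UNIV. r (Inl a) (Inr a)) = (0::real) \<and> (\<forall>i j. r i j = - r j i)"
    using ex i2 sk by blast
  assume X: "vfield W0 X" and Y: "vfield W0 Y"
  have J: "g p (app_endo J X p) (E (Inl a) p) = - g p (X p) (E (Inr a) p)" "g p (app_endo J X p) (E (Inr a) p) = g p (X p) (E (Inl a) p)"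
    if "vfield W0 X" for X a
  proof -
    note XT = vfield_Tan[OF that W0(2)]
    show "g p (app_endo J X p) (E (Inl a) p) = - g p (X p) (E (Inr a) p)"
      unfolding app_endo_def g_J_skew[OF XT E_Tan[OF p]] J_Inl[OF p] ..
    show "g p (app_endo J X p) (E (Inr a) p) = g p (X p) (E (Inl a) p)"
      unfolding app_endo_def J_Inl[OF p, symmetric] by (rule g_J[OF XT E_Tan[OF p]])
  qed
  show "Curv (app_endo J X) (app_endo J Y) Z V p = Curv X Y Z V p"
    unfolding ex[OF X Y] ex[OF J_smooth[OF W0(1) X] J_smooth[OF W0(1) Y]]
    by (simp add: sum_idx J[OF X] J[OF Y] i1 sum.distrib)
qed

end

section \<open>Determinants and the Hodge star\<close>

text \<open>
  Determinant over a set of natural numbers as row and column indices, in the form in which it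
  occurs in \<open>volume\<close>. It is evaluated by expansion along rows, which changes the index set.
\<close>
definition leibniz_det :: "nat set \<Rightarrow> (nat \<Rightarrow> nat \<Rightarrow> real) \<Rightarrow> real" where
  "leibniz_det S B = (\<Sum>\<sigma> | \<sigma> permutes S. of_int (sign \<sigma>) * (\<Prod>i\<in>S. B i (\<sigma> i)))"

lemma leibniz_det_empty: "leibniz_det {} B = 1"
  by (simp add: leibniz_det_def sign_id)

lemma leibniz_det_insert:
  assumes S: "finite S" and a: "a \<notin> S"
  shows "leibniz_det (insert a S) B =
    (\<Sum>b\<in>insert a S. (if a = b then 1 else -1) * B a b * leibniz_det S (\<lambda>i j. B i (Transposition.transpose a b j)))"
proof -
  have "leibniz_det (insert a S) B = (\<Sum>b\<in>insert a S. \<Sum>q | q permutes S.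
     of_int (sign (Transposition.transpose a b \<circ> q)) * (\<Prod>i\<in>insert a S. B i ((Transposition.transpose a b \<circ> q) i)))"
    unfolding leibniz_det_def by (rule sum_over_permutations_insert[OF S a])
  also have "\<dots> = (\<Sum>b\<in>insert a S. \<Sum>q | q permutes S. (if a = b then 1 else -1) * B a b *
     (of_int (sign q) * (\<Prod>i\<in>S. B i (Transposition.transpose a b (q i)))))"
  proof (intro sum.cong refl)
    fix b q assume "q \<in> {q. q permutes S}"
    then have q: "q permutes S" by simp
    have "sign (Transposition.transpose a b \<circ> q) = sign (Transposition.transpose a b) * sign q"
      by (rule sign_compose[OF permutation_swap_id permutation_permutes[THEN iffD2]]) (use q S in blast)
    moreover have "q a = a" using q a by (simp add: permutes_def)
    ultimately show "of_int (sign (Transposition.transpose a b \<circ> q)) * (\<Prod>i\<in>insert a S. B i ((Transposition.transpose a b \<circ> q) i)) =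
      (if a = b then 1 else -1) * B a b * (of_int (sign q) * (\<Prod>i\<in>S. B i (Transposition.transpose a b (q i))))"
      by (simp add: S a sign_swap_id)
  qed
  finally show ?thesis unfolding leibniz_det_def sum_distrib_left .
qed

lemma transpose_if: "Transposition.transpose a b c = (if c = a then b else if c = b then a else c)"
  by (simp add: Transposition.transpose_def)

definition det4 :: "(nat \<Rightarrow> nat \<Rightarrow> real) \<Rightarrow> nat \<Rightarrow> nat \<Rightarrow> nat \<Rightarrow> nat \<Rightarrow> real" where
  "det4 x c d e f =
     x c 0 * (x d 1 * (x e 2 * x f 3 - x e 3 * x f 2) - x d 2 * (x e 1 * x f 3 - x e 3 * x f 1) + x d 3 * (x e 1 * x f 2 - x e 2 * x f 1))
   - x c 1 * (x d 0 * (x e 2 * x f 3 - x e 3 * x f 2) - x d 2 * (x e 0 * x f 3 - x e 3 * x f 0) + x d 3 * (x e 0 * x f 2 - x e 2 * x f 0))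
   + x c 2 * (x d 0 * (x e 1 * x f 3 - x e 3 * x f 1) - x d 1 * (x e 0 * x f 3 - x e 3 * x f 0) + x d 3 * (x e 0 * x f 1 - x e 1 * x f 0))
   - x c 3 * (x d 0 * (x e 1 * x f 2 - x e 2 * x f 1) - x d 1 * (x e 0 * x f 2 - x e 2 * x f 0) + x d 2 * (x e 0 * x f 1 - x e 1 * x f 0))"

text \<open>
  The determinant of \<open>B\<close> with columns permuted by \<open>p\<close>, where \<open>Z\<close> marks entries known to be zero.
  Tracking these entries makes the row expansion of the sparse matrices below collapse instead of
  producing 720 terms.
\<close>
definition sparse_det :: "(nat \<Rightarrow> nat \<Rightarrow> bool) \<Rightarrow> (nat \<Rightarrow> nat \<Rightarrow> real) \<Rightarrow> nat set \<Rightarrow> (nat \<Rightarrow> nat) \<Rightarrow> real" where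
  "sparse_det Z B S p = leibniz_det S (\<lambda>i j. if Z i (p j) then 0 else B i (p j))"

lemma sparse_det_insert:
  assumes "finite S" "a \<notin> S"
  shows "sparse_det Z B (insert a S) p = (\<Sum>b\<in>insert a S. if Z a (p b) then 0 else
     (if a = b then 1 else -1) * B a (p b) * sparse_det Z B S (p(a := p b, b := p a)))"
proof -
  have e: "p (Transposition.transpose a b j) = (p(a := p b, b := p a)) j" for b j
    by (simp add: transpose_if)
  show ?thesis
    unfolding sparse_det_def leibniz_det_insert[OF assms] e
  proof (rule sum.cong[OF refl])
    fix b
    show "(if a = b then 1 else - 1) * (if Z a (p b) then 0 else B a (p b)) *
         leibniz_det S (\<lambda>i j. if Z i ((p(a := p b, b := p a)) j) then 0 else B i ((p(a := p b, b := p a)) j)) =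
         (if Z a (p b) then 0 else (if a = b then 1 else - 1) * B a (p b) *
          leibniz_det S (\<lambda>i j. if Z i ((p(a := p b, b := p a)) j) then 0 else B i ((p(a := p b, b := p a)) j)))"
      by (cases "Z a (p b)") (simp_all only: if_True if_False mult_zero_right mult_zero_left)
  qed
qed

lemma sparse_det_empty: "sparse_det Z B {} p = 1"
  by (simp add: sparse_det_def leibniz_det_empty)

lemma sparse_det_eq:
  assumes "finite S" "\<And>i j. i \<in> S \<Longrightarrow> Z i j \<Longrightarrow> B i j = 0" shows "leibniz_det S B = sparse_det Z B S id"
proof -
  have "(\<Prod>i\<in>S. B i (\<sigma> i)) = (\<Prod>i\<in>S. if Z i (\<sigma> i) then 0 else B i (\<sigma> i))" for \<sigma>
    by (rule prod.cong[OF refl]) (simp add: assms(2))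
  then show ?thesis unfolding sparse_det_def leibniz_det_def id_apply by simp
qed

text \<open>
  Columns 0 and 1 are unit vectors, as for the arguments \<open>e\<^sub>a, e\<^sub>b\<close> of the volume form; the remaining
  minor is the one with the rows \<open>a\<close> and \<open>b\<close> removed.
\<close>
lemma det_two_units:
  fixes B :: "nat \<Rightarrow> nat \<Rightarrow> real"
  assumes B: "\<And>i. B i 2 = x i 0" "\<And>i. B i 3 = x i (Suc 0)" "\<And>i. B i 4 = x i 2" "\<And>i. B i 5 = x i 3"
    and u: "\<And>i. i < 6 \<Longrightarrow> B i 0 = (if i = a then 1 else 0)" "\<And>i. i < 6 \<Longrightarrow> B i (Suc 0) = (if i = b then 1 else 0)"
  shows "a = 0 \<Longrightarrow> b = 1 \<Longrightarrow> leibniz_det {..<6} B = det4 x 2 3 4 5"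
    and "a = 2 \<Longrightarrow> b = 3 \<Longrightarrow> leibniz_det {..<6} B = det4 x 0 1 4 5"
    and "a = 4 \<Longrightarrow> b = 5 \<Longrightarrow> leibniz_det {..<6} B = det4 x 0 1 2 3"
proof -
  have s: "{..<6::nat} = insert 2 (insert 3 (insert 4 (insert 5 (insert 0 (insert (Suc 0) {})))))"
    "{..<6::nat} = insert 0 (insert (Suc 0) (insert 4 (insert 5 (insert 2 (insert 3 {})))))"
    "{..<6::nat} = insert 2 (insert 3 (insert 0 (insert (Suc 0) (insert 4 (insert 5 {})))))"
    by auto
  define Z where "Z i j \<longleftrightarrow> (j = 0 \<and> i \<noteq> a) \<or> (j = Suc 0 \<and> i \<noteq> b)" for i j :: nat
  have e: "leibniz_det {..<6} B = sparse_det Z B {..<6} id"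
    by (rule sparse_det_eq) (auto simp: Z_def u)
  show "leibniz_det {..<6} B = det4 x 2 3 4 5" if "a = 0" "b = 1"
    unfolding e unfolding s(1) det4_def
    by (simp add: sparse_det_insert sparse_det_empty B u that transpose_if Z_def) (simp add: algebra_simps)
  show "leibniz_det {..<6} B = det4 x 0 1 4 5" if "a = 2" "b = 3"
    unfolding e unfolding s(2) det4_def
    by (simp add: sparse_det_insert sparse_det_empty B u that transpose_if Z_def) (simp add: algebra_simps)
  show "leibniz_det {..<6} B = det4 x 0 1 2 3" if "a = 4" "b = 5"
    unfolding e unfolding s(3) det4_def
    by (simp add: sparse_det_insert sparse_det_empty B u that transpose_if Z_def) (simp add: algebra_simps)
qed

lemma det_five_units:
  fixes B :: "nat \<Rightarrow> nat \<Rightarrow> real"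
  assumes k: "k < 6" and B: "\<And>i. B i 5 = w i"
    and u: "\<And>i j. i < 6 \<Longrightarrow> j < 5 \<Longrightarrow> B i j = (if i = (if j < k then j else Suc j) then 1 else 0)"
  shows "leibniz_det {..<6} B = (- 1) ^ Suc k * w k"
proof -
  define Z where "Z i j \<longleftrightarrow> j < 5 \<and> i \<noteq> (if j < k then j else Suc j)" for i j :: nat
  have e: "leibniz_det {..<6} B = sparse_det Z B {..<6} id"
    by (rule sparse_det_eq) (auto simp: Z_def u)
  have s: "{..<6::nat} = insert 0 (insert (Suc 0) (insert 2 (insert 3 (insert 4 (insert 5 {})))))" by auto
  consider "k = 0" | "k = 1" | "k = 2" | "k = 3" | "k = 4" | "k = 5" using k by linarith
  then show ?thesis
    unfolding e unfolding s
    by cases (simp_all add: sparse_det_insert sparse_det_empty B u Z_def)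
qed

lemma volume_det: "volume g p e vs = leibniz_det {..<6} (\<lambda>i j. g p (e i) (vs ! j))"
  by (simp add: volume_def leibniz_det_def)

lemma sum_pairs:
  fixes f :: "nat list \<Rightarrow> real"
  shows "(\<Sum>I | I \<subseteq> {..<6} \<and> card I + 4 = 6. f (sorted_list_of_set I)) = (\<Sum>i<6. \<Sum>j<6. if i < j then f [i, j] else 0)"
proof -
  let ?P = "{x \<in> {..<6} \<times> {..<6}. fst x < snd x} :: (nat \<times> nat) set"
  have inj: "inj_on (\<lambda>x. {fst x, snd x}) ?P"
    by (auto simp: inj_on_def doubleton_eq_iff)
  have "{I. I \<subseteq> {..<6} \<and> card I + 4 = 6} = (\<lambda>x. {fst x, snd x}) ` ?P"
  proof (intro equalityI subsetI)
    fix I assume "I \<in> {I. I \<subseteq> {..<6::nat} \<and> card I + 4 = 6}"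
    then have I: "I \<subseteq> {..<6}" "card I = 2" by auto
    then obtain x y where xy: "I = {x, y}" "x \<noteq> y" by (auto simp: card_2_iff)
    have "\<exists>i j. I = {i, j} \<and> i < j"
      using xy by (cases "x < y") (auto simp: insert_commute not_less le_less)
    then obtain i j where "I = {i, j}" "i < j" by blast
    then show "I \<in> (\<lambda>x. {fst x, snd x}) ` ?P"
      using I by (intro image_eqI[of _ _ "(i, j)"]) auto
  next
    fix I :: "nat set" assume "I \<in> (\<lambda>x. {fst x, snd x}) ` ?P"
    then obtain i j where "i < j" "j < 6" "I = {i, j}" by auto
    then show "I \<in> {I. I \<subseteq> {..<6} \<and> card I + 4 = 6}" by auto
  qed
  then have "(\<Sum>I | I \<subseteq> {..<6} \<and> card I + 4 = 6. f (sorted_list_of_set I)) = (\<Sum>x\<in>?P. f (sorted_list_of_set {fst x, snd x}))"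
    using sum.reindex[OF inj, of "\<lambda>I. f (sorted_list_of_set I)"] by (simp only: comp_def)
  also have "\<dots> = (\<Sum>x\<in>?P. f [fst x, snd x])"
  proof (rule sum.cong[OF refl])
    fix x assume "x \<in> ?P"
    then have "fst x < snd x" by auto
    then have "sorted_list_of_set {fst x, snd x} = [fst x, snd x]"
      by (intro sorted_list_of_set_unique[THEN iffD1]) auto
    then show "f (sorted_list_of_set {fst x, snd x}) = f [fst x, snd x]" by simp
  qed
  also have "\<dots> = (\<Sum>x\<in>{..<6} \<times> {..<6}. if fst x < snd x then f [fst x, snd x] else 0)"
    by (rule sum.inter_filter) auto
  finally show ?thesis by (simp add: sum.cartesian_product case_prod_beta)
qed

lemma sum_five_subsets:
  fixes f :: "nat list \<Rightarrow> real"
  shows "(\<Sum>I | I \<subseteq> {..<6} \<and> card I + 1 = 6. f (sorted_list_of_set I)) =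
    f [1,2,3,4,5] + f [0,2,3,4,5] + f [0,1,3,4,5] + f [0,1,2,4,5] + f [0,1,2,3,5] + f [0,1,2,3,4]"
proof -
  have inj: "inj_on (\<lambda>k. {..<6} - {k}) {..<6::nat}"
    by (auto simp: inj_on_def)
  have "{I. I \<subseteq> {..<6} \<and> card I + 1 = 6} = (\<lambda>k. {..<6} - {k}) ` {..<6::nat}"
  proof (intro equalityI subsetI)
    fix I assume "I \<in> {I. I \<subseteq> {..<6::nat} \<and> card I + 1 = 6}"
    then have I: "I \<subseteq> {..<6}" "card I = 5" by auto
    then have "card ({..<6} - I) = 1" by (subst card_Diff_subset) (auto intro: finite_subset)
    then obtain k where "{..<6} - I = {k}" by (auto simp: card_1_singleton_iff)
    then have "I = {..<6} - {k}" "k < 6" using I by auto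
    then show "I \<in> (\<lambda>k. {..<6} - {k}) ` {..<6::nat}" by auto
  qed auto
  then have "(\<Sum>I | I \<subseteq> {..<6} \<and> card I + 1 = 6. f (sorted_list_of_set I)) = (\<Sum>k<6. f (sorted_list_of_set ({..<6} - {k})))"
    using sum.reindex[OF inj, of "\<lambda>I. f (sorted_list_of_set I)"] by (simp only: comp_def)
  also have "\<dots> = (\<Sum>k<6. f (remove1 k [0..<6]))"
    by (simp add: sorted_list_of_set_remove lessThan_atLeast0)
  also have "[0..<6] = [0,1,2,3,4,5::nat]" by (simp add: upt_rec)
  finally show ?thesis by (simp add: sum_lt6)
qed

context almost_hermitian_manifold
begin

text \<open>
  Parseval's identity. The matrix between an orthonormal basis and a unitary one has orthonormal
  rows, hence orthonormal columns.
\<close>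
lemma orthonormal_complete:
  assumes E: "unitary_at p E" and e: "orthonormal_basis A g p e" and u: "u \<in> Tan p" and v: "v \<in> Tan p"
  shows "(\<Sum>n<6. g p (e n) u * g p (e n) v) = g p u v"
proof -
  have ET: "E i \<in> Tan p" and Eo: "g p (E i) (E j) = (if i = j then 1 else 0)" and Ex: "w \<in> Tan p \<Longrightarrow> w = (\<Sum>i\<in>UNIV. vscale (g p w (E i)) (E i))" for i j w
    using E unfolding unitary_at_def by blast+
  have eT: "n < 6 \<Longrightarrow> e n \<in> Tan p" and eo: "n < 6 \<Longrightarrow> m < 6 \<Longrightarrow> g p (e n) (e m) = (if n = m then 1 else 0)" for n m
    using e unfolding orthonormal_basis_def by blast+
  have ip: "g p u v = (\<Sum>i\<in>UNIV. g p u (E i) * g p v (E i))" if "u \<in> Tan p" "v \<in> Tan p" for u v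
  proof -
    have "g p u v = g p u (\<Sum>i\<in>UNIV. vscale (g p v (E i)) (E i))" using Ex[OF that(2)] by simp
    also have "\<dots> = (\<Sum>i\<in>UNIV. g p v (E i) * g p u (E i))"
      by (subst g_sum_right[OF finite that(1) Tan_vscale[OF ET]]) (simp only: g_vscale_right[OF that(1) ET])
    finally show ?thesis by (simp add: mult.commute)
  qed
  define M :: "real ^ idx ^ idx" where "M = (\<chi> a b. g p (e (num a)) (E b))"
  have "M ** transpose M = mat 1"
    by (simp add: vec_eq_iff matrix_matrix_mult_def transpose_def M_def mat_def ip[OF eT[OF num_less] eT[OF num_less], symmetric]
        eo[OF num_less num_less] num_inject)
  then have "transpose M ** M = mat 1" using matrix_left_right_inverse by blast
  then have par: "(\<Sum>a\<in>UNIV. g p (e (num a)) (E i) * g p (e (num a)) (E j)) = (if i = j then 1 else 0)" for i j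
    by (simp add: vec_eq_iff matrix_matrix_mult_def transpose_def M_def mat_def)
  have "(\<Sum>n<6. g p (e n) u * g p (e n) v) = (\<Sum>a\<in>UNIV. (\<Sum>i\<in>UNIV. g p (e (num a)) (E i) * g p u (E i)) * (\<Sum>j\<in>UNIV. g p (e (num a)) (E j) * g p v (E j)))"
    unfolding sum_num[symmetric] ip[OF eT[OF num_less] u, symmetric] ip[OF eT[OF num_less] v, symmetric] ..
  also have "\<dots> = (\<Sum>i\<in>UNIV. \<Sum>j\<in>UNIV. \<Sum>a\<in>UNIV. g p u (E i) * g p v (E j) * (g p (e (num a)) (E i) * g p (e (num a)) (E j)))"
    unfolding sum_product by (subst sum.swap, rule sum.cong[OF refl], subst sum.swap) (simp add: mult_ac)
  also have "\<dots> = (\<Sum>i\<in>UNIV. \<Sum>j\<in>UNIV. if i = j then g p u (E i) * g p v (E j) else 0)"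
    unfolding sum_distrib_left[symmetric] par by (intro sum.cong refl) simp
  also have "\<dots> = g p u v" by (simp add: ip[OF u v])
  finally show ?thesis .
qed

text \<open>
  By Parseval's identity the left side is the trace of \<open>r\<close> against \<open>J\<close>, which the unitary basis
  computes as well.
\<close>
lemma hermitian_trace:
  assumes E: "unitary_at p E" and e: "orthonormal_basis A g p e" and r: "\<And>i j. r i j = - (r j i :: real)"
  shows "(\<Sum>n<6. \<Sum>i\<in>UNIV. \<Sum>j\<in>UNIV. g p (e n) (E i) * g p (J p (e n)) (E j) * r i j) = 2 * (\<Sum>a\<in>UNIV. r (Inl a) (Inr a))"
proof -
  have ET: "E i \<in> Tan p" and Eo: "g p (E i) (E j) = (if i = j then 1 else 0)" and EJ: "J p (E (Inl a)) = E (Inr a)" for i j a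
    using E unfolding unitary_at_def by blast+
  have eT: "n < 6 \<Longrightarrow> e n \<in> Tan p" for n using e unfolding orthonormal_basis_def by blast
  have "(\<Sum>n<6. \<Sum>i\<in>UNIV. \<Sum>j\<in>UNIV. g p (e n) (E i) * g p (J p (e n)) (E j) * r i j) =
      (\<Sum>i\<in>UNIV. \<Sum>j\<in>UNIV. (\<Sum>n<6. g p (e n) (E i) * g p (J p (e n)) (E j)) * r i j)"
    unfolding sum_distrib_right by (subst sum.swap, rule sum.cong[OF refl], rule sum.swap)
  also have "\<dots> = (\<Sum>i\<in>UNIV. \<Sum>j\<in>UNIV. - g p (E i) (J p (E j)) * r i j)"
  proof (intro sum.cong refl arg_cong2[where f = "(*)"])
    fix i j
    have "(\<Sum>n<6. g p (e n) (E i) * g p (J p (e n)) (E j)) = (\<Sum>n<6. - (g p (e n) (E i) * g p (e n) (J p (E j))))"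
      by (rule sum.cong[OF refl]) (simp add: g_J_skew[OF eT ET])
    then show "(\<Sum>n<6. g p (e n) (E i) * g p (J p (e n)) (E j)) = - g p (E i) (J p (E j))"
      unfolding sum_negf orthonormal_complete[OF E e ET J_Tan[OF ET]] .
  qed
  also have "\<dots> = 2 * (\<Sum>a\<in>UNIV. r (Inl a) (Inr a))"
    by (simp add: sum_idx sum_i3 EJ unitary_at_Inr[OF E] g_uminus_right[OF ET ET] Eo r[of "Inr _" "Inl _"])
  finally show ?thesis .
qed

abbreviation K where "K \<equiv> kahler_form g J"

lemma K_skew: "u \<in> Tan p \<Longrightarrow> v \<in> Tan p \<Longrightarrow> K p u v = - K p v u"
  unfolding kahler_form_def using g_J_skew[of v p u] g_sym[OF J_Tan, of v p u] by simp

lemma adapted_Tan: "adapted_basis A g J p e \<Longrightarrow> n < 6 \<Longrightarrow> e n \<in> Tan p"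
  and adapted_orth: "adapted_basis A g J p e \<Longrightarrow> n < 6 \<Longrightarrow> m < 6 \<Longrightarrow> g p (e n) (e m) = (if n = m then 1 else 0)"
  unfolding adapted_basis_def orthonormal_basis_def by blast+

lemma adapted_J:
  assumes "adapted_basis A g J p e"
  shows "J p (e 0) = e 1" "J p (e 1) = - e 0" "J p (e 2) = e 3" "J p (e 3) = - e 2" "J p (e 4) = e 5" "J p (e 5) = - e 4"
  using assms J_J[OF adapted_Tan[OF assms]] unfolding adapted_basis_def by auto

text \<open>The Kaehler form \<open>- e\<^sub>0\<^sub>1 - e\<^sub>2\<^sub>3 - e\<^sub>4\<^sub>5\<close> of an adapted basis.\<close>
lemma K_adapted:
  assumes E: "unitary_at p E" and e: "adapted_basis A g J p e" and u: "u \<in> Tan p" and v: "v \<in> Tan p"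
  shows "K p u v = - (g p (e 0) u * g p (e 1) v - g p (e 1) u * g p (e 0) v)
     - (g p (e 2) u * g p (e 3) v - g p (e 3) u * g p (e 2) v) - (g p (e 4) u * g p (e 5) v - g p (e 5) u * g p (e 4) v)"
proof -
  have on: "orthonormal_basis A g p e" using e unfolding adapted_basis_def by blast
  have J: "g p (e n) (J p v) = - g p (J p (e n)) v" if "n < 6" for n
    using g_J_skew[OF adapted_Tan[OF e that] v] by simp
  note T = adapted_Tan[OF e]
  show ?thesis
    unfolding kahler_form_def orthonormal_complete[OF E on u J_Tan[OF v], symmetric] sum_lt6
    by (simp add: J adapted_J[OF e, unfolded One_nat_def] g_uminus_left[OF v T] algebra_simps)
qed

abbreviation FF :: "'m form" where "FF \<equiv> \<lambda>q vs. kahler_form g J q (vs ! 0) (vs ! 1)"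

text \<open>
  This is \<open>*F = - F \<and> F / 2\<close>: the star interchanges \<open>e\<^sub>0\<^sub>1\<close> and \<open>e\<^sub>2\<^sub>3\<^sub>4\<^sub>5\<close>, and likewise for the other
  two planes.
\<close>
lemma hodge_star_FF:
  assumes E: "unitary_at q E" and ex: "\<exists>e. adapted_basis A g J q e"
    and w: "w0 \<in> Tan q" "w1 \<in> Tan q" "w2 \<in> Tan q" "w3 \<in> Tan q"
  shows "hodge_star A g J FF q [w0, w1, w2, w3] =
    - (K q w0 w1 * K q w2 w3 - K q w0 w2 * K q w1 w3 + K q w0 w3 * K q w1 w2)"
proof -
  define e where "e = (SOME e. adapted_basis A g J q e)"
  have e: "adapted_basis A g J q e" unfolding e_def using ex by (rule someI_ex)
  note T = adapted_Tan[OF e] and on = adapted_orth[OF e]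
  let ?x = "\<lambda>i j. g q (e i) ([w0, w1, w2, w3] ! j)"
  have vol: "volume g q e ([e 0, e 1] @ [w0, w1, w2, w3]) = det4 ?x 2 3 4 5"
    "volume g q e ([e 2, e 3] @ [w0, w1, w2, w3]) = det4 ?x 0 1 4 5"
    "volume g q e ([e 4, e 5] @ [w0, w1, w2, w3]) = det4 ?x 0 1 2 3"
    unfolding volume_det by (rule det_two_units(1)[where a = 0 and b = 1] det_two_units(2)[where a = 2 and b = 3]
        det_two_units(3)[where a = 4 and b = 5]; simp add: on)+
  have Ke: "K q (e i) (e j) = - (g q (e 0) (e i) * g q (e 1) (e j) - g q (e 1) (e i) * g q (e 0) (e j))
     - (g q (e 2) (e i) * g q (e 3) (e j) - g q (e 3) (e i) * g q (e 2) (e j)) - (g q (e 4) (e i) * g q (e 5) (e j) - g q (e 5) (e i) * g q (e 4) (e j))"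
    if "i < 6" "j < 6" for i j
    by (rule K_adapted[OF E e T[OF that(1)] T[OF that(2)]])
  let ?G = "\<lambda>l. FF q (map e l) * volume g q e (map e l @ [w0, w1, w2, w3])"
  have "hodge_star A g J FF q [w0, w1, w2, w3] = (\<Sum>I | I \<subseteq> {..<6} \<and> card I + 4 = 6. ?G (sorted_list_of_set I))"
    unfolding hodge_star_def Let_def e_def[symmetric] by simp
  also have "\<dots> = (\<Sum>i<6. \<Sum>j<6. if i < j then ?G [i, j] else 0)" by (rule sum_pairs)
  also have "\<dots> = (\<Sum>i<6. \<Sum>j<6. if i < j then K q (e i) (e j) * volume g q e ([e i, e j] @ [w0, w1, w2, w3]) else 0)"
    by (simp cong: if_cong)
  also have "\<dots> = - volume g q e ([e 0, e 1] @ [w0, w1, w2, w3]) - volume g q e ([e 2, e 3] @ [w0, w1, w2, w3])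
     - volume g q e ([e 4, e 5] @ [w0, w1, w2, w3])"
    by (simp add: sum_lt6 Ke on)
  also have "\<dots> = - (K q w0 w1 * K q w2 w3 - K q w0 w2 * K q w1 w3 + K q w0 w3 * K q w1 w2)"
    unfolding vol det4_def K_adapted[OF E e w(1,2)] K_adapted[OF E e w(3,4)] K_adapted[OF E e w(1,3)]
      K_adapted[OF E e w(2,4)] K_adapted[OF E e w(1,4)] K_adapted[OF E e w(2,3)]
    by (simp add: algebra_simps)
  finally show ?thesis .
qed

text \<open>
  The star of a 5-form is a 1-form whose six components are, up to sign, those of the 5-form. The
  basis is the one chosen in \<open>hodge_star\<close>.
\<close>
lemma hodge_star_five:
  assumes ex: "\<exists>e. adapted_basis A g J p e" and 0: "\<And>w. w \<in> Tan p \<Longrightarrow> hodge_star A g J \<eta> p [w] = 0"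
  shows "\<exists>e. adapted_basis A g J p e \<and> \<eta> p (map e [1,2,3,4,5]) = 0 \<and> \<eta> p (map e [0,2,3,4,5]) = 0 \<and> \<eta> p (map e [0,1,3,4,5]) = 0
    \<and> \<eta> p (map e [0,1,2,4,5]) = 0 \<and> \<eta> p (map e [0,1,2,3,5]) = 0 \<and> \<eta> p (map e [0,1,2,3,4]) = 0"
proof -
  define e where "e = (SOME e. adapted_basis A g J p e)"
  have e: "adapted_basis A g J p e" unfolding e_def using ex by (rule someI_ex)
  note T = adapted_Tan[OF e] and on = adapted_orth[OF e]
  have vol: "volume g p e (map e [1,2,3,4,5] @ [w]) = - g p (e 0) w" "volume g p e (map e [0,2,3,4,5] @ [w]) = g p (e 1) w"
    "volume g p e (map e [0,1,3,4,5] @ [w]) = - g p (e 2) w" "volume g p e (map e [0,1,2,4,5] @ [w]) = g p (e 3) w"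
    "volume g p e (map e [0,1,2,3,5] @ [w]) = - g p (e 4) w" "volume g p e (map e [0,1,2,3,4] @ [w]) = g p (e 5) w" for w
    unfolding volume_det
    by (subst det_five_units[where w = "\<lambda>i. g p (e i) w" and k = 0] det_five_units[where w = "\<lambda>i. g p (e i) w" and k = 1]
        det_five_units[where w = "\<lambda>i. g p (e i) w" and k = 2] det_five_units[where w = "\<lambda>i. g p (e i) w" and k = 3]
        det_five_units[where w = "\<lambda>i. g p (e i) w" and k = 4] det_five_units[where w = "\<lambda>i. g p (e i) w" and k = 5];
        auto simp: on less_Suc_eq numeral_eq_Suc; fail)+
  have h: "hodge_star A g J \<eta> p [w] = - \<eta> p (map e [1,2,3,4,5]) * g p (e 0) w + \<eta> p (map e [0,2,3,4,5]) * g p (e 1) w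
     - \<eta> p (map e [0,1,3,4,5]) * g p (e 2) w + \<eta> p (map e [0,1,2,4,5]) * g p (e 3) w - \<eta> p (map e [0,1,2,3,5]) * g p (e 4) w
     + \<eta> p (map e [0,1,2,3,4]) * g p (e 5) w" for w
  proof -
    let ?F = "\<lambda>l. \<eta> p (map e l) * volume g p e (map e l @ [w])"
    have "hodge_star A g J \<eta> p [w] = (\<Sum>I | I \<subseteq> {..<6} \<and> card I + 1 = 6. ?F (sorted_list_of_set I))"
      unfolding hodge_star_def Let_def e_def[symmetric] by simp
    also have "\<dots> = ?F [1,2,3,4,5] + ?F [0,2,3,4,5] + ?F [0,1,3,4,5] + ?F [0,1,2,4,5] + ?F [0,1,2,3,5] + ?F [0,1,2,3,4]"
      by (rule sum_five_subsets)
    finally show ?thesis unfolding vol by simp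
  qed
  have "\<eta> p (map e [1,2,3,4,5]) = 0" using 0[OF T[of 0]] unfolding h by (simp add: on)
  moreover have "\<eta> p (map e [0,2,3,4,5]) = 0" using 0[OF T[of 1]] unfolding h by (simp add: on)
  moreover have "\<eta> p (map e [0,1,3,4,5]) = 0" using 0[OF T[of 2]] unfolding h by (simp add: on)
  moreover have "\<eta> p (map e [0,1,2,4,5]) = 0" using 0[OF T[of 3]] unfolding h by (simp add: on)
  moreover have "\<eta> p (map e [0,1,2,3,5]) = 0" using 0[OF T[of 4]] unfolding h by (simp add: on)
  moreover have "\<eta> p (map e [0,1,2,3,4]) = 0" using 0[OF T[of 5]] unfolding h by (simp add: on)
  ultimately show ?thesis using e by blast
qed

lemma balanced_hodge:
  assumes bal: "balanced A g J" and w: "w \<in> Tan p"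
  shows "hodge_star A g J (ext_deriv A (hodge_star A g J FF)) p [w] = 0"
proof -
  have "lee_form A g J p (- J p w) = 0"
    using bal Tan_uminus[OF J_Tan[OF w]] unfolding balanced_def by blast
  moreover have "J p (- J p w) = w"
    using J_vscale[OF J_Tan[OF w], of "-1"] J_J[OF w] by (simp add: uminus_vscale[symmetric])
  ultimately show ?thesis unfolding lee_form_def codifferential_def by simp
qed

end

context su3_manifold
begin

lemma unitary_exists: "\<exists>E. unitary_at p E"
  using local_frame[of p] by blast

lemma adapted_exists: "\<exists>e. adapted_basis A g J p e"
proof -
  obtain E where E: "unitary_at p E" using unitary_exists by blast
  have num_inv: "inv num (num i) = i" for i by (rule inv_f_f) (simp add: inj_on_def num_inject)
  have n: "inv num 0 = Inl I1" "inv num (Suc 0) = Inr I1" "inv num 2 = Inl I2" "inv num 3 = Inr I2" "inv num 4 = Inl I3" "inv num 5 = Inr I3"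
    using num_inv[of "Inl I1"] num_inv[of "Inr I1"] num_inv[of "Inl I2"] num_inv[of "Inr I2"] num_inv[of "Inl I3"] num_inv[of "Inr I3"]
    by simp_all
  have "adapted_basis A g J p (\<lambda>i. E (inv num i))"
    unfolding adapted_basis_def orthonormal_basis_def
  proof (intro conjI allI impI)
    fix i j :: nat assume i: "i < 6" and j: "j < 6"
    then obtain K L where "i = num K" "j = num L" using num_surj by blast
    then show "g p (E (inv num i)) (E (inv num j)) = (if i = j then 1 else 0)"
      using E by (simp add: num_inv num_inject unitary_at_def)
  qed (use E in \<open>simp_all add: unitary_at_def n\<close>)
  then show ?thesis by blast
qed

end

section \<open>The Lee form as a trace of the torsion\<close>

context acyt_connection
begin

text \<open>The Kaehler form is parallel.\<close>
lemma vderiv_K: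
  assumes W: "open W" "p \<in> W" and X: "vfield W X" and Y: "vfield W Y" and Z: "vfield W Z"
  shows "vderiv A p (X p) (\<lambda>q. K q (Y q) (Z q)) = K p (D X Y p) (Z p) - K p (D X Z p) (Y p)"
    "sfun W (\<lambda>q. K q (Y q) (Z q))"
proof -
  have JZ: "vfield W (app_endo J Z)" by (rule J_smooth[OF W(1) Z])
  have "vderiv A p (X p) (\<lambda>q. g q (Y q) (app_endo J Z q)) - g p (D X Y p) (app_endo J Z p) - g p (Y p) (D X (app_endo J Z) p) = 0"
    using par_g X Y JZ W unfolding parallel_metric_def by blast
  moreover have "D X (app_endo J Z) p - J p (D X Z p) = (\<lambda>c. 0)"
    using par_J X Z W unfolding parallel_endo_def by blast
  then have "D X (app_endo J Z) p = J p (D X Z p)" by (simp add: fun_eq_iff)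
  ultimately show "vderiv A p (X p) (\<lambda>q. K q (Y q) (Z q)) = K p (D X Y p) (Z p) - K p (D X Z p) (Y p)"
    using K_skew[OF vfield_Tan[OF Y W(2)] D_Tan[OF W X Z]]
    unfolding kahler_form_def app_endo_def by simp
  show "sfun W (\<lambda>q. K q (Y q) (Z q))"
    using g_smooth[OF W(1) Y JZ] unfolding kahler_form_def app_endo_def .
qed

text \<open>The extension of a tangent vector at \<open>p\<close> that \<open>ext_deriv\<close> uses.\<close>
definition cf :: "'m \<Rightarrow> 'm tvec \<Rightarrow> 'm vfield" where "cf p v = const_field A (chart_at A p) v"

lemma cf: "vfield (dom (chart_at A p)) (cf p v)" "v \<in> Tan p \<Longrightarrow> cf p v p = v"
  unfolding cf_def by (rule vfield_const_field[OF chart_at(1)], rule const_field_eq[OF chart_at])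

text \<open>
  \<open>F(\<nabla>\<^sub>w u, v)\<close> for the constant extensions of \<open>w\<close> and \<open>u\<close>; the skew part in \<open>u, v\<close> is the derivative
  of \<open>F(u, v)\<close>, and the skew part in \<open>w, u\<close> is the torsion.
\<close>
definition nK :: "'m \<Rightarrow> 'm tvec \<Rightarrow> 'm tvec \<Rightarrow> 'm tvec \<Rightarrow> real" where
  "nK p w u v = K p (D (cf p w) (cf p u) p) v"

text \<open>
  The derivative of \<open>*F(a, b, c, d)\<close> in the direction \<open>w\<close>, by the product rule from
  \<open>*F = - F \<and> F / 2\<close>.
\<close>
definition star_deriv :: "'m \<Rightarrow> 'm tvec \<Rightarrow> 'm tvec \<Rightarrow> 'm tvec \<Rightarrow> 'm tvec \<Rightarrow> 'm tvec \<Rightarrow> real" where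
  "star_deriv p w a b c d = - ((nK p w a b - nK p w b a) * K p c d + K p a b * (nK p w c d - nK p w d c)
     - (nK p w a c - nK p w c a) * K p b d - K p a c * (nK p w b d - nK p w d b)
     + (nK p w a d - nK p w d a) * K p b c + K p a d * (nK p w b c - nK p w c b))"

lemma vderiv_star:
  assumes w: "w \<in> Tan p" and v: "a \<in> Tan p" "b \<in> Tan p" "c \<in> Tan p" "d \<in> Tan p"
  shows "vderiv A p w (\<lambda>q. hodge_star A g J FF q [cf p a q, cf p b q, cf p c q, cf p d q]) = star_deriv p w a b c d"
proof -
  let ?W = "dom (chart_at A p)"
  have W: "open ?W" "p \<in> ?W" using dom_open chart_at by auto
  have wT: "cf p w p \<in> Tan p" by (simp add: cf(2) w)
  let ?k = "\<lambda>a b q. K q (cf p a q) (cf p b q)"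
  note sm = vderiv_K(2)[OF W cf(1) cf(1) cf(1)]
  have dk: "vderiv A p w (?k a b) = nK p w a b - nK p w b a" if "a \<in> Tan p" "b \<in> Tan p" for a b
    using vderiv_K(1)[OF W cf(1) cf(1) cf(1), of w a b] by (simp add: cf(2) w that nK_def)
  have "vderiv A p w (\<lambda>q. hodge_star A g J FF q [cf p a q, cf p b q, cf p c q, cf p d q]) =
     vderiv A p w (\<lambda>q. - (?k a b q * ?k c d q - ?k a c q * ?k b d q + ?k a d q * ?k b c q))"
  proof (rule vderiv_cong[OF W])
    fix q assume q: "q \<in> ?W"
    note T = vfield_Tan[OF cf(1) q]
    obtain E where E: "unitary_at q E" using unitary_exists by blast
    show "hodge_star A g J FF q [cf p a q, cf p b q, cf p c q, cf p d q] = - (?k a b q * ?k c d q - ?k a c q * ?k b d q + ?k a d q * ?k b c q)"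
      by (rule hodge_star_FF[OF E adapted_exists T T T T])
  qed
  also have "\<dots> = - (vderiv A p w (?k a b) * ?k c d p + ?k a b p * vderiv A p w (?k c d)
     - (vderiv A p w (?k a c) * ?k b d p + ?k a c p * vderiv A p w (?k b d))
     + (vderiv A p w (?k a d) * ?k b c p + ?k a d p * vderiv A p w (?k b c)))"
  proof -
    let ?p = "\<lambda>q. ?k a b q * ?k c d q" and ?q = "\<lambda>q. ?k a c q * ?k b d q" and ?r = "\<lambda>q. ?k a d q * ?k b c q"
    have s: "sfun ?W ?p" "sfun ?W ?q" "sfun ?W ?r" by (rule sfun_mult[OF W(1) sm sm])+
    have m: "vderiv A p w ?p = vderiv A p w (?k a b) * ?k c d p + ?k a b p * vderiv A p w (?k c d)"
      "vderiv A p w ?q = vderiv A p w (?k a c) * ?k b d p + ?k a c p * vderiv A p w (?k b d)"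
      "vderiv A p w ?r = vderiv A p w (?k a d) * ?k b c p + ?k a d p * vderiv A p w (?k b c)"
      by (rule vderiv_mult[OF W w sm sm])+
    have "vderiv A p w (\<lambda>q. - (?p q - ?q q + ?r q)) = - vderiv A p w (\<lambda>q. (?p q - ?q q) + ?r q)"
      by (rule vderiv_uminus[OF W w sfun_add[OF W(1) sfun_diff[OF W(1) s(1,2)] s(3)]])
    also have "vderiv A p w (\<lambda>q. (?p q - ?q q) + ?r q) = vderiv A p w (\<lambda>q. ?p q - ?q q) + vderiv A p w ?r"
      by (rule vderiv_add[OF W w sfun_diff[OF W(1) s(1,2)] s(3)])
    also have "vderiv A p w (\<lambda>q. ?p q - ?q q) = vderiv A p w ?p - vderiv A p w ?q"
      using vderiv_add[OF W w s(1) sfun_uminus[OF W(1) s(2)]] vderiv_uminus[OF W w s(2)] by simp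
    finally show ?thesis unfolding m .
  qed
  also have "\<dots> = star_deriv p w a b c d"
    by (simp add: dk v cf(2) star_deriv_def algebra_simps)
  finally show ?thesis .
qed

lemma ext_deriv_star:
  assumes v: "a \<in> Tan p" "b \<in> Tan p" "c \<in> Tan p" "d \<in> Tan p" "f \<in> Tan p"
  shows "ext_deriv A (hodge_star A g J FF) p [a, b, c, d, f] =
    star_deriv p a b c d f - star_deriv p b a c d f + star_deriv p c a b d f - star_deriv p d a b c f + star_deriv p f a b c d"
  unfolding ext_deriv_def cf_def[symmetric]
  by (simp add: vderiv_star[unfolded One_nat_def] v numeral_eq_Suc)

text \<open>Constant fields commute.\<close>
lemma nK_torsion:
  assumes v: "u \<in> Tan p" "v \<in> Tan p" "w \<in> Tan p"
  shows "nK p u v w - nK p v u w = Tor (cf p u) (cf p v) (cf p (J p w)) p"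
proof -
  let ?W = "dom (chart_at A p)"
  have W: "open ?W" "p \<in> ?W" using dom_open chart_at by auto
  have "lie (cf p u) (cf p v) p = 0" unfolding cf_def by (rule lie_const_field[OF chart_at])
  then have "torsion_vec A D (cf p u) (cf p v) p = D (cf p u) (cf p v) p - D (cf p v) (cf p u) p"
    unfolding torsion_vec_at[OF W] by simp
  then show ?thesis
    unfolding nK_def kahler_form_def torsion_def
    by (simp add: cf(2) J_Tan v g_diff_left[OF J_Tan[OF v(3)] D_Tan[OF W cf(1) cf(1)] D_Tan[OF W cf(1) cf(1)]])
qed

text \<open>
  The component of \<open>d*F\<close> on the five basis vectors other than \<open>e\<^sub>l\<close> is evaluated. The derivatives of
  \<open>F\<close> enter through \<open>nK\<close>, and their skew combinations reduce to the torsion; what is left is, up to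
  sign, the trace of the torsion with last argument \<open>e\<^sub>l\<close>.
\<close>
lemma balanced_adapted:
  assumes bal: "balanced A g J"
  shows "\<exists>e. adapted_basis A g J p e \<and> (\<forall>k<6. Tor (cf p (e 0)) (cf p (e 1)) (cf p (e k)) p
     + Tor (cf p (e 2)) (cf p (e 3)) (cf p (e k)) p + Tor (cf p (e 4)) (cf p (e 5)) (cf p (e k)) p = 0)"
proof -
  let ?\<eta> = "ext_deriv A (hodge_star A g J FF)"
  obtain e where e: "adapted_basis A g J p e" and 0: "?\<eta> p (map e [1,2,3,4,5]) = 0" "?\<eta> p (map e [0,2,3,4,5]) = 0" "?\<eta> p (map e [0,1,3,4,5]) = 0"
    "?\<eta> p (map e [0,1,2,4,5]) = 0" "?\<eta> p (map e [0,1,2,3,5]) = 0" "?\<eta> p (map e [0,1,2,3,4]) = 0"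
    using hodge_star_five[OF adapted_exists balanced_hodge[OF bal]] by blast
  let ?W = "dom (chart_at A p)"
  have W: "open ?W" "p \<in> ?W" using dom_open chart_at by auto
  note T = adapted_Tan[OF e]
  define t where "t i j k = Tor (cf p (e i)) (cf p (e j)) (cf p (e k)) p" for i j k
  define n where "n i j k = nK p (e i) (e j) (e k)" for i j k
  define kk where "kk i j = K p (e i) (e j)" for i j
  have t_sw: "t j i k = - t i j k" "t i k j = - t i j k" for i j k
    unfolding t_def by (rule Tor_skew[OF W cf(1) cf(1) cf(1)])+
  have t0: "t i i k = 0" "t i k k = 0" "t i k i = 0" for i k
    using t_sw(1)[of i i k] t_sw(2)[of i k k] t_sw(1)[of i k i] t_sw(2)[of k i i] by simp_all
  have t_ord: "i < j \<Longrightarrow> t j i k = - t i j k" "j < k \<Longrightarrow> t i k j = - t i j k" for i j k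
    by (rule t_sw)+
  have kk: "kk i j = (if (i, j) \<in> {(0,1),(2,3),(4,5)} then -1 else if (i, j) \<in> {(1,0),(3,2),(5,4)} then 1 else 0)"
    if "i < 6" "j < 6" for i j
  proof -
    obtain E where E: "unitary_at p E" using unitary_exists by blast
    have i: "i = 0 \<or> i = 1 \<or> i = 2 \<or> i = 3 \<or> i = 4 \<or> i = 5" "j = 0 \<or> j = 1 \<or> j = 2 \<or> j = 3 \<or> j = 4 \<or> j = 5" using that by linarith+
    then show ?thesis
      unfolding kk_def K_adapted[OF E e T[OF that(1)] T[OF that(2)]]
      by (elim disjE; simp add: adapted_orth[OF e])
  qed
  have tu: "Tor (cf p (e i)) (cf p (e j)) (cf p (- e k)) p = - t i j k" if "k < 6" for i j k
  proof -
    have "Tor (cf p (e i)) (cf p (e j)) (cf p (- e k)) p = g p (torsion_vec A D (cf p (e i)) (cf p (e j)) p) (- e k)"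
      unfolding torsion_def by (simp add: cf(2) Tan_uminus T that)
    also have "\<dots> = - g p (torsion_vec A D (cf p (e i)) (cf p (e j)) p) (e k)"
      by (rule g_uminus_right[OF torsion_vec_Tan[OF W cf(1) cf(1)] T[OF that]])
    finally show ?thesis unfolding t_def torsion_def by (simp add: cf(2) T that)
  qed
  have J: "J p (e 0) = e (Suc 0)" "J p (e (Suc 0)) = - e 0" "J p (e 2) = e 3" "J p (e 3) = - e 2" "J p (e 4) = e 5" "J p (e 5) = - e 4"
    using adapted_J[OF e] by simp_all
  have nn: "n i j k = n j i k + Tor (cf p (e i)) (cf p (e j)) (cf p (J p (e k))) p" if "i < 6" "j < 6" "k < 6" for i j k
    using nK_torsion[OF T T T, of i j k] that unfolding n_def by simp
  have n: "j < i \<Longrightarrow> i < 6 \<Longrightarrow> n i j 0 = n j i 0 + t i j (Suc 0)" "j < i \<Longrightarrow> i < 6 \<Longrightarrow> n i j (Suc 0) = n j i (Suc 0) - t i j 0"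
    "j < i \<Longrightarrow> i < 6 \<Longrightarrow> n i j 2 = n j i 2 + t i j 3" "j < i \<Longrightarrow> i < 6 \<Longrightarrow> n i j 3 = n j i 3 - t i j 2"
    "j < i \<Longrightarrow> i < 6 \<Longrightarrow> n i j 4 = n j i 4 + t i j 5" "j < i \<Longrightarrow> i < 6 \<Longrightarrow> n i j 5 = n j i 5 - t i j 4" for i j
    using nn[of i j 0] nn[of i j "Suc 0"] nn[of i j 2] nn[of i j 3] nn[of i j 4] nn[of i j 5] unfolding J by (simp_all add: tu t_def)
  (* Derivatives nK with decreasing first two indices are rewritten to increasing
     ones plus torsion, after which the nK terms cancel. *)
  note eval = ext_deriv_star[unfolded One_nat_def] T star_deriv_def n_def[symmetric] kk_def[symmetric] kk n t0 t_ord
  have "t 0 1 5 + t 2 3 5 + t 4 5 5 = 0" using 0(6) by (simp add: eval)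
  moreover have "t 0 1 4 + t 2 3 4 + t 4 5 4 = 0" using 0(5) by (simp add: eval)
  moreover have "t 0 1 3 + t 2 3 3 + t 4 5 3 = 0" using 0(4) by (simp add: eval)
  moreover have "t 0 1 2 + t 2 3 2 + t 4 5 2 = 0" using 0(3) by (simp add: eval)
  moreover have "t 0 1 1 + t 2 3 1 + t 4 5 1 = 0" using 0(2) by (simp add: eval)
  moreover have "t 0 1 0 + t 2 3 0 + t 4 5 0 = 0" using 0(1) by (simp add: eval)
  ultimately have "\<forall>k<6. t 0 1 k + t 2 3 k + t 4 5 k = 0"
    by (auto simp: less_Suc_eq numeral_eq_Suc)
  then show ?thesis using e unfolding t_def by blast
qed

end

context framed
begin

text \<open>
  The previous lemma concerns one adapted basis and constant fields. Since the torsion is tensorial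
  and the trace against \<open>J\<close> does not depend on the orthonormal basis, it carries over to the frame
  \<open>E\<close>.
\<close>
lemma balanced_trace:
  assumes bal: "balanced A g J" and q: "q \<in> U"
  shows "(\<Sum>a\<in>UNIV. Tor (E (Inl a)) (E (Inr a)) (E k) q) = 0"
proof -
  obtain e where e: "adapted_basis A g J q e" and 0: "\<And>k. k < 6 \<Longrightarrow> Tor (cf q (e 0)) (cf q (e 1)) (cf q (e k)) q
     + Tor (cf q (e 2)) (cf q (e 3)) (cf q (e k)) q + Tor (cf q (e 4)) (cf q (e 5)) (cf q (e k)) q = 0"
    using balanced_adapted[OF bal, of q] by blast
  have on: "orthonormal_basis A g q e" using e unfolding adapted_basis_def by blast
  note T = adapted_Tan[OF e]
  define W where "W = dom (chart_at A q) \<inter> U"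
  have W: "open W" "q \<in> W" "W \<subseteq> U" using dom_open chart_at q U by (auto simp: W_def)
  have cW: "vfield W (cf q v)" for v by (rule vfield_subset[OF cf(1)]) (simp add: W_def)
  note EE = EW[OF W(3)] and ex = tensorial_expand[OF W]
  have tr: "(\<Sum>a\<in>UNIV. Tor (E (Inl a)) (E (Inr a)) (cf q (e k)) q) = 0" if k: "k < 6" for k
  proof -
    define r where "r i j = Tor (E i) (E j) (cf q (e k)) q" for i j
    define \<Phi> where "\<Phi> u v = (\<Sum>i\<in>UNIV. \<Sum>j\<in>UNIV. g q u (E i q) * g q v (E j q) * r i j)" for u v
    have \<Phi>: "Tor (cf q u) (cf q v) (cf q (e k)) q = \<Phi> u v" if "u \<in> Tan q" "v \<in> Tan q" for u v
      unfolding \<Phi>_def r_def ex[OF Tor_tensorial(1)[OF W(1,2) cW cW] cW] ex[OF Tor_tensorial(2)[OF W(1,2) EE cW] cW]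
      by (simp add: cf(2) that sum_distrib_left mult.assoc)
    have sk: "r i j = - r j i" for i j unfolding r_def by (rule Tor_skew(1)[OF W(1,2) EE EE cW])
    have \<Phi>sk: "\<Phi> u v = - \<Phi> v u" for u v
    proof -
      have "\<Phi> v u = (\<Sum>i\<in>UNIV. \<Sum>j\<in>UNIV. g q v (E j q) * g q u (E i q) * r j i)"
        unfolding \<Phi>_def by (rule sum.swap)
      moreover have "g q v (E j q) * g q u (E i q) * r j i = - (g q u (E i q) * g q v (E j q) * r i j)" for i j
        using sk[of j i] by simp
      ultimately show ?thesis unfolding \<Phi>_def by (simp add: sum_negf)
    qed
    have \<Phi>m: "\<Phi> u (- v) = - \<Phi> u v" if "v \<in> Tan q" for u v
      unfolding \<Phi>_def sum_negf[symmetric] by (simp add: g_uminus_left[OF E_Tan[OF q] that])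
    have "(\<Sum>n<6. \<Phi> (e n) (J q (e n))) = 2 * (\<Sum>a\<in>UNIV. r (Inl a) (Inr a))"
      unfolding \<Phi>_def by (rule hermitian_trace[OF unitary[OF q] on sk])
    moreover have "(\<Sum>n<6. \<Phi> (e n) (J q (e n))) = 2 * (\<Phi> (e 0) (e 1) + \<Phi> (e 2) (e 3) + \<Phi> (e 4) (e 5))"
      using \<Phi>sk[of "e 1" "e 0"] \<Phi>sk[of "e 3" "e 2"] \<Phi>sk[of "e 5" "e 4"]
      by (simp add: sum_lt6 adapted_J[OF e, unfolded One_nat_def] \<Phi>m T)
    moreover have "\<Phi> (e 0) (e 1) + \<Phi> (e 2) (e 3) + \<Phi> (e 4) (e 5) = 0"
      using 0[OF k] by (simp add: \<Phi> T)
    ultimately show ?thesis unfolding r_def by simp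
  qed
  define s where "s i = (\<Sum>a\<in>UNIV. Tor (E (Inl a)) (E (Inr a)) (E i) q)" for i
  have s: "(\<Sum>i\<in>UNIV. g q (e n) (E i q) * s i) = 0" if n: "n < 6" for n
  proof -
    have "(\<Sum>a\<in>UNIV. Tor (E (Inl a)) (E (Inr a)) (cf q (e n)) q) =
        (\<Sum>a\<in>UNIV. \<Sum>i\<in>UNIV. g q (e n) (E i q) * Tor (E (Inl a)) (E (Inr a)) (E i) q)"
      unfolding ex[OF Tor_tensorial(3)[OF W(1,2) EE EE] cW] by (simp add: cf(2) T n)
    also have "\<dots> = (\<Sum>i\<in>UNIV. g q (e n) (E i q) * s i)"
      unfolding s_def sum_distrib_left by (rule sum.swap)
    finally show ?thesis using tr[OF n] by simp
  qed
  have "0 = (\<Sum>n<6. g q (e n) (E k q) * (\<Sum>i\<in>UNIV. g q (e n) (E i q) * s i))"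
    by (simp add: s)
  also have "\<dots> = (\<Sum>i\<in>UNIV. (\<Sum>n<6. g q (e n) (E k q) * g q (e n) (E i q)) * s i)"
    unfolding sum_distrib_left sum_distrib_right by (subst sum.swap) (simp add: mult.assoc)
  also have "\<dots> = (\<Sum>i\<in>UNIV. if i = k then s i else 0)"
    unfolding orthonormal_complete[OF unitary[OF q] on E_Tan[OF q] E_Tan[OF q]]
    by (rule sum.cong[OF refl]) (simp add: E_orth[OF q])
  finally show ?thesis unfolding s_def by simp
qed

lemma real_frame_balanced: "balanced A g J \<Longrightarrow> real_su3_frame U C dd \<Gamma> \<beta>"
  by (rule real_frame[OF balanced_trace])

end

section \<open>Instantons and parallel torsion\<close>

theorem corollary1p2:
  fixes A :: "'m::{t2_space, second_countable_topology} chart set"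
    and g :: "'m metric" and J :: "'m endo" and \<Psi> :: "'m cform3"
    and D :: "'m connection"
  assumes "ACYT A g J \<Psi>"
    and "balanced A g J"
    and "torsion_connection A g J \<Psi> D"
  shows "SU3_instanton A g J D \<longleftrightarrow> parallel3 A D (torsion A g D)"
proof -
  interpret acyt_connection A g J \<Psi> D
    using assms(1,3) unfolding ACYT_def torsion_connection_def by unfold_locales auto
  have frame: "\<exists>U c E. p \<in> U \<and> framed A g J \<Psi> D U c E" for p
  proof -
    obtain U c E where *: "open U" "p \<in> U" "c \<in> A" "U \<subseteq> dom c" "\<And>i. vfield U (E i)"
       "\<And>q. q \<in> U \<Longrightarrow> unitary_at q (\<lambda>i. E i q)"
       "\<And>q. q \<in> U \<Longrightarrow> \<exists>e. \<forall>u\<in>Tan q. \<forall>v\<in>Tan q. \<forall>w\<in>Tan q. (\<forall>i. e (num i) u = g q u (E i q)) \<and> \<Psi> q u v w =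
             - wedge3 (\<lambda>x. Complex (e 0 x) (e (1::nat) x)) (\<lambda>x. Complex (e 2 x) (e 3 x))
                 (\<lambda>x. Complex (e 4 x) (e 5 x)) u v w"
      using local_frame[of p] by blast
    then have "framed A g J \<Psi> D U c E" by unfold_locales
    then show ?thesis using *(2) by blast
  qed
  show ?thesis
  proof
    assume inst: "SU3_instanton A g J D"
    show "parallel3 A D (torsion A g D)"
      unfolding parallel3_def
    proof (intro allI impI ballI, elim conjE)
      fix W0 X Y Z V p
      assume W0: "open W0" "vfield W0 X" "vfield W0 Y" "vfield W0 Z" "vfield W0 V" and p: "p \<in> W0"
      obtain U c E where U: "p \<in> U" and F: "framed A g J \<Psi> D U c E" using frame by blast
      interpret F: framed A g J \<Psi> D U c E by (rule F)
      interpret R: real_su3_frame U F.C F.dd F.\<Gamma> F.\<beta> by (rule F.real_frame_balanced[OF assms(2)])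
      have "NT (E i) (E j) (E k) (E l) p = 0" for i j k l
        unfolding F.NT_eq[OF U]
        by (rule R.instanton_imp_parallel[OF F.instanton_at_frame[OF F.balanced_trace[OF assms(2)] inst] U])
      then show "NT X Y Z V p = 0" by (rule F.NT_zero[OF _ W0(1) p U W0(2-5)])
    qed
  next
    assume par: "parallel3 A D (torsion A g D)"
    have at: "real_su3_frame.instanton_at (framed.dd A E) (framed.\<Gamma> g D E) (framed.\<beta> A g E) p"
      if U: "p \<in> U" and F: "framed A g J \<Psi> D U c E" for p U c E
    proof -
      interpret F: framed A g J \<Psi> D U c E by (rule F)
      interpret R: real_su3_frame U F.C F.dd F.\<Gamma> F.\<beta> by (rule F.real_frame_balanced[OF assms(2)])
      show ?thesis
      proof (rule R.parallel_imp_instanton[OF U])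
        fix i j k l
        show "nabla_tor F.dd F.\<Gamma> F.\<beta> i j k l p = 0"
          unfolding F.NT_eq[OF U, symmetric] using par F.U F.E U unfolding parallel3_def by blast
      qed
    qed
    show "SU3_instanton A g J D"
      unfolding SU3_instanton_def
    proof (intro conjI allI impI ballI; elim conjE)
      fix W0 X Y Z V p
      assume W0: "open W0" "vfield W0 X" "vfield W0 Y" "vfield W0 Z" "vfield W0 V" and p: "p \<in> W0"
      obtain U c E where U: "p \<in> U" and F: "framed A g J \<Psi> D U c E" using frame by blast
      interpret F: framed A g J \<Psi> D U c E by (rule F)
      show "Curv (app_endo J X) (app_endo J Y) Z V p = Curv X Y Z V p"
        by (rule F.instanton_from_frame(1)[OF F.balanced_trace[OF assms(2)] at[OF U F] W0(1) p U W0(4,5,2,3)])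
    next
      fix W0 E' Z V p
      assume W0: "open W0" "vfield W0 Z" "vfield W0 V" and p: "p \<in> W0"
        and E': "\<forall>i<6. vfield W0 (E' i)" and on: "orthonormal_basis A g p (\<lambda>i. E' i p)"
      obtain U c E where U: "p \<in> U" and F: "framed A g J \<Psi> D U c E" using frame by blast
      interpret F: framed A g J \<Psi> D U c E by (rule F)
      obtain r where r: "\<And>X Y. vfield W0 X \<Longrightarrow> vfield W0 Y \<Longrightarrow> Curv X Y Z V p =
            (\<Sum>i\<in>UNIV. \<Sum>j\<in>UNIV. g p (X p) (E i p) * g p (Y p) (E j p) * r i j)"
          "(\<Sum>a\<in>UNIV. r (Inl a) (Inr a)) = (0::real)" "\<And>i j. r i j = - r j i"
        using F.instanton_from_frame(2)[OF F.balanced_trace[OF assms(2)] at[OF U F] W0(1) p U W0(2,3)] by blast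
      have "(\<Sum>n<6. Curv (E' n) (app_endo J (E' n)) Z V p) =
          (\<Sum>n<6. \<Sum>i\<in>UNIV. \<Sum>j\<in>UNIV. g p (E' n p) (E i p) * g p (J p (E' n p)) (E j p) * r i j)"
      proof (rule sum.cong[OF refl])
        fix n assume "n \<in> {..<6::nat}"
        then have n: "vfield W0 (E' n)" using E' by simp
        show "Curv (E' n) (app_endo J (E' n)) Z V p = (\<Sum>i\<in>UNIV. \<Sum>j\<in>UNIV. g p (E' n p) (E i p) * g p (J p (E' n p)) (E j p) * r i j)"
          using r(1)[OF n J_smooth[OF W0(1) n]] by (simp add: app_endo_def)
      qed
      also have "\<dots> = 2 * (\<Sum>a\<in>UNIV. r (Inl a) (Inr a))"
        by (rule hermitian_trace[OF F.unitary[OF U] on r(3)])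
      finally show "(\<Sum>n<6. Curv (E' n) (app_endo J (E' n)) Z V p) = 0" using r(2) by simp
    qed
  qed
qed

end
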